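(* For $i=1,\dots,k$ let $D_i\subset\mathbb{R}^{2n_i}$ be a $\tau_0$-invariant compact convex subset. Then, with $\mathbb{R}^{2n}=\mathbb{R}^{2n_1}\times\cdots\times\mathbb{R}^{2n_k}$, $$c_{\rm EH,\tau_0}(D_1\times\cdots\times D_k)=\min_ic_{\rm EH,\tau_0}(D_i)=c_{\rm EH,\tau_0}(\partial D_1\times\cdots\times\partial D_k).$$
   Context: On each $\mathbb{R}^{2l}$ with coordinates $(x,y)\in\mathbb{R}^l\times\mathbb{R}^l$, $\omega_0=\sum dx_i\wedge dy_i$, $J_0(x,y)=(-y,x)$, $\tau_0(x,y)=(x,-y)$ is the canonical anti-symplectic involution and $L_0={\rm Fix}(\tau_0)$; on the product $\mathbb{R}^{2n}$ (with product symplectic form) $\tau_0$ is the product of the canonical involutions. Symmetric Ekeland–Hofer capacity on $\mathbb{R}^{2l}$: let $\mathbb E$ be the Hilbert space of $x\in L^2(\mathbb{R}/\mathbb{Z};\mathbb{R}^{2l})$, $x(t)=\sum_{j\in\mathbb Z}e^{2\pi jtJ_0}x_j$, $x_j\in L_0$, $\sum|j||x_j|^2<\infty$, inner product $\langle x,y\rangle=\langle x_0,y_0\rangle+\sum_j2\pi|j|\langle x_j,y_j\rangle$; $\mathbb E=\mathbb E^-\oplus\mathbb E^0\oplus\mathbb E^+$ ($\mathbb E^0=L_0$, $\mathbb E^\pm$ the sums over $\pm j>0$), $x=x^-+x^0+x^+$, $S^+$ the unit sphere of $\mathbb E^+$. An admissible deformation is a continuous $\gamma:\mathbb E\to\mathbb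 E$ with a homotopy $(\gamma_u)_{u\in[0,1]}$, $\gamma_0=\mathrm{id}$, $\gamma_1=\gamma$, such that $x^+\ne0\Rightarrow\gamma_u(x)^+\ne0$ and $\gamma_u(x)=a(x,u)x^++b(x,u)x^0+c(x,u)x^-+K(x,u)$ with $(a,b,c,K):\mathbb E\times[0,1]\to(0,\infty)^3\times\mathbb E$ continuous, mapping bounded sets to relatively compact sets; $\Gamma$ is their set. For continuous $H\ge0$, $\Phi_H(x)=\frac12(\|x^+\|^2-\|x^-\|^2)-\int_0^1H(x(t))dt$, $c_{\rm EH,\tau_0}(H)=\sup_{h\in\Gamma}\inf_{h(S^+)}\Phi_H$. For bounded $B$ with $\tau_0B=B$, $B\cap L_0\ne\emptyset$, $c_{\rm EH,\tau_0}(B)=\inf c_{\rm EH,\tau_0}(H)$ over continuous $H\ge0$ with $H\circ\tau_0=H$, ${\rm Int}(H^{-1}(0))\cap L_0\ne\emptyset$, $H(z)=a|z|^2+\langle z,z_0\rangle+b$ outside a compact set ($z_0\in L_0$, $a>2\pi$), and $H$ vanishing near $\overline B$. *)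

theory Defs
  imports "HOL-Analysis.Analysis"
begin

text \<open>A point z = (x,y) of R^(2l) = R^l x R^l is represented as a pair of
  sequences nat => real which vanish at all indices >= l.  The topology used is
  the (product) topology of the function type restricted to this carrier, which
  coincides with the Euclidean topology of R^(2l).\<close>

type_synonym pt = "(nat \<Rightarrow> real) \<times> (nat \<Rightarrow> real)"

definition pts :: "nat \<Rightarrow> pt set" where
  "pts l = {(x, y). \<forall>i. l \<le> i \<longrightarrow> x i = 0 \<and> y i = 0}"

definition tau0 :: "pt \<Rightarrow> pt" where
  "tau0 z = (fst z, \<lambda>i. - snd z i)"

definition Lag0 :: "nat \<Rightarrow> pt set" where
  "Lag0 l = {z \<in> pts l. tau0 z = z}"

definition pt_inner :: "nat \<Rightarrow> pt \<Rightarrow> pt \<Rightarrow> real" where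
  "pt_inner l z w = (\<Sum>i<l. fst z i * fst w i + snd z i * snd w i)"

definition pt_sqnorm :: "nat \<Rightarrow> pt \<Rightarrow> real" where
  "pt_sqnorm l z = pt_inner l z z"

definition pt_diff :: "pt \<Rightarrow> pt \<Rightarrow> pt" where
  "pt_diff z w = (\<lambda>i. fst z i - fst w i, \<lambda>i. snd z i - snd w i)"

definition pt_comb :: "real \<Rightarrow> pt \<Rightarrow> real \<Rightarrow> pt \<Rightarrow> pt" where
  "pt_comb a z b w = (\<lambda>i. a * fst z i + b * fst w i, \<lambda>i. a * snd z i + b * snd w i)"

definition convex_pts :: "pt set \<Rightarrow> bool" where
  "convex_pts D \<longleftrightarrow> (\<forall>z\<in>D. \<forall>w\<in>D. \<forall>t\<in>{0..1::real}. pt_comb (1 - t) z t w \<in> D)"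

definition pts_frontier :: "nat \<Rightarrow> pt set \<Rightarrow> pt set" where
  "pts_frontier l B = (top_of_set (pts l)) frontier_of B"

text \<open>An element x(t) = sum_j exp(2 pi j t J0) x_j of E (with x_j in L0) is represented by
  its coefficient family j |-> x_j, where x_j = (c j, 0) and c j :: nat => real vanishes
  at indices >= l.\<close>

type_synonym ecoef = "int \<Rightarrow> nat \<Rightarrow> real"

definition Espace :: "nat \<Rightarrow> ecoef set" where
  "Espace l = {x. (\<forall>j i. l \<le> i \<longrightarrow> x j i = 0) \<and>
      (\<lambda>j. \<bar>real_of_int j\<bar> * (\<Sum>i<l. (x j i)\<^sup>2)) summable_on (UNIV :: int set)}"

definition E_inner :: "nat \<Rightarrow> ecoef \<Rightarrow> ecoef \<Rightarrow> real" where
  "E_inner l x y = (\<Sum>i<l. x 0 i * y 0 i)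
      + (\<Sum>\<^sub>\<infinity>j\<in>(UNIV :: int set). 2 * pi * \<bar>real_of_int j\<bar> * (\<Sum>i<l. x j i * y j i))"

definition E_norm :: "nat \<Rightarrow> ecoef \<Rightarrow> real" where
  "E_norm l x = sqrt (E_inner l x x)"

definition E_diff :: "ecoef \<Rightarrow> ecoef \<Rightarrow> ecoef" where
  "E_diff x y = (\<lambda>j i. x j i - y j i)"

definition Eplus :: "ecoef \<Rightarrow> ecoef" where
  "Eplus x = (\<lambda>j i. if 0 < j then x j i else 0)"

definition Ezero :: "ecoef \<Rightarrow> ecoef" where
  "Ezero x = (\<lambda>j i. if j = 0 then x j i else 0)"

definition Eminus :: "ecoef \<Rightarrow> ecoef" where
  "Eminus x = (\<lambda>j i. if j < 0 then x j i else 0)"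

definition Esphere_plus :: "nat \<Rightarrow> ecoef set" where
  "Esphere_plus l = {x \<in> Espace l. Eplus x = x \<and> E_norm l x = 1}"

text \<open>The loop t |-> x(t) in L^2(R/Z; R^(2l)).  Since exp(theta J0)(c,0) = (cos theta c, sin theta c),
  the symmetric partial sums of the Fourier series are:\<close>
definition Epsum :: "ecoef \<Rightarrow> nat \<Rightarrow> real \<Rightarrow> pt" where
  "Epsum x N t =
     ((\<lambda>i. \<Sum>j\<in>{- int N..int N}. cos (2 * pi * real_of_int j * t) * x j i),
      (\<lambda>i. \<Sum>j\<in>{- int N..int N}. sin (2 * pi * real_of_int j * t) * x j i))"

text \<open>f represents (on [0,1]) the L^2 function x(t): measurable, and the partial sums
  converge to it in L^2([0,1]).  Such f is unique up to null sets.\<close>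
definition is_loop_of :: "nat \<Rightarrow> ecoef \<Rightarrow> (real \<Rightarrow> pt) \<Rightarrow> bool" where
  "is_loop_of l x f \<longleftrightarrow>
     (\<forall>t. f t \<in> pts l) \<and>
     (\<forall>i. (\<lambda>t. fst (f t) i) \<in> borel_measurable lborel \<and> (\<lambda>t. snd (f t) i) \<in> borel_measurable lborel) \<and>
     ((\<lambda>N. \<integral>\<^sup>+ t. ennreal (pt_sqnorm l (pt_diff (Epsum x N t) (f t))) * indicator {0..1} t \<partial>lborel)
        \<longlonglongrightarrow> 0)"

definition Eloop :: "nat \<Rightarrow> ecoef \<Rightarrow> real \<Rightarrow> pt" where
  "Eloop l x = (SOME f. is_loop_of l x f)"

definition PhiH :: "nat \<Rightarrow> (pt \<Rightarrow> real) \<Rightarrow> ecoef \<Rightarrow> real" where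
  "PhiH l H x = (E_norm l (Eplus x))\<^sup>2 / 2 - (E_norm l (Eminus x))\<^sup>2 / 2
      - (LINT t:{0..1}|lborel. H (Eloop l x t))"

definition Edeform ::
  "(ecoef \<Rightarrow> real \<Rightarrow> real) \<Rightarrow> (ecoef \<Rightarrow> real \<Rightarrow> real) \<Rightarrow> (ecoef \<Rightarrow> real \<Rightarrow> real)
     \<Rightarrow> (ecoef \<Rightarrow> real \<Rightarrow> ecoef) \<Rightarrow> ecoef \<Rightarrow> real \<Rightarrow> ecoef" where
  "Edeform a b c K x u =
     (\<lambda>j i. (if 0 < j then a x u else if j = 0 then b x u else c x u) * x j i + K x u j i)"

definition admissible_deformation :: "nat \<Rightarrow> (ecoef \<Rightarrow> ecoef) \<Rightarrow> bool" where
  "admissible_deformation l g \<longleftrightarrow>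
     (\<forall>x\<in>Espace l. g x \<in> Espace l) \<and>
     (\<forall>x\<in>Espace l. \<forall>\<epsilon>>0. \<exists>\<delta>>0. \<forall>x'\<in>Espace l.
        E_norm l (E_diff x' x) < \<delta> \<longrightarrow> E_norm l (E_diff (g x') (g x)) < \<epsilon>) \<and>
     (\<exists>a b c K.
        \<comment> \<open>(a,b,c,K) : E x [0,1] -> (0,oo)^3 x E\<close>
        (\<forall>x\<in>Espace l. \<forall>u\<in>{0..1}. 0 < a x u \<and> 0 < b x u \<and> 0 < c x u \<and> K x u \<in> Espace l) \<and>
        \<comment> \<open>continuity\<close>
        (\<forall>x\<in>Espace l. \<forall>u\<in>{0..1}. \<forall>\<epsilon>>0. \<exists>\<delta>>0. \<forall>x'\<in>Espace l. \<forall>u'\<in>{0..1}.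
           E_norm l (E_diff x' x) < \<delta> \<and> \<bar>u' - u\<bar> < \<delta> \<longrightarrow>
             \<bar>a x' u' - a x u\<bar> < \<epsilon> \<and> \<bar>b x' u' - b x u\<bar> < \<epsilon> \<and> \<bar>c x' u' - c x u\<bar> < \<epsilon> \<and>
             E_norm l (E_diff (K x' u') (K x u)) < \<epsilon>) \<and>
        \<comment> \<open>bounded sets are mapped to relatively compact subsets of (0,oo)^3 x E
            (sequential characterisation in the metric space (0,oo)^3 x E)\<close>
        (\<forall>R (s :: nat \<Rightarrow> ecoef) (v :: nat \<Rightarrow> real). (\<forall>m. s m \<in> Espace l \<and> E_norm l (s m) \<le> R \<and> v m \<in> {0..1}) \<longrightarrow>
           (\<exists>(r :: nat \<Rightarrow> nat) \<alpha> \<beta> \<gamma> k. strict_mono r \<and> 0 < \<alpha> \<and> 0 < \<beta> \<and> 0 < \<gamma> \<and> k \<in> Espace l \<and>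
              (\<lambda>m. a (s (r m)) (v (r m))) \<longlonglongrightarrow> \<alpha> \<and>
              (\<lambda>m. b (s (r m)) (v (r m))) \<longlonglongrightarrow> \<beta> \<and>
              (\<lambda>m. c (s (r m)) (v (r m))) \<longlonglongrightarrow> \<gamma> \<and>
              (\<lambda>m. E_norm l (E_diff (K (s (r m)) (v (r m))) k)) \<longlonglongrightarrow> 0)) \<and>
        \<comment> \<open>gamma_0 = id, gamma_1 = gamma\<close>
        (\<forall>x\<in>Espace l. Edeform a b c K x 0 = x) \<and>
        (\<forall>x\<in>Espace l. Edeform a b c K x 1 = g x) \<and>
        \<comment> \<open>x^+ /= 0 implies gamma_u(x)^+ /= 0\<close>
        (\<forall>x\<in>Espace l. \<forall>u\<in>{0..1}.
           Eplus x \<noteq> (\<lambda>j i. 0) \<longrightarrow> Eplus (Edeform a b c K x u) \<noteq> (\<lambda>j i. 0)))"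

definition cEH_fun :: "nat \<Rightarrow> (pt \<Rightarrow> real) \<Rightarrow> ereal" where
  "cEH_fun l H = (SUP h\<in>{h. admissible_deformation l h}. INF x\<in>Esphere_plus l. ereal (PhiH l H (h x)))"

definition admissible_H :: "nat \<Rightarrow> pt set \<Rightarrow> (pt \<Rightarrow> real) \<Rightarrow> bool" where
  "admissible_H l B H \<longleftrightarrow>
     continuous_on (pts l) H \<and>
     (\<forall>z\<in>pts l. 0 \<le> H z) \<and>
     (\<forall>z\<in>pts l. H (tau0 z) = H z) \<and>
     ((top_of_set (pts l)) interior_of {z \<in> pts l. H z = 0}) \<inter> Lag0 l \<noteq> {} \<and>
     (\<exists>a b z0 C. a > 2 * pi \<and> z0 \<in> Lag0 l \<and> compact C \<and>
        (\<forall>z\<in>pts l - C. H z = a * pt_sqnorm l z + pt_inner l z z0 + b)) \<and>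
     (\<exists>U. openin (top_of_set (pts l)) U \<and> closure B \<subseteq> U \<and> (\<forall>z\<in>U. H z = 0))"

definition cEH_set :: "nat \<Rightarrow> pt set \<Rightarrow> ereal" where
  "cEH_set l B = (INF H\<in>{H. admissible_H l B H}. cEH_fun l H)"

text \<open>The i-th factor of z = (x,y) in R^(2N), N = sum n_j, where x = (x^(0),...,x^(k-1)),
  y = (y^(0),...,y^(k-1)); this identification is symplectic and intertwines the tau0's.\<close>
definition blk :: "(nat \<Rightarrow> nat) \<Rightarrow> nat \<Rightarrow> pt \<Rightarrow> pt" where
  "blk n i z =
     ((\<lambda>m. if m < n i then fst z ((\<Sum>j<i. n j) + m) else 0),
      (\<lambda>m. if m < n i then snd z ((\<Sum>j<i. n j) + m) else 0))"

definition prod_set :: "(nat \<Rightarrow> nat) \<Rightarrow> nat \<Rightarrow> (nat \<Rightarrow> pt set) \<Rightarrow> pt set" where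
  "prod_set n k D = {z \<in> pts (\<Sum>i<k. n i). \<forall>i<k. blk n i z \<in> D i}"

end

theory Submission
  imports Defs "HOL-Homology.Homology" "HOL-Library.Diagonal_Subsequence"
begin

text \<open>For a compact convex neighbourhood \<open>K\<close> of \<open>D\<close>, the function \<open>H = M dist(\<cdot>, K)\<^sup>2\<close> is
  convex and has the property that a critical point \<open>x\<close> of its action maximises the action over the cone of
  all loops whose positive part is a nonnegative multiple of that of \<open>x\<close>. Every admissible deformation of the
  sphere in the positive space meets this cone, also after embedding one factor into the product, so each positive
  critical level of a factor bounds the capacities of the factor and of the product from above. Conversely,
  if no factor has a positive critical level up to \<open>\<beta>\<close>, the gradient flow of the sum of such Hamiltonians pushes a
  small sphere above the level \<open>\<beta>\<close>, because it does not decrease the action of any block. This still works after adding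
  to \<open>H\<close> a large bump deep inside \<open>D\<close> that decreases along rays from a point: a critical loop in the bump has
  nonpositive action. Such sums dominate every Hamiltonian admissible for the product of the boundaries.
  Comparing the two bounds gives all equalities.\<close>

section \<open>Square-summable families\<close>

text \<open>Two obstacles shape the argument. A convex body may have empty interior, so it need not
  bound a domain on which a boundary characteristic could be studied: critical levels are therefore
  taken for \<open>M\<close> times the squared distance to the closed
  \<open>d\<close>-neighbourhood, which has Lipschitz gradient however rough the body is. Both
  \<open>d\<close> and \<open>M\<close> stay free, since the lower bound must fit them to the
  competing Hamiltonian. Moreover, a deformation must have the form a x^+ + b x^0 + c x^- + K with
  positive coefficients and compact K. The gradient of the action is x^+ - x^- minus a compact term,
  so an Euler step of gradient ascent alters only a, c and K. Finitely many such steps stand in for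
  a flow; the Lipschitz constant dictates their length. The bump is there because a competitor that
  vanishes only near the product of the boundaries may be large deep inside. The sums only have to
  dominate a competitor, so they are not made quadratic at infinity; boundedness of almost critical
  sequences comes instead from linear growth of half the radial derivative minus the value, measured
  from a point of the fixed space.\<close>

typedef 'a ell2 = "{f :: 'a \<Rightarrow> real. (\<lambda>c. (f c)\<^sup>2) summable_on UNIV}"
  morphisms ev Abs_ell2
  by (rule exI[of _ "\<lambda>_. 0"]) simp

lemma ev_summable: "(\<lambda>c. (ev x c)\<^sup>2) summable_on UNIV"
  using ev[of x] by simp

lemma ell2_eqI: "(\<And>c. ev x c = ev y c) \<Longrightarrow> x = y"
  by (simp add: ev_inject[symmetric] fun_eq_iff)

lemma ev_Abs: "(\<lambda>c. (f c)\<^sup>2) summable_on UNIV \<Longrightarrow> ev (Abs_ell2 f) = f"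
  by (simp add: Abs_ell2_inverse)

lemma prod_summable:
  fixes f g :: "'a \<Rightarrow> real"
  assumes "(\<lambda>c. (f c)\<^sup>2) summable_on A" "(\<lambda>c. (g c)\<^sup>2) summable_on A"
  shows "(\<lambda>c. f c * g c) summable_on A"
proof -
  have "(\<lambda>c. norm (f c * g c)) summable_on A"
  proof (rule Infinite_Sum.abs_summable_on_comparison_test')
    show "(\<lambda>c. (f c)\<^sup>2 + (g c)\<^sup>2) summable_on A"
      by (intro summable_on_add assms)
    fix c assume "c \<in> A"
    have "0 \<le> (\<bar>f c\<bar> - \<bar>g c\<bar>)\<^sup>2" by simp
    then have "2 * (\<bar>f c\<bar> * \<bar>g c\<bar>) \<le> (f c)\<^sup>2 + (g c)\<^sup>2"
      by (simp add: power2_diff)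
    moreover have "0 \<le> \<bar>f c\<bar> * \<bar>g c\<bar>" by simp
    ultimately show "norm (f c * g c) \<le> (f c)\<^sup>2 + (g c)\<^sup>2"
      unfolding real_norm_def abs_mult by linarith
  qed
  then show ?thesis by (rule abs_summable_summable)
qed

lemma sum_sq_summable:
  fixes f g :: "'a \<Rightarrow> real"
  assumes "(\<lambda>c. (f c)\<^sup>2) summable_on A" "(\<lambda>c. (g c)\<^sup>2) summable_on A"
  shows "(\<lambda>c. (f c + g c)\<^sup>2) summable_on A"
proof -
  have "(\<lambda>c. (f c)\<^sup>2 + (g c)\<^sup>2 + 2 * (f c * g c)) summable_on A"
    by (intro summable_on_add summable_on_cmult_right assms prod_summable)
  then show ?thesis by (simp add: power2_sum mult.assoc)
qed

lemma cmult_sq_summable: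
  fixes f :: "'a \<Rightarrow> real"
  assumes "(\<lambda>c. (f c)\<^sup>2) summable_on A"
  shows "(\<lambda>c. (k * f c)\<^sup>2) summable_on A"
  using summable_on_cmult_right[OF assms, of "k\<^sup>2"] by (simp add: power_mult_distrib)

instantiation ell2 :: (type) real_vector
begin

definition zero_ell2 :: "'a ell2" where "0 = Abs_ell2 (\<lambda>_. 0)"
definition plus_ell2 :: "'a ell2 \<Rightarrow> 'a ell2 \<Rightarrow> 'a ell2" where "x + y = Abs_ell2 (\<lambda>c. ev x c + ev y c)"
definition uminus_ell2 :: "'a ell2 \<Rightarrow> 'a ell2" where "- x = Abs_ell2 (\<lambda>c. - ev x c)"
definition minus_ell2 :: "'a ell2 \<Rightarrow> 'a ell2 \<Rightarrow> 'a ell2" where "x - y = Abs_ell2 (\<lambda>c. ev x c - ev y c)"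
definition scaleR_ell2 :: "real \<Rightarrow> 'a ell2 \<Rightarrow> 'a ell2" where "r *\<^sub>R x = Abs_ell2 (\<lambda>c. r * ev x c)"
lemma ev_zero [simp]: "ev 0 c = 0"
  by (simp add: zero_ell2_def ev_Abs)

lemma ev_add [simp]: "ev (x + y) c = ev x c + ev y c"
  by (simp add: plus_ell2_def ev_Abs[OF sum_sq_summable[OF ev_summable ev_summable]])

lemma ev_uminus [simp]: "ev (- x) c = - ev x c"
  by (simp add: uminus_ell2_def ev_Abs ev_summable)

lemma ev_scaleR [simp]: "ev (r *\<^sub>R x) c = r * ev x c"
  by (simp add: scaleR_ell2_def ev_Abs cmult_sq_summable ev_summable)

lemma ev_diff [simp]: "ev (x - y) c = ev x c - ev y c"
proof -
  have "(\<lambda>c. (ev x c + (-1) * ev y c)\<^sup>2) summable_on UNIV"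
    by (intro sum_sq_summable cmult_sq_summable ev_summable)
  then show ?thesis by (simp add: minus_ell2_def ev_Abs)
qed

instance
  by standard (rule ell2_eqI; simp add: algebra_simps)+

end

instantiation ell2 :: (type) real_inner
begin

definition inner_ell2 :: "'a ell2 \<Rightarrow> 'a ell2 \<Rightarrow> real" where "inner x y = (\<Sum>\<^sub>\<infinity>c. ev x c * ev y c)"
definition norm_ell2 :: "'a ell2 \<Rightarrow> real" where "norm (x :: 'a ell2) = sqrt (inner x x)"
definition sgn_ell2 :: "'a ell2 \<Rightarrow> 'a ell2" where "sgn (x :: 'a ell2) = x /\<^sub>R norm x"
definition dist_ell2 :: "'a ell2 \<Rightarrow> 'a ell2 \<Rightarrow> real" where "dist (x :: 'a ell2) y = norm (x - y)"
definition uniformity_ell2 :: "('a ell2 \<times> 'a ell2) filter" where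
  "uniformity_ell2 = (INF e\<in>{0 <..}. principal {(x, y). dist x y < e})"
definition open_ell2 :: "'a ell2 set \<Rightarrow> bool" where
  "open_ell2 U \<longleftrightarrow> (\<forall>x\<in>U. eventually (\<lambda>(x', y). x' = x \<longrightarrow> y \<in> U) uniformity)"

instance
proof
  show "dist x y = norm (x - y)" for x y :: "'a ell2" by (simp add: dist_ell2_def)
  show "sgn x = x /\<^sub>R norm x" for x :: "'a ell2" by (simp add: sgn_ell2_def)
  show "(uniformity :: ('a ell2 \<times> 'a ell2) filter) = (INF e\<in>{0 <..}. principal {(x, y). dist x y < e})"
    by (simp add: uniformity_ell2_def)
  show "open U \<longleftrightarrow> (\<forall>x\<in>U. \<forall>\<^sub>F (x', y) in uniformity. x' = x \<longrightarrow> y \<in> U)" for U :: "'a ell2 set"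
    by (simp add: open_ell2_def)
  show "norm x = sqrt (inner x x)" for x :: "'a ell2" by (simp add: norm_ell2_def)
  show "inner x y = inner y x" for x y :: "'a ell2" by (simp add: inner_ell2_def mult.commute)
  show "inner (x + y) z = inner x z + inner y z" for x y z :: "'a ell2"
    by (simp add: inner_ell2_def distrib_right infsum_add prod_summable ev_summable)
  show "inner (r *\<^sub>R x) y = r * inner x y" for r and x y :: "'a ell2"
    by (simp add: inner_ell2_def mult.assoc infsum_cmult_right prod_summable ev_summable)
  show "0 \<le> inner x x" for x :: "'a ell2"
    by (simp add: inner_ell2_def infsum_nonneg)
  show "(inner x x = 0) = (x = 0)" for x :: "'a ell2"
  proof
    assume "inner x x = 0"
    then have "infsum (\<lambda>c. (ev x c)\<^sup>2) UNIV = 0" by (simp add: inner_ell2_def power2_eq_square)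
    then have "(ev x c)\<^sup>2 = 0" for c
      using nonneg_infsum_le_0D[of "\<lambda>c. (ev x c)\<^sup>2" UNIV c] ev_summable[of x] by simp
    then show "x = 0" by (intro ell2_eqI) simp
  qed (simp add: inner_ell2_def)
qed

end

lemma inner_infsum: "inner x y = (\<Sum>\<^sub>\<infinity>c. ev x c * ev y c)"
  by (simp add: inner_ell2_def)

lemma norm_sq_infsum: "(norm x)\<^sup>2 = (\<Sum>\<^sub>\<infinity>c. (ev x c)\<^sup>2)"
  unfolding power2_norm_eq_inner inner_infsum by (simp add: power2_eq_square)

lemma sum_sq_le_norm: "finite F \<Longrightarrow> (\<Sum>c\<in>F. (ev x c)\<^sup>2) \<le> (norm x)\<^sup>2"
  unfolding norm_sq_infsum by (rule finite_sum_le_infsum) (auto simp: ev_summable)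

lemma abs_ev_le: "\<bar>ev x c\<bar> \<le> norm x"
proof -
  have "(ev x c)\<^sup>2 \<le> (norm x)\<^sup>2" using sum_sq_le_norm[of "{c}" x] by simp
  then show ?thesis by (metis abs_le_square_iff abs_norm_cancel)
qed

text \<open>A uniform bound on finite partial sums of squares yields membership, evaluation and the
  norm estimate at once; the operators on families below are constructed through this test.\<close>

lemma ell2_of_bound:
  fixes f :: "'a \<Rightarrow> real"
  assumes "\<And>F. finite F \<Longrightarrow> (\<Sum>c\<in>F. (f c)\<^sup>2) \<le> B"
  shows "(\<lambda>c. (f c)\<^sup>2) summable_on UNIV"
    and "ev (Abs_ell2 f) = f"
    and "(norm (Abs_ell2 f))\<^sup>2 \<le> B"
proof -
  show s: "(\<lambda>c. (f c)\<^sup>2) summable_on UNIV"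
    by (rule nonneg_bdd_above_summable_on) (auto intro!: bdd_aboveI2[of _ _ B] assms)
  then show e: "ev (Abs_ell2 f) = f" by (rule ev_Abs)
  show "(norm (Abs_ell2 f))\<^sup>2 \<le> B"
    unfolding norm_sq_infsum e by (rule infsum_le_finite_sums[OF s]) (simp add: assms)
qed

lemma inner_finite:
  assumes "finite F" "\<And>c. c \<notin> F \<Longrightarrow> ev x c * ev y c = 0"
  shows "inner x y = (\<Sum>c\<in>F. ev x c * ev y c)"
proof -
  have "inner x y = infsum (\<lambda>c. ev x c * ev y c) F"
    unfolding inner_infsum by (rule infsum_cong_neutral) (auto simp: assms)
  then show ?thesis using assms(1) by simp
qed

lemma norm_sq_finite:
  assumes "finite F" "\<And>c. c \<notin> F \<Longrightarrow> ev x c = 0"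
  shows "(norm x)\<^sup>2 = (\<Sum>c\<in>F. (ev x c)\<^sup>2)"
  unfolding power2_norm_eq_inner using inner_finite[of F x x] assms by (simp add: power2_eq_square)

lemma ev_sum [simp]: "ev (sum f A) c = (\<Sum>a\<in>A. ev (f a) c)"
  by (induction A rule: infinite_finite_induct) auto

lemma bounded_linear_ev: "bounded_linear (\<lambda>x. ev x c)"
  by (rule bounded_linear_intro[where K = 1]) (auto simp: abs_ev_le)

lemmas continuous_on_ev [continuous_intros] =
  bounded_linear.continuous_on[OF bounded_linear_ev]
lemmas tendsto_ev [tendsto_intros] = bounded_linear.tendsto[OF bounded_linear_ev]

section \<open>Basis vectors, diagonal operators and restrictions to sets of coordinates\<close>

definition bas :: "'a \<Rightarrow> 'a ell2" where
  "bas c = Abs_ell2 (\<lambda>d. if d = c then 1 else 0)"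

lemma ev_bas: "ev (bas c) d = (if d = c then 1 else 0)"
proof -
  have "(\<Sum>d\<in>F. (if d = c then 1 else 0 :: real)\<^sup>2) \<le> 1" if "finite F" for F
  proof -
    have "(\<Sum>d\<in>F. (if d = c then 1 else 0 :: real)\<^sup>2) = (\<Sum>d\<in>F. (if d = c then 1 else 0 :: real))"
      by (intro sum.cong) auto
    then show ?thesis using that by (simp add: sum.delta)
  qed
  then have "ev (bas c) = (\<lambda>d. if d = c then 1 else 0)"
    unfolding bas_def by (rule ell2_of_bound(2))
  then show ?thesis by simp
qed

lemma inner_bas [simp]: "inner x (bas c) = ev x c"
  by (subst inner_finite[of "{c}"]) (auto simp: ev_bas)

lemma inner_bas' [simp]: "inner (bas c) x = ev x c"
  by (simp add: inner_commute)

lemma norm_bas [simp]: "norm (bas c) = 1"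
  by (simp add: norm_eq_sqrt_inner ev_bas)

text \<open>Restrictions, the removal of the scaling of loop coefficients and the involution on
  points are all diagonal. For a multiplier that leaves the space the value is unspecified, so each
  use passes through \<open>dmul_bound\<close>.\<close>

definition dmul :: "('a \<Rightarrow> real) \<Rightarrow> 'a ell2 \<Rightarrow> 'a ell2" where
  "dmul \<theta> x = Abs_ell2 (\<lambda>c. \<theta> c * ev x c)"

lemma dmul_bound:
  assumes "\<And>c. \<bar>\<theta> c\<bar> \<le> B"
  shows "ev (dmul \<theta> x) c = \<theta> c * ev x c" "norm (dmul \<theta> x) \<le> B * norm x"
proof -
  have B: "0 \<le> B" using assms[of undefined] by linarith
  have *: "(\<Sum>c\<in>F. (\<theta> c * ev x c)\<^sup>2) \<le> (B * norm x)\<^sup>2" if "finite F" for F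
  proof -
    have "(\<Sum>c\<in>F. (\<theta> c * ev x c)\<^sup>2) \<le> (\<Sum>c\<in>F. B\<^sup>2 * (ev x c)\<^sup>2)"
    proof (rule sum_mono)
      fix c
      have "(\<theta> c)\<^sup>2 \<le> B\<^sup>2" using assms[of c] B by (metis abs_of_nonneg abs_le_square_iff)
      then show "(\<theta> c * ev x c)\<^sup>2 \<le> B\<^sup>2 * (ev x c)\<^sup>2"
        by (simp add: power_mult_distrib mult_right_mono)
    qed
    also have "\<dots> \<le> B\<^sup>2 * (norm x)\<^sup>2"
      using sum_sq_le_norm[OF that, of x] by (simp add: sum_distrib_left[symmetric] mult_left_mono)
    finally show ?thesis by (simp add: power_mult_distrib)
  qed
  show "ev (dmul \<theta> x) c = \<theta> c * ev x c" using ell2_of_bound(2)[OF *] by (simp add: dmul_def)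
  have "(norm (dmul \<theta> x))\<^sup>2 \<le> (B * norm x)\<^sup>2" using ell2_of_bound(3)[OF *] by (simp add: dmul_def)
  then show "norm (dmul \<theta> x) \<le> B * norm x"
    using B by (meson mult_nonneg_nonneg norm_ge_zero power2_le_imp_le)
qed

definition rst :: "'a set \<Rightarrow> 'a ell2 \<Rightarrow> 'a ell2" where
  "rst S x = dmul (indicator S) x"

lemma ev_rst [simp]: "ev (rst S x) c = (if c \<in> S then ev x c else 0)"
  unfolding rst_def by (subst dmul_bound(1)[of _ 1]) (auto simp: indicator_def)

lemma norm_rst_le: "norm (rst S x) \<le> norm x"
  unfolding rst_def using dmul_bound(2)[of "indicator S" 1 x] by (auto simp: indicator_def)

lemma rst_add: "rst S (x + y) = rst S x + rst S y"
  and rst_diff: "rst S (x - y) = rst S x - rst S y"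
  and rst_scaleR: "rst S (r *\<^sub>R x) = r *\<^sub>R rst S x"
  and rst_zero [simp]: "rst S 0 = 0"
  by (rule ell2_eqI; simp)+

lemma rst_rst [simp]: "rst S (rst T x) = rst (S \<inter> T) x"
  by (rule ell2_eqI) auto

lemma rst_compl: "rst S x + rst (- S) x = x"
  by (rule ell2_eqI) auto

lemma rst_Un: "S \<inter> T = {} \<Longrightarrow> rst (S \<union> T) x = rst S x + rst T x"
  by (rule ell2_eqI) auto

lemma bounded_linear_rst: "bounded_linear (rst S)"
  by (rule bounded_linear_intro[where K = 1]) (auto simp: rst_add rst_scaleR norm_rst_le)

lemmas continuous_on_rst [continuous_intros] =
  bounded_linear.continuous_on[OF bounded_linear_rst]
lemmas tendsto_rst [tendsto_intros] = bounded_linear.tendsto[OF bounded_linear_rst]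

lemma inner_rst_disjoint: "S \<inter> T = {} \<Longrightarrow> inner (rst S x) (rst T y) = 0"
proof -
  assume "S \<inter> T = {}"
  then have "ev (rst S x) c * ev (rst T y) c = 0" for c by auto
  then show ?thesis by (simp only: inner_infsum infsum_0)
qed

lemma norm_rst_Un:
  assumes "S \<inter> T = {}"
  shows "(norm (rst (S \<union> T) x))\<^sup>2 = (norm (rst S x))\<^sup>2 + (norm (rst T x))\<^sup>2"
  using inner_rst_disjoint[OF assms, of x x]
  by (simp add: rst_Un[OF assms] power2_norm_eq_inner inner_add_left inner_add_right inner_commute)

lemma rst_UNIV [simp]: "rst UNIV x = x"
  by (rule ell2_eqI) auto

lemma norm_rst_compl: "(norm x)\<^sup>2 = (norm (rst S x))\<^sup>2 + (norm (rst (- S) x))\<^sup>2"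
  using norm_rst_Un[of S "- S" x] by (simp add: Compl_partition)

lemma norm_rst_tail:
  assumes "0 < e"
  shows "\<exists>F. finite F \<and> norm (rst (- F) x) < e"
proof -
  have "((\<lambda>c. (ev x c)\<^sup>2) has_sum (norm x)\<^sup>2) UNIV"
    using ev_summable[of x] unfolding norm_sq_infsum by (rule has_sum_infsum)
  then have "((sum (\<lambda>c. (ev x c)\<^sup>2)) \<longlongrightarrow> (norm x)\<^sup>2) (finite_subsets_at_top UNIV)"
    by (simp add: has_sum_def)
  then have "\<forall>\<^sub>F F in finite_subsets_at_top UNIV. dist (sum (\<lambda>c. (ev x c)\<^sup>2) F) ((norm x)\<^sup>2) < e\<^sup>2"
    using assms by (intro tendstoD) auto
  then obtain F where F: "finite F" "dist (sum (\<lambda>c. (ev x c)\<^sup>2) F) ((norm x)\<^sup>2) < e\<^sup>2"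
    unfolding eventually_finite_subsets_at_top by blast
  have "(norm (rst F x))\<^sup>2 = sum (\<lambda>c. (ev x c)\<^sup>2) F"
    using F(1) by (subst norm_sq_finite[of F]) auto
  then have "(norm (rst (- F) x))\<^sup>2 < e\<^sup>2"
    using F(2) norm_rst_compl[of x F] by (simp add: dist_real_def)
  then have "norm (rst (- F) x) < e" using assms by (simp add: power2_less_imp_less)
  then show ?thesis using F(1) by blast
qed

text \<open>Diagonal extraction gives limits of all coordinates, and the norm bound survives because
  every finite partial sum of squares passes to the limit. Boundedness with coordinatewise
  convergence plays the role of weak convergence.\<close>

lemma ell2_bounded_weak_subseq:
  fixes x :: "nat \<Rightarrow> ('a::countable) ell2"
  assumes B: "\<And>m. norm (x m) \<le> B"
  shows "\<exists>r y. strict_mono (r :: nat \<Rightarrow> nat) \<and> norm y \<le> B \<and> (\<forall>c. (\<lambda>m. ev (x (r m)) c) \<longlonglongrightarrow> ev y c)"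
proof -
  have B0: "0 \<le> B" using B[of 0] norm_ge_zero order_trans by blast
  interpret subseqs "\<lambda>n s. convergent (\<lambda>m. ev (x (s m)) (from_nat n))"
  proof
    fix n :: nat and s :: "nat \<Rightarrow> nat" assume "strict_mono s"
    have "bounded (range (\<lambda>m. ev (x (s m)) (from_nat n)))"
      by (intro boundedI[of _ B]) (auto intro!: order_trans[OF abs_ev_le B])
    then obtain l r where "strict_mono r" "((\<lambda>m. ev (x (s m)) (from_nat n)) \<circ> r) \<longlonglongrightarrow> l"
      using bounded_imp_convergent_subsequence by blast
    then show "\<exists>r'. strict_mono r' \<and> convergent (\<lambda>m. ev (x ((s \<circ> r') m)) (from_nat n))"
      by (auto simp: o_def convergent_def)
  qed
  \<comment> \<open>The diagonal sequence is a subsequence of the \<open>n\<close>-th extraction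
    only from index \<open>Suc n\<close> on; \<open>conv\<close> removes the shift.\<close>
  have cs: "convergent (\<lambda>m. ev (x (diagseq (m + (Suc n)))) (from_nat n))" for n
  proof -
    have "convergent (\<lambda>m. ev (x ((diagseq \<circ> (+) (Suc n)) m)) (from_nat n))"
    proof (rule diagseq_holds)
      fix n and s r :: "nat \<Rightarrow> nat"
      assume "strict_mono r" "convergent (\<lambda>m. ev (x (s m)) (from_nat n))"
      then show "convergent (\<lambda>m. ev (x ((s \<circ> r) m)) (from_nat n))"
        using convergent_subseq_convergent[of "\<lambda>m. ev (x (s m)) (from_nat n)" r] by (simp add: o_def)
    qed
    then show ?thesis by (simp add: o_def add.commute)
  qed
  have conv: "convergent (\<lambda>m. ev (x (diagseq m)) (from_nat n))" for n
    by (rule iffD1[OF convergent_ignore_initial_segment[of "\<lambda>m. ev (x (diagseq m)) (from_nat n)" "Suc n"] cs[of n]])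
  define f where "f c = lim (\<lambda>m. ev (x (diagseq m)) c)" for c
  have lim: "(\<lambda>m. ev (x (diagseq m)) c) \<longlonglongrightarrow> f c" for c
    using conv[of "to_nat c"] by (simp add: f_def convergent_LIMSEQ_iff)
  have bd: "(\<Sum>c\<in>F. (f c)\<^sup>2) \<le> B\<^sup>2" if "finite F" for F
  proof (rule LIMSEQ_le_const2)
    show "(\<lambda>m. \<Sum>c\<in>F. (ev (x (diagseq m)) c)\<^sup>2) \<longlonglongrightarrow> (\<Sum>c\<in>F. (f c)\<^sup>2)"
      by (intro tendsto_sum tendsto_power lim)
    show "\<exists>N. \<forall>m\<ge>N. (\<Sum>c\<in>F. (ev (x (diagseq m)) c)\<^sup>2) \<le> B\<^sup>2"
      using order_trans[OF sum_sq_le_norm[OF that] power_mono[OF B norm_ge_zero]] by blast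
  qed
  have "norm (Abs_ell2 f) \<le> B" by (rule power2_le_imp_le[OF ell2_of_bound(3)[OF bd] B0])
  moreover have "ev (Abs_ell2 f) = f" using ell2_of_bound(2)[OF bd] .
  ultimately show ?thesis
    using lim subseq_diagseq by (intro exI[of _ diagseq] exI[of _ "Abs_ell2 f"] conjI allI) simp_all
qed

text \<open>A diagonal operator whose multipliers tend to zero on the support \<open>S\<close> is
  compact: finitely many coordinates converge by hypothesis, and all others carry a multiplier below
  \<open>d\<close>.\<close>

lemma dmul_compact_tendsto:
  assumes \<theta>: "\<And>c. \<bar>\<theta> c\<bar> \<le> 1" "\<And>e. 0 < e \<Longrightarrow> finite {c \<in> S. e \<le> \<bar>\<theta> c\<bar>}"
    and x: "\<And>m. norm (x m) \<le> B" "\<And>m c. c \<notin> S \<Longrightarrow> ev (x m) c = 0"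
    and y: "norm y \<le> B" and lim: "\<And>c. (\<lambda>m. ev (x m) c) \<longlonglongrightarrow> ev y c"
  shows "(\<lambda>m. dmul \<theta> (x m)) \<longlonglongrightarrow> dmul \<theta> y"
proof -
  have B: "0 \<le> B" using y norm_ge_zero order_trans by blast
  have yS: "ev y c = 0" if "c \<notin> S" for c
    using lim[of c] x(2)[OF that] by (simp add: LIMSEQ_const_iff)
  note evd = dmul_bound(1)[of \<theta> 1, OF \<theta>(1)]
  have "(\<lambda>m. dmul \<theta> (x m - y)) \<longlonglongrightarrow> 0"
  proof (rule LIMSEQ_I)
    fix e :: real assume e: "0 < e"
    \<comment> \<open>The difference of two vectors of norm at most \<open>B\<close> has norm at
      most \<open>2 * B\<close>, so the coordinates with small multiplier contribute at most
      \<open>e / 2\<close>; the \<open>+ 1\<close> covers \<open>B = 0\<close>.\<close>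
    define d where "d = e / (4 * (B + 1))"
    have d: "0 < d" using e B by (simp add: d_def)
    define F where "F = {c \<in> S. d \<le> \<bar>\<theta> c\<bar>}"
    have F: "finite F" using \<theta>(2)[OF d] by (simp add: F_def)
    have "(\<lambda>m. \<Sum>c\<in>F. \<bar>ev (x m) c - ev y c\<bar>) \<longlonglongrightarrow> (\<Sum>c\<in>F. \<bar>ev y c - ev y c\<bar>)"
      by (intro tendsto_intros lim)
    then have "\<forall>\<^sub>F m in sequentially. (\<Sum>c\<in>F. \<bar>ev (x m) c - ev y c\<bar>) < e / 2"
      using e by (intro order_tendstoD(2)) auto
    then obtain N where N: "\<And>m. m \<ge> N \<Longrightarrow> (\<Sum>c\<in>F. \<bar>ev (x m) c - ev y c\<bar>) < e / 2"
      by (auto simp: eventually_sequentially)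
    have "norm (dmul \<theta> (x m - y)) < e" if m: "m \<ge> N" for m
    proof -
      let ?z = "x m - y"
      have "dmul \<theta> ?z = rst F (dmul \<theta> ?z) + rst (- F) (dmul \<theta> ?z)" by (simp add: rst_compl)
      then have "norm (dmul \<theta> ?z) \<le> norm (rst F (dmul \<theta> ?z)) + norm (rst (- F) (dmul \<theta> ?z))"
        by (metis norm_triangle_ineq)
      moreover have "norm (rst F (dmul \<theta> ?z)) \<le> (\<Sum>c\<in>F. \<bar>ev ?z c\<bar>)"
      proof -
        have "rst F (dmul \<theta> ?z) = (\<Sum>c\<in>F. ev (dmul \<theta> ?z) c *\<^sub>R bas c)"
        proof (rule ell2_eqI)
          fix d
          have "(\<Sum>c\<in>F. ev (dmul \<theta> ?z) c * (if d = c then 1 else 0)) = (if d \<in> F then ev (dmul \<theta> ?z) d else 0)"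
            using F by (simp add: if_distrib[of "\<lambda>t. _ * t"] sum.delta' cong: if_cong)
          then show "ev (rst F (dmul \<theta> ?z)) d = ev (\<Sum>c\<in>F. ev (dmul \<theta> ?z) c *\<^sub>R bas c) d"
            by (simp add: ev_bas)
        qed
        then have "norm (rst F (dmul \<theta> ?z)) \<le> (\<Sum>c\<in>F. norm (ev (dmul \<theta> ?z) c *\<^sub>R bas c))"
          by (metis norm_sum)
        also have "\<dots> \<le> (\<Sum>c\<in>F. \<bar>ev ?z c\<bar>)"
        proof (rule sum_mono)
          fix c
          have "\<bar>\<theta> c\<bar> * \<bar>ev ?z c\<bar> \<le> 1 * \<bar>ev ?z c\<bar>" by (rule mult_right_mono[OF \<theta>(1)]) simp
          then show "norm (ev (dmul \<theta> ?z) c *\<^sub>R bas c) \<le> \<bar>ev ?z c\<bar>" by (simp add: evd abs_mult)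
        qed
        finally show ?thesis .
      qed
      moreover have "norm (rst (- F) (dmul \<theta> ?z)) \<le> d * norm ?z"
      proof -
        have eq: "rst (- F) (dmul \<theta> ?z) = dmul (\<lambda>c. if c \<in> F \<or> c \<notin> S then 0 else \<theta> c) ?z"
        proof (rule ell2_eqI)
          fix c
          have "ev (dmul (\<lambda>c. if c \<in> F \<or> c \<notin> S then 0 else \<theta> c) ?z) c
              = (if c \<in> F \<or> c \<notin> S then 0 else \<theta> c) * ev ?z c"
            by (rule dmul_bound(1)[of _ 1]) (auto simp: \<theta>(1))
          then show "ev (rst (- F) (dmul \<theta> ?z)) c = ev (dmul (\<lambda>c. if c \<in> F \<or> c \<notin> S then 0 else \<theta> c) ?z) c"
            using x(2)[of c m] yS[of c] by (auto simp: evd)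
        qed
        show ?thesis unfolding eq
          by (rule dmul_bound(2)) (use d in \<open>auto simp: F_def\<close>)
      qed
      moreover have "d * norm ?z \<le> d * (2 * B)"
        using norm_triangle_ineq4[of "x m" y] x(1)[of m] y d by (intro mult_left_mono) auto
      moreover have "d * (2 * B) \<le> e / 2" using e B by (simp add: d_def field_simps)
      ultimately show ?thesis using N[OF m] by simp
    qed
    then show "\<exists>N. \<forall>m\<ge>N. norm (dmul \<theta> (x m - y) - 0) < e" by auto
  qed
  moreover have "dmul \<theta> (x m - y) = dmul \<theta> (x m) - dmul \<theta> y" for m
    by (rule ell2_eqI) (simp add: evd algebra_simps)
  ultimately show ?thesis by (simp add: LIM_zero_iff)
qed

section \<open>Square-integrable functions on the unit interval\<close>

text \<open>One period with total mass one, so that L^1 norms are bounded by L^2 norms.\<close>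

definition MI :: "real measure" where "MI = restrict_space lborel {0..1}"

lemma space_MI [simp]: "space MI = {0..1}"
  by (simp add: MI_def space_restrict_space)

lemma emeasure_MI: "emeasure MI {0..1} = 1"
  by (simp add: MI_def emeasure_restrict_space)

interpretation MI: finite_measure MI
  unfolding MI_def
  by (rule finite_measureI) (simp add: emeasure_restrict_space space_restrict_space)

lemma measure_MI [simp]: "measure MI {0..1} = 1"
  by (simp add: measure_def emeasure_MI)

lemma integral_MI_const [simp]: "(\<integral>t. c \<partial>MI) = (c :: real)"
  by (simp add: measure_def emeasure_MI)

lemma integral_MI: "(\<integral>t. f t \<partial>MI) = (LINT t:{0..1}|lborel. (f t :: real))"
  by (simp add: MI_def integral_restrict_space set_lebesgue_integral_def)

lemma nn_integral_MI: "(\<integral>\<^sup>+t. f t \<partial>MI) = (\<integral>\<^sup>+t. f t * indicator {0..1} t \<partial>lborel)"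
  by (simp add: MI_def nn_integral_restrict_space)

lemma measurable_MI: "f \<in> borel_measurable lborel \<Longrightarrow> f \<in> borel_measurable MI"
  by (simp add: MI_def measurable_restrict_space1)

lemma measurable_MI_cont: "continuous_on {0..1} f \<Longrightarrow> (f :: real \<Rightarrow> real) \<in> borel_measurable MI"
  unfolding MI_def
  by (metis borel_measurable_continuous_on_restrict measurable_cong_sets sets_lborel sets_restrict_space_cong)

lemma integrable_MI_bounded:
  fixes f :: "real \<Rightarrow> real"
  assumes "f \<in> borel_measurable MI" "\<And>t. t \<in> {0..1} \<Longrightarrow> \<bar>f t\<bar> \<le> B"
  shows "integrable MI f"
  by (rule MI.integrable_const_bound[of _ B]) (use assms in \<open>auto intro!: AE_I2\<close>)

lemma integrable_MI_cont:
  assumes "continuous_on {0..1} (f :: real \<Rightarrow> real)"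
  shows "integrable MI f"
proof -
  have "compact (f ` {0..1})" using assms by (intro compact_continuous_image) auto
  then obtain B where "\<And>t. t \<in> {0..1} \<Longrightarrow> \<bar>f t\<bar> \<le> B"
    using compact_imp_bounded bounded_iff by (metis imageI real_norm_def)
  then show ?thesis using integrable_MI_bounded measurable_MI_cont[OF assms] by blast
qed

text \<open>With total mass one, an L^2 Cauchy sequence is Cauchy in L^1, so a subsequence converges
  almost everywhere. Fatou's lemma along it bounds the L^2 distance of every late term to the
  limit.\<close>

lemma L2_complete:
  fixes s :: "nat \<Rightarrow> real \<Rightarrow> real"
  assumes m [measurable]: "\<And>n. s n \<in> borel_measurable MI"
    and i: "\<And>n. integrable MI (\<lambda>t. (s n t)\<^sup>2)"
    and C: "\<And>e. 0 < e \<Longrightarrow> \<exists>N. \<forall>i\<ge>N. \<forall>j\<ge>N. (\<integral>t. (s i t - s j t)\<^sup>2 \<partial>MI) < e"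
  obtains f where "f \<in> borel_measurable MI" "\<And>n. integrable MI (\<lambda>t. (s n t - f t)\<^sup>2)"
    "(\<lambda>n. \<integral>t. (s n t - f t)\<^sup>2 \<partial>MI) \<longlonglongrightarrow> 0"
proof -
  have i2: "integrable MI (\<lambda>t. (s n t - s k t)\<^sup>2)" for n k
  proof (rule Bochner_Integration.integrable_bound)
    show "integrable MI (\<lambda>t. 2 * (s n t)\<^sup>2 + 2 * (s k t)\<^sup>2)"
      by (intro Bochner_Integration.integrable_add integrable_mult_right i)
    have "(a - b)\<^sup>2 \<le> 2 * a\<^sup>2 + 2 * b\<^sup>2" for a b :: real
      using zero_le_power2[of "a + b"] by (simp add: power2_sum power2_diff)
    then show "AE t in MI. norm ((s n t - s k t)\<^sup>2) \<le> norm (2 * (s n t)\<^sup>2 + 2 * (s k t)\<^sup>2)"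
      by (intro AE_I2) (simp add: order_trans[OF _ abs_ge_self])
  qed simp
  have i1: "integrable MI (s n)" for n
  proof (rule Bochner_Integration.integrable_bound)
    show "integrable MI (\<lambda>t. 1 + (s n t)\<^sup>2)" by (intro Bochner_Integration.integrable_add i) simp
    have "\<bar>a\<bar> \<le> 1 + a\<^sup>2" for a :: real
      using zero_le_power2[of "\<bar>a\<bar> - 1"] abs_ge_zero[of a] unfolding power2_diff by simp
    then show "AE t in MI. norm (s n t) \<le> norm (1 + (s n t)\<^sup>2)"
      by (intro AE_I2) (simp add: order_trans[OF _ abs_ge_self])
  qed simp
  have "\<exists>N. \<forall>i\<ge>N. \<forall>j\<ge>N. (LINT t|MI. norm (s i t - s j t)) < e" if e: "0 < e" for e
  proof -
    obtain N where N: "\<And>i j. i \<ge> N \<Longrightarrow> j \<ge> N \<Longrightarrow> (\<integral>t. (s i t - s j t)\<^sup>2 \<partial>MI) < e\<^sup>2 / 2"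
      using C[of "e\<^sup>2 / 2"] e by auto
    have "(LINT t|MI. norm (s i t - s j t)) < e" if ij: "i \<ge> N" "j \<ge> N" for i j
    proof -
      \<comment> \<open>Young's inequality with weight \<open>e\<close>; integrated, it turns a
        squared L^2 distance below \<open>e\<^sup>2 / 2\<close> into an L^1 distance below
        \<open>e\<close>.\<close>
      have le: "\<bar>a\<bar> \<le> (1 / (2 * e)) * a\<^sup>2 + e / 2" for a :: real
      proof -
        have "0 \<le> (\<bar>a\<bar> - e)\<^sup>2" by simp
        then have "2 * e * \<bar>a\<bar> \<le> a\<^sup>2 + e\<^sup>2" by (simp add: power2_diff algebra_simps)
        then have "\<bar>a\<bar> \<le> (a\<^sup>2 + e\<^sup>2) / (2 * e)" using e by (simp add: pos_le_divide_eq mult.commute)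
        also have "\<dots> = (1 / (2 * e)) * a\<^sup>2 + e / 2" using e by (simp add: field_simps power2_eq_square)
        finally show ?thesis .
      qed
      have "(LINT t|MI. norm (s i t - s j t)) \<le> (LINT t|MI. (1 / (2 * e)) * (s i t - s j t)\<^sup>2 + e / 2)"
        by (intro integral_mono integrable_norm Bochner_Integration.integrable_diff i1
              Bochner_Integration.integrable_add integrable_mult_right i2) (use le in auto)
      also have "\<dots> = (1 / (2 * e)) * (\<integral>t. (s i t - s j t)\<^sup>2 \<partial>MI) + e / 2"
        by (subst Bochner_Integration.integral_add) (use i2 in \<open>auto\<close>)
      also have "\<dots> < (1 / (2 * e)) * (e\<^sup>2 / 2) + e / 2"
        using N[OF ij] e by (intro add_strict_right_mono mult_strict_left_mono) auto
      also have "\<dots> < e" using e by (simp add: power2_eq_square)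
      finally show ?thesis .
    qed
    then show ?thesis by blast
  qed
  from cauchy_L1_AE_cauchy_subseq[OF i1 this]
  obtain r where r: "strict_mono r" "AE t in MI. Cauchy (\<lambda>i. s (r i) t)" by blast
  define f where "f t = lim (\<lambda>i. s (r i) t)" for t
  have fm [measurable]: "f \<in> borel_measurable MI"
    unfolding f_def by measurable
  have lim: "AE t in MI. (\<lambda>i. s (r i) t) \<longlonglongrightarrow> f t"
    using r(2) by eventually_elim (simp add: f_def Cauchy_convergent convergent_LIMSEQ_iff[symmetric])
  have key: "(\<integral>\<^sup>+t. ennreal ((s n t - f t)\<^sup>2) \<partial>MI) \<le> ennreal e"
    if N: "\<And>i. i \<ge> N \<Longrightarrow> (\<integral>t. (s n t - s i t)\<^sup>2 \<partial>MI) < e" for n N e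
  proof -
    have "(\<integral>\<^sup>+t. ennreal ((s n t - f t)\<^sup>2) \<partial>MI) = (\<integral>\<^sup>+t. liminf (\<lambda>i. ennreal ((s n t - s (r i) t)\<^sup>2)) \<partial>MI)"
    proof (rule nn_integral_cong_AE)
      show "AE t in MI. ennreal ((s n t - f t)\<^sup>2) = liminf (\<lambda>i. ennreal ((s n t - s (r i) t)\<^sup>2))"
        using lim
      proof eventually_elim
        case (elim t)
        then have "(\<lambda>i. ennreal ((s n t - s (r i) t)\<^sup>2)) \<longlonglongrightarrow> ennreal ((s n t - f t)\<^sup>2)"
          by (intro tendsto_intros)
        from lim_imp_Liminf[OF _ this] show ?case by simp
      qed
    qed
    also have "\<dots> \<le> liminf (\<lambda>i. \<integral>\<^sup>+t. ennreal ((s n t - s (r i) t)\<^sup>2) \<partial>MI)"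
      by (rule nn_integral_liminf) simp
    also have "\<dots> \<le> liminf (\<lambda>i. ennreal e)"
    proof (rule Liminf_mono)
      show "\<forall>\<^sub>F i in sequentially. (\<integral>\<^sup>+t. ennreal ((s n t - s (r i) t)\<^sup>2) \<partial>MI) \<le> ennreal e"
        unfolding eventually_sequentially
      proof (intro exI allI impI)
        fix i assume "N \<le> i"
        then have "r i \<ge> N" using seq_suble[OF r(1), of i] by linarith
        then show "(\<integral>\<^sup>+t. ennreal ((s n t - s (r i) t)\<^sup>2) \<partial>MI) \<le> ennreal e"
          using N[of "r i"] by (subst nn_integral_eq_integral[OF i2]) (auto intro: ennreal_leI)
      qed
    qed
    also have "\<dots> = ennreal e" by (simp add: Liminf_const)
    finally show ?thesis .
  qed
  \<comment> \<open>One term at finite distance from \<open>f\<close> suffices; the triangle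
    inequality carries integrability to all other terms.\<close>
  obtain N1 where "\<And>i j. i \<ge> N1 \<Longrightarrow> j \<ge> N1 \<Longrightarrow> (\<integral>t. (s i t - s j t)\<^sup>2 \<partial>MI) < 1"
    using C[of 1] by auto
  then have "(\<integral>\<^sup>+t. ennreal ((s N1 t - f t)\<^sup>2) \<partial>MI) \<le> ennreal 1" by (intro key[of N1]) auto
  then have "integrable MI (\<lambda>t. (s N1 t - f t)\<^sup>2)"
    by (intro integrableI_bounded) (auto simp: top_unique less_top[symmetric] intro: le_less_trans)
  then have i3: "integrable MI (\<lambda>t. (s n t - f t)\<^sup>2)" for n
  proof -
    assume I: "integrable MI (\<lambda>t. (s N1 t - f t)\<^sup>2)"
    show ?thesis
    proof (rule Bochner_Integration.integrable_bound)
      show "integrable MI (\<lambda>t. 2 * (s n t - s N1 t)\<^sup>2 + 2 * (s N1 t - f t)\<^sup>2)"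
        by (intro Bochner_Integration.integrable_add integrable_mult_right i2 I)
      have "(a - b)\<^sup>2 \<le> 2 * (a - c)\<^sup>2 + 2 * (c - b)\<^sup>2" for a b c :: real
        using zero_le_power2[of "a + b - 2 * c"] by (simp add: power2_eq_square algebra_simps)
      then show "AE t in MI. norm ((s n t - f t)\<^sup>2) \<le> norm (2 * (s n t - s N1 t)\<^sup>2 + 2 * (s N1 t - f t)\<^sup>2)"
        by (intro AE_I2) (simp add: order_trans[OF _ abs_ge_self])
    qed simp
  qed
  moreover have "(\<lambda>n. \<integral>t. (s n t - f t)\<^sup>2 \<partial>MI) \<longlonglongrightarrow> 0"
  proof (rule LIMSEQ_I)
    fix e :: real assume e: "0 < e"
    obtain N where N: "\<And>i j. i \<ge> N \<Longrightarrow> j \<ge> N \<Longrightarrow> (\<integral>t. (s i t - s j t)\<^sup>2 \<partial>MI) < e / 2"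
      using C[of "e / 2"] e by auto
    have "(\<integral>t. (s n t - f t)\<^sup>2 \<partial>MI) \<le> e / 2" if "n \<ge> N" for n
    proof -
      have "ennreal (\<integral>t. (s n t - f t)\<^sup>2 \<partial>MI) = (\<integral>\<^sup>+t. ennreal ((s n t - f t)\<^sup>2) \<partial>MI)"
        by (rule nn_integral_eq_integral[symmetric, OF i3]) simp
      also have "\<dots> \<le> ennreal (e / 2)" using N[OF that] by (intro key[of N]) auto
      finally show ?thesis using e by (simp add: ennreal_le_iff)
    qed
    then have "\<forall>n\<ge>N. norm ((\<integral>t. (s n t - f t)\<^sup>2 \<partial>MI) - 0) < e"
      using e by (force simp: abs_of_nonneg)
    then show "\<exists>N. \<forall>n\<ge>N. norm ((\<integral>t. (s n t - f t)\<^sup>2 \<partial>MI) - 0) < e" by blast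
  qed
  ultimately show thesis using that fm by blast
qed

lemma integral_cos_MI: "(\<integral>t. cos (2 * pi * real_of_int m * t) \<partial>MI) = (if m = 0 then 1 else 0)"
proof (cases "m = 0")
  case False
  let ?a = "2 * pi * real_of_int m"
  have a: "?a \<noteq> 0" using False by simp
  have "(\<integral>t. indicator {0..1} t *\<^sub>R cos (?a * t) \<partial>lborel) = sin (?a * 1) / ?a - sin (?a * 0) / ?a"
  proof (rule integral_FTC_Icc)
    fix t :: real
    have "DERIV (\<lambda>t. sin (?a * t) / ?a) t :> cos (?a * t)"
      using a by (auto intro!: derivative_eq_intros)
    then show "((\<lambda>t. sin (?a * t) / ?a) has_vector_derivative cos (?a * t)) (at t within {0..1})"
      using has_real_derivative_iff_has_vector_derivative has_vector_derivative_at_within by blast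
  qed (auto intro!: continuous_intros)
  moreover have "sin ?a = 0" using sin_integer_2pi[of "real_of_int m"] by (simp add: mult.assoc)
  ultimately show ?thesis
    using False by (simp add: integral_MI set_lebesgue_integral_def)
qed simp

lemma integral_sin_MI: "(\<integral>t. sin (2 * pi * real_of_int m * t) \<partial>MI) = 0"
proof (cases "m = 0")
  case False
  let ?a = "2 * pi * real_of_int m"
  have a: "?a \<noteq> 0" using False by simp
  have "(\<integral>t. indicator {0..1} t *\<^sub>R sin (?a * t) \<partial>lborel) = (- cos (?a * 1) / ?a) - (- cos (?a * 0) / ?a)"
  proof (rule integral_FTC_Icc)
    fix t :: real
    have "DERIV (\<lambda>t. - cos (?a * t) / ?a) t :> sin (?a * t)"
      using a by (auto intro!: derivative_eq_intros)
    then show "((\<lambda>t. - cos (?a * t) / ?a) has_vector_derivative sin (?a * t)) (at t within {0..1})"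
      using has_real_derivative_iff_has_vector_derivative has_vector_derivative_at_within by blast
  qed (auto intro!: continuous_intros)
  moreover have "cos ?a = 1" using cos_integer_2pi[of "real_of_int m"] by (simp add: mult.assoc)
  ultimately show ?thesis
    by (simp add: integral_MI set_lebesgue_integral_def)
qed simp

section \<open>Square-integrable curves\<close>

text \<open>One type of families serves both spaces. Points are indexed by a coordinate number and a
  Boolean, \<open>False\<close> for x and \<open>True\<close> for y; loops by a frequency and a
  coordinate number. The dimension is a support condition, so factors and their product share a
  type.\<close>

type_synonym pv = "(nat \<times> bool) ell2"
type_synonym ec = "(int \<times> nat) ell2"

definition Ps :: "nat \<Rightarrow> pv set" where
  "Ps l = {v. \<forall>i b. l \<le> i \<longrightarrow> ev v (i, b) = 0}"

definition Cl :: "nat \<Rightarrow> (nat \<times> bool) set" where "Cl l = {..<l} \<times> UNIV"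

lemma finite_Cl [simp]: "finite (Cl l)" by (simp add: Cl_def)

lemma Ps_iff: "v \<in> Ps l \<longleftrightarrow> (\<forall>c. c \<notin> Cl l \<longrightarrow> ev v c = 0)"
  by (auto simp: Ps_def Cl_def not_less)

lemma Ps_ev: "v \<in> Ps l \<Longrightarrow> c \<notin> Cl l \<Longrightarrow> ev v c = 0" unfolding Ps_iff by blast

lemma Ps_0 [simp]: "0 \<in> Ps l"
  and Ps_add: "v \<in> Ps l \<Longrightarrow> w \<in> Ps l \<Longrightarrow> v + w \<in> Ps l"
  and Ps_diff: "v \<in> Ps l \<Longrightarrow> w \<in> Ps l \<Longrightarrow> v - w \<in> Ps l"
  and Ps_scaleR: "v \<in> Ps l \<Longrightarrow> r *\<^sub>R v \<in> Ps l"
  by (auto simp: Ps_def)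

lemma Ps_sum: "(\<And>a. a \<in> A \<Longrightarrow> f a \<in> Ps l) \<Longrightarrow> sum f A \<in> Ps l"
  by (induction A rule: infinite_finite_induct) (auto intro: Ps_add)

lemma inner_Ps: "v \<in> Ps l \<Longrightarrow> inner v w = (\<Sum>c\<in>Cl l. ev v c * ev w c)"
  by (rule inner_finite) (auto simp: Ps_ev)

lemma norm_Ps: "v \<in> Ps l \<Longrightarrow> (norm v)\<^sup>2 = (\<Sum>c\<in>Cl l. (ev v c)\<^sup>2)"
  by (rule norm_sq_finite) (auto simp: Ps_ev)

lemma Ps_expand: "v \<in> Ps l \<Longrightarrow> v = (\<Sum>c\<in>Cl l. ev v c *\<^sub>R bas c)"
  by (rule ell2_eqI) (auto simp: ev_bas if_distrib[of "\<lambda>t. _ * t"] sum.delta' Ps_ev cong: if_cong)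

text \<open>Functions rather than classes, with values in \<open>Ps l\<close> at every time;
  identities valid only almost everywhere are carried as such.\<close>

definition L2f :: "nat \<Rightarrow> (real \<Rightarrow> pv) \<Rightarrow> bool" where
  "L2f l f \<longleftrightarrow> (\<forall>t. f t \<in> Ps l) \<and> (\<forall>c. (\<lambda>t. ev (f t) c) \<in> borel_measurable MI) \<and>
     integrable MI (\<lambda>t. (norm (f t))\<^sup>2)"

lemma L2f_Ps: "L2f l f \<Longrightarrow> f t \<in> Ps l"
  and L2f_ev: "L2f l f \<Longrightarrow> (\<lambda>t. ev (f t) c) \<in> borel_measurable MI"
  and L2f_sq: "L2f l f \<Longrightarrow> integrable MI (\<lambda>t. (norm (f t))\<^sup>2)"
  unfolding L2f_def by blast+

lemma inner_measurable:
  assumes "\<And>t. f t \<in> Ps l" "\<And>c. (\<lambda>t. ev (f t) c) \<in> borel_measurable MI"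
    "\<And>c. (\<lambda>t. ev (g t) c) \<in> borel_measurable MI"
  shows "(\<lambda>t. inner (f t) (g t)) \<in> borel_measurable MI"
proof -
  have "(\<lambda>t. inner (f t) (g t)) = (\<lambda>t. \<Sum>c\<in>Cl l. ev (f t) c * ev (g t) c)"
    by (simp add: inner_Ps[OF assms(1)])
  then show ?thesis using assms by simp
qed

lemma norm_measurable:
  assumes "\<And>t. f t \<in> Ps l" "\<And>c. (\<lambda>t. ev (f t) c) \<in> borel_measurable MI"
  shows "(\<lambda>t. norm (f t)) \<in> borel_measurable MI"
  unfolding norm_eq_sqrt_inner using inner_measurable[OF assms assms(2)] by simp

text \<open>The values lie in the span of finitely many basis vectors, so \<open>G\<close> may be
  replaced by a continuous function of the coordinate sequence, which is measurable coordinate by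
  coordinate.\<close>

lemma continuous_measurable:
  fixes G :: "pv \<Rightarrow> real"
  assumes G: "continuous_on UNIV G"
    and "\<And>t. f t \<in> Ps l" "\<And>c. (\<lambda>t. ev (f t) c) \<in> borel_measurable MI"
  shows "(\<lambda>t. G (f t)) \<in> borel_measurable MI"
proof -
  define \<phi> :: "(nat \<times> bool \<Rightarrow> real) \<Rightarrow> real" where "\<phi> z = G (\<Sum>c\<in>Cl l. z c *\<^sub>R bas c)" for z
  have "continuous_on UNIV \<phi>"
    unfolding \<phi>_def
    by (rule continuous_on_compose2[OF G]) (auto intro!: continuous_intros)
  then have 1: "\<phi> \<in> borel_measurable borel" by (rule borel_measurable_continuous_onI)
  have 2: "(\<lambda>t. ev (f t)) \<in> borel_measurable MI"
    by (rule measurable_coordinatewise_then_product) (rule assms(3))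
  have "(\<lambda>t. \<phi> (ev (f t))) \<in> borel_measurable MI"
    using measurable_compose[OF 2 1] .
  moreover have "\<phi> (ev (f t)) = G (f t)" for t
    unfolding \<phi>_def using Ps_expand[OF assms(2)[of t]] by simp
  ultimately show ?thesis by simp
qed

lemma L2f_zero [simp]: "L2f l (\<lambda>t. 0)"
  by (simp add: L2f_def)

lemma L2f_scaleR:
  assumes "L2f l f"
  shows "L2f l (\<lambda>t. r *\<^sub>R f t)"
proof -
  have "(\<lambda>t. ev (r *\<^sub>R f t) c) \<in> borel_measurable MI" for c
    using L2f_ev[OF assms, of c] by simp
  then show ?thesis
    using L2f_Ps[OF assms] L2f_sq[OF assms] by (simp add: L2f_def Ps_scaleR power_mult_distrib)
qed

lemma L2f_add:
  assumes "L2f l f" "L2f l g"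
  shows "L2f l (\<lambda>t. f t + g t)"
proof -
  have 1: "f t + g t \<in> Ps l" for t using assms by (simp add: L2f_Ps Ps_add)
  have 2: "(\<lambda>t. ev (f t + g t) c) \<in> borel_measurable MI" for c
    using L2f_ev[OF assms(1), of c] L2f_ev[OF assms(2), of c] by simp
  have "integrable MI (\<lambda>t. (norm (f t + g t))\<^sup>2)"
  proof (rule Bochner_Integration.integrable_bound)
    show "integrable MI (\<lambda>t. 2 * (norm (f t))\<^sup>2 + 2 * (norm (g t))\<^sup>2)"
      using assms by (intro Bochner_Integration.integrable_add integrable_mult_right L2f_sq)
    show "(\<lambda>t. (norm (f t + g t))\<^sup>2) \<in> borel_measurable MI"
      using norm_measurable[OF 1 2] by simp
    have "(norm (a + b))\<^sup>2 \<le> 2 * (norm a)\<^sup>2 + 2 * (norm b)\<^sup>2" for a b :: pv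
      using zero_le_power2[of "norm (a - b)"] unfolding power2_norm_eq_inner
      by (simp add: inner_add_left inner_add_right inner_diff_left inner_diff_right)
    then show "AE t in MI. norm ((norm (f t + g t))\<^sup>2) \<le> norm (2 * (norm (f t))\<^sup>2 + 2 * (norm (g t))\<^sup>2)"
      by (intro AE_I2) simp
  qed
  then show ?thesis using 1 2 by (simp add: L2f_def)
qed

lemma L2f_diff: "L2f l f \<Longrightarrow> L2f l g \<Longrightarrow> L2f l (\<lambda>t. f t - g t)"
  using L2f_add[of l f "\<lambda>t. (-1) *\<^sub>R g t"] L2f_scaleR[of l g "-1"] by simp

lemma L2f_inner_integrable:
  assumes "L2f l f" "L2f l g"
  shows "integrable MI (\<lambda>t. inner (f t) (g t))"
proof (rule Bochner_Integration.integrable_bound)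
  show "integrable MI (\<lambda>t. (norm (f t))\<^sup>2 + (norm (g t))\<^sup>2)"
    using assms by (intro Bochner_Integration.integrable_add L2f_sq)
  show "(\<lambda>t. inner (f t) (g t)) \<in> borel_measurable MI"
    by (rule inner_measurable[OF L2f_Ps[OF assms(1)] L2f_ev[OF assms(1)] L2f_ev[OF assms(2)]])
  have "\<bar>inner a b\<bar> \<le> (norm a)\<^sup>2 + (norm b)\<^sup>2" for a b :: pv
  proof -
    have "\<bar>inner a b\<bar> \<le> norm a * norm b" by (rule Cauchy_Schwarz_ineq2)
    moreover have "0 \<le> (norm a - norm b)\<^sup>2" "0 \<le> norm a * norm b" by simp_all
    ultimately show ?thesis unfolding power2_diff by linarith
  qed
  then show "AE t in MI. norm (inner (f t) (g t)) \<le> norm ((norm (f t))\<^sup>2 + (norm (g t))\<^sup>2)"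
    by (intro AE_I2) simp
qed

lemma L2f_norm_integrable:
  assumes "L2f l f"
  shows "integrable MI (\<lambda>t. norm (f t))"
proof (rule Bochner_Integration.integrable_bound)
  show "integrable MI (\<lambda>t. 1 + (norm (f t))\<^sup>2)"
    using assms by (intro Bochner_Integration.integrable_add L2f_sq) auto
  show "(\<lambda>t. norm (f t)) \<in> borel_measurable MI"
    by (rule norm_measurable[OF L2f_Ps[OF assms] L2f_ev[OF assms]])
  have "a \<le> 1 + a\<^sup>2" for a :: real
    using zero_le_power2[of "2 * a - 1"] by (simp add: power2_eq_square algebra_simps)
  then show "AE t in MI. norm (norm (f t)) \<le> norm (1 + (norm (f t))\<^sup>2)"
    by (intro AE_I2) simp
qed

definition n2 :: "(real \<Rightarrow> pv) \<Rightarrow> real" where "n2 f = sqrt (\<integral>t. (norm (f t))\<^sup>2 \<partial>MI)"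

lemma n2_sq: "(n2 f)\<^sup>2 = (\<integral>t. (norm (f t))\<^sup>2 \<partial>MI)"
  by (simp add: n2_def)

lemma n2_nonneg [simp]: "0 \<le> n2 f"
  by (simp add: n2_def)

lemma norm_sq_comb:
  fixes a b :: "'a :: real_inner"
  shows "(norm (s *\<^sub>R a + b))\<^sup>2 = s\<^sup>2 * (norm a)\<^sup>2 + 2 * s * inner a b + (norm b)\<^sup>2"
proof -
  have "inner (s *\<^sub>R a + b) (s *\<^sub>R a + b) = s * s * inner a a + 2 * s * inner a b + inner b b"
    by (simp only: inner_add_left inner_add_right inner_scaleR_left inner_scaleR_right inner_commute[of b a])
      (simp add: algebra_simps)
  then show ?thesis unfolding power2_norm_eq_inner by (simp add: power2_eq_square)
qed

text \<open>The quadratic s -> integral of |s f + g|^2 is nonnegative, and its discriminant is the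
  inequality.\<close>

lemma L2f_CS:
  assumes "L2f l f" "L2f l g"
  shows "\<bar>\<integral>t. inner (f t) (g t) \<partial>MI\<bar> \<le> n2 f * n2 g"
proof -
  define a where "a = (n2 f)\<^sup>2"
  define b where "b = (n2 g)\<^sup>2"
  define c where "c = (\<integral>t. inner (f t) (g t) \<partial>MI)"
  have q: "0 \<le> a * s\<^sup>2 + 2 * s * c + b" for s
  proof -
    have "0 \<le> (\<integral>t. (norm (s *\<^sub>R f t + g t))\<^sup>2 \<partial>MI)" by simp
    also have "\<dots> = (\<integral>t. s\<^sup>2 * (norm (f t))\<^sup>2 + 2 * s * inner (f t) (g t) + (norm (g t))\<^sup>2 \<partial>MI)"
      by (simp only: norm_sq_comb)
    also have "\<dots> = s\<^sup>2 * a + 2 * s * c + b"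
      using assms by (simp add: L2f_sq L2f_inner_integrable a_def b_def c_def n2_sq)
    finally show ?thesis by (simp add: mult.commute)
  qed
  have "c\<^sup>2 \<le> a * b"
  proof (cases "a = 0")
    case True
    have "c = 0"
    proof (rule ccontr)
      assume c0: "c \<noteq> 0"
      \<comment> \<open>With leading coefficient zero the quadratic is affine, and this argument
        gives it the value -1.\<close>
      show False using q[of "- (b + 1) / (2 * c)"] True c0 by (simp add: field_simps)
    qed
    then show ?thesis by (simp add: True)
  next
    case False
    then have a: "0 < a" by (simp add: a_def)
    have "0 \<le> a * (- c / a)\<^sup>2 + 2 * (- c / a) * c + b" by (rule q)
    also have "\<dots> = b - c\<^sup>2 / a" using a by (simp add: power2_eq_square field_simps)
    finally show ?thesis using a by (simp add: pos_divide_le_eq mult.commute)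
  qed
  then have "c\<^sup>2 \<le> (n2 f * n2 g)\<^sup>2" by (simp add: a_def b_def power_mult_distrib)
  then show ?thesis by (simp add: c_def abs_le_square_iff[symmetric])
qed

lemma n2_triangle:
  assumes "L2f l f" "L2f l g"
  shows "n2 (\<lambda>t. f t + g t) \<le> n2 f + n2 g"
proof (rule power2_le_imp_le)
  have "(n2 (\<lambda>t. f t + g t))\<^sup>2 = (\<integral>t. (norm (f t))\<^sup>2 + 2 * inner (f t) (g t) + (norm (g t))\<^sup>2 \<partial>MI)"
    unfolding n2_sq by (intro Bochner_Integration.integral_cong refl)
        (simp add: power2_norm_eq_inner inner_add_left inner_add_right inner_commute)
  also have "\<dots> = (n2 f)\<^sup>2 + 2 * (\<integral>t. inner (f t) (g t) \<partial>MI) + (n2 g)\<^sup>2"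
    using assms by (simp add: L2f_sq L2f_inner_integrable n2_sq)
  also have "\<dots> \<le> (n2 f)\<^sup>2 + 2 * (n2 f * n2 g) + (n2 g)\<^sup>2"
    using L2f_CS[OF assms] by simp
  finally show "(n2 (\<lambda>t. f t + g t))\<^sup>2 \<le> (n2 f + n2 g)\<^sup>2" by (simp add: power2_sum)
qed simp

lemma n2_scaleR: "n2 (\<lambda>t. r *\<^sub>R f t) = \<bar>r\<bar> * n2 f"
  by (simp add: n2_def power_mult_distrib real_sqrt_mult)

lemma n2_minus_commute: "n2 (\<lambda>t. f t - g t) = n2 (\<lambda>t. g t - f t)"
  by (simp add: n2_def norm_minus_commute)

lemma n2_zero_AE:
  assumes "L2f l f" "n2 f = 0"
  shows "AE t in MI. f t = 0"
proof -
  have "(\<integral>t. (norm (f t))\<^sup>2 \<partial>MI) = 0" using assms(2) n2_sq[of f] by simp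
  then have "AE t in MI. (norm (f t))\<^sup>2 = 0"
    using integral_nonneg_eq_0_iff_AE[OF L2f_sq[OF assms(1)]] by simp
  then show ?thesis by simp
qed

lemma n2_cong_AE:
  assumes "L2f l f" "L2f l g" "AE t in MI. f t = g t"
  shows "n2 f = n2 g"
proof -
  have "(\<integral>t. (norm (f t))\<^sup>2 \<partial>MI) = (\<integral>t. (norm (g t))\<^sup>2 \<partial>MI)"
    by (rule integral_cong_AE) (use assms in \<open>auto intro: borel_measurable_integrable L2f_sq\<close>)
  then show ?thesis by (simp add: n2_def)
qed

text \<open>A loop is a chosen representative of an L^2 limit; algebraic properties of the loop map
  are obtained by comparing two limits of the same partial sums.\<close>

lemma L2_limit_unique:
  assumes f: "L2f l f" and g: "L2f l g" and s: "\<And>N. L2f l (s N)"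
    and "(\<lambda>N. n2 (\<lambda>t. s N t - f t)) \<longlonglongrightarrow> 0" "(\<lambda>N. n2 (\<lambda>t. s N t - g t)) \<longlonglongrightarrow> 0"
  shows "AE t in MI. f t = g t"
proof -
  have "n2 (\<lambda>t. f t - g t) \<le> n2 (\<lambda>t. s N t - f t) + n2 (\<lambda>t. s N t - g t)" for N
    using n2_triangle[OF L2f_diff[OF f s[of N]] L2f_diff[OF s[of N] g]]
    by (simp add: n2_minus_commute[of f])
  moreover have "(\<lambda>N. n2 (\<lambda>t. s N t - f t) + n2 (\<lambda>t. s N t - g t)) \<longlonglongrightarrow> 0 + 0"
    by (intro tendsto_add assms)
  ultimately have "n2 (\<lambda>t. f t - g t) \<le> 0"
    by (intro LIMSEQ_le_const[of _ "0 + 0" "n2 (\<lambda>t. f t - g t)", simplified]) auto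
  then have "n2 (\<lambda>t. f t - g t) = 0" by (simp add: antisym)
  from n2_zero_AE[OF L2f_diff[OF f g] this] show ?thesis by simp
qed

lemma L2f_inner_tendsto:
  assumes f: "L2f l f" and g: "L2f l g" and s: "\<And>N. L2f l (s N)"
    and "(\<lambda>N. n2 (\<lambda>t. s N t - f t)) \<longlonglongrightarrow> 0"
  shows "(\<lambda>N. \<integral>t. inner (g t) (s N t) \<partial>MI) \<longlonglongrightarrow> (\<integral>t. inner (g t) (f t) \<partial>MI)"
proof -
  have "(\<lambda>N. (\<integral>t. inner (g t) (s N t) \<partial>MI) - (\<integral>t. inner (g t) (f t) \<partial>MI)) \<longlonglongrightarrow> 0"
  proof (rule Lim_null_comparison)
    show "(\<lambda>N. n2 g * n2 (\<lambda>t. s N t - f t)) \<longlonglongrightarrow> 0"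
      using tendsto_mult_left[OF assms(4), of "n2 g"] by simp
    have "norm ((\<integral>t. inner (g t) (s N t) \<partial>MI) - (\<integral>t. inner (g t) (f t) \<partial>MI)) \<le> n2 g * n2 (\<lambda>t. s N t - f t)" for N
      using L2f_CS[OF g L2f_diff[OF s[of N] f]]
      by (simp add: inner_diff_right Bochner_Integration.integral_diff L2f_inner_integrable[OF g] s f)
    then show "\<forall>\<^sub>F N in sequentially. norm ((\<integral>t. inner (g t) (s N t) \<partial>MI) - (\<integral>t. inner (g t) (f t) \<partial>MI))
        \<le> n2 g * n2 (\<lambda>t. s N t - f t)" by simp
  qed
  then show ?thesis by (simp add: LIM_zero_iff)
qed

lemma L2f_cont:
  assumes "\<And>t. f t \<in> Ps l" "continuous_on {0..1} f"
  shows "L2f l f"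
  unfolding L2f_def
  by (intro conjI allI assms(1) measurable_MI_cont integrable_MI_cont continuous_intros assms(2))

section \<open>Fourier series and loops\<close>

text \<open>Scaling the coefficients by \<open>wt\<close> turns the norm of E into the plain \<open>\<ell>\<^sup>2\<close> norm.\<close>

definition wt :: "int \<times> nat \<Rightarrow> real" where
  "wt c = (if fst c = 0 then 1 else sqrt (2 * pi * \<bar>real_of_int (fst c)\<bar>))"

definition Es :: "nat \<Rightarrow> ec set" where
  "Es l = {\<xi>. \<forall>j i. l \<le> i \<longrightarrow> ev \<xi> (j, i) = 0}"

definition ofE :: "ec \<Rightarrow> ecoef" where "ofE \<xi> = (\<lambda>j i. ev \<xi> (j, i) / wt (j, i))"

definition toE :: "ecoef \<Rightarrow> ec" where "toE x = Abs_ell2 (\<lambda>c. wt c * x (fst c) (snd c))"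

lemma wt_sq: "(wt c)\<^sup>2 = (if fst c = 0 then 1 else 2 * pi * \<bar>real_of_int (fst c)\<bar>)"
  by (simp add: wt_def)

lemma wt_ge_1: "1 \<le> wt c"
proof (cases "fst c = 0")
  case False
  then have "1 \<le> \<bar>real_of_int (fst c)\<bar>" by linarith
  then have "1 * 1 \<le> 2 * pi * \<bar>real_of_int (fst c)\<bar>"
    using pi_gt3 by (intro mult_mono) auto
  then show ?thesis using False by (simp add: wt_def)
qed (simp add: wt_def)

lemma wt_pos [simp]: "0 < wt c" using wt_ge_1[of c] by linarith
lemma wt_nz [simp]: "wt c \<noteq> 0" using wt_pos[of c] by linarith

lemma abs_wt [simp]: "\<bar>wt c\<bar> = wt c" using wt_pos[of c] by linarith

lemma Es_0 [simp]: "0 \<in> Es l"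
  and Es_add: "x \<in> Es l \<Longrightarrow> y \<in> Es l \<Longrightarrow> x + y \<in> Es l"
  and Es_diff: "x \<in> Es l \<Longrightarrow> y \<in> Es l \<Longrightarrow> x - y \<in> Es l"
  and Es_scaleR: "x \<in> Es l \<Longrightarrow> r *\<^sub>R x \<in> Es l"
  and Es_rst: "x \<in> Es l \<Longrightarrow> rst S x \<in> Es l"
  by (auto simp: Es_def)

lemma Es_ev: "x \<in> Es l \<Longrightarrow> l \<le> snd c \<Longrightarrow> ev x c = 0"
  by (cases c) (simp add: Es_def)

lemma Es_nz: "x \<in> Es l \<Longrightarrow> ev x (j, i) \<noteq> 0 \<Longrightarrow> i < l"
  using Es_ev[of x l "(j, i)"] by (cases "i < l") auto

text \<open>For \<open>c = (j, i)\<close> this is exp(2 pi j t J0) applied to the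
  \<open>i\<close>-th basis vector of the fixed space. These loops are orthonormal in L^2.\<close>

definition ee :: "int \<times> nat \<Rightarrow> real \<Rightarrow> pv" where
  "ee c t = cos (2 * pi * real_of_int (fst c) * t) *\<^sub>R bas (snd c, False)
          + sin (2 * pi * real_of_int (fst c) * t) *\<^sub>R bas (snd c, True)"

lemma ee_Ps: "snd c < l \<Longrightarrow> ee c t \<in> Ps l"
  by (auto simp: ee_def Ps_def ev_bas)

lemma inner_ee: "inner (ee c t) (ee d t) =
    (if snd c = snd d then cos (2 * pi * real_of_int (fst c - fst d) * t) else 0)"
proof (cases "snd c = snd d")
  case True
  have "inner (ee c t) (ee d t) = cos (2 * pi * real_of_int (fst c) * t) * cos (2 * pi * real_of_int (fst d) * t)
      + sin (2 * pi * real_of_int (fst c) * t) * sin (2 * pi * real_of_int (fst d) * t)"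
    using True by (simp add: ee_def inner_add_left inner_add_right ev_bas)
  also have "\<dots> = cos (2 * pi * real_of_int (fst c) * t - 2 * pi * real_of_int (fst d) * t)"
    by (rule cos_diff[symmetric])
  finally show ?thesis using True by (simp add: algebra_simps)
next
  case False
  then show ?thesis by (simp add: ee_def inner_add_left inner_add_right ev_bas)
qed

lemma norm_ee: "norm (ee c t) = 1"
  by (simp add: norm_eq_sqrt_inner inner_ee)

lemma ee_cont: "continuous_on S (ee c)"
  unfolding ee_def by (intro continuous_intros)

lemma L2f_ee: "snd c < l \<Longrightarrow> L2f l (ee c)"
  by (intro L2f_cont ee_Ps ee_cont)

lemma integral_ee: "(\<integral>t. inner (ee c t) (ee d t) \<partial>MI) = (if c = d then 1 else 0)"
proof (cases "snd c = snd d")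
  case True
  then have "(\<integral>t. inner (ee c t) (ee d t) \<partial>MI) = (\<integral>t. cos (2 * pi * real_of_int (fst c - fst d) * t) \<partial>MI)"
    by (simp add: inner_ee)
  also have "\<dots> = (if fst c - fst d = 0 then 1 else 0)" by (rule integral_cos_MI)
  finally show ?thesis using True by (auto simp: prod_eq_iff)
next
  case False
  then show ?thesis by (auto simp: inner_ee)
qed

text \<open>Partial Fourier sum over the frequencies in \<open>A\<close>; dividing by
  \<open>wt\<close> undoes the scaling of the coefficients.\<close>

definition trg :: "nat \<Rightarrow> ec \<Rightarrow> int set \<Rightarrow> real \<Rightarrow> pv" where
  "trg l \<xi> A t = (\<Sum>c\<in>A \<times> {..<l}. (ev \<xi> c / wt c) *\<^sub>R ee c t)"

lemma trg_Ps: "trg l \<xi> A t \<in> Ps l"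
  unfolding trg_def by (intro Ps_sum Ps_scaleR ee_Ps) auto

lemma trg_cont: "continuous_on S (trg l \<xi> A)"
  unfolding trg_def by (intro continuous_intros ee_cont)

lemma L2f_trg [simp]: "L2f l (trg l \<xi> A)"
  by (intro L2f_cont trg_Ps trg_cont)

lemma integral_inner_trg:
  assumes "L2f l g"
  shows "(\<integral>t. inner (g t) (trg l \<xi> A t) \<partial>MI) = (\<Sum>c\<in>A \<times> {..<l}. (ev \<xi> c / wt c) * (\<integral>t. inner (g t) (ee c t) \<partial>MI))"
proof -
  have "(\<integral>t. inner (g t) (trg l \<xi> A t) \<partial>MI)
      = (\<integral>t. (\<Sum>c\<in>A \<times> {..<l}. (ev \<xi> c / wt c) * inner (g t) (ee c t)) \<partial>MI)"
    by (simp add: trg_def inner_sum_right)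
  also have "\<dots> = (\<Sum>c\<in>A \<times> {..<l}. \<integral>t. (ev \<xi> c / wt c) * inner (g t) (ee c t) \<partial>MI)"
    by (intro Bochner_Integration.integral_sum integrable_mult_right L2f_inner_integrable[OF assms] L2f_ee) auto
  finally show ?thesis by simp
qed

lemma integral_ee_trg:
  assumes "finite A" "snd d < l"
  shows "(\<integral>t. inner (ee d t) (trg l \<xi> A t) \<partial>MI) = (if fst d \<in> A then ev \<xi> d / wt d else 0)"
proof -
  have "(\<integral>t. inner (ee d t) (trg l \<xi> A t) \<partial>MI) = (\<Sum>c\<in>A \<times> {..<l}. if d = c then ev \<xi> c / wt c else 0)"
    unfolding integral_inner_trg[OF L2f_ee[OF assms(2)]] integral_ee by (intro sum.cong) auto
  also have "\<dots> = (if fst d \<in> A then ev \<xi> d / wt d else 0)"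
    using assms by (subst sum.delta') (auto simp: mem_Times_iff)
  finally show ?thesis .
qed

lemma integral_trg_trg:
  assumes "finite A"
  shows "(\<integral>t. inner (trg l \<xi> A t) (trg l \<eta> A t) \<partial>MI) = (\<Sum>c\<in>A \<times> {..<l}. (ev \<xi> c / wt c) * (ev \<eta> c / wt c))"
proof -
  have "(\<integral>t. inner (trg l \<xi> A t) (trg l \<eta> A t) \<partial>MI)
      = (\<Sum>c\<in>A \<times> {..<l}. (ev \<eta> c / wt c) * (\<integral>t. inner (ee c t) (trg l \<xi> A t) \<partial>MI))"
    by (subst integral_inner_trg) (auto simp: inner_commute)
  also have "\<dots> = (\<Sum>c\<in>A \<times> {..<l}. (ev \<xi> c / wt c) * (ev \<eta> c / wt c))"
    by (intro sum.cong refl) (auto simp: integral_ee_trg[OF assms])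
  finally show ?thesis .
qed

lemma n2_trg:
  assumes "finite A"
  shows "(n2 (trg l \<xi> A))\<^sup>2 = (\<Sum>c\<in>A \<times> {..<l}. (ev \<xi> c / wt c)\<^sup>2)"
  using integral_trg_trg[OF assms, of l \<xi> \<xi>] by (simp add: n2_sq power2_norm_eq_inner power2_eq_square[of "_ / _"])

lemma trg_diff:
  assumes "A \<subseteq> B" "finite B"
  shows "trg l \<xi> B t - trg l \<xi> A t = trg l \<xi> (B - A) t"
proof -
  have "(B - A) \<times> {..<l} = B \<times> {..<l} - A \<times> {..<l}" by auto
  then show ?thesis unfolding trg_def
    using assms by (simp add: sum_diff Sigma_mono)
qed

lemma trg_add: "trg l (\<xi> + \<eta>) A t = trg l \<xi> A t + trg l \<eta> A t"
  by (simp add: trg_def add_divide_distrib scaleR_left_distrib sum.distrib)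

lemma trg_scaleR: "trg l (r *\<^sub>R \<xi>) A t = r *\<^sub>R trg l \<xi> A t"
  by (simp add: trg_def scaleR_sum_right)

abbreviation An :: "nat \<Rightarrow> int set" where "An N \<equiv> {- int N..int N}"

text \<open>Beyond the largest frequency of a finite set carrying almost all of the norm, two
  partial sums differ only in the tail, and \<open>1 \<le> wt c\<close> makes the L^2 norm no larger
  than that of the tail.\<close>

lemma trg_Cauchy:
  assumes "0 < e"
  shows "\<exists>N. \<forall>i\<ge>N. \<forall>j\<ge>N. n2 (\<lambda>t. trg l \<xi> (An i) t - trg l \<xi> (An j) t) < e"
proof -
  obtain F where F: "finite F" "norm (rst (- F) \<xi>) < e" using norm_rst_tail[OF assms] by blast
  define N where "N = nat (Max (insert 0 ((\<lambda>c. \<bar>fst c\<bar>) ` F)))"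
  have N: "\<bar>fst c\<bar> \<le> int N" if "c \<in> F" for c
  proof -
    have "\<bar>fst c\<bar> \<le> Max (insert 0 ((\<lambda>c. \<bar>fst c\<bar>) ` F))" using F(1) that by (intro Max_ge) auto
    then show ?thesis unfolding N_def by linarith
  qed
  have le: "n2 (\<lambda>t. trg l \<xi> (An j) t - trg l \<xi> (An i) t) < e" if "N \<le> i" "i \<le> j" for i j
  proof -
    have "(n2 (\<lambda>t. trg l \<xi> (An j) t - trg l \<xi> (An i) t))\<^sup>2 = (n2 (trg l \<xi> (An j - An i)))\<^sup>2"
      using that by (subst trg_diff) auto
    also have "\<dots> = (\<Sum>c\<in>(An j - An i) \<times> {..<l}. (ev \<xi> c / wt c)\<^sup>2)" by (rule n2_trg) simp
    also have "\<dots> \<le> (\<Sum>c\<in>(An j - An i) \<times> {..<l}. (ev (rst (- F) \<xi>) c)\<^sup>2)"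
    proof (rule sum_mono)
      fix c assume c: "c \<in> (An j - An i) \<times> {..<l}"
      have "c \<notin> F"
      proof
        assume "c \<in> F"
        from N[OF this] that c show False by auto
      qed
      moreover have "\<bar>ev \<xi> c / wt c\<bar> \<le> \<bar>ev \<xi> c\<bar> / 1"
        unfolding abs_divide using wt_ge_1[of c] by (intro divide_left_mono) auto
      ultimately show "(ev \<xi> c / wt c)\<^sup>2 \<le> (ev (rst (- F) \<xi>) c)\<^sup>2"
        by (simp add: abs_le_square_iff[symmetric])
    qed
    also have "\<dots> \<le> (norm (rst (- F) \<xi>))\<^sup>2" by (rule sum_sq_le_norm) simp
    also have "\<dots> < e\<^sup>2" using F(2) by (intro power_strict_mono) auto
    finally show ?thesis using assms by (simp add: power2_less_imp_less)
  qed
  have "n2 (\<lambda>t. trg l \<xi> (An i) t - trg l \<xi> (An j) t) < e" if "N \<le> i" "N \<le> j" for i j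
    using le[of i j] le[of j i] that n2_minus_commute[of "trg l \<xi> (An i)" "trg l \<xi> (An j)"]
    by (cases "i \<le> j") auto
  then show ?thesis by blast
qed

lemma sq_ev_le_n2:
  assumes "L2f l f"
  shows "integrable MI (\<lambda>t. (ev (f t) c)\<^sup>2)" "(\<integral>t. (ev (f t) c)\<^sup>2 \<partial>MI) \<le> (n2 f)\<^sup>2"
proof -
  have le: "(ev v c)\<^sup>2 \<le> (norm v)\<^sup>2" for v :: pv
    using abs_ev_le[of v c] by (simp add: abs_le_square_iff[symmetric])
  show i: "integrable MI (\<lambda>t. (ev (f t) c)\<^sup>2)"
    by (rule Bochner_Integration.integrable_bound[OF L2f_sq[OF assms]])
      (use L2f_ev[OF assms, of c] le in auto)
  show "(\<integral>t. (ev (f t) c)\<^sup>2 \<partial>MI) \<le> (n2 f)\<^sup>2"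
    unfolding n2_sq by (rule integral_mono[OF i L2f_sq[OF assms] le])
qed

lemma L2f_of_components:
  assumes "\<And>t. f t \<in> Ps l" "\<And>c. (\<lambda>t. ev (f t) c) \<in> borel_measurable MI"
    "\<And>c. c \<in> Cl l \<Longrightarrow> integrable MI (\<lambda>t. (ev (f t) c)\<^sup>2)"
  shows "L2f l f" "(n2 f)\<^sup>2 = (\<Sum>c\<in>Cl l. \<integral>t. (ev (f t) c)\<^sup>2 \<partial>MI)"
proof -
  have "integrable MI (\<lambda>t. \<Sum>c\<in>Cl l. (ev (f t) c)\<^sup>2)"
    by (intro Bochner_Integration.integrable_sum assms(3))
  then show "L2f l f" using assms(1,2) by (simp add: L2f_def norm_Ps[OF assms(1)])
  show "(n2 f)\<^sup>2 = (\<Sum>c\<in>Cl l. \<integral>t. (ev (f t) c)\<^sup>2 \<partial>MI)"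
    unfolding n2_sq norm_Ps[OF assms(1)] by (intro Bochner_Integration.integral_sum assms(3))
qed

text \<open>Completeness is applied to each coordinate separately; only the finitely many
  coordinates in \<open>Cl l\<close> enter the limit curve.\<close>

lemma Riesz_Fischer:
  obtains F where "L2f l F" "(\<lambda>N. n2 (\<lambda>t. trg l \<xi> (An N) t - F t)) \<longlonglongrightarrow> 0"
proof -
  have ex: "\<exists>f. f \<in> borel_measurable MI \<and> (\<forall>N. integrable MI (\<lambda>t. (ev (trg l \<xi> (An N) t) c - f t)\<^sup>2)) \<and>
      (\<lambda>N. \<integral>t. (ev (trg l \<xi> (An N) t) c - f t)\<^sup>2 \<partial>MI) \<longlonglongrightarrow> 0" for c
  proof -
    let ?s = "\<lambda>N t. ev (trg l \<xi> (An N) t) c"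
    have "\<exists>N. \<forall>i\<ge>N. \<forall>j\<ge>N. (\<integral>t. (?s i t - ?s j t)\<^sup>2 \<partial>MI) < e" if e: "0 < e" for e
    proof -
      obtain N where N: "\<And>i j. N \<le> i \<Longrightarrow> N \<le> j \<Longrightarrow> n2 (\<lambda>t. trg l \<xi> (An i) t - trg l \<xi> (An j) t) < sqrt e"
        using trg_Cauchy[of "sqrt e" l \<xi>] e by auto
      have "(\<integral>t. (?s i t - ?s j t)\<^sup>2 \<partial>MI) < e" if "N \<le> i" "N \<le> j" for i j
      proof -
        have "(\<integral>t. (?s i t - ?s j t)\<^sup>2 \<partial>MI) \<le> (n2 (\<lambda>t. trg l \<xi> (An i) t - trg l \<xi> (An j) t))\<^sup>2"
          using sq_ev_le_n2(2)[OF L2f_diff[OF L2f_trg L2f_trg], of l \<xi> "An i" \<xi> "An j" c] by simp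
        also have "\<dots> < (sqrt e)\<^sup>2" using N[OF that] by (intro power_strict_mono) auto
        finally show ?thesis using e by simp
      qed
      then show ?thesis by blast
    qed
    then show ?thesis
      by (rule L2_complete[of ?s, OF L2f_ev[OF L2f_trg] sq_ev_le_n2(1)[OF L2f_trg]]) blast+
  qed
  define Q where "Q c f \<longleftrightarrow> f \<in> borel_measurable MI \<and> (\<forall>N. integrable MI (\<lambda>t. (ev (trg l \<xi> (An N) t) c - f t)\<^sup>2)) \<and>
      (\<lambda>N. \<integral>t. (ev (trg l \<xi> (An N) t) c - f t)\<^sup>2 \<partial>MI) \<longlonglongrightarrow> 0" for c f
  have "\<forall>c. \<exists>f. Q c f" using ex unfolding Q_def by (rule allI)
  from choice[OF this] obtain f where fQ: "\<forall>c. Q c (f c)" ..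
  have f: "f c \<in> borel_measurable MI"
      "integrable MI (\<lambda>t. (ev (trg l \<xi> (An N) t) c - f c t)\<^sup>2)"
      "(\<lambda>N. \<integral>t. (ev (trg l \<xi> (An N) t) c - f c t)\<^sup>2 \<partial>MI) \<longlonglongrightarrow> 0" for c N
    using spec[OF fQ, of c] unfolding Q_def by auto
  define F where "F t = (\<Sum>c\<in>Cl l. f c t *\<^sub>R bas c)" for t
  have evF: "ev (F t) c = (if c \<in> Cl l then f c t else 0)" for t c
    by (simp add: F_def ev_bas if_distrib[of "\<lambda>t. _ * t"] sum.delta' cong: if_cong)
  have FPs: "F t \<in> Ps l" for t by (simp add: Ps_iff evF)
  have Fm: "(\<lambda>t. ev (F t) c) \<in> borel_measurable MI" for c
    using f(1)[of c] by (cases "c \<in> Cl l") (simp_all add: evF)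
  have d1: "trg l \<xi> (An N) t - F t \<in> Ps l" for N t by (intro Ps_diff trg_Ps FPs)
  have d2: "(\<lambda>t. ev (trg l \<xi> (An N) t - F t) c) \<in> borel_measurable MI" for N c
    using L2f_ev[OF L2f_trg[of l \<xi> "An N"], of c] Fm[of c] by simp
  have d3: "integrable MI (\<lambda>t. (ev (trg l \<xi> (An N) t - F t) c)\<^sup>2)" if "c \<in> Cl l" for N c
    using f(2)[of N c] that by (simp add: evF)
  have D: "L2f l (\<lambda>t. trg l \<xi> (An N) t - F t)"
      "(n2 (\<lambda>t. trg l \<xi> (An N) t - F t))\<^sup>2 = (\<Sum>c\<in>Cl l. \<integral>t. (ev (trg l \<xi> (An N) t - F t) c)\<^sup>2 \<partial>MI)" for N
    by (rule L2f_of_components[OF d1 d2], erule d3)+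
  have "L2f l (\<lambda>t. trg l \<xi> (An 0) t - (trg l \<xi> (An 0) t - F t))"
    by (intro L2f_diff L2f_trg D(1))
  then have LF: "L2f l F" by simp
  have "(\<lambda>N. \<Sum>c\<in>Cl l. \<integral>t. (ev (trg l \<xi> (An N) t - F t) c)\<^sup>2 \<partial>MI) \<longlonglongrightarrow> (\<Sum>c\<in>Cl l. 0)"
    by (intro tendsto_sum) (use f(3) in \<open>simp add: evF\<close>)
  then have "(\<lambda>N. (n2 (\<lambda>t. trg l \<xi> (An N) t - F t))\<^sup>2) \<longlonglongrightarrow> 0"
    unfolding D(2) by simp
  from tendsto_real_sqrt[OF this] have "(\<lambda>N. n2 (\<lambda>t. trg l \<xi> (An N) t - F t)) \<longlonglongrightarrow> 0" by simp
  with LF show thesis by (rule that)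
qed

section \<open>Points as vectors, and the loop of a coefficient family\<close>

definition iota :: "nat \<Rightarrow> pt \<Rightarrow> pv" where
  "iota l z = (\<Sum>i<l. fst z i *\<^sub>R bas (i, False) + snd z i *\<^sub>R bas (i, True))"

definition pnt :: "pv \<Rightarrow> pt" where
  "pnt v = (\<lambda>i. ev v (i, False), \<lambda>i. ev v (i, True))"

lemma ev_iota: "ev (iota l z) (i, b) = (if i < l then (if b then snd z i else fst z i) else 0)"
proof -
  have "ev (iota l z) (i, b) = (\<Sum>j<l. if i = j then (if b then snd z j else fst z j) else 0)"
    unfolding iota_def ev_sum by (intro sum.cong) (auto simp: ev_bas)
  then show ?thesis by simp
qed

lemma iota_Ps [simp]: "iota l z \<in> Ps l"
  by (auto simp: Ps_def ev_iota)

lemma pnt_pts: "v \<in> Ps l \<Longrightarrow> pnt v \<in> pts l"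
  by (auto simp: pnt_def pts_def Ps_def)

lemma pnt_iota: "z \<in> pts l \<Longrightarrow> pnt (iota l z) = z"
  by (cases z) (auto simp: pnt_def pts_def ev_iota fun_eq_iff not_less)

lemma iota_pnt: "v \<in> Ps l \<Longrightarrow> iota l (pnt v) = v"
proof (rule ell2_eqI)
  fix c :: "nat \<times> bool" assume "v \<in> Ps l"
  then show "ev (iota l (pnt v)) c = ev v c"
    by (cases c) (auto simp: ev_iota pnt_def Ps_def not_less)
qed

lemma iota_diff: "iota l (pt_diff z w) = iota l z - iota l w"
proof (rule ell2_eqI)
  fix c :: "nat \<times> bool"
  show "ev (iota l (pt_diff z w)) c = ev (iota l z - iota l w) c"
    by (cases c) (auto simp: ev_iota pt_diff_def)
qed

lemma iota_comb: "iota l (pt_comb a z b w) = a *\<^sub>R iota l z + b *\<^sub>R iota l w"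
proof (rule ell2_eqI)
  fix c :: "nat \<times> bool"
  show "ev (iota l (pt_comb a z b w)) c = ev (a *\<^sub>R iota l z + b *\<^sub>R iota l w) c"
    by (cases c) (auto simp: ev_iota pt_comb_def)
qed

lemma inner_iota: "inner (iota l z) (iota l w) = pt_inner l z w"
proof -
  have "inner (iota l z) (iota l w) = (\<Sum>c\<in>{..<l} \<times> UNIV. ev (iota l z) c * ev (iota l w) c)"
    unfolding inner_Ps[OF iota_Ps] Cl_def ..
  also have "\<dots> = (\<Sum>i<l. \<Sum>b\<in>UNIV. ev (iota l z) (i, b) * ev (iota l w) (i, b))"
    by (simp add: sum.cartesian_product case_prod_beta)
  also have "\<dots> = pt_inner l z w"
    unfolding pt_inner_def by (intro sum.cong) (auto simp: UNIV_bool ev_iota)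
  finally show ?thesis .
qed

lemma pt_sqnorm_iota: "pt_sqnorm l z = (norm (iota l z))\<^sup>2"
  by (simp add: pt_sqnorm_def inner_iota power2_norm_eq_inner)

lemma continuous_on_iota: "continuous_on S (iota l)"
  unfolding iota_def
  by (intro continuous_intros continuous_on_product_then_coordinatewise)

lemma continuous_on_pnt: "continuous_on S pnt"
  unfolding pnt_def by (intro continuous_on_Pair continuous_on_coordinatewise_then_product continuous_intros)

lemma iota_Epsum: "iota l (Epsum (ofE \<xi>) N t) = trg l \<xi> (An N) t"
proof (rule ell2_eqI)
  fix c :: "nat \<times> bool"
  obtain i b where c: "c = (i, b)" by (cases c)
  have "ev (trg l \<xi> (An N) t) (i, b) = (\<Sum>j\<in>An N. \<Sum>k<l. ev \<xi> (j, k) / wt (j, k) * ev (ee (j, k) t) (i, b))"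
    by (simp add: trg_def sum.cartesian_product case_prod_beta)
  also have "\<dots> = (\<Sum>j\<in>An N. if i < l then ev \<xi> (j, i) / wt (j, i) * ev (ee (j, i) t) (i, b) else 0)"
  proof (intro sum.cong refl)
    fix j
    have "(\<Sum>k<l. ev \<xi> (j, k) / wt (j, k) * ev (ee (j, k) t) (i, b))
        = (\<Sum>k<l. if i = k then ev \<xi> (j, k) / wt (j, k) * ev (ee (j, k) t) (i, b) else 0)"
      by (intro sum.cong) (auto simp: ee_def ev_bas)
    then show "(\<Sum>k<l. ev \<xi> (j, k) / wt (j, k) * ev (ee (j, k) t) (i, b))
        = (if i < l then ev \<xi> (j, i) / wt (j, i) * ev (ee (j, i) t) (i, b) else 0)" by simp
  qed
  also have "\<dots> = ev (iota l (Epsum (ofE \<xi>) N t)) (i, b)"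
    by (auto simp: ev_iota Epsum_def ofE_def ee_def ev_bas intro!: sum.cong)
  finally show "ev (iota l (Epsum (ofE \<xi>) N t)) c = ev (trg l \<xi> (An N) t) c" by (simp add: c)
qed

text \<open>The choice behind \<open>Eloop\<close> fixes the curve only up to a null set, so
  linearity in the coefficient family holds almost everywhere.\<close>

definition lp :: "nat \<Rightarrow> ec \<Rightarrow> real \<Rightarrow> pv" where
  "lp l \<xi> t = iota l (Eloop l (ofE \<xi>) t)"

lemma loop_dist_nn_integral:
  assumes "L2f l (\<lambda>t. trg l \<xi> (An N) t - iota l (f t))"
  shows "(\<integral>\<^sup>+ t. ennreal (pt_sqnorm l (pt_diff (Epsum (ofE \<xi>) N t) (f t))) * indicator {0..1} t \<partial>lborel)
     = ennreal ((n2 (\<lambda>t. trg l \<xi> (An N) t - iota l (f t)))\<^sup>2)"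
  unfolding nn_integral_MI[symmetric] pt_sqnorm_iota iota_diff iota_Epsum n2_sq
  by (rule nn_integral_eq_integral) (use L2f_sq[OF assms] in auto)

lemma borel_measurable_MI_extend:
  "g \<in> borel_measurable MI \<Longrightarrow> (\<lambda>t. if t \<in> {0..1} then g t else (0::real)) \<in> borel_measurable lborel"
proof -
  assume "g \<in> borel_measurable MI"
  then have "(\<lambda>t. g t * indicator {0..1} t) \<in> borel_measurable lborel"
    by (simp add: MI_def borel_measurable_restrict_space_iff mult.commute)
  moreover have "(\<lambda>t. g t * indicator {0..1} t) = (\<lambda>t. if t \<in> {0..1} then g t else 0)"
    by (auto simp: indicator_def)
  ultimately show ?thesis by simp
qed

text \<open>The Riesz-Fischer limit shows that the predicate behind the choice is
  satisfiable.\<close>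

lemma is_loop_of_Eloop: "is_loop_of l (ofE \<xi>) (Eloop l (ofE \<xi>))"
proof -
  obtain F where F: "L2f l F" "(\<lambda>N. n2 (\<lambda>t. trg l \<xi> (An N) t - F t)) \<longlonglongrightarrow> 0"
    by (rule Riesz_Fischer)
  \<comment> \<open>Measurability is required on the whole line, while the limit is controlled only
    on [0,1]; it is extended by zero.\<close>
  define f where "f t = (if t \<in> {0..1} then pnt (F t) else (\<lambda>_. 0, \<lambda>_. 0))" for t :: real
  have fF: "iota l (f t) = F t" if "t \<in> {0..1}" for t
    using that by (simp add: f_def iota_pnt L2f_Ps[OF F(1)])
  have "f t \<in> pts l" for t
    using pnt_pts[OF L2f_Ps[OF F(1)]] by (simp add: f_def) (simp add: pts_def)
  moreover have "(\<lambda>t. fst (f t) i) \<in> borel_measurable lborel" for i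
    using borel_measurable_MI_extend[OF L2f_ev[OF F(1), of "(i, False)"]]
    by (simp add: f_def pnt_def if_distrib[of fst] if_distrib[of "\<lambda>g. g i"] cong: if_cong)
  moreover have "(\<lambda>t. snd (f t) i) \<in> borel_measurable lborel" for i
    using borel_measurable_MI_extend[OF L2f_ev[OF F(1), of "(i, True)"]]
    by (simp add: f_def pnt_def if_distrib[of snd] if_distrib[of "\<lambda>g. g i"] cong: if_cong)
  moreover have "(\<lambda>N. \<integral>\<^sup>+ t. ennreal (pt_sqnorm l (pt_diff (Epsum (ofE \<xi>) N t) (f t))) * indicator {0..1} t \<partial>lborel) \<longlonglongrightarrow> 0"
  proof -
    have "(\<integral>\<^sup>+ t. ennreal (pt_sqnorm l (pt_diff (Epsum (ofE \<xi>) N t) (f t))) * indicator {0..1} t \<partial>lborel)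
        = ennreal ((n2 (\<lambda>t. trg l \<xi> (An N) t - F t))\<^sup>2)" for N
    proof -
      have "(\<integral>\<^sup>+ t. ennreal (pt_sqnorm l (pt_diff (Epsum (ofE \<xi>) N t) (f t))) * indicator {0..1} t \<partial>lborel)
        = (\<integral>\<^sup>+ t. ennreal ((norm (trg l \<xi> (An N) t - F t))\<^sup>2) \<partial>MI)"
        unfolding nn_integral_MI[symmetric] pt_sqnorm_iota iota_diff iota_Epsum
        by (rule nn_integral_cong) (simp add: fF)
      also have "\<dots> = ennreal ((n2 (\<lambda>t. trg l \<xi> (An N) t - F t))\<^sup>2)"
        unfolding n2_sq by (rule nn_integral_eq_integral[OF L2f_sq[OF L2f_diff[OF L2f_trg F(1)]]]) simp
      finally show ?thesis .
    qed
    moreover have "(\<lambda>N. ennreal ((n2 (\<lambda>t. trg l \<xi> (An N) t - F t))\<^sup>2)) \<longlonglongrightarrow> ennreal (0\<^sup>2)"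
      by (intro tendsto_ennrealI tendsto_power F(2))
    ultimately show ?thesis by simp
  qed
  ultimately have "is_loop_of l (ofE \<xi>) f" by (simp add: is_loop_of_def)
  then show ?thesis unfolding Eloop_def by (rule someI[of "is_loop_of l (ofE \<xi>)"])
qed

text \<open>The defining property of the loop speaks only of distances to partial sums.
  Square-integrability follows because one of these distances is finite and partial sums are
  continuous.\<close>

lemma lp_L2f_limit:
  shows L2f_lp [simp]: "L2f l (lp l \<xi>)"
    and lp_limit: "(\<lambda>N. n2 (\<lambda>t. trg l \<xi> (An N) t - lp l \<xi> t)) \<longlonglongrightarrow> 0"
proof -
  let ?f = "Eloop l (ofE \<xi>)"
  let ?I = "\<lambda>N. \<integral>\<^sup>+ t. ennreal (pt_sqnorm l (pt_diff (Epsum (ofE \<xi>) N t) (?f t))) * indicator {0..1} t \<partial>lborel"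
  have f: "?f t \<in> pts l" "(\<lambda>t. fst (?f t) i) \<in> borel_measurable lborel"
      "(\<lambda>t. snd (?f t) i) \<in> borel_measurable lborel" "?I \<longlonglongrightarrow> 0" for t i
    using is_loop_of_Eloop[of l \<xi>] unfolding is_loop_of_def by auto
  have m: "(\<lambda>t. ev (lp l \<xi> t) c) \<in> borel_measurable MI" for c
  proof (cases c)
    case (Pair i b)
    then show ?thesis
      using measurable_MI[OF f(2)[of i]] measurable_MI[OF f(3)[of i]]
      by (cases "i < l"; cases b) (simp_all add: lp_def ev_iota)
  qed
  have Ps: "lp l \<xi> t \<in> Ps l" for t by (simp add: lp_def)
  have "\<forall>\<^sub>F N in sequentially. ?I N < 1" using f(4) by (intro order_tendstoD(2)) auto
  then obtain N where N: "?I N < 1" by (auto simp: eventually_sequentially)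
  have nm: "(\<lambda>t. norm (trg l \<xi> (An N) t - lp l \<xi> t)) \<in> borel_measurable MI"
  proof (rule norm_measurable[where l = l])
    show "trg l \<xi> (An N) t - lp l \<xi> t \<in> Ps l" for t by (intro Ps_diff trg_Ps Ps)
    show "(\<lambda>t. ev (trg l \<xi> (An N) t - lp l \<xi> t) c) \<in> borel_measurable MI" for c
      using L2f_ev[OF L2f_trg[of l \<xi> "An N"], of c] m[of c] by simp
  qed
  have "(\<integral>\<^sup>+ t. ennreal ((norm (trg l \<xi> (An N) t - lp l \<xi> t))\<^sup>2) \<partial>MI) = ?I N"
    unfolding nn_integral_MI[symmetric] pt_sqnorm_iota iota_diff iota_Epsum lp_def ..
  then have "integrable MI (\<lambda>t. (norm (trg l \<xi> (An N) t - lp l \<xi> t))\<^sup>2)"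
    using N nm by (intro integrableI_bounded) (auto intro: less_trans[OF _ ennreal_one_less_top])
  then have "L2f l (\<lambda>t. trg l \<xi> (An N) t - lp l \<xi> t)"
    unfolding L2f_def using L2f_ev[OF L2f_trg[of l \<xi> "An N"]] m trg_Ps Ps
    by (auto intro: Ps_diff)
  from L2f_diff[OF L2f_trg[of l \<xi> "An N"] this] show L: "L2f l (lp l \<xi>)" by simp
  have "?I N = ennreal ((n2 (\<lambda>t. trg l \<xi> (An N) t - lp l \<xi> t))\<^sup>2)" for N
    using loop_dist_nn_integral[of l \<xi> N ?f] L2f_diff[OF L2f_trg L] by (simp add: lp_def)
  then have "(\<lambda>N. ennreal ((n2 (\<lambda>t. trg l \<xi> (An N) t - lp l \<xi> t))\<^sup>2)) \<longlonglongrightarrow> ennreal 0"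
    using f(4) by simp
  then have "(\<lambda>N. (n2 (\<lambda>t. trg l \<xi> (An N) t - lp l \<xi> t))\<^sup>2) \<longlonglongrightarrow> 0"
    by (subst (asm) tendsto_ennreal_iff) auto
  then have "(\<lambda>N. sqrt ((n2 (\<lambda>t. trg l \<xi> (An N) t - lp l \<xi> t))\<^sup>2)) \<longlonglongrightarrow> sqrt 0"
    by (rule tendsto_real_sqrt)
  then show "(\<lambda>N. n2 (\<lambda>t. trg l \<xi> (An N) t - lp l \<xi> t)) \<longlonglongrightarrow> 0" by simp
qed

section \<open>The loop map and its adjoint\<close>

lemma lp_Ps [simp]: "lp l \<xi> t \<in> Ps l"
  by (simp add: lp_def)

lemma lp_add: "AE t in MI. lp l (\<xi> + \<eta>) t = lp l \<xi> t + lp l \<eta> t"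
proof (rule L2_limit_unique[where l = l and s = "\<lambda>N. trg l (\<xi> + \<eta>) (An N)"])
  show "(\<lambda>N. n2 (\<lambda>t. trg l (\<xi> + \<eta>) (An N) t - (lp l \<xi> t + lp l \<eta> t))) \<longlonglongrightarrow> 0"
  proof (rule Lim_null_comparison)
    show "(\<lambda>N. n2 (\<lambda>t. trg l \<xi> (An N) t - lp l \<xi> t) + n2 (\<lambda>t. trg l \<eta> (An N) t - lp l \<eta> t)) \<longlonglongrightarrow> 0"
      using tendsto_add[OF lp_limit[of l \<xi>] lp_limit[of l \<eta>]] by simp
    have "n2 (\<lambda>t. trg l (\<xi> + \<eta>) (An N) t - (lp l \<xi> t + lp l \<eta> t))
        \<le> n2 (\<lambda>t. trg l \<xi> (An N) t - lp l \<xi> t) + n2 (\<lambda>t. trg l \<eta> (An N) t - lp l \<eta> t)" for N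
    proof -
      have "n2 (\<lambda>t. (trg l \<xi> (An N) t - lp l \<xi> t) + (trg l \<eta> (An N) t - lp l \<eta> t))
        \<le> n2 (\<lambda>t. trg l \<xi> (An N) t - lp l \<xi> t) + n2 (\<lambda>t. trg l \<eta> (An N) t - lp l \<eta> t)"
        by (rule n2_triangle[where l = l]) (intro L2f_diff L2f_trg L2f_lp)+
      then show ?thesis by (simp add: trg_add algebra_simps)
    qed
    then show "\<forall>\<^sub>F N in sequentially. norm (n2 (\<lambda>t. trg l (\<xi> + \<eta>) (An N) t - (lp l \<xi> t + lp l \<eta> t)))
        \<le> n2 (\<lambda>t. trg l \<xi> (An N) t - lp l \<xi> t) + n2 (\<lambda>t. trg l \<eta> (An N) t - lp l \<eta> t)" by simp
  qed
qed (auto intro: L2f_add lp_limit)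

lemma lp_scaleR: "AE t in MI. lp l (r *\<^sub>R \<xi>) t = r *\<^sub>R lp l \<xi> t"
proof (rule L2_limit_unique[where l = l and s = "\<lambda>N. trg l (r *\<^sub>R \<xi>) (An N)"])
  show "(\<lambda>N. n2 (\<lambda>t. trg l (r *\<^sub>R \<xi>) (An N) t - r *\<^sub>R lp l \<xi> t)) \<longlonglongrightarrow> 0"
    unfolding trg_scaleR scaleR_diff_right[symmetric] n2_scaleR
    using tendsto_mult_left[OF lp_limit[of l \<xi>], of "\<bar>r\<bar>"] by simp
qed (auto intro: L2f_scaleR lp_limit)

lemma lp_diff: "AE t in MI. lp l (\<xi> - \<eta>) t = lp l \<xi> t - lp l \<eta> t"
  using lp_add[of l \<xi> "(-1) *\<^sub>R \<eta>"] lp_scaleR[of l "-1" \<eta>] by eventually_elim simp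

text \<open>In coordinates this is the inclusion of E into L^2, with multipliers tending to zero as
  the frequency grows.\<close>

definition iw :: "ec \<Rightarrow> ec" where "iw = dmul (\<lambda>c. 1 / wt c)"

lemma inv_wt_le: "\<bar>1 / wt c\<bar> \<le> 1"
  using wt_ge_1[of c] by simp

lemma ev_iw [simp]: "ev (iw \<xi>) c = ev \<xi> c / wt c"
  unfolding iw_def by (subst dmul_bound(1)[OF inv_wt_le]) simp

lemma norm_iw_le: "norm (iw \<xi>) \<le> norm \<xi>"
  unfolding iw_def using dmul_bound(2)[of "\<lambda>c. 1 / wt c" 1 \<xi>] inv_wt_le by simp

lemma n2_lp_le_iw: "n2 (lp l \<xi>) \<le> norm (iw \<xi>)"
proof -
  have "n2 (trg l \<xi> (An N)) \<le> norm (iw \<xi>)" for N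
  proof (rule power2_le_imp_le)
    have "(n2 (trg l \<xi> (An N)))\<^sup>2 = (\<Sum>c\<in>An N \<times> {..<l}. (ev (iw \<xi>) c)\<^sup>2)"
      by (subst n2_trg) auto
    also have "\<dots> \<le> (norm (iw \<xi>))\<^sup>2" by (rule sum_sq_le_norm) simp
    finally show "(n2 (trg l \<xi> (An N)))\<^sup>2 \<le> (norm (iw \<xi>))\<^sup>2" .
  qed simp
  moreover have "n2 (lp l \<xi>) \<le> n2 (\<lambda>t. trg l \<xi> (An N) t - lp l \<xi> t) + n2 (trg l \<xi> (An N))" for N
  proof -
    have "n2 (\<lambda>t. (lp l \<xi> t - trg l \<xi> (An N) t) + trg l \<xi> (An N) t)
        \<le> n2 (\<lambda>t. lp l \<xi> t - trg l \<xi> (An N) t) + n2 (trg l \<xi> (An N))"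
      by (rule n2_triangle[where l = l]) (intro L2f_diff L2f_trg L2f_lp)+
    then show ?thesis by (simp add: n2_minus_commute)
  qed
  ultimately have "n2 (lp l \<xi>) \<le> n2 (\<lambda>t. trg l \<xi> (An N) t - lp l \<xi> t) + norm (iw \<xi>)" for N
    by (meson add_left_mono order_trans)
  moreover have "(\<lambda>N. n2 (\<lambda>t. trg l \<xi> (An N) t - lp l \<xi> t) + norm (iw \<xi>)) \<longlonglongrightarrow> 0 + norm (iw \<xi>)"
    by (intro tendsto_add lp_limit tendsto_const)
  ultimately show ?thesis
    using LIMSEQ_le_const[of "\<lambda>N. n2 (\<lambda>t. trg l \<xi> (An N) t - lp l \<xi> t) + norm (iw \<xi>)" "0 + norm (iw \<xi>)"]
    by auto
qed

lemma n2_lp_le: "n2 (lp l \<xi>) \<le> norm \<xi>"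
  using n2_lp_le_iw norm_iw_le order_trans by blast

lemma lp_coeff:
  assumes "snd c < l"
  shows "(\<integral>t. inner (ee c t) (lp l \<xi> t) \<partial>MI) = ev \<xi> c / wt c"
proof (rule LIMSEQ_unique)
  show "(\<lambda>N. \<integral>t. inner (ee c t) (trg l \<xi> (An N) t) \<partial>MI) \<longlonglongrightarrow> (\<integral>t. inner (ee c t) (lp l \<xi> t) \<partial>MI)"
    by (rule L2f_inner_tendsto[OF L2f_lp L2f_ee[OF assms] L2f_trg lp_limit])
  have "\<forall>\<^sub>F N in sequentially. (\<integral>t. inner (ee c t) (trg l \<xi> (An N) t) \<partial>MI) = ev \<xi> c / wt c"
    unfolding eventually_sequentially
  proof (intro exI allI impI)
    fix N assume "nat \<bar>fst c\<bar> \<le> N"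
    then show "(\<integral>t. inner (ee c t) (trg l \<xi> (An N) t) \<partial>MI) = ev \<xi> c / wt c"
      using assms by (subst integral_ee_trg) auto
  qed
  then show "(\<lambda>N. \<integral>t. inner (ee c t) (trg l \<xi> (An N) t) \<partial>MI) \<longlonglongrightarrow> ev \<xi> c / wt c"
    by (rule tendsto_eventually)
qed

lemma lp_eq_0_imp:
  assumes "\<xi> \<in> Es l" "AE t in MI. lp l \<xi> t = 0"
  shows "\<xi> = 0"
proof (rule ell2_eqI)
  fix c
  show "ev \<xi> c = ev 0 c"
  proof (cases "snd c < l")
    case True
    have "(\<integral>t. inner (ee c t) (lp l \<xi> t) \<partial>MI) = (\<integral>t. 0 \<partial>MI)"
    proof (rule integral_cong_AE)
      show "(\<lambda>t. inner (ee c t) (lp l \<xi> t)) \<in> borel_measurable MI"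
        using L2f_inner_integrable[OF L2f_ee[OF True] L2f_lp] by (rule borel_measurable_integrable)
      show "AE t in MI. inner (ee c t) (lp l \<xi> t) = 0" using assms(2) by eventually_elim simp
    qed simp
    then show ?thesis using lp_coeff[OF True, of \<xi>] by simp
  qed (use Es_ev[OF assms(1), of c] in simp)
qed

lemma rst_An_tendsto: "(\<lambda>N. rst (An N \<times> UNIV) (\<xi> :: ec)) \<longlonglongrightarrow> \<xi>"
proof (rule LIMSEQ_I)
  fix e :: real assume "0 < e"
  then obtain F where F: "finite F" "norm (rst (- F) \<xi>) < e" using norm_rst_tail by blast
  define N where "N = nat (Max (insert 0 ((\<lambda>c. \<bar>fst c\<bar>) ` F)))"
  have N: "\<bar>fst c\<bar> \<le> int N" if "c \<in> F" for c
  proof -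
    have "\<bar>fst c\<bar> \<le> Max (insert 0 ((\<lambda>c. \<bar>fst c\<bar>) ` F))" using F(1) that by (intro Max_ge) auto
    then show ?thesis unfolding N_def by linarith
  qed
  have "norm (rst (An M \<times> UNIV) \<xi> - \<xi>) < e" if "M \<ge> N" for M
  proof -
    have "rst (An M \<times> UNIV) \<xi> - \<xi> = - rst (- (An M \<times> UNIV)) (rst (- F) \<xi>)"
    proof (rule ell2_eqI)
      fix c
      show "ev (rst (An M \<times> UNIV) \<xi> - \<xi>) c = ev (- rst (- (An M \<times> UNIV)) (rst (- F) \<xi>)) c"
        using N[of c] that by (cases c) auto
    qed
    then have "norm (rst (An M \<times> UNIV) \<xi> - \<xi>) \<le> norm (rst (- F) \<xi>)"
      by (metis norm_minus_cancel norm_rst_le)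
    then show ?thesis using F(2) by simp
  qed
  then show "\<exists>N. \<forall>M\<ge>N. norm (rst (An M \<times> UNIV) \<xi> - \<xi>) < e" by blast
qed

section \<open>Fourier coefficients and the adjoint of the loop map\<close>

definition gh :: "(real \<Rightarrow> pv) \<Rightarrow> int \<times> nat \<Rightarrow> real" where
  "gh g c = (\<integral>t. inner (g t) (ee c t) \<partial>MI)"

definition Bes :: "nat \<Rightarrow> (real \<Rightarrow> pv) \<Rightarrow> ec" where
  "Bes l g = Abs_ell2 (\<lambda>c. if snd c < l then gh g c else 0)"

text \<open>The trigonometric polynomial f with the coefficients of \<open>g\<close> on a finite set
  satisfies |f|^2 = <g, f>, which is at most |g| |f|; hence |f| is at most |g|.\<close>

lemma Bessel:
  assumes g: "L2f l g"
  shows ev_Bes: "ev (Bes l g) c = (if snd c < l then gh g c else 0)"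
    and norm_Bes: "norm (Bes l g) \<le> n2 g"
proof -
  have fin: "(\<Sum>c\<in>F. (if snd c < l then gh g c else 0)\<^sup>2) \<le> (n2 g)\<^sup>2" if F: "finite F" for F
  proof -
    define F' where "F' = F \<inter> UNIV \<times> {..<l}"
    \<comment> \<open>The factor \<open>wt c\<close> cancels the division in \<open>trg\<close>, so
      the polynomial has the coefficients \<open>gh g c\<close>.\<close>
    define \<xi> where "\<xi> = (\<Sum>c\<in>F'. (wt c * gh g c) *\<^sub>R bas c)"
    have F': "finite F'" using F by (simp add: F'_def)
    have ev: "ev \<xi> c = (if c \<in> F' then wt c * gh g c else 0)" for c
      unfolding \<xi>_def using F' by (simp add: ev_bas if_distrib[of "\<lambda>t. _ * t"] sum.delta' cong: if_cong)
    define S where "S = (\<Sum>c\<in>F'. (gh g c)\<^sup>2)"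
    have A: "finite (fst ` F')" using F' by simp
    have sub: "F' \<subseteq> fst ` F' \<times> {..<l}" unfolding F'_def by force
    have "(\<integral>t. inner (g t) (trg l \<xi> (fst ` F') t) \<partial>MI) = (\<Sum>c\<in>fst ` F' \<times> {..<l}. (ev \<xi> c / wt c) * gh g c)"
      unfolding gh_def by (rule integral_inner_trg[OF g])
    also have "\<dots> = S"
      unfolding S_def by (rule sum.mono_neutral_cong_right) (use A sub ev in \<open>auto simp: power2_eq_square\<close>)
    finally have 1: "(\<integral>t. inner (g t) (trg l \<xi> (fst ` F') t) \<partial>MI) = S" .
    have "(n2 (trg l \<xi> (fst ` F')))\<^sup>2 = (\<Sum>c\<in>fst ` F' \<times> {..<l}. (ev \<xi> c / wt c)\<^sup>2)"
      by (rule n2_trg[OF A])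
    also have "\<dots> = S"
      unfolding S_def by (rule sum.mono_neutral_cong_right) (use A sub ev in auto)
    finally have 2: "(n2 (trg l \<xi> (fst ` F')))\<^sup>2 = S" .
    let ?n = "n2 (trg l \<xi> (fst ` F'))"
    have "?n * ?n \<le> n2 g * ?n" using L2f_CS[OF g L2f_trg[of l \<xi> "fst ` F'"]] 1 2 by (simp add: power2_eq_square)
    then have "?n \<le> n2 g"
    proof (cases "?n = 0")
      case False
      then have "0 < ?n" using n2_nonneg[of "trg l \<xi> (fst ` F')"] by linarith
      with \<open>?n * ?n \<le> n2 g * ?n\<close> show ?thesis by (rule mult_right_le_imp_le)
    qed simp
    then have "S \<le> (n2 g)\<^sup>2" unfolding 2[symmetric] by (intro power_mono) auto
    moreover have "(\<Sum>c\<in>F. (if snd c < l then gh g c else 0)\<^sup>2) = S"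
      unfolding S_def F'_def by (rule sum.mono_neutral_cong_right) (use F in auto)
    ultimately show ?thesis by simp
  qed
  show "ev (Bes l g) c = (if snd c < l then gh g c else 0)"
    unfolding Bes_def using ell2_of_bound(2)[OF fin] by simp
  show "norm (Bes l g) \<le> n2 g"
    unfolding Bes_def by (rule power2_le_imp_le[OF ell2_of_bound(3)[OF fin]]) auto
qed

text \<open>The adjoint of the loop map from E to L^2, as \<open>inner_Jst\<close> shows. The
  division by \<open>wt\<close>, which stems from the weights in the norm of E, makes it
  compact.\<close>

definition Jst :: "nat \<Rightarrow> (real \<Rightarrow> pv) \<Rightarrow> ec" where "Jst l g = iw (Bes l g)"

lemma ev_Jst: "L2f l g \<Longrightarrow> ev (Jst l g) c = (if snd c < l then gh g c / wt c else 0)"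
  by (simp add: Jst_def ev_Bes)

lemma Jst_Es: "L2f l g \<Longrightarrow> Jst l g \<in> Es l"
  by (simp add: Es_def ev_Jst)

lemma norm_Jst: "L2f l g \<Longrightarrow> norm (Jst l g) \<le> n2 g"
  unfolding Jst_def using norm_iw_le norm_Bes order_trans by blast

lemma gh_diff:
  assumes "L2f l f" "L2f l g" "snd c < l"
  shows "gh (\<lambda>t. f t - g t) c = gh f c - gh g c"
  unfolding gh_def inner_diff_left
  by (intro Bochner_Integration.integral_diff L2f_inner_integrable[where l = l, OF _ L2f_ee] assms)

lemma gh_scaleR: "gh (\<lambda>t. r *\<^sub>R f t) c = r * gh f c"
  by (simp add: gh_def)

lemma Jst_diff:
  assumes "L2f l f" "L2f l g"
  shows "Jst l (\<lambda>t. f t - g t) = Jst l f - Jst l g"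
proof (rule ell2_eqI)
  fix c
  show "ev (Jst l (\<lambda>t. f t - g t)) c = ev (Jst l f - Jst l g) c"
    using gh_diff[OF assms, of c] by (simp add: ev_Jst assms L2f_diff diff_divide_distrib)
qed

lemma Jst_scaleR: "L2f l f \<Longrightarrow> Jst l (\<lambda>t. r *\<^sub>R f t) = r *\<^sub>R Jst l f"
  by (rule ell2_eqI) (simp add: ev_Jst L2f_scaleR gh_scaleR)

lemma gh_cong_AE:
  assumes "L2f l f" "L2f l g" "AE t in MI. f t = g t" "snd c < l"
  shows "gh f c = gh g c"
  unfolding gh_def
proof (rule integral_cong_AE)
  show "AE t in MI. inner (f t) (ee c t) = inner (g t) (ee c t)" using assms(3) by eventually_elim simp
qed (use L2f_inner_integrable[OF _ L2f_ee[OF assms(4)]] assms(1,2) borel_measurable_integrable in blast)+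

lemma Jst_cong_AE:
  assumes "L2f l f" "L2f l g" "AE t in MI. f t = g t"
  shows "Jst l f = Jst l g"
proof (rule ell2_eqI)
  fix c
  show "ev (Jst l f) c = ev (Jst l g) c"
    using gh_cong_AE[OF assms, of c] by (simp add: ev_Jst assms)
qed

text \<open>For partial sums both sides are the same finite sum; each side is continuous along the
  partial sums of \<open>\<xi>\<close>.\<close>

lemma inner_Jst:
  assumes g: "L2f l g" and \<xi>: "\<xi> \<in> Es l"
  shows "inner (Jst l g) \<xi> = (\<integral>t. inner (g t) (lp l \<xi> t) \<partial>MI)"
proof (rule LIMSEQ_unique)
  show "(\<lambda>N. \<integral>t. inner (g t) (trg l \<xi> (An N) t) \<partial>MI) \<longlonglongrightarrow> (\<integral>t. inner (g t) (lp l \<xi> t) \<partial>MI)"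
    by (rule L2f_inner_tendsto[OF L2f_lp g L2f_trg lp_limit])
  have "(\<integral>t. inner (g t) (trg l \<xi> (An N) t) \<partial>MI) = inner (Jst l g) (rst (An N \<times> UNIV) \<xi>)" for N
  proof -
    have "inner (Jst l g) (rst (An N \<times> UNIV) \<xi>) = (\<Sum>c\<in>An N \<times> {..<l}. ev (Jst l g) c * ev (rst (An N \<times> UNIV) \<xi>) c)"
      by (rule inner_finite) (auto dest: Es_nz[OF \<xi>])
    also have "\<dots> = (\<Sum>c\<in>An N \<times> {..<l}. (ev \<xi> c / wt c) * (\<integral>t. inner (g t) (ee c t) \<partial>MI))"
      by (intro sum.cong) (auto simp: ev_Jst[OF g] gh_def)
    finally show ?thesis by (simp add: integral_inner_trg[OF g])
  qed
  moreover have "(\<lambda>N. inner (Jst l g) (rst (An N \<times> UNIV) \<xi>)) \<longlonglongrightarrow> inner (Jst l g) \<xi>"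
    by (intro tendsto_inner tendsto_const rst_An_tendsto)
  ultimately show "(\<lambda>N. \<integral>t. inner (g t) (trg l \<xi> (An N) t) \<partial>MI) \<longlonglongrightarrow> inner (Jst l g) \<xi>" by simp
qed

lemma finite_inv_wt:
  assumes "0 < e"
  shows "finite {c \<in> UNIV \<times> {..<l}. e \<le> \<bar>1 / wt c\<bar>}"
proof (rule finite_subset)
  define N where "N = nat \<lceil>1 / e\<^sup>2\<rceil>"
  show "{c \<in> UNIV \<times> {..<l}. e \<le> \<bar>1 / wt c\<bar>} \<subseteq> {- int N..int N} \<times> {..<l}"
  proof
    fix c assume c: "c \<in> {c \<in> UNIV \<times> {..<l}. e \<le> \<bar>1 / wt c\<bar>}"
    have "\<bar>fst c\<bar> \<le> int N"
    proof (cases "fst c = 0")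
      case False
      from c have "e \<le> 1 / wt c" by simp
      then have "e * wt c \<le> 1" by (simp add: pos_le_divide_eq)
      then have "(e * wt c)\<^sup>2 \<le> 1" using assms less_imp_le[OF wt_pos[of c]] by (intro power_le_one mult_nonneg_nonneg) simp_all
      then have "e\<^sup>2 * (2 * pi * \<bar>real_of_int (fst c)\<bar>) \<le> 1" using False by (simp add: power_mult_distrib wt_sq)
      then have "2 * pi * \<bar>real_of_int (fst c)\<bar> \<le> 1 / e\<^sup>2" using assms by (simp add: pos_le_divide_eq mult.commute)
      moreover have "1 * \<bar>real_of_int (fst c)\<bar> \<le> 2 * pi * \<bar>real_of_int (fst c)\<bar>"
        using pi_gt3 by (intro mult_right_mono) auto
      ultimately have "\<bar>real_of_int (fst c)\<bar> \<le> 1 / e\<^sup>2" by linarith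
      then show ?thesis unfolding N_def by linarith
    qed simp
    then show "c \<in> {- int N..int N} \<times> {..<l}" using c by (cases c) auto
  qed
qed simp

text \<open>Bessel's inequality bounds the coefficients, a subsequence converges coordinatewise, and
  the diagonal factor \<open>1 / wt c\<close> upgrades this to norm convergence. All compactness of
  gradients comes from here.\<close>

lemma Jst_compact:
  assumes "\<And>m. L2f l (g m)" "\<And>m :: nat. n2 (g m) \<le> B"
  shows "\<exists>r k. strict_mono (r :: nat \<Rightarrow> nat) \<and> k \<in> Es l \<and> (\<lambda>m. Jst l (g (r m))) \<longlonglongrightarrow> k"
proof -
  have B: "norm (Bes l (g m)) \<le> B" for m using norm_Bes[OF assms(1)] assms(2) order_trans by blast
  obtain r y where r: "strict_mono r" "norm y \<le> B" "\<And>c. (\<lambda>m. ev (Bes l (g (r m))) c) \<longlonglongrightarrow> ev y c"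
    using ell2_bounded_weak_subseq[of "\<lambda>m. Bes l (g m)", OF B] by blast
  have "(\<lambda>m. dmul (\<lambda>c. 1 / wt c) (Bes l (g (r m)))) \<longlonglongrightarrow> dmul (\<lambda>c. 1 / wt c) y"
    by (rule dmul_compact_tendsto[where S = "UNIV \<times> {..<l}" and B = B])
      (use inv_wt_le finite_inv_wt B r ev_Bes[OF assms(1)] in \<open>auto simp: not_less\<close>)
  then have lim: "(\<lambda>m. Jst l (g (r m))) \<longlonglongrightarrow> iw y" by (simp add: Jst_def iw_def)
  have "ev (iw y) (j, i) = 0" if "l \<le> i" for j i
  proof -
    have "(\<lambda>m. ev (Jst l (g (r m))) (j, i)) \<longlonglongrightarrow> ev (iw y) (j, i)" by (intro tendsto_ev lim)
    moreover have "ev (Jst l (g (r m))) (j, i) = 0" for m using that by (simp add: ev_Jst[OF assms(1)])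
    ultimately show ?thesis by (simp add: LIMSEQ_const_iff)
  qed
  then have "iw y \<in> Es l" by (simp add: Es_def)
  with r(1) lim show ?thesis by blast
qed

lemma Es_closed_seq:
  assumes "\<And>m. x m \<in> Es l" "x \<longlonglongrightarrow> k"
  shows "k \<in> Es l"
  unfolding Es_def
proof (intro CollectI allI impI)
  fix j i assume "l \<le> i"
  then have "(\<lambda>m. ev (x m) (j, i)) = (\<lambda>m. 0)" using assms(1) by (auto simp: Es_def)
  moreover have "(\<lambda>m. ev (x m) (j, i)) \<longlonglongrightarrow> ev k (j, i)" by (intro tendsto_ev assms(2))
  ultimately show "ev k (j, i) = 0" by (simp add: LIMSEQ_const_iff)
qed

section \<open>Constant loops in the fixed space\<close>

definition L0 :: "nat \<Rightarrow> pv set" where "L0 l = {v \<in> Ps l. \<forall>i. ev v (i, True) = 0}"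

text \<open>Only the x coordinates enter, because the constants of E lie in the fixed space of the
  involution.\<close>

definition cst :: "nat \<Rightarrow> pv \<Rightarrow> ec" where
  "cst l v = (\<Sum>i<l. ev v (i, False) *\<^sub>R bas (0, i))"

lemma ev_cst: "ev (cst l v) (j, i) = (if j = 0 \<and> i < l then ev v (i, False) else 0)"
proof -
  have "ev (cst l v) (j, i) = (\<Sum>k<l. if i = k then (if j = 0 then ev v (k, False) else 0) else 0)"
    unfolding cst_def ev_sum by (intro sum.cong) (auto simp: ev_bas)
  then show ?thesis by simp
qed

lemma cst_Es: "cst l v \<in> Es l"
  by (simp add: Es_def ev_cst)

lemma lp_cst:
  assumes "v \<in> L0 l"
  shows "AE t in MI. lp l (cst l v) t = v"
proof -
  have v: "v \<in> Ps l" "\<And>i. ev v (i, True) = 0" using assms by (auto simp: L0_def)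
  have eq: "trg l (cst l v) (An N) t = v" for N t
  proof -
    have "trg l (cst l v) (An N) t = (\<Sum>j\<in>An N. \<Sum>i<l. (ev (cst l v) (j, i) / wt (j, i)) *\<^sub>R ee (j, i) t)"
      by (simp add: trg_def sum.cartesian_product case_prod_beta)
    also have "\<dots> = (\<Sum>j\<in>An N. if j = 0 then (\<Sum>i<l. ev v (i, False) *\<^sub>R bas (i, False)) else 0)"
      by (intro sum.cong refl) (auto simp: ev_cst wt_def ee_def intro!: sum.cong)
    also have "\<dots> = (\<Sum>i<l. ev v (i, False) *\<^sub>R bas (i, False))" by simp
    also have "\<dots> = v"
    proof (rule ell2_eqI)
      fix c :: "nat \<times> bool"
      obtain k b where c: "c = (k, b)" by (cases c)
      have "ev (\<Sum>i<l. ev v (i, False) *\<^sub>R bas (i, False)) (k, b) = (\<Sum>i<l. if k = i then (if b then 0 else ev v (i, False)) else 0)"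
        unfolding ev_sum by (intro sum.cong) (auto simp: ev_bas)
      then show "ev (\<Sum>i<l. ev v (i, False) *\<^sub>R bas (i, False)) c = ev v c"
        using v by (auto simp: c Ps_def)
    qed
    finally show ?thesis .
  qed
  have "L2f l (\<lambda>t. v)" using v(1) by (intro L2f_cont) auto
  then show ?thesis
    by (intro L2_limit_unique[OF _ _ L2f_trg lp_limit]) (simp_all add: eq n2_def)
qed

section \<open>Extraction and embedding of the factors of a product\<close>

definition pull :: "('b \<Rightarrow> 'a) \<Rightarrow> 'b set \<Rightarrow> 'a ell2 \<Rightarrow> 'b ell2" where
  "pull f S x = Abs_ell2 (\<lambda>c. if c \<in> S then ev x (f c) else 0)"

lemma pull_props:
  assumes "inj_on f S"
  shows ev_pull: "ev (pull f S x) c = (if c \<in> S then ev x (f c) else 0)"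
    and norm_pull_le: "norm (pull f S x) \<le> norm x"
proof -
  have fin: "(\<Sum>c\<in>F. (if c \<in> S then ev x (f c) else 0)\<^sup>2) \<le> (norm x)\<^sup>2" if F: "finite F" for F
  proof -
    have "(\<Sum>c\<in>F. (if c \<in> S then ev x (f c) else 0)\<^sup>2) = (\<Sum>c\<in>F \<inter> S. (ev x (f c))\<^sup>2)"
      using F by (intro sum.mono_neutral_cong_right) auto
    also have "\<dots> = (\<Sum>d\<in>f ` (F \<inter> S). (ev x d)\<^sup>2)"
      using inj_on_subset[OF assms, of "F \<inter> S"] by (simp add: sum.reindex)
    also have "\<dots> \<le> (norm x)\<^sup>2" using F by (intro sum_sq_le_norm) auto
    finally show ?thesis .
  qed
  show "ev (pull f S x) c = (if c \<in> S then ev x (f c) else 0)"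
    unfolding pull_def using ell2_of_bound(2)[OF fin] by simp
  show "norm (pull f S x) \<le> norm x"
    unfolding pull_def by (rule power2_le_imp_le[OF ell2_of_bound(3)[OF fin]]) auto
qed

text \<open>\<open>s\<close> is the offset and \<open>n\<close> the size of a factor. The suffix
  \<open>E\<close> refers to coefficient families and \<open>P\<close> to points; each embedding is
  adjoint to the corresponding extraction.\<close>

definition blkE :: "nat \<Rightarrow> nat \<Rightarrow> ec \<Rightarrow> ec" where
  "blkE s n = pull (\<lambda>c. (fst c, s + snd c)) (UNIV \<times> {..<n})"
definition blkP :: "nat \<Rightarrow> nat \<Rightarrow> pv \<Rightarrow> pv" where
  "blkP s n = pull (\<lambda>c. (s + fst c, snd c)) ({..<n} \<times> UNIV)"
definition embE :: "nat \<Rightarrow> nat \<Rightarrow> ec \<Rightarrow> ec" where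
  "embE s n = pull (\<lambda>c. (fst c, snd c - s)) (UNIV \<times> {s..<s+n})"
definition embP :: "nat \<Rightarrow> nat \<Rightarrow> pv \<Rightarrow> pv" where
  "embP s n = pull (\<lambda>c. (fst c - s, snd c)) ({s..<s+n} \<times> UNIV)"

lemma ev_blkE [simp]: "ev (blkE s n x) (j, m) = (if m < n then ev x (j, s + m) else 0)"
  unfolding blkE_def by (subst ev_pull) (auto simp: inj_on_def)
lemma norm_blkE_le: "norm (blkE s n x) \<le> norm x"
  unfolding blkE_def by (rule norm_pull_le) (auto simp: inj_on_def)
lemma ev_blkP [simp]: "ev (blkP s n x) (m, b) = (if m < n then ev x (s + m, b) else 0)"
  unfolding blkP_def by (subst ev_pull) (auto simp: inj_on_def)
lemma norm_blkP_le: "norm (blkP s n x) \<le> norm x"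
  unfolding blkP_def by (rule norm_pull_le) (auto simp: inj_on_def)
lemma ev_embE [simp]: "ev (embE s n x) (j, m) = (if s \<le> m \<and> m < s + n then ev x (j, m - s) else 0)"
  unfolding embE_def by (subst ev_pull) (auto simp: inj_on_def)
lemma norm_embE_le: "norm (embE s n x) \<le> norm x"
  unfolding embE_def by (rule norm_pull_le) (auto simp: inj_on_def)
lemma ev_embP [simp]: "ev (embP s n x) (m, b) = (if s \<le> m \<and> m < s + n then ev x (m - s, b) else 0)"
  unfolding embP_def by (subst ev_pull) (auto simp: inj_on_def)
lemma norm_embP_le: "norm (embP s n x) \<le> norm x"
  unfolding embP_def by (rule norm_pull_le) (auto simp: inj_on_def)

lemma pair_ell2_eqI: "(\<And>i j. ev x (i, j) = ev y (i, j)) \<Longrightarrow> x = y"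
  by (rule ell2_eqI) auto

lemma blkE_add: "blkE s n (x + y) = blkE s n x + blkE s n y"
  and blkE_diff: "blkE s n (x - y) = blkE s n x - blkE s n y"
  and blkE_scaleR: "blkE s n (r *\<^sub>R x) = r *\<^sub>R blkE s n x"
  and blkP_add: "blkP s n (v + w) = blkP s n v + blkP s n w"
  and blkP_diff: "blkP s n (v - w) = blkP s n v - blkP s n w"
  and blkP_scaleR: "blkP s n (r *\<^sub>R v) = r *\<^sub>R blkP s n v"
  by (rule pair_ell2_eqI; simp)+

lemma blkE_Es [simp]: "blkE s n x \<in> Es n"
  by (simp add: Es_def)
lemma blkP_Ps [simp]: "blkP s n v \<in> Ps n"
  by (simp add: Ps_def)
lemma embE_Es: "s + n \<le> N \<Longrightarrow> embE s n x \<in> Es N"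
  by (simp add: Es_def)
lemma embP_Ps: "s + n \<le> N \<Longrightarrow> embP s n x \<in> Ps N"
  by (simp add: Ps_def)
lemma blkE_embE: "x \<in> Es n \<Longrightarrow> blkE s n (embE s n x) = x"
  by (rule pair_ell2_eqI) (auto simp: Es_def not_less)

lemma bounded_linear_blkE: "bounded_linear (blkE s n)"
  by (rule bounded_linear_intro[where K = 1]) (auto simp: blkE_add blkE_scaleR norm_blkE_le)
lemma bounded_linear_blkP: "bounded_linear (blkP s n)"
  by (rule bounded_linear_intro[where K = 1]) (auto simp: blkP_add blkP_scaleR norm_blkP_le)

lemmas continuous_on_blkP [continuous_intros] = bounded_linear.continuous_on[OF bounded_linear_blkP]

lemma inner_embP: "v \<in> Ps n \<Longrightarrow> inner (embP s n v) w = inner v (blkP s n w)"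
proof -
  assume v: "v \<in> Ps n"
  have "inner (embP s n v) w = (\<Sum>c\<in>{s..<s+n} \<times> UNIV. ev (embP s n v) c * ev w c)"
    by (rule inner_finite) (auto split: if_splits)
  also have "\<dots> = (\<Sum>c\<in>{..<n} \<times> UNIV. ev v c * ev (blkP s n w) c)"
    by (rule sum.reindex_bij_witness[of _ "\<lambda>c. (fst c + s, snd c)" "\<lambda>c. (fst c - s, snd c)"]) auto
  also have "\<dots> = inner v (blkP s n w)" unfolding inner_Ps[OF v] Cl_def ..
  finally show ?thesis .
qed

lemma ee_blk:
  "snd c < n \<Longrightarrow> blkP s n (ee (fst c, s + snd c) t) = ee c t"
  "snd c < n \<Longrightarrow> embP s n (ee c t) = ee (fst c, s + snd c) t"
  by (rule pair_ell2_eqI; auto simp: ee_def ev_bas)+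

lemma trg_blk:
  assumes "s + n \<le> N" "finite A"
  shows "trg n (blkE s n \<xi>) A t = blkP s n (trg N \<xi> A t)"
proof (rule pair_ell2_eqI)
  fix i b
  have "ev (blkP s n (trg N \<xi> A t)) (i, b)
      = (if i < n then (\<Sum>c\<in>A \<times> {..<N}. (ev \<xi> c / wt c) * ev (ee c t) (s + i, b)) else 0)"
    by (simp add: trg_def)
  also have "\<dots> = (if i < n then (\<Sum>c\<in>A \<times> {s + i}. (ev \<xi> c / wt c) * ev (ee c t) (s + i, b)) else 0)"
    using assms by (auto simp: ee_def ev_bas finite_cartesian_product_iff intro!: sum.mono_neutral_right split: if_splits)
  also have "\<dots> = (if i < n then (\<Sum>c\<in>A \<times> {i}. (ev (blkE s n \<xi>) c / wt c) * ev (ee c t) (i, b)) else 0)"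
    by (auto simp: wt_def ee_def ev_bas intro!: sum.reindex_bij_witness[of _ "\<lambda>c. (fst c, s + snd c)" "\<lambda>c. (fst c, i)"])
  also have "\<dots> = ev (trg n (blkE s n \<xi>) A t) (i, b)"
  proof (cases "i < n")
    case True
    then show ?thesis using assms(2)
      by (auto simp: trg_def ee_def ev_bas intro!: sum.mono_neutral_left split: if_splits)
  next
    case False
    then show ?thesis using trg_Ps[of n "blkE s n \<xi>" A t] by (simp add: Ps_def)
  qed
  finally show "ev (trg n (blkE s n \<xi>) A t) (i, b) = ev (blkP s n (trg N \<xi> A t)) (i, b)" ..
qed

lemma L2f_blkP:
  assumes "L2f N f"
  shows "L2f n (\<lambda>t. blkP s n (f t))"
proof -
  have m: "(\<lambda>t. ev (blkP s n (f t)) c) \<in> borel_measurable MI" for c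
    using L2f_ev[OF assms, of "(s + fst c, snd c)"] by (cases c) simp
  have "integrable MI (\<lambda>t. (norm (blkP s n (f t)))\<^sup>2)"
  proof (rule Bochner_Integration.integrable_bound[OF L2f_sq[OF assms]])
    show "(\<lambda>t. (norm (blkP s n (f t)))\<^sup>2) \<in> borel_measurable MI"
      using norm_measurable[of "\<lambda>t. blkP s n (f t)" n, OF blkP_Ps m] by simp
    show "AE t in MI. norm ((norm (blkP s n (f t)))\<^sup>2) \<le> norm ((norm (f t))\<^sup>2)"
      by (intro AE_I2) (simp add: norm_blkP_le power_mono)
  qed
  then show ?thesis using m by (simp add: L2f_def)
qed

lemma n2_blkP_le:
  assumes "L2f N f"
  shows "n2 (\<lambda>t. blkP s n (f t)) \<le> n2 f"
proof -
  have "(\<integral>t. (norm (blkP s n (f t)))\<^sup>2 \<partial>MI) \<le> (\<integral>t. (norm (f t))\<^sup>2 \<partial>MI)"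
    by (rule integral_mono[OF L2f_sq[OF L2f_blkP[OF assms]] L2f_sq[OF assms]])
      (simp add: norm_blkP_le power_mono)
  then show ?thesis unfolding n2_def by simp
qed

text \<open>Extraction shifts coordinate numbers and the loop map sums over frequencies, so both
  commute on partial sums; the chosen representatives then agree almost everywhere.\<close>

lemma lp_blk:
  assumes "s + n \<le> N"
  shows "AE t in MI. lp n (blkE s n \<xi>) t = blkP s n (lp N \<xi> t)"
proof (rule L2_limit_unique[OF L2f_lp L2f_blkP[OF L2f_lp] L2f_trg lp_limit])
  show "(\<lambda>M. n2 (\<lambda>t. trg n (blkE s n \<xi>) (An M) t - blkP s n (lp N \<xi> t))) \<longlonglongrightarrow> 0"
  proof (rule Lim_null_comparison[OF _ lp_limit[of N \<xi>]])
    show "\<forall>\<^sub>F M in sequentially. norm (n2 (\<lambda>t. trg n (blkE s n \<xi>) (An M) t - blkP s n (lp N \<xi> t)))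
        \<le> n2 (\<lambda>t. trg N \<xi> (An M) t - lp N \<xi> t)"
    proof (intro always_eventually allI)
      fix M
      have "n2 (\<lambda>t. blkP s n (trg N \<xi> (An M) t - lp N \<xi> t)) \<le> n2 (\<lambda>t. trg N \<xi> (An M) t - lp N \<xi> t)"
        by (rule n2_blkP_le[where N = N]) (intro L2f_diff L2f_trg L2f_lp)
      then show "norm (n2 (\<lambda>t. trg n (blkE s n \<xi>) (An M) t - blkP s n (lp N \<xi> t)))
          \<le> n2 (\<lambda>t. trg N \<xi> (An M) t - lp N \<xi> t)"
        by (simp add: trg_blk[OF assms] blkP_diff)
    qed
  qed
qed

section \<open>The action functional\<close>

definition Pp :: "ec \<Rightarrow> ec" where "Pp = rst {c. 0 < fst c}"
definition Pm :: "ec \<Rightarrow> ec" where "Pm = rst {c. fst c < 0}"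
definition Pz :: "ec \<Rightarrow> ec" where "Pz = rst {c. fst c = 0}"

lemma ev_Pp [simp]: "ev (Pp x) c = (if 0 < fst c then ev x c else 0)"
  and ev_Pm [simp]: "ev (Pm x) c = (if fst c < 0 then ev x c else 0)"
  and ev_Pz [simp]: "ev (Pz x) c = (if fst c = 0 then ev x c else 0)"
  by (simp_all add: Pp_def Pm_def Pz_def)

lemma P_decomp: "x = Pp x + Pz x + Pm x"
  by (rule ell2_eqI) auto

lemma P_add: "Pp (x + y) = Pp x + Pp y" "Pm (x + y) = Pm x + Pm y" "Pz (x + y) = Pz x + Pz y"
  and P_diff: "Pp (x - y) = Pp x - Pp y" "Pm (x - y) = Pm x - Pm y" "Pz (x - y) = Pz x - Pz y"
  and P_scaleR: "Pp (r *\<^sub>R x) = r *\<^sub>R Pp x" "Pm (r *\<^sub>R x) = r *\<^sub>R Pm x" "Pz (r *\<^sub>R x) = r *\<^sub>R Pz x"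
  and P_zero [simp]: "Pp 0 = 0" "Pm 0 = 0" "Pz 0 = 0"
  by (simp_all add: Pp_def Pm_def Pz_def rst_add rst_diff rst_scaleR)

lemma P_P [simp]: "Pp (Pp x) = Pp x" "Pm (Pm x) = Pm x" "Pz (Pz x) = Pz x"
  "Pp (Pm x) = 0" "Pm (Pp x) = 0" "Pp (Pz x) = 0" "Pz (Pp x) = 0" "Pm (Pz x) = 0" "Pz (Pm x) = 0"
  by (rule ell2_eqI; simp)+

lemma P_Es: "x \<in> Es l \<Longrightarrow> Pp x \<in> Es l" "x \<in> Es l \<Longrightarrow> Pm x \<in> Es l" "x \<in> Es l \<Longrightarrow> Pz x \<in> Es l"
  by (simp_all add: Pp_def Pm_def Pz_def Es_rst)

lemma norm_P_le: "norm (Pp x) \<le> norm x" "norm (Pm x) \<le> norm x" "norm (Pz x) \<le> norm x"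
  by (simp_all add: Pp_def Pm_def Pz_def norm_rst_le)

lemma tendsto_P [tendsto_intros]:
  "(f \<longlongrightarrow> a) F \<Longrightarrow> ((\<lambda>x. Pp (f x)) \<longlongrightarrow> Pp a) F"
  "(f \<longlongrightarrow> a) F \<Longrightarrow> ((\<lambda>x. Pm (f x)) \<longlongrightarrow> Pm a) F"
  "(f \<longlongrightarrow> a) F \<Longrightarrow> ((\<lambda>x. Pz (f x)) \<longlongrightarrow> Pz a) F"
  unfolding Pp_def Pm_def Pz_def by (intro tendsto_rst, assumption)+

lemma inner_P:
  "inner (Pp x) (Pm y) = 0" "inner (Pm x) (Pp y) = 0" "inner (Pp x) (Pz y) = 0" "inner (Pm x) (Pz y) = 0"
  "inner (Pz x) (Pp y) = 0" "inner (Pz x) (Pm y) = 0"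
  unfolding Pp_def Pm_def Pz_def by (rule inner_rst_disjoint, force)+

lemma inner_P_self: "inner (Pp x) y = inner (Pp x) (Pp y)" "inner (Pm x) y = inner (Pm x) (Pm y)"
  "inner (Pz x) y = inner (Pz x) (Pz y)"
  by (subst (1 2) P_decomp[of y]; simp only: inner_add_right P_add P_P inner_P; simp)+

lemma norm_P_sum: "(norm x)\<^sup>2 = (norm (Pp x))\<^sup>2 + (norm (Pz x))\<^sup>2 + (norm (Pm x))\<^sup>2"
proof -
  have "inner x x = inner (Pp x + Pz x + Pm x) (Pp x + Pz x + Pm x)" by (simp only: P_decomp[symmetric])
  also have "\<dots> = inner (Pp x) (Pp x) + inner (Pz x) (Pz x) + inner (Pm x) (Pm x)"
    by (simp only: inner_add_left inner_add_right inner_P)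
  finally show ?thesis by (simp add: power2_norm_eq_inner)
qed

lemma P_cst [simp]: "Pp (cst l v) = 0" "Pm (cst l v) = 0" "Pz (cst l v) = cst l v"
  by (rule pair_ell2_eqI; simp add: ev_cst)+

definition Act :: "ec \<Rightarrow> real" where "Act x = (norm (Pp x))\<^sup>2 / 2 - (norm (Pm x))\<^sup>2 / 2"

definition IG :: "nat \<Rightarrow> (pv \<Rightarrow> real) \<Rightarrow> ec \<Rightarrow> real" where "IG l G x = (\<integral>t. G (lp l x t) \<partial>MI)"

definition Phi :: "nat \<Rightarrow> (pv \<Rightarrow> real) \<Rightarrow> ec \<Rightarrow> real" where "Phi l G x = Act x - IG l G x"

text \<open>The gradient of \<open>IG\<close> for the inner product of E: the gradient of the
  Hamiltonian along the loop, carried back by the adjoint of the loop map.\<close>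

definition Wg :: "nat \<Rightarrow> (pv \<Rightarrow> pv) \<Rightarrow> ec \<Rightarrow> ec" where "Wg l gr x = Jst l (\<lambda>t. gr (lp l x t))"

definition gradP :: "nat \<Rightarrow> (pv \<Rightarrow> pv) \<Rightarrow> ec \<Rightarrow> ec" where "gradP l gr x = Pp x - Pm x - Wg l gr x"

lemma Act_add: "Act (x + v) = Act x + inner (Pp x - Pm x) v + Act v"
proof -
  have "(norm (Pp x + Pp v))\<^sup>2 = (norm (Pp x))\<^sup>2 + 2 * inner (Pp x) v + (norm (Pp v))\<^sup>2"
    using norm_sq_comb[of 1 "Pp x" "Pp v"] inner_P_self(1)[of x v] by simp
  moreover have "(norm (Pm x + Pm v))\<^sup>2 = (norm (Pm x))\<^sup>2 + 2 * inner (Pm x) v + (norm (Pm v))\<^sup>2"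
    using norm_sq_comb[of 1 "Pm x" "Pm v"] inner_P_self(2)[of x v] by simp
  ultimately show ?thesis by (simp add: Act_def P_add inner_diff_left field_simps)
qed

lemma abs_Act_le: "\<bar>Act v\<bar> \<le> (norm v)\<^sup>2 / 2"
  using norm_P_sum[of v] zero_le_power2[of "norm (Pp v)"] zero_le_power2[of "norm (Pm v)"] zero_le_power2[of "norm (Pz v)"]
  unfolding Act_def abs_le_iff by linarith

section \<open>Hamiltonians with Lipschitz gradient\<close>

text \<open>Quantitative C^{1,1} regularity. The two-sided quadratic remainder bound takes the place
  of differentiability: it integrates along loops with no limit argument and directly yields a safe
  length for ascent steps.\<close>

locale ham =
  fixes l :: nat and G :: "pv \<Rightarrow> real" and gr :: "pv \<Rightarrow> pv" and Lc :: real
  assumes Lc1: "1 \<le> Lc"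
    and G_nonneg: "0 \<le> G z"
    and gr_Ps: "z \<in> Ps l \<Longrightarrow> gr z \<in> Ps l"
    and gr_lip: "norm (gr z - gr w) \<le> Lc * norm (z - w)"
    and G_quad: "\<bar>G w - G z - inner (gr z) (w - z)\<bar> \<le> Lc * (norm (w - z))\<^sup>2"
begin

lemma gr_cont: "continuous_on UNIV gr"
proof (rule lipschitz_on_continuous_on)
  show "Lc-lipschitz_on UNIV gr"
    using gr_lip Lc1 by (intro lipschitz_onI) (auto simp: dist_norm)
qed

lemma G_cont: "continuous_on UNIV G"
proof (rule continuous_at_imp_continuous_on, rule ballI)
  fix z
  have "(G \<longlongrightarrow> G z) (at z)"
  proof (rule Lim_null_comparison[where f = "\<lambda>w. G w - G z" and g = "\<lambda>w. Lc * (norm (w - z))\<^sup>2 + norm (gr z) * norm (w - z)", THEN LIM_zero_cancel])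
    have "norm (G w - G z) \<le> Lc * (norm (w - z))\<^sup>2 + norm (gr z) * norm (w - z)" for w
      using G_quad[of w z] Cauchy_Schwarz_ineq2[of "gr z" "w - z"] by simp
    then show "\<forall>\<^sub>F w in at z. norm (G w - G z) \<le> Lc * (norm (w - z))\<^sup>2 + norm (gr z) * norm (w - z)" by simp
    have "((\<lambda>w. Lc * (norm (w - z))\<^sup>2 + norm (gr z) * norm (w - z)) \<longlongrightarrow> Lc * (norm (z - z))\<^sup>2 + norm (gr z) * norm (z - z)) (at z)"
      by (intro tendsto_intros)
    then show "((\<lambda>w. Lc * (norm (w - z))\<^sup>2 + norm (gr z) * norm (w - z)) \<longlongrightarrow> 0) (at z)" by simp
  qed
  then show "isCont G z" by (simp add: isCont_def)
qed

lemma gr_le: "norm (gr z) \<le> norm (gr 0) + Lc * norm z"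
  using gr_lip[of z 0] norm_triangle_ineq2[of "gr z" "gr 0"] by simp

lemma L2f_gr:
  assumes "L2f l f"
  shows "L2f l (\<lambda>t. gr (f t))"
proof -
  have m: "(\<lambda>t. ev (gr (f t)) c) \<in> borel_measurable MI" for c
    by (rule continuous_measurable[where G = "\<lambda>z. ev (gr z) c", OF _ L2f_Ps[OF assms] L2f_ev[OF assms]])
      (intro continuous_intros gr_cont)
  have Ps: "gr (f t) \<in> Ps l" for t using L2f_Ps[OF assms] gr_Ps by blast
  have "integrable MI (\<lambda>t. (norm (gr (f t)))\<^sup>2)"
  proof (rule Bochner_Integration.integrable_bound)
    show "integrable MI (\<lambda>t. 2 * (norm (gr 0))\<^sup>2 + 2 * Lc\<^sup>2 * (norm (f t))\<^sup>2)"
      by (intro Bochner_Integration.integrable_add integrable_mult_right L2f_sq[OF assms]) simp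
    show "(\<lambda>t. (norm (gr (f t)))\<^sup>2) \<in> borel_measurable MI"
      using norm_measurable[of "\<lambda>t. gr (f t)" l, OF Ps m] by simp
    have "(norm (gr z))\<^sup>2 \<le> 2 * (norm (gr 0))\<^sup>2 + 2 * Lc\<^sup>2 * (norm z)\<^sup>2" for z
    proof -
      have "(norm (gr z))\<^sup>2 \<le> (norm (gr 0) + Lc * norm z)\<^sup>2" by (intro power_mono gr_le) simp
      also have "\<dots> \<le> 2 * (norm (gr 0))\<^sup>2 + 2 * (Lc * norm z)\<^sup>2"
        using zero_le_power2[of "norm (gr 0) - Lc * norm z"] by (simp add: power2_sum power2_diff)
      finally show ?thesis by (simp add: power_mult_distrib)
    qed
    then show "AE t in MI. norm ((norm (gr (f t)))\<^sup>2) \<le> norm (2 * (norm (gr 0))\<^sup>2 + 2 * Lc\<^sup>2 * (norm (f t))\<^sup>2)"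
      by (intro AE_I2) (simp add: order_trans[OF _ abs_ge_self])
  qed
  then show ?thesis using m Ps by (simp add: L2f_def)
qed

lemma G_integrable:
  assumes "L2f l f"
  shows "integrable MI (\<lambda>t. G (f t))"
proof (rule Bochner_Integration.integrable_bound)
  show "integrable MI (\<lambda>t. \<bar>G 0\<bar> + norm (gr 0) * norm (f t) + Lc * (norm (f t))\<^sup>2)"
    by (intro Bochner_Integration.integrable_add integrable_mult_right L2f_sq[OF assms] L2f_norm_integrable[OF assms]) simp
  show "(\<lambda>t. G (f t)) \<in> borel_measurable MI"
    by (rule continuous_measurable[OF G_cont L2f_Ps[OF assms] L2f_ev[OF assms]])
  have "\<bar>G z\<bar> \<le> \<bar>G 0\<bar> + norm (gr 0) * norm z + Lc * (norm z)\<^sup>2" for z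
    using G_quad[of z 0] Cauchy_Schwarz_ineq2[of "gr 0" z] by simp
  then show "AE t in MI. norm (G (f t)) \<le> norm (\<bar>G 0\<bar> + norm (gr 0) * norm (f t) + Lc * (norm (f t))\<^sup>2)"
    by (intro AE_I2) (simp add: order_trans[OF _ abs_ge_self])
qed

lemma Wg_Es: "Wg l gr x \<in> Es l"
  unfolding Wg_def by (intro Jst_Es L2f_gr L2f_lp)

lemma gradP_Es: "x \<in> Es l \<Longrightarrow> gradP l gr x \<in> Es l"
  unfolding gradP_def by (intro Es_diff P_Es Wg_Es)

lemma n2_gr_diff:
  assumes "L2f l f" "L2f l g"
  shows "n2 (\<lambda>t. gr (f t) - gr (g t)) \<le> Lc * n2 (\<lambda>t. f t - g t)"
proof (rule power2_le_imp_le)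
  have "(n2 (\<lambda>t. gr (f t) - gr (g t)))\<^sup>2 \<le> (\<integral>t. Lc\<^sup>2 * (norm (f t - g t))\<^sup>2 \<partial>MI)"
    unfolding n2_sq
  proof (rule integral_mono)
    show "integrable MI (\<lambda>t. (norm (gr (f t) - gr (g t)))\<^sup>2)"
      by (intro L2f_sq[where l = l] L2f_diff L2f_gr assms)
    show "integrable MI (\<lambda>t. Lc\<^sup>2 * (norm (f t - g t))\<^sup>2)"
      by (intro integrable_mult_right L2f_sq[where l = l] L2f_diff assms)
    show "(norm (gr (f t) - gr (g t)))\<^sup>2 \<le> Lc\<^sup>2 * (norm (f t - g t))\<^sup>2" for t
      unfolding power_mult_distrib[symmetric] by (intro power_mono gr_lip) simp
  qed
  also have "\<dots> = (Lc * n2 (\<lambda>t. f t - g t))\<^sup>2" by (simp add: power_mult_distrib n2_sq)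
  finally show "(n2 (\<lambda>t. gr (f t) - gr (g t)))\<^sup>2 \<le> (Lc * n2 (\<lambda>t. f t - g t))\<^sup>2" .
qed (use Lc1 in simp)

lemma Wg_lip: "norm (Wg l gr x - Wg l gr y) \<le> Lc * norm (x - y)"
proof -
  have "n2 (\<lambda>t. lp l x t - lp l y t) = n2 (lp l (x - y))"
    by (rule n2_cong_AE[where l = l]) (use lp_diff[of l x y] in \<open>auto intro: L2f_diff elim: AE_mp\<close>)
  then have 1: "n2 (\<lambda>t. lp l x t - lp l y t) \<le> norm (x - y)" using n2_lp_le[of l "x - y"] by simp
  have "norm (Wg l gr x - Wg l gr y) = norm (Jst l (\<lambda>t. gr (lp l x t) - gr (lp l y t)))"
    unfolding Wg_def by (simp add: Jst_diff L2f_gr)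
  also have "\<dots> \<le> n2 (\<lambda>t. gr (lp l x t) - gr (lp l y t))"
    by (intro norm_Jst L2f_diff L2f_gr L2f_lp)
  also have "\<dots> \<le> Lc * n2 (\<lambda>t. lp l x t - lp l y t)" by (intro n2_gr_diff L2f_lp)
  also have "\<dots> \<le> Lc * norm (x - y)" using 1 Lc1 by (intro mult_left_mono) auto
  finally show ?thesis .
qed

text \<open>The pointwise remainder bound is integrated along the loop, and the loop map does not
  increase norms.\<close>

lemma IG_quad:
  assumes v: "v \<in> Es l"
  shows "\<bar>IG l G (x + v) - IG l G x - inner (Wg l gr x) v\<bar> \<le> Lc * (norm v)\<^sup>2"
proof -
  have "IG l G (x + v) = (\<integral>t. G (lp l x t + lp l v t) \<partial>MI)"
    unfolding IG_def
  proof (rule integral_cong_AE)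
    show "AE t in MI. G (lp l (x + v) t) = G (lp l x t + lp l v t)"
      using lp_add[of l x v] by eventually_elim simp
  qed (intro borel_measurable_integrable G_integrable L2f_add L2f_lp)+
  then have "IG l G (x + v) - IG l G x - inner (Wg l gr x) v
      = (\<integral>t. G (lp l x t + lp l v t) - G (lp l x t) - inner (gr (lp l x t)) (lp l v t) \<partial>MI)"
    unfolding Wg_def IG_def using inner_Jst[OF L2f_gr[OF L2f_lp] v, of x]
    by (simp add: Bochner_Integration.integral_diff G_integrable L2f_add L2f_inner_integrable[OF L2f_gr[OF L2f_lp] L2f_lp])
  moreover have "\<bar>\<integral>t. G (lp l x t + lp l v t) - G (lp l x t) - inner (gr (lp l x t)) (lp l v t) \<partial>MI\<bar>
      \<le> (\<integral>t. Lc * (norm (lp l v t))\<^sup>2 \<partial>MI)"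
  proof (rule order_trans[OF integral_abs_bound integral_mono])
    show "integrable MI (\<lambda>t. \<bar>G (lp l x t + lp l v t) - G (lp l x t) - inner (gr (lp l x t)) (lp l v t)\<bar>)"
      by (intro integrable_abs Bochner_Integration.integrable_diff G_integrable L2f_add L2f_lp
            L2f_inner_integrable[OF L2f_gr[OF L2f_lp] L2f_lp])
    show "integrable MI (\<lambda>t. Lc * (norm (lp l v t))\<^sup>2)"
      by (intro integrable_mult_right L2f_sq[where l = l] L2f_lp)
    show "\<bar>G (lp l x t + lp l v t) - G (lp l x t) - inner (gr (lp l x t)) (lp l v t)\<bar> \<le> Lc * (norm (lp l v t))\<^sup>2" for t
      using G_quad[of "lp l x t + lp l v t" "lp l x t"] by simp
  qed
  moreover have "(\<integral>t. Lc * (norm (lp l v t))\<^sup>2 \<partial>MI) \<le> Lc * (norm v)\<^sup>2"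
  proof -
    have "(n2 (lp l v))\<^sup>2 \<le> (norm v)\<^sup>2" by (intro power_mono n2_lp_le) simp
    then show ?thesis using Lc1 by (simp add: n2_sq)
  qed
  ultimately show ?thesis by simp
qed

lemma Phi_quad:
  assumes v: "v \<in> Es l"
  shows "\<bar>Phi l G (x + v) - Phi l G x - inner (gradP l gr x) v\<bar> \<le> (Lc + 1) * (norm v)\<^sup>2"
proof -
  have "Phi l G (x + v) - Phi l G x - inner (gradP l gr x) v
     = Act v - (IG l G (x + v) - IG l G x - inner (Wg l gr x) v)"
    by (simp add: Phi_def gradP_def Act_add inner_diff_left)
  then show ?thesis
    using IG_quad[OF v, of x] abs_Act_le[of v] zero_le_power2[of "norm v"] by (simp add: algebra_simps)
qed

text \<open>At this step length the quadratic remainder consumes at most half of the first-order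
  gain.\<close>

lemma Phi_ascent:
  assumes x: "x \<in> Es l" and \<tau>: "0 \<le> \<tau>" "\<tau> * (2 * (Lc + 1)) \<le> 1"
  shows "Phi l G (x + \<tau> *\<^sub>R gradP l gr x) \<ge> Phi l G x + \<tau> / 2 * (norm (gradP l gr x))\<^sup>2"
proof -
  let ?g = "gradP l gr x"
  have "Phi l G (x + \<tau> *\<^sub>R ?g) \<ge> Phi l G x + inner ?g (\<tau> *\<^sub>R ?g) - (Lc + 1) * (norm (\<tau> *\<^sub>R ?g))\<^sup>2"
    using Phi_quad[OF Es_scaleR[OF gradP_Es[OF x]], of x \<tau>] by linarith
  also have "inner ?g (\<tau> *\<^sub>R ?g) = \<tau> * (norm ?g)\<^sup>2" by (simp add: power2_norm_eq_inner)
  also have "(Lc + 1) * (norm (\<tau> *\<^sub>R ?g))\<^sup>2 = (\<tau> * (2 * (Lc + 1))) * (\<tau> / 2 * (norm ?g)\<^sup>2)"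
    using \<tau>(1) by (simp add: power_mult_distrib power2_eq_square algebra_simps)
  finally have 1: "Phi l G (x + \<tau> *\<^sub>R ?g) \<ge> Phi l G x + \<tau> * (norm ?g)\<^sup>2 - (\<tau> * (2 * (Lc + 1))) * (\<tau> / 2 * (norm ?g)\<^sup>2)" .
  have "(\<tau> * (2 * (Lc + 1))) * (\<tau> / 2 * (norm ?g)\<^sup>2) \<le> 1 * (\<tau> / 2 * (norm ?g)\<^sup>2)"
    using \<tau> by (intro mult_right_mono) auto
  with 1 show ?thesis by (simp add: field_simps)
qed

lemma gradP_lip: "norm (gradP l gr x - gradP l gr y) \<le> (Lc + 2) * norm (x - y)"
proof -
  have "gradP l gr x - gradP l gr y = Pp (x - y) - Pm (x - y) - (Wg l gr x - Wg l gr y)"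
    by (simp add: gradP_def P_diff)
  then have "norm (gradP l gr x - gradP l gr y) \<le> norm (Pp (x - y)) + norm (Pm (x - y)) + norm (Wg l gr x - Wg l gr y)"
    by (metis (no_types) add_right_mono norm_triangle_ineq4 order_trans)
  then show ?thesis using norm_P_le[of "x - y"] Wg_lip[of x y] by (simp add: algebra_simps)
qed

lemma Phi_tendsto:
  assumes y: "y \<in> Es l" and x: "\<And>m. x m \<in> Es l" "x \<longlonglongrightarrow> y"
  shows "(\<lambda>m. Phi l G (x m)) \<longlonglongrightarrow> Phi l G y"
proof -
  have "(\<lambda>m. Phi l G (x m) - Phi l G y) \<longlonglongrightarrow> 0"
  proof (rule Lim_null_comparison)
    have "norm (Phi l G (x m) - Phi l G y) \<le> norm (gradP l gr y) * norm (x m - y) + (Lc + 1) * (norm (x m - y))\<^sup>2" for m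
      using Phi_quad[OF Es_diff[OF x(1)[of m] y], of y] Cauchy_Schwarz_ineq2[of "gradP l gr y" "x m - y"] by simp
    then show "\<forall>\<^sub>F m in sequentially. norm (Phi l G (x m) - Phi l G y)
        \<le> norm (gradP l gr y) * norm (x m - y) + (Lc + 1) * (norm (x m - y))\<^sup>2" by simp
    have "(\<lambda>m. norm (gradP l gr y) * norm (x m - y) + (Lc + 1) * (norm (x m - y))\<^sup>2)
        \<longlonglongrightarrow> norm (gradP l gr y) * norm (y - y) + (Lc + 1) * (norm (y - y))\<^sup>2"
      by (intro tendsto_intros x)
    then show "(\<lambda>m. norm (gradP l gr y) * norm (x m - y) + (Lc + 1) * (norm (x m - y))\<^sup>2) \<longlonglongrightarrow> 0" by simp
  qed
  then show ?thesis by (rule LIM_zero_cancel)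
qed

lemma gradP_tendsto:
  assumes "x \<longlonglongrightarrow> y"
  shows "(\<lambda>m. gradP l gr (x m)) \<longlonglongrightarrow> gradP l gr y"
proof -
  have "(\<lambda>m. gradP l gr (x m) - gradP l gr y) \<longlonglongrightarrow> 0"
  proof (rule Lim_null_comparison)
    show "\<forall>\<^sub>F m in sequentially. norm (gradP l gr (x m) - gradP l gr y) \<le> (Lc + 2) * norm (x m - y)"
      using gradP_lip by simp
    have "(\<lambda>m. (Lc + 2) * norm (x m - y)) \<longlonglongrightarrow> (Lc + 2) * norm (y - y)" by (intro tendsto_intros assms)
    then show "(\<lambda>m. (Lc + 2) * norm (x m - y)) \<longlonglongrightarrow> 0" by simp
  qed
  then show ?thesis by (rule LIM_zero_cancel)
qed

lemma n2_gr_lp: "n2 (\<lambda>t. gr (lp l x t)) \<le> norm (gr 0) + Lc * norm x"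
proof -
  have z: "L2f l (\<lambda>t. 0)" by simp
  have c: "L2f l (\<lambda>t. gr 0)" using L2f_gr[OF z] by simp
  have "n2 (\<lambda>t. (gr (lp l x t) - gr 0) + gr 0) \<le> n2 (\<lambda>t. gr (lp l x t) - gr 0) + n2 (\<lambda>t. gr 0)"
    by (rule n2_triangle[where l = l]) (intro L2f_diff L2f_gr L2f_lp c)+
  moreover have "n2 (\<lambda>t. gr (lp l x t) - gr 0) \<le> Lc * n2 (\<lambda>t. lp l x t - 0)"
    using n2_gr_diff[OF L2f_lp z] by simp
  moreover have "n2 (\<lambda>t. gr 0) = norm (gr 0)" by (simp add: n2_def)
  moreover have "Lc * n2 (lp l x) \<le> Lc * norm x" using Lc1 by (intro mult_left_mono n2_lp_le) auto
  ultimately show ?thesis by simp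
qed

end

section \<open>The Palais-Smale condition\<close>

text \<open>The kernel of x -> x^+ - x^- consists of constants in the fixed space, which is
  finite-dimensional; there boundedness alone gives a convergent subsequence.\<close>

lemma Es_subseq:
  assumes "\<And>m. x m \<in> Es l" "\<And>m :: nat. norm (x m) \<le> B" "(\<lambda>m. Pp (x m) - Pm (x m)) \<longlonglongrightarrow> k"
  shows "\<exists>r y. strict_mono (r :: nat \<Rightarrow> nat) \<and> y \<in> Es l \<and> (\<lambda>m. x (r m)) \<longlonglongrightarrow> y"
proof -
  obtain r z where r: "strict_mono r" "\<And>c. (\<lambda>m. ev (x (r m)) c) \<longlonglongrightarrow> ev z c"
    using ell2_bounded_weak_subseq[of x B] assms(2) by blast
  let ?z = "\<Sum>i<l. ev z (0, i) *\<^sub>R bas (0, i) :: ec"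
  have Pz: "Pz (x m) = (\<Sum>i<l. ev (x m) (0, i) *\<^sub>R bas (0, i))" for m
  proof (rule pair_ell2_eqI)
    fix j :: int and k
    have "ev (\<Sum>i<l. ev (x m) (0, i) *\<^sub>R bas (0, i)) (j, k) = (\<Sum>i<l. if k = i then (if j = 0 then ev (x m) (0, i) else 0) else 0)"
      unfolding ev_sum by (intro sum.cong) (auto simp: ev_bas)
    then show "ev (Pz (x m)) (j, k) = ev (\<Sum>i<l. ev (x m) (0, i) *\<^sub>R bas (0, i)) (j, k)"
      using assms(1)[of m] by (auto dest: Es_nz)
  qed
  have "(\<lambda>m. Pz (x (r m))) \<longlonglongrightarrow> ?z" unfolding Pz by (intro tendsto_intros r)
  moreover have k: "(\<lambda>m. Pp (x (r m)) - Pm (x (r m))) \<longlonglongrightarrow> k"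
    using LIMSEQ_subseq_LIMSEQ[OF assms(3) r(1)] by (simp add: o_def)
  moreover have "(\<lambda>m. Pp (x (r m))) \<longlonglongrightarrow> Pp k"
    using tendsto_P(1)[OF k] by (simp add: P_diff)
  moreover have "(\<lambda>m. - Pm (x (r m))) \<longlonglongrightarrow> Pm k"
    using tendsto_P(2)[OF k] by (simp add: P_diff)
  ultimately have "(\<lambda>m. Pp (x (r m)) + Pz (x (r m)) - - Pm (x (r m))) \<longlonglongrightarrow> Pp k + ?z - Pm k"
    by (intro tendsto_diff tendsto_add)
  moreover have "Pp (x (r m)) + Pz (x (r m)) - - Pm (x (r m)) = x (r m)" for m
    using P_decomp[of "x (r m)"] by simp
  ultimately have "(\<lambda>m. x (r m)) \<longlonglongrightarrow> Pp k + ?z - Pm k" by simp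
  with r(1) Es_closed_seq[of "\<lambda>m. x (r m)" l] assms(1) show ?thesis by blast
qed

lemma L2f_norm_integral_le:
  assumes "L2f l f"
  shows "(\<integral>t. norm (f t) \<partial>MI) \<le> n2 f"
proof (rule power2_le_imp_le)
  let ?a = "\<integral>t. norm (f t) \<partial>MI"
  have i: "integrable MI (\<lambda>t. norm (f t))" by (rule L2f_norm_integrable[OF assms])
  have "0 \<le> (\<integral>t. (norm (f t) - ?a)\<^sup>2 \<partial>MI)" by simp
  also have "\<dots> = (\<integral>t. (norm (f t))\<^sup>2 - 2 * ?a * norm (f t) + ?a\<^sup>2 \<partial>MI)"
    by (simp add: power2_diff algebra_simps)
  also have "\<dots> = (n2 f)\<^sup>2 - 2 * ?a * ?a + ?a\<^sup>2"
    using L2f_sq[OF assms] i by (simp add: n2_sq)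
  finally show "?a\<^sup>2 \<le> (n2 f)\<^sup>2" by (simp add: power2_eq_square)
qed simp

text \<open>The right-hand side is the integrand of the action minus half its derivative in the
  direction away from the constant loop \<open>p\<close>, a combination free of the indefinite
  quadratic part. Its linear growth replaces a nonresonance condition at infinity.\<close>

locale ham_coercive = ham +
  fixes p :: pv and cc C :: real
  assumes p: "p \<in> L0 l" and cc: "0 < cc"
    and coercive: "z \<in> Ps l \<Longrightarrow> cc * norm z - C \<le> inner (gr z) (z - p) / 2 - G z"
begin

text \<open>The quadratic part is homogeneous of degree two and does not see constants, so it
  cancels.\<close>

lemma Phi_minus_half:
  assumes x: "x \<in> Es l"
  shows "cc * (\<integral>t. norm (lp l x t) \<partial>MI) - C \<le> Phi l G x - inner (gradP l gr x) (x - cst l p) / 2"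
proof -
  let ?u = "x - cst l p"
  have u: "?u \<in> Es l" by (intro Es_diff x cst_Es)
  have "inner (Pp x - Pm x) ?u = 2 * Act x"
    using inner_P_self(1)[of x ?u] inner_P_self(2)[of x ?u]
    by (simp add: inner_diff_left P_diff Act_def power2_norm_eq_inner)
  moreover have "inner (Wg l gr x) ?u = (\<integral>t. inner (gr (lp l x t)) (lp l x t - p) \<partial>MI)"
    unfolding Wg_def inner_Jst[OF L2f_gr[OF L2f_lp] u]
  proof (rule integral_cong_AE)
    have p': "L2f l (\<lambda>t. p)" using p by (intro L2f_cont) (auto simp: L0_def)
    show "(\<lambda>t. inner (gr (lp l x t)) (lp l x t - p)) \<in> borel_measurable MI"
      by (intro borel_measurable_integrable L2f_inner_integrable[where l = l] L2f_gr L2f_diff L2f_lp p')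
    show "(\<lambda>t. inner (gr (lp l x t)) (lp l ?u t)) \<in> borel_measurable MI"
      by (intro borel_measurable_integrable L2f_inner_integrable[where l = l] L2f_gr L2f_lp)
    show "AE t in MI. inner (gr (lp l x t)) (lp l ?u t) = inner (gr (lp l x t)) (lp l x t - p)"
      using lp_diff[of l x "cst l p"] lp_cst[OF p] by eventually_elim simp
  qed
  ultimately have "Phi l G x - inner (gradP l gr x) ?u / 2
      = (\<integral>t. inner (gr (lp l x t)) (lp l x t - p) \<partial>MI) / 2 - IG l G x"
    by (simp add: Phi_def gradP_def inner_diff_left diff_divide_distrib)
  also have "\<dots> = (\<integral>t. inner (gr (lp l x t)) (lp l x t - p) / 2 - G (lp l x t) \<partial>MI)"
  proof -
    have p': "L2f l (\<lambda>t. p)" using p by (intro L2f_cont) (auto simp: L0_def)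
    have "integrable MI (\<lambda>t. inner (gr (lp l x t)) (lp l x t - p))"
      by (intro L2f_inner_integrable[where l = l] L2f_gr L2f_diff L2f_lp p')
    then show ?thesis unfolding IG_def using G_integrable[OF L2f_lp] by simp
  qed
  also have "\<dots> \<ge> (\<integral>t. cc * norm (lp l x t) - C \<partial>MI)"
  proof (rule integral_mono)
    have p': "L2f l (\<lambda>t. p)" using p by (intro L2f_cont) (auto simp: L0_def)
    show "integrable MI (\<lambda>t. inner (gr (lp l x t)) (lp l x t - p) / 2 - G (lp l x t))"
      by (intro Bochner_Integration.integrable_diff integrable_divide L2f_inner_integrable[where l = l] L2f_gr L2f_diff L2f_lp p' G_integrable)
    show "integrable MI (\<lambda>t. cc * norm (lp l x t) - C)"
      by (intro Bochner_Integration.integrable_diff integrable_mult_right L2f_norm_integrable[where l = l] L2f_lp) simp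
  qed (rule coercive[OF lp_Ps])
  also have "(\<integral>t. cc * norm (lp l x t) - C \<partial>MI) = cc * (\<integral>t. norm (lp l x t) \<partial>MI) - C"
    using L2f_norm_integrable[OF L2f_lp, of l x] by simp
  finally show ?thesis .
qed

text \<open>For an unbounded sequence, the normalised families \<open>y\<close> have Hamiltonian
  gradients bounded in L^2, hence subconverge to a unit vector. By \<open>Phi_minus_half\<close> the
  L^1 norms of their loops tend to zero, so the limit has a vanishing loop, a contradiction.\<close>

lemma PS_bounded:
  "\<exists>R \<delta>. 0 < \<delta> \<and> (\<forall>x\<in>Es l. Phi l G x \<le> \<beta> \<longrightarrow> norm (gradP l gr x) < \<delta> \<longrightarrow> norm x \<le> R)"
proof (rule ccontr)
  assume neg: "\<not> ?thesis"
  have "\<exists>x\<in>Es l. Phi l G x \<le> \<beta> \<and> norm (gradP l gr x) < 1 / (real m + 1) \<and> real m + 1 < norm x" for m :: nat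
    using neg[simplified, rule_format, of "1 / (real m + 1)" "real m + 1"] by (auto simp: not_le)
  then obtain x where x: "\<And>m. x m \<in> Es l" "\<And>m. Phi l G (x m) \<le> \<beta>"
      "\<And>m. norm (gradP l gr (x m)) < 1 / (real m + 1)" "\<And>m :: nat. real m + 1 < norm (x m)"
    by metis
  define q where "q m = norm (x m)" for m
  have q: "real m + 1 < q m" "1 < q m" "0 < q m" for m
    using x(4)[of m] unfolding q_def by linarith+
  define y where "y m = (1 / q m) *\<^sub>R x m" for m
  have y: "y m \<in> Es l" "norm (y m) = 1" for m
    using x(1)[of m] q(3)[of m] x(4)[of m] by (auto simp: y_def Es_scaleR q_def)
  have iq: "(\<lambda>m. 1 / q m) \<longlonglongrightarrow> 0"
  proof (rule Lim_null_comparison)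
    have "norm (1 / q m) \<le> 1 / (real m + 1)" for m
      using q[of m] by (simp add: frac_le)
    then show "\<forall>\<^sub>F m in sequentially. norm (1 / q m) \<le> 1 / (real m + 1)" by simp
    show "(\<lambda>m. 1 / (real m + 1)) \<longlonglongrightarrow> 0"
      using LIMSEQ_inverse_real_of_nat by (simp add: inverse_eq_divide add.commute)
  qed
  define g where "g m t = (1 / q m) *\<^sub>R gr (lp l (x m) t)" for m t
  have gL: "L2f l (g m)" for m unfolding g_def by (intro L2f_scaleR L2f_gr L2f_lp)
  have gB: "n2 (g m) \<le> norm (gr 0) + Lc" for m
  proof -
    have "n2 (g m) = 1 / q m * n2 (\<lambda>t. gr (lp l (x m) t))" unfolding g_def n2_scaleR using q(3)[of m] by simp
    also have "\<dots> \<le> 1 / q m * (norm (gr 0) + Lc * q m)"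
      using q(3)[of m] n2_gr_lp[of "x m"] unfolding q_def by (intro mult_left_mono) auto
    also have "\<dots> = (1 / q m) * norm (gr 0) + Lc" using q(3)[of m] by (simp add: field_simps)
    also have "(1 / q m) * norm (gr 0) \<le> 1 * norm (gr 0)" using q(2)[of m] by (intro mult_right_mono) auto
    finally show ?thesis by simp
  qed
  obtain r k where r: "strict_mono r" "k \<in> Es l" "(\<lambda>m. Jst l (g (r m))) \<longlonglongrightarrow> k"
    using Jst_compact[of l g, OF gL gB] by blast
  have Jg: "Pp (y m) - Pm (y m) = (1 / q m) *\<^sub>R gradP l gr (x m) + Jst l (g m)" for m
    unfolding y_def g_def Jst_scaleR[OF L2f_gr[OF L2f_lp]] gradP_def Wg_def P_scaleR
    by (simp add: scaleR_diff_right)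
  have g0: "(\<lambda>m. (1 / q m) *\<^sub>R gradP l gr (x m)) \<longlonglongrightarrow> 0"
  proof (rule Lim_null_comparison[OF _ iq])
    have "norm ((1 / q m) *\<^sub>R gradP l gr (x m)) \<le> 1 / q m" for m
    proof -
      have "norm (gradP l gr (x m)) \<le> 1" using x(3)[of m] by (rule less_imp_le[THEN order_trans]) simp
      then have "(1 / q m) * norm (gradP l gr (x m)) \<le> (1 / q m) * 1" using q(3)[of m] by (intro mult_left_mono) auto
      then show ?thesis using q(3)[of m] by simp
    qed
    then show "\<forall>\<^sub>F m in sequentially. norm ((1 / q m) *\<^sub>R gradP l gr (x m)) \<le> 1 / q m" by simp
  qed
  have "(\<lambda>m. Pp (y (r m)) - Pm (y (r m))) \<longlonglongrightarrow> 0 + k"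
    unfolding Jg using LIMSEQ_subseq_LIMSEQ[OF g0 r(1)] r(3) by (intro tendsto_add) (simp_all add: o_def)
  then obtain r' z where r': "strict_mono r'" "z \<in> Es l" "(\<lambda>m. y (r (r' m))) \<longlonglongrightarrow> z"
    using Es_subseq[of "\<lambda>m. y (r m)" l 1 "0 + k"] y by auto
  define s where "s m = r (r' m)" for m
  have s: "strict_mono s" unfolding s_def using r(1) r'(1) by (simp add: strict_mono_def)
  have yz: "(\<lambda>m. y (s m)) \<longlonglongrightarrow> z" using r'(3) by (simp add: s_def)
  have "norm z = 1" using LIMSEQ_unique[OF tendsto_norm[OF yz], of 1] y(2) by simp
  define I where "I w = (\<integral>t. norm (lp l w t) \<partial>MI)" for w
  \<comment> \<open>Division by \<open>q m\<close> makes the level and the constant \<open>C\<close>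
    negligible; the gradient term grows like \<open>q m\<close> but carries the factor
    \<open>1 / (real m + 1)\<close>.\<close>
  have Iy: "cc * I (y m) \<le> (C + \<beta>) / q m + (1 / (real m + 1)) * (1 + norm (cst l p)) / 2" for m
  proof -
    let ?e = "1 / (real m + 1)" and ?c = "norm (cst l p)"
    have 1: "cc * I (x m) - C \<le> \<beta> - inner (gradP l gr (x m)) (x m - cst l p) / 2"
      using Phi_minus_half[OF x(1)[of m]] x(2)[of m] unfolding I_def by linarith
    have "- inner (gradP l gr (x m)) (x m - cst l p) \<le> norm (gradP l gr (x m)) * norm (x m - cst l p)"
      using Cauchy_Schwarz_ineq2[of "gradP l gr (x m)" "x m - cst l p"] by simp
    also have "\<dots> \<le> ?e * (q m + ?c)"
      using x(3)[of m] norm_triangle_ineq4[of "x m" "cst l p"] unfolding q_def by (intro mult_mono) auto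
    also have "\<dots> \<le> ?e * (q m * (1 + ?c))"
    proof (intro mult_left_mono)
      have "1 * ?c \<le> q m * ?c" using q(2)[of m] by (intro mult_right_mono) auto
      then show "q m + ?c \<le> q m * (1 + ?c)" by (simp add: algebra_simps)
    qed simp
    finally have 2: "- inner (gradP l gr (x m)) (x m - cst l p) \<le> ?e * (q m * (1 + ?c))" .
    have gen: "a \<le> C + b + k / 2" if "a - C \<le> b - i / 2" "- i \<le> k" for a b i k :: real
      using that by linarith
    have 1: "cc * I (x m) \<le> C + \<beta> + (?e * (q m * (1 + ?c))) / 2" by (rule gen[OF 1 2])
    have "I (y m) = I (x m) / q m"
    proof -
      have "I (y m) = (\<integral>t. norm ((1 / q m) *\<^sub>R lp l (x m) t) \<partial>MI)"
        unfolding I_def y_def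
      proof (rule integral_cong_AE)
        show "(\<lambda>t. norm (lp l ((1 / q m) *\<^sub>R x m) t)) \<in> borel_measurable MI"
          by (rule borel_measurable_integrable[OF L2f_norm_integrable[OF L2f_lp]])
        show "(\<lambda>t. norm ((1 / q m) *\<^sub>R lp l (x m) t)) \<in> borel_measurable MI"
          by (rule borel_measurable_integrable[OF L2f_norm_integrable[OF L2f_scaleR[OF L2f_lp]]])
        show "AE t in MI. norm (lp l ((1 / q m) *\<^sub>R x m) t) = norm ((1 / q m) *\<^sub>R lp l (x m) t)"
          using lp_scaleR[of l "1 / q m" "x m"] by eventually_elim simp
      qed
      then show ?thesis using q(3)[of m] by (simp add: I_def)
    qed
    then have "cc * I (y m) = cc * I (x m) / q m" by simp
    also have "\<dots> \<le> (C + \<beta> + (1 / (real m + 1)) * (q m * (1 + norm (cst l p))) / 2) / q m"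
      using 1 q(3)[of m] by (intro divide_right_mono) auto
    also have "\<dots> = (C + \<beta>) / q m + (1 / (real m + 1)) * (1 + norm (cst l p)) / 2"
      using q(3)[of m] by (simp add: add_divide_distrib)
    finally show ?thesis .
  qed
  have "(\<lambda>m. (C + \<beta>) / q m + (1 / (real m + 1)) * (1 + norm (cst l p)) / 2) \<longlonglongrightarrow> 0"
  proof -
    have 1: "(\<lambda>m. 1 / (real m + 1)) \<longlonglongrightarrow> 0"
      using LIMSEQ_inverse_real_of_nat by (simp add: inverse_eq_divide add.commute)
    have "(\<lambda>m. (C + \<beta>) * (1 / q m) + (1 / (real m + 1)) * (1 + norm (cst l p)) / 2) \<longlonglongrightarrow> (C + \<beta>) * 0 + 0 * (1 + norm (cst l p)) / 2"
      by (intro tendsto_intros iq 1) simp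
    then show ?thesis by simp
  qed
  from LIMSEQ_subseq_LIMSEQ[OF this s]
  have b0: "(\<lambda>m. (C + \<beta>) / q (s m) + (1 / (real (s m) + 1)) * (1 + norm (cst l p)) / 2) \<longlonglongrightarrow> 0" by (simp add: o_def)
  have Iz: "cc * I z \<le> ((C + \<beta>) / q (s m) + (1 / (real (s m) + 1)) * (1 + norm (cst l p)) / 2) + cc * norm (z - y (s m))" for m
  proof -
    have "I z \<le> (\<integral>t. norm (lp l (y (s m)) t) + norm (lp l (z - y (s m)) t) \<partial>MI)"
      unfolding I_def
    proof (rule integral_mono_AE)
      show "integrable MI (\<lambda>t. norm (lp l (y (s m)) t) + norm (lp l (z - y (s m)) t))"
        by (intro Bochner_Integration.integrable_add L2f_norm_integrable[where l = l] L2f_lp)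
      show "AE t in MI. norm (lp l z t) \<le> norm (lp l (y (s m)) t) + norm (lp l (z - y (s m)) t)"
        using lp_add[of l "y (s m)" "z - y (s m)"] by eventually_elim (simp add: norm_triangle_ineq)
    qed (rule L2f_norm_integrable[OF L2f_lp])
    also have "\<dots> = I (y (s m)) + (\<integral>t. norm (lp l (z - y (s m)) t) \<partial>MI)"
      unfolding I_def by (intro Bochner_Integration.integral_add L2f_norm_integrable[where l = l] L2f_lp)
    also have "(\<integral>t. norm (lp l (z - y (s m)) t) \<partial>MI) \<le> norm (z - y (s m))"
      using L2f_norm_integral_le[OF L2f_lp] n2_lp_le order_trans by blast
    finally have "cc * I z \<le> cc * (I (y (s m)) + norm (z - y (s m)))" using cc by (intro mult_left_mono) auto
    then show ?thesis using Iy[of "s m"] by (simp add: algebra_simps)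
  qed
  have "(\<lambda>m. ((C + \<beta>) / q (s m) + (1 / (real (s m) + 1)) * (1 + norm (cst l p)) / 2) + cc * norm (z - y (s m)))
      \<longlonglongrightarrow> 0 + cc * norm (z - z)"
    by (intro tendsto_add[OF b0] tendsto_intros yz)
  then have "cc * I z \<le> 0 + cc * norm (z - z)" by (rule LIMSEQ_le_const) (use Iz in blast)
  then have "I z \<le> 0" using cc by (simp add: mult_le_0_iff)
  then have "(\<integral>t. norm (lp l z t) \<partial>MI) = 0" unfolding I_def by (simp add: antisym)
  then have "AE t in MI. norm (lp l z t) = 0"
    by (subst (asm) integral_nonneg_eq_0_iff_AE[OF L2f_norm_integrable[OF L2f_lp]]) auto
  then have "z = 0" using lp_eq_0_imp[OF r'(2)] by simp
  with \<open>norm z = 1\<close> show False by simp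
qed

text \<open>Almost critical points at levels between \<open>\<alpha>\<close> and
  \<open>\<beta>\<close> are bounded, hence subconverge, and the limit would be an excluded critical
  point.\<close>

lemma PS_gap:
  assumes nocrit: "\<And>x. x \<in> Es l \<Longrightarrow> gradP l gr x = 0 \<Longrightarrow> \<not> (\<alpha> \<le> Phi l G x \<and> Phi l G x \<le> \<beta>)"
  shows "\<exists>\<delta>>0. \<forall>x\<in>Es l. \<alpha> \<le> Phi l G x \<longrightarrow> Phi l G x \<le> \<beta> \<longrightarrow> \<delta> \<le> norm (gradP l gr x)"
proof (rule ccontr)
  assume neg: "\<not> ?thesis"
  obtain R \<delta> where R: "0 < \<delta>" "\<And>x. x \<in> Es l \<Longrightarrow> Phi l G x \<le> \<beta> \<Longrightarrow> norm (gradP l gr x) < \<delta> \<Longrightarrow> norm x \<le> R"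
    using PS_bounded[of \<beta>] by blast
  have "\<exists>x\<in>Es l. \<alpha> \<le> Phi l G x \<and> Phi l G x \<le> \<beta> \<and> norm (gradP l gr x) < \<delta> / (real m + 1)" for m :: nat
    using neg[simplified, rule_format, of "\<delta> / (real m + 1)"] R(1) by (auto simp: not_le)
  then obtain x where x: "\<And>m. x m \<in> Es l" "\<And>m. \<alpha> \<le> Phi l G (x m)" "\<And>m. Phi l G (x m) \<le> \<beta>"
      "\<And>m :: nat. norm (gradP l gr (x m)) < \<delta> / (real m + 1)" by metis
  have lt: "norm (gradP l gr (x m)) < \<delta>" for m
  proof -
    have "\<delta> / (real m + 1) \<le> \<delta> / 1" using R(1) by (intro divide_left_mono) auto
    then show ?thesis using x(4)[of m] by simp
  qed
  have xR: "norm (x m) \<le> R" for m by (rule R(2)[OF x(1) x(3) lt])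
  have gB: "n2 (\<lambda>t. gr (lp l (x m) t)) \<le> norm (gr 0) + Lc * R" for m
    using n2_gr_lp[of "x m"] mult_left_mono[OF xR[of m], of Lc] Lc1 by linarith
  obtain r k where r: "strict_mono r" "k \<in> Es l" "(\<lambda>m. Jst l (\<lambda>t. gr (lp l (x (r m)) t))) \<longlonglongrightarrow> k"
    using Jst_compact[of l "\<lambda>m t. gr (lp l (x m) t)", OF L2f_gr[OF L2f_lp] gB] by blast
  have g0: "(\<lambda>m. gradP l gr (x m)) \<longlonglongrightarrow> 0"
  proof (rule Lim_null_comparison)
    show "\<forall>\<^sub>F m in sequentially. norm (gradP l gr (x m)) \<le> \<delta> * (1 / (real m + 1))"
      using x(4) by (intro always_eventually allI less_imp_le) simp
    have "(\<lambda>m. 1 / (real m + 1)) \<longlonglongrightarrow> 0"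
      using LIMSEQ_inverse_real_of_nat by (simp add: inverse_eq_divide add.commute)
    from tendsto_mult_left[OF this, of \<delta>] show "(\<lambda>m. \<delta> * (1 / (real m + 1))) \<longlonglongrightarrow> 0" by simp
  qed
  have "Pp (x m) - Pm (x m) = gradP l gr (x m) + Jst l (\<lambda>t. gr (lp l (x m) t))" for m
    by (simp add: gradP_def Wg_def)
  then have "(\<lambda>m. Pp (x (r m)) - Pm (x (r m))) \<longlonglongrightarrow> 0 + k"
    using LIMSEQ_subseq_LIMSEQ[OF g0 r(1)] r(3) by (simp only:) (intro tendsto_add; simp add: o_def)
  then obtain r' y where r': "strict_mono r'" "y \<in> Es l" "(\<lambda>m. x (r (r' m))) \<longlonglongrightarrow> y"
    using Es_subseq[of "\<lambda>m. x (r m)" l R "0 + k"] x(1) xR by auto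
  have s: "strict_mono (\<lambda>m. r (r' m))" using r(1) r'(1) by (simp add: strict_mono_def)
  have "gradP l gr y = 0"
    using LIMSEQ_unique[OF gradP_tendsto[OF r'(3)] LIMSEQ_subseq_LIMSEQ[OF g0 s, unfolded o_def]] .
  moreover have lim: "(\<lambda>m. Phi l G (x (r (r' m)))) \<longlonglongrightarrow> Phi l G y"
    by (intro Phi_tendsto r' x)
  have "\<alpha> \<le> Phi l G y" by (rule LIMSEQ_le_const[OF lim]) (use x(2) in blast)
  moreover have "Phi l G y \<le> \<beta>" by (rule LIMSEQ_le_const2[OF lim]) (use x(3) in blast)
  ultimately show False using nocrit[OF r'(2)] by blast
qed

end

section \<open>Continuous functions orthogonal to all characters\<close>

text \<open>Each factor of the kernel is converted by the product formula for cosines into frequency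
  shifts by one and a change of phase; therefore frequency and phase are left arbitrary in the
  induction.\<close>

lemma trig_kernel_orthogonal:
  assumes d: "continuous_on {0..1} d"
    and c: "\<And>n :: nat. (\<integral>t. d t * cos (2 * pi * real n * t) \<partial>MI) = 0"
    and s: "\<And>n :: nat. (\<integral>t. d t * sin (2 * pi * real n * t) \<partial>MI) = 0"
  shows "(\<integral>t. d t * ((1 + cos (2 * pi * (t - s0))) / 2) ^ m * cos (2 * pi * real_of_int n * t + \<phi>) \<partial>MI) = 0"
proof (induction m arbitrary: n \<phi>)
  case 0
  have c': "(\<integral>t. d t * cos (2 * pi * real_of_int n * t) \<partial>MI) = 0"
    using c[of "nat \<bar>n\<bar>"] by (cases "0 \<le> n") (simp_all)
  have s': "(\<integral>t. d t * sin (2 * pi * real_of_int n * t) \<partial>MI) = 0"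
    using s[of "nat \<bar>n\<bar>"] by (cases "0 \<le> n") (simp_all)
  have "(\<integral>t. d t * cos (2 * pi * real_of_int n * t + \<phi>) \<partial>MI)
     = (\<integral>t. cos \<phi> * (d t * cos (2 * pi * real_of_int n * t)) - sin \<phi> * (d t * sin (2 * pi * real_of_int n * t)) \<partial>MI)"
    by (simp add: cos_add algebra_simps)
  also have "\<dots> = 0"
    by (subst Bochner_Integration.integral_diff)
      (auto simp: c' s' intro!: integrable_MI_cont continuous_intros d)
  finally show ?case by simp
next
  case (Suc m)
  let ?K = "\<lambda>t. ((1 + cos (2 * pi * (t - s0))) / 2) ^ m"
  have e: "d t * ((1 + cos (2 * pi * (t - s0))) / 2) ^ Suc m * cos (2 * pi * real_of_int n * t + \<phi>)
     = (d t * ?K t * cos (2 * pi * real_of_int n * t + \<phi>)) / 2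
       + (d t * ?K t * cos (2 * pi * real_of_int (n + 1) * t + (\<phi> - 2 * pi * s0))) / 4
       + (d t * ?K t * cos (2 * pi * real_of_int (n - 1) * t + (\<phi> + 2 * pi * s0))) / 4" for t
  proof -
    let ?a = "2 * pi * real_of_int n * t + \<phi>" and ?b = "2 * pi * (t - s0)"
    have "cos ?b * cos ?a = (cos (?a + ?b) + cos (?a - ?b)) / 2"
      by (simp add: cos_add cos_diff)
    moreover have "?a + ?b = 2 * pi * real_of_int (n + 1) * t + (\<phi> - 2 * pi * s0)"
      by (simp add: algebra_simps)
    moreover have "?a - ?b = 2 * pi * real_of_int (n - 1) * t + (\<phi> + 2 * pi * s0)"
      by (simp add: algebra_simps)
    ultimately have 1: "cos ?b * cos ?a = (cos (2 * pi * real_of_int (n + 1) * t + (\<phi> - 2 * pi * s0))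
        + cos (2 * pi * real_of_int (n - 1) * t + (\<phi> + 2 * pi * s0))) / 2" by simp
    have "d t * ((1 + cos ?b) / 2) ^ Suc m * cos ?a = d t * ?K t * (cos ?a + cos ?b * cos ?a) / 2"
      by (simp add: algebra_simps)
    then show ?thesis unfolding 1 by (simp add: field_simps)
  qed
  have i: "integrable MI (\<lambda>t. d t * ?K t * cos (2 * pi * real_of_int k * t + \<psi>) / r)" for k \<psi> r
    by (intro integrable_divide integrable_MI_cont continuous_intros d) simp
  have z: "(\<integral>t. d t * ?K t * cos (2 * pi * real_of_int k * t + \<psi>) / r \<partial>MI) = 0" for k \<psi> r
    using Suc.IH[of k \<psi>] by simp
  show ?case
    unfolding e Bochner_Integration.integral_add[OF Bochner_Integration.integrable_add[OF i i] i]
      Bochner_Integration.integral_add[OF i i] z by simp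
qed

lemma half_cos_nonneg: "0 \<le> (1 + cos x) / (2 :: real)"
proof -
  have "0 \<le> (1 + c) / 2" if "-1 \<le> c" for c :: real using that by simp
  then show ?thesis using cos_ge_minus_one by blast
qed

text \<open>High powers of the kernel concentrate at \<open>s0\<close>. If \<open>d s0\<close> were
  positive, the contribution near \<open>s0\<close> would outweigh all the rest, against
  orthogonality.\<close>

lemma Fourier_zero_aux:
  assumes d: "continuous_on {0..1} d"
    and c: "\<And>n :: nat. (\<integral>t. d t * cos (2 * pi * real n * t) \<partial>MI) = 0"
    and s: "\<And>n :: nat. (\<integral>t. d t * sin (2 * pi * real n * t) \<partial>MI) = 0"
    and s0: "0 < s0" "s0 < 1"
  shows "d s0 \<le> 0"
proof (rule ccontr)
  assume "\<not> d s0 \<le> 0"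
  then have pos: "0 < d s0" by simp
  have "isCont d s0"
    using continuous_on_interior[OF d, of s0] s0 by (simp add: interior_atLeastAtMost_real)
  then obtain \<eta>0 where \<eta>0: "0 < \<eta>0" "\<And>t. \<bar>t - s0\<bar> < \<eta>0 \<Longrightarrow> \<bar>d t - d s0\<bar> < d s0 / 2"
    unfolding continuous_at_real_range using pos by (metis half_gt_zero real_norm_def)
  \<comment> \<open>Below the distance of \<open>s0\<close> to both ends, so that the kernel, of
    period one, has no second peak in [0,1].\<close>
  define \<eta> where "\<eta> = min (\<eta>0) (min s0 (1 - s0)) / 2"
  have \<eta>: "0 < \<eta>" "\<eta> < \<eta>0" "\<eta> < s0" "\<eta> < 1 - s0" "\<eta> < 1 / 2"
    using \<eta>0(1) s0 by (auto simp: \<eta>_def min_def)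
  define C where "C = d s0 / 2"
  have C: "0 < C" "C \<le> d t" if "\<bar>t - s0\<bar> \<le> \<eta>" for t
  proof -
    show "0 < C" using pos by (simp add: C_def)
    have "\<bar>d t - d s0\<bar> < d s0 / 2" using \<eta>0(2)[of t] that \<eta>(2) by linarith
    then show "C \<le> d t" unfolding C_def by linarith
  qed
  have C0: "0 < C" using pos by (simp add: C_def)
  have "compact (d ` {0..1})" using d by (intro compact_continuous_image) auto
  then obtain D where D: "\<And>t. t \<in> {0..1} \<Longrightarrow> \<bar>d t\<bar> \<le> D"
    using compact_imp_bounded bounded_iff by (metis imageI real_norm_def)
  have D0: "0 \<le> D" using D[of 0] by simp
  define K where "K t = (1 + cos (2 * pi * (t - s0))) / 2" for t
  \<comment> \<open>\<open>r1\<close> bounds the kernel from below within \<open>\<eta> / 2\<close>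
    of \<open>s0\<close>, and \<open>r2\<close> bounds it from above at distance at least
    \<open>\<eta>\<close>; the powers separate because \<open>r2 < r1\<close>.\<close>
  define r1 where "r1 = (1 + cos (pi * \<eta>)) / 2"
  define r2 where "r2 = (1 + cos (2 * pi * \<eta>)) / 2"
  have "cos (2 * pi * \<eta>) < cos (pi * \<eta>)"
    using \<eta> by (intro cos_monotone_0_pi) auto
  then have r: "r2 < r1" by (simp add: r1_def r2_def)
  have r2: "0 \<le> r2" unfolding r2_def by (rule half_cos_nonneg)
  have r1: "0 < r1" using r r2 by simp
  have K0: "0 \<le> K t" for t unfolding K_def by (rule half_cos_nonneg)
  have abs: "cos (2 * pi * (t - s0)) = cos (2 * pi * \<bar>t - s0\<bar>)" for t
    using cos_abs_real[of "2 * pi * (t - s0)"] by (simp add: abs_mult)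
  have K1: "r1 \<le> K t" if "\<bar>t - s0\<bar> \<le> \<eta> / 2" for t
  proof -
    have "cos (pi * \<eta>) \<le> cos (2 * pi * \<bar>t - s0\<bar>)"
      using that \<eta> by (intro cos_monotone_0_pi_le) auto
    then show ?thesis by (simp add: K_def r1_def abs)
  qed
  have K2: "K t \<le> r2" if "\<eta> \<le> \<bar>t - s0\<bar>" "t \<in> {0..1}" for t
  proof -
    have le: "\<bar>t - s0\<bar> \<le> 1 - \<eta>" using that(2) \<eta> by auto
    have "cos (2 * pi * \<bar>t - s0\<bar>) \<le> cos (2 * pi * \<eta>)"
    proof (cases "\<bar>t - s0\<bar> \<le> 1 / 2")
      case True
      then show ?thesis using that(1) \<eta> by (intro cos_monotone_0_pi_le) auto
    next
      case False
      have "cos (2 * pi * \<bar>t - s0\<bar>) = cos (2 * pi * (1 - \<bar>t - s0\<bar>))"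
        by (simp add: right_diff_distrib cos_diff)
      also have "\<dots> \<le> cos (2 * pi * \<eta>)" using False le \<eta> by (intro cos_monotone_0_pi_le) auto
      finally show ?thesis .
    qed
    then show ?thesis by (simp add: K_def r2_def abs)
  qed
  have "(\<lambda>m. D * (r2 / r1) ^ m) \<longlonglongrightarrow> D * 0"
    using r r1 r2 by (intro tendsto_intros LIMSEQ_realpow_zero) auto
  then have "\<forall>\<^sub>F m in sequentially. D * (r2 / r1) ^ m < C * \<eta>"
    using C0 \<eta>(1) by (intro order_tendstoD(2)) auto
  then obtain m where m: "D * (r2 / r1) ^ m < C * \<eta>" by (auto simp: eventually_sequentially)
  then have m': "D * r2 ^ m < C * \<eta> * r1 ^ m"
    using r1 by (simp add: power_divide pos_divide_less_eq)
  have "(\<integral>t. d t * K t ^ m \<partial>MI) = 0"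
    using trig_kernel_orthogonal[OF d c s, of s0 m 0 0] by (simp add: K_def)
  moreover have i: "integrable MI (\<lambda>t. indicator {s0 - \<eta> / 2..s0 + \<eta> / 2} t :: real)"
    by (rule integrable_MI_bounded[of _ 1]) (auto simp: indicator_def intro: measurable_MI)
  moreover have "(\<integral>t. indicator {s0 - \<eta> / 2..s0 + \<eta> / 2} t * (C * r1 ^ m) - D * r2 ^ m \<partial>MI) \<le> (\<integral>t. d t * K t ^ m \<partial>MI)"
  proof (rule integral_mono)
    show "integrable MI (\<lambda>t. indicator {s0 - \<eta> / 2..s0 + \<eta> / 2} t * (C * r1 ^ m) - D * r2 ^ m)"
      by (intro Bochner_Integration.integrable_diff integrable_mult_left i) simp
    show "integrable MI (\<lambda>t. d t * K t ^ m)"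
      unfolding K_def by (intro integrable_MI_cont continuous_intros d) simp
    fix t assume "t \<in> space MI"
    then have t: "t \<in> {0..1}" by simp
    have p2: "0 \<le> D * r2 ^ m" using D0 r2 by simp
    consider "\<bar>t - s0\<bar> \<le> \<eta> / 2" | "\<eta> / 2 < \<bar>t - s0\<bar>" "\<bar>t - s0\<bar> < \<eta>" | "\<eta> \<le> \<bar>t - s0\<bar>" by linarith
    then show "indicator {s0 - \<eta> / 2..s0 + \<eta> / 2} t * (C * r1 ^ m) - D * r2 ^ m \<le> d t * K t ^ m"
    proof cases
      case 1
      then have "C * r1 ^ m \<le> d t * K t ^ m"
        using C0 C(2)[of t] \<eta>(1) r1 K1[OF 1] by (intro mult_mono power_mono) auto
      moreover have "t \<in> {s0 - \<eta> / 2..s0 + \<eta> / 2}" using 1 unfolding atLeastAtMost_iff by linarith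
      ultimately show ?thesis using p2 by simp
    next
      case 2
      have "0 \<le> d t * K t ^ m" using C0 C(2)[of t] 2 K0[of t] by simp
      moreover have "t \<notin> {s0 - \<eta> / 2..s0 + \<eta> / 2}" using 2 unfolding atLeastAtMost_iff by linarith
      ultimately show ?thesis using p2 by simp
    next
      case 3
      have "\<bar>d t * K t ^ m\<bar> \<le> D * r2 ^ m"
        unfolding abs_mult using D[OF t] K0[of t] K2[OF 3 t] D0 by (intro mult_mono) (auto simp: power_mono)
      moreover have "t \<notin> {s0 - \<eta> / 2..s0 + \<eta> / 2}" using 3 \<eta>(1) unfolding atLeastAtMost_iff by linarith
      ultimately show ?thesis by simp
    qed
  qed
  moreover have "(\<integral>t. indicator {s0 - \<eta> / 2..s0 + \<eta> / 2} t * (C * r1 ^ m) - D * r2 ^ m \<partial>MI) = \<eta> * (C * r1 ^ m) - D * r2 ^ m"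
  proof -
    have "(\<integral>t. (indicator {s0 - \<eta> / 2..s0 + \<eta> / 2} t :: real) \<partial>MI) = (\<integral>t. indicator {s0 - \<eta> / 2..s0 + \<eta> / 2} t \<partial>lborel)"
      unfolding integral_MI set_lebesgue_integral_def
      by (rule Bochner_Integration.integral_cong) (use \<eta> in \<open>auto simp: indicator_def\<close>)
    also have "\<dots> = \<eta>" using \<eta>(1) by simp
    finally have 1: "(\<integral>t. (indicator {s0 - \<eta> / 2..s0 + \<eta> / 2} t :: real) \<partial>MI) = \<eta>" .
    show ?thesis
    proof -
      have "(\<integral>t. indicator {s0 - \<eta> / 2..s0 + \<eta> / 2} t * (C * r1 ^ m) - D * r2 ^ m \<partial>MI)
          = (\<integral>t. indicator {s0 - \<eta> / 2..s0 + \<eta> / 2} t * (C * r1 ^ m) \<partial>MI) - (\<integral>t. D * r2 ^ m \<partial>MI)"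
        by (rule Bochner_Integration.integral_diff) (intro integrable_mult_left i, simp)
      also have "(\<integral>t. indicator {s0 - \<eta> / 2..s0 + \<eta> / 2} t * (C * r1 ^ m) \<partial>MI) = \<eta> * (C * r1 ^ m)"
        unfolding integral_mult_left_zero 1 ..
      finally show ?thesis by (simp only: integral_MI_const)
    qed
  qed
  ultimately have "\<eta> * (C * r1 ^ m) - D * r2 ^ m \<le> 0" by (simp only:)
  moreover have "C * \<eta> * r1 ^ m = \<eta> * (C * r1 ^ m)" by (simp only: ac_simps)
  ultimately show False using m' by linarith
qed

lemma Fourier_zero:
  assumes d: "continuous_on {0..1} d"
    and c: "\<And>n :: nat. (\<integral>t. d t * cos (2 * pi * real n * t) \<partial>MI) = 0"
    and s: "\<And>n :: nat. (\<integral>t. d t * sin (2 * pi * real n * t) \<partial>MI) = 0"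
    and t: "t \<in> {0..1}"
  shows "d t = 0"
proof -
  have "d t = 0" if "0 < t" "t < 1" for t
  proof (rule antisym)
    show "d t \<le> 0" by (rule Fourier_zero_aux[OF d c s that])
    have "continuous_on {0..1} (\<lambda>t. - d t)" by (intro continuous_intros d)
    from Fourier_zero_aux[OF this _ _ that] show "0 \<le> d t" using c s by simp
  qed
  then have "d ` {0<..<1} \<subseteq> {0}" by auto
  moreover have "closure {0<..<1 :: real} = {0..1}" by simp
  ultimately have "d ` {0..1} \<subseteq> {0}"
    using image_closure_subset[of "{0<..<1}" d "{0}"] d by simp
  with imageI[OF t, of d] show ?thesis by blast
qed

text \<open>By integration by parts, \<open>u\<close> and the primitive \<open>I\<close> of
  \<open>v\<close> have the same nonconstant Fourier coefficients, so they differ by a constant.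
  Zero mean of \<open>v\<close> makes \<open>I\<close> vanish at both ends, which removes the
  boundary terms.\<close>

lemma Fourier_primitive:
  assumes u: "continuous_on {0..1} u" and v: "continuous_on {0..1} (v :: real \<Rightarrow> real)"
    and v0: "(\<integral>t. v t \<partial>MI) = 0"
    and c: "\<And>n :: nat. 0 < n \<Longrightarrow> (2 * pi * real n) * (\<integral>t. u t * cos (2 * pi * real n * t) \<partial>MI) = - (\<integral>t. v t * sin (2 * pi * real n * t) \<partial>MI)"
    and s: "\<And>n :: nat. 0 < n \<Longrightarrow> (2 * pi * real n) * (\<integral>t. u t * sin (2 * pi * real n * t) \<partial>MI) = (\<integral>t. v t * cos (2 * pi * real n * t) \<partial>MI)"
    and t: "t \<in> {0..1}"
  shows "(u has_vector_derivative v t) (at t within {0..1})"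
proof -
  define I where "I t = integral {0..t} v" for t
  have I': "(I has_vector_derivative v t) (at t within {0..1})" if "t \<in> {0..1}" for t
    unfolding I_def using integral_has_vector_derivative[OF v that] .
  have Ic: "continuous_on {0..1} I"
    using I' by (intro continuous_on_vector_derivative)
  have FTC: "(\<integral>t. f t \<partial>MI) = F 1 - F 0"
    if "\<And>t. t \<in> {0..1} \<Longrightarrow> (F has_vector_derivative f t) (at t within {0..1})" "continuous_on {0..1} f" for f F :: "real \<Rightarrow> real"
    unfolding integral_MI set_lebesgue_integral_def
    by (rule integral_FTC_Icc) (use that in auto)
  have I0: "I 0 = 0" by (simp add: I_def)
  have I1: "I 1 = 0" using FTC[OF I' v] v0 I0 by simp
  define d0 where "d0 t = u t - I t" for t
  define k where "k = (\<integral>t. d0 t \<partial>MI)"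
  have dc: "continuous_on {0..1} d0" unfolding d0_def by (intro continuous_intros u Ic)
  have dcos: "(\<integral>t. d0 t * cos (2 * pi * real n * t) \<partial>MI) = 0" if n: "0 < n" for n :: nat
  proof -
    let ?a = "2 * pi * real n"
    have a: "?a \<noteq> 0" using n by simp
    have "(\<integral>t. v t * sin (?a * t) + ?a * (I t * cos (?a * t)) \<partial>MI) = I 1 * sin (?a * 1) - I 0 * sin (?a * 0)"
    proof (rule FTC)
      fix t :: real assume t: "t \<in> {0..1}"
      have "((\<lambda>t. sin (?a * t)) has_vector_derivative ?a * cos (?a * t)) (at t within {0..1})"
        unfolding has_real_derivative_iff_has_vector_derivative[symmetric]
        by (auto intro!: derivative_eq_intros)
      from has_vector_derivative_mult[OF I'[OF t] this]
      show "((\<lambda>t. I t * sin (?a * t)) has_vector_derivative v t * sin (?a * t) + ?a * (I t * cos (?a * t))) (at t within {0..1})"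
        by (simp add: algebra_simps)
    qed (intro continuous_intros v Ic)
    also have "\<dots> = 0" by (simp add: I0 I1)
    also have "(\<integral>t. v t * sin (?a * t) + ?a * (I t * cos (?a * t)) \<partial>MI)
        = (\<integral>t. v t * sin (?a * t) \<partial>MI) + ?a * (\<integral>t. I t * cos (?a * t) \<partial>MI)"
      by (subst Bochner_Integration.integral_add) (auto intro!: integrable_MI_cont continuous_intros v Ic)
    finally have "?a * (\<integral>t. u t * cos (?a * t) \<partial>MI) = ?a * (\<integral>t. I t * cos (?a * t) \<partial>MI)"
      using c[OF n] by simp
    then have "(\<integral>t. u t * cos (?a * t) \<partial>MI) = (\<integral>t. I t * cos (?a * t) \<partial>MI)" using a by simp
    moreover have "(\<integral>t. d0 t * cos (?a * t) \<partial>MI) = (\<integral>t. u t * cos (?a * t) \<partial>MI) - (\<integral>t. I t * cos (?a * t) \<partial>MI)"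
      unfolding d0_def left_diff_distrib
      by (rule Bochner_Integration.integral_diff) (intro integrable_MI_cont continuous_intros u Ic)+
    ultimately show ?thesis by simp
  qed
  have dsin: "(\<integral>t. d0 t * sin (2 * pi * real n * t) \<partial>MI) = 0" if n: "0 < n" for n :: nat
  proof -
    let ?a = "2 * pi * real n"
    have a: "?a \<noteq> 0" using n by simp
    have "(\<integral>t. v t * cos (?a * t) - ?a * (I t * sin (?a * t)) \<partial>MI) = I 1 * cos (?a * 1) - I 0 * cos (?a * 0)"
    proof (rule FTC)
      fix t :: real assume t: "t \<in> {0..1}"
      have "((\<lambda>t. cos (?a * t)) has_vector_derivative - (?a * sin (?a * t))) (at t within {0..1})"
        unfolding has_real_derivative_iff_has_vector_derivative[symmetric]
        by (auto intro!: derivative_eq_intros)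
      from has_vector_derivative_mult[OF I'[OF t] this]
      show "((\<lambda>t. I t * cos (?a * t)) has_vector_derivative v t * cos (?a * t) - ?a * (I t * sin (?a * t))) (at t within {0..1})"
        by (simp add: algebra_simps)
    qed (intro continuous_intros v Ic)
    also have "\<dots> = 0" by (simp add: I0 I1)
    also have "(\<integral>t. v t * cos (?a * t) - ?a * (I t * sin (?a * t)) \<partial>MI)
        = (\<integral>t. v t * cos (?a * t) \<partial>MI) - ?a * (\<integral>t. I t * sin (?a * t) \<partial>MI)"
      by (subst Bochner_Integration.integral_diff) (auto intro!: integrable_MI_cont continuous_intros v Ic)
    finally have "?a * (\<integral>t. u t * sin (?a * t) \<partial>MI) = ?a * (\<integral>t. I t * sin (?a * t) \<partial>MI)"
      using s[OF n] by simp
    then have "(\<integral>t. u t * sin (?a * t) \<partial>MI) = (\<integral>t. I t * sin (?a * t) \<partial>MI)" using a by simp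
    moreover have "(\<integral>t. d0 t * sin (?a * t) \<partial>MI) = (\<integral>t. u t * sin (?a * t) \<partial>MI) - (\<integral>t. I t * sin (?a * t) \<partial>MI)"
      unfolding d0_def left_diff_distrib
      by (rule Bochner_Integration.integral_diff) (intro integrable_MI_cont continuous_intros u Ic)+
    ultimately show ?thesis by simp
  qed
  have "d0 t - k = 0" if "t \<in> {0..1}" for t
  proof (rule Fourier_zero[OF _ _ _ that])
    show "continuous_on {0..1} (\<lambda>t. d0 t - k)" by (intro continuous_intros dc)
    fix n :: nat
    have "(\<integral>t. (d0 t - k) * cos (2 * pi * real n * t) \<partial>MI)
        = (\<integral>t. d0 t * cos (2 * pi * real n * t) \<partial>MI) - (\<integral>t. k * cos (2 * pi * real n * t) \<partial>MI)"
      unfolding left_diff_distrib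
      by (rule Bochner_Integration.integral_diff) (intro integrable_MI_cont continuous_intros dc)+
    also have "\<dots> = 0"
    proof (cases "n = 0")
      case False
      then show ?thesis using dcos[of n] integral_cos_MI[of "int n"] by simp
    qed (simp add: k_def)
    finally show "(\<integral>t. (d0 t - k) * cos (2 * pi * real n * t) \<partial>MI) = 0" .
    have "(\<integral>t. (d0 t - k) * sin (2 * pi * real n * t) \<partial>MI)
        = (\<integral>t. d0 t * sin (2 * pi * real n * t) \<partial>MI) - (\<integral>t. k * sin (2 * pi * real n * t) \<partial>MI)"
      unfolding left_diff_distrib
      by (rule Bochner_Integration.integral_diff) (intro integrable_MI_cont continuous_intros dc)+
    also have "\<dots> = 0"
    proof (cases "n = 0")
      case False
      then show ?thesis using dsin[of n] integral_sin_MI[of "int n"] by simp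
    qed simp
    finally show "(\<integral>t. (d0 t - k) * sin (2 * pi * real n * t) \<partial>MI) = 0" .
  qed
  then have uI: "u t = k + I t" if "t \<in> {0..1}" for t
    using that unfolding d0_def by (simp only: eq_iff_diff_eq_0[of "u t"]) (simp add: algebra_simps)
  have "((\<lambda>t. k + I t) has_vector_derivative v t) (at t within {0..1})"
    using has_vector_derivative_add[OF has_vector_derivative_const I'[OF t], of k] by simp
  then show ?thesis
    by (rule has_vector_derivative_transform[OF t, rotated]) (simp add: uI)
qed

lemma integral_MI_reflect: "(\<integral>t. f (1 - t) \<partial>MI) = (\<integral>t. (f t :: real) \<partial>MI)"
proof -
  have "(\<integral>t. indicator {0..1} t *\<^sub>R f t \<partial>lborel) = \<bar>-1\<bar> *\<^sub>R (\<integral>t. indicator {0..1} (1 + (-1) * t) *\<^sub>R f (1 + (-1) * t) \<partial>lborel)"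
    by (rule lborel_integral_real_affine) simp
  also have "\<dots> = (\<integral>t. indicator {0..1} t *\<^sub>R f (1 - t) \<partial>lborel)"
    by (auto simp: indicator_def intro!: Bochner_Integration.integral_cong)
  finally show ?thesis by (simp add: integral_MI set_lebesgue_integral_def)
qed

section \<open>Critical loops have constant energy\<close>

lemma has_derivative_of_quad:
  fixes G :: "'a :: real_inner \<Rightarrow> real"
  assumes "\<And>w. \<bar>G w - G z - inner g (w - z)\<bar> \<le> L * (norm (w - z))\<^sup>2"
  shows "(G has_derivative (\<lambda>h. inner g h)) (at z)"
proof (rule has_derivativeI)
  show "bounded_linear (\<lambda>h. inner g h)" by (rule bounded_linear_inner_right)
  show "((\<lambda>w. (G w - G z - inner g (w - z)) /\<^sub>R norm (w - z)) \<longlongrightarrow> 0) (at z)"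
  proof (rule Lim_null_comparison)
    have "norm ((G w - G z - inner g (w - z)) /\<^sub>R norm (w - z)) \<le> L * norm (w - z)" for w
    proof (cases "w = z")
      case False
      then have "\<bar>G w - G z - inner g (w - z)\<bar> / norm (w - z) \<le> L * (norm (w - z))\<^sup>2 / norm (w - z)"
        by (intro divide_right_mono assms) simp
      also have "\<dots> = L * norm (w - z)" using False by (simp add: power2_eq_square)
      finally have 1: "\<bar>G w - G z - inner g (w - z)\<bar> / norm (w - z) \<le> L * norm (w - z)" .
      have 2: "norm (q /\<^sub>R norm v) = \<bar>q\<bar> / norm v" for q :: real and v :: 'a
        by (simp add: divide_inverse abs_mult mult.commute)
      show ?thesis unfolding 2 by (rule 1)
    qed simp
    then show "\<forall>\<^sub>F w in at z. norm ((G w - G z - inner g (w - z)) /\<^sub>R norm (w - z)) \<le> L * norm (w - z)" by simp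
    have "((\<lambda>w. L * norm (w - z)) \<longlongrightarrow> L * norm (z - z)) (at z)" by (intro tendsto_intros)
    then show "((\<lambda>w. L * norm (w - z)) \<longlongrightarrow> 0) (at z)" by simp
  qed
qed

section \<open>The involution on points and time reversal of loops\<close>

definition tauP :: "pv \<Rightarrow> pv" where "tauP = dmul (\<lambda>c. if snd c then -1 else 1)"

lemma ev_tauP [simp]: "ev (tauP v) c = (if snd c then - ev v c else ev v c)"
  unfolding tauP_def by (subst dmul_bound(1)[of _ 1]) auto

lemma tauP_add: "tauP (v + w) = tauP v + tauP w"
  and tauP_diff: "tauP (v - w) = tauP v - tauP w"
  and tauP_scaleR: "tauP (r *\<^sub>R v) = r *\<^sub>R tauP v"
  and tauP_tauP [simp]: "tauP (tauP v) = v"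
  by (rule ell2_eqI; simp)+

lemma tauP_Ps [simp]: "tauP v \<in> Ps l \<longleftrightarrow> v \<in> Ps l"
proof -
  have "ev (tauP v) c = 0 \<longleftrightarrow> ev v c = 0" for c by simp
  then show ?thesis by (simp only: Ps_def mem_Collect_eq)
qed

lemma inner_tauP: "inner (tauP v) (tauP w) = inner v w"
  unfolding inner_infsum by (rule infsum_cong) auto

lemma norm_tauP [simp]: "norm (tauP v) = norm v"
  by (simp add: norm_eq_sqrt_inner inner_tauP)

lemma tauP_sum: "tauP (sum f A) = (\<Sum>a\<in>A. tauP (f a))"
  by (rule ell2_eqI) (simp add: sum_negf)

lemma tauP_ee: "tauP (ee c t) = ee c (1 - t)"
proof (rule ell2_eqI)
  fix d
  have 1: "cos (2 * pi * real_of_int (fst c) * (1 - t)) = cos (2 * pi * real_of_int (fst c) * t)"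
    and 2: "sin (2 * pi * real_of_int (fst c) * (1 - t)) = - sin (2 * pi * real_of_int (fst c) * t)"
    using cos_integer_2pi[of "real_of_int (fst c)"] sin_integer_2pi[of "real_of_int (fst c)"]
    by (simp_all add: right_diff_distrib cos_diff sin_diff mult.assoc)
  show "ev (tauP (ee c t)) d = ev (ee c (1 - t)) d"
    unfolding ee_def ev_tauP 1 2 by (auto simp: ev_bas)
qed

lemma tauP_trg: "tauP (trg l \<xi> A t) = trg l \<xi> A (1 - t)"
  by (simp add: trg_def tauP_sum tauP_scaleR tauP_ee)

definition An1 :: "nat \<Rightarrow> int set" where "An1 n = {- int n, int n}"

text \<open>Groups a symmetric partial sum by the absolute value of the frequency, which produces a
  series over \<open>nat\<close> fit for the Weierstrass test. For \<open>n = 0\<close> the group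
  \<open>An1 n\<close> is a singleton.\<close>

lemma sum_An:
  fixes f :: "int \<times> nat \<Rightarrow> 'a :: comm_monoid_add"
  shows "(\<Sum>c\<in>An N \<times> {..<l}. f c) = (\<Sum>n\<le>N. \<Sum>c\<in>An1 n \<times> {..<l}. f c)"
proof (induction N)
  case (Suc N)
  have 1: "An (Suc N) \<times> {..<l} = An N \<times> {..<l} \<union> An1 (Suc N) \<times> {..<l}"
    by (auto simp: An1_def)
  have 2: "(An N \<times> {..<l}) \<inter> (An1 (Suc N) \<times> {..<l}) = {}" by (auto simp: An1_def)
  have "sum f (An N \<times> {..<l} \<union> An1 (Suc N) \<times> {..<l}) = sum f (An N \<times> {..<l}) + sum f (An1 (Suc N) \<times> {..<l})"
    by (rule sum.union_disjoint[OF _ _ 2]) (simp_all add: An1_def)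
  then show ?case unfolding 1 by (simp only: Suc.IH sum.atMost_Suc)
qed (simp add: An1_def)

text \<open>A critical point is tested only against symmetric loops. Equivariance of the gradient
  makes the remaining Fourier coefficients vanish by parity, so that the full Hamiltonian equation
  holds.\<close>

locale ham_sym = ham +
  assumes gr_tau: "gr (tauP z) = tauP (gr z)"
begin

text \<open>One coordinate of the critical point equation: the two scalings by \<open>wt\<close>
  multiply to 2 pi |j|, and x^+ - x^- supplies the sign of j.\<close>

lemma crit_coeff:
  assumes "x \<in> Es l" "gradP l gr x = 0" "snd c < l"
  shows "gh (\<lambda>t. gr (lp l x t)) c = 2 * pi * real_of_int (fst c) * (ev x c / wt c)"
proof -
  let ?g = "\<lambda>t. gr (lp l x t)"
  have "Pp x - Pm x = Wg l gr x" using assms(2) by (simp add: gradP_def)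
  then have "ev (Pp x - Pm x) c = ev (Jst l ?g) c" by (simp add: Wg_def)
  then have "(if 0 < fst c then ev x c else if fst c < 0 then - ev x c else 0) = gh ?g c / wt c"
    using assms(3) by (auto simp: ev_Jst[OF L2f_gr[OF L2f_lp]])
  then have 1: "gh ?g c = (if 0 < fst c then ev x c else if fst c < 0 then - ev x c else 0) * wt c"
    by (simp add: field_simps)
  have 2: "(wt c)\<^sup>2 = 2 * pi * \<bar>real_of_int (fst c)\<bar>" if "fst c \<noteq> 0" using that by (simp add: wt_sq)
  have "a * wt c = (wt c)\<^sup>2 * (a / wt c)" for a by (simp add: power2_eq_square)
  then show ?thesis unfolding 1 using 2 by (cases "fst c" "0 :: int" rule: linorder_cases) auto
qed

text \<open>The coefficients of the loop are square-summable numbers divided by 2 pi j, hence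
  absolutely summable. The Fourier series therefore converges uniformly to a continuous
  representative, which inherits the symmetry of the partial sums.\<close>

lemma crit_series:
  assumes x: "x \<in> Es l" and crit: "gradP l gr x = 0"
  obtains X where "continuous_on {0..1} X" "\<And>t. X t \<in> Ps l" "AE t in MI. lp l x t = X t"
    "\<And>t. t \<in> {0..1} \<Longrightarrow> X (1 - t) = tauP (X t)"
proof -
  let ?g = "\<lambda>t. gr (lp l x t)"
  have gL: "L2f l ?g" by (intro L2f_gr L2f_lp)
  define y where "y c = ev x c / wt c" for c
  define a where "a n = (\<Sum>c\<in>An1 n \<times> {..<l}. \<bar>y c\<bar>)" for n
  define b where "b n = (\<Sum>c\<in>An1 n \<times> {..<l}. (gh ?g c)\<^sup>2)" for n
  have sb: "summable b"
  proof (rule summableI_nonneg_bounded)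
    show "0 \<le> b n" for n unfolding b_def by (rule sum_nonneg) simp
    fix N
    have "sum b {..<N} \<le> sum b {..N}" by (rule sum_mono2) (auto simp: b_def intro: sum_nonneg)
    also have "\<dots> = (\<Sum>c\<in>An N \<times> {..<l}. (gh ?g c)\<^sup>2)" unfolding b_def by (rule sum_An[symmetric])
    also have "\<dots> = (\<Sum>c\<in>An N \<times> {..<l}. (ev (Bes l ?g) c)\<^sup>2)" by (intro sum.cong) (auto simp: ev_Bes[OF gL])
    also have "\<dots> \<le> (norm (Bes l ?g))\<^sup>2" by (rule sum_sq_le_norm) simp
    finally show "sum b {..<N} \<le> (norm (Bes l ?g))\<^sup>2" .
  qed
  \<comment> \<open>A product is at most the sum of the squares of its factors; there are
    \<open>2 * l\<close> modes of each positive absolute frequency.\<close>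
  have le: "a n \<le> b n + 2 * real l * (1 / (real n)\<^sup>2)" if n: "0 < n" for n
  proof -
    have "a n \<le> (\<Sum>c\<in>An1 n \<times> {..<l}. (gh ?g c)\<^sup>2 + 1 / (real n)\<^sup>2)"
      unfolding a_def
    proof (rule sum_mono)
      fix c assume c: "c \<in> An1 n \<times> {..<l}"
      then have "gh ?g c = 2 * pi * real_of_int (fst c) * y c" using crit_coeff[OF x crit, of c] by (auto simp: y_def)
      moreover have fc: "\<bar>real_of_int (fst c)\<bar> = real n" using c by (auto simp: An1_def)
      ultimately have "\<bar>gh ?g c\<bar> = 2 * pi * real n * \<bar>y c\<bar>" by (simp add: abs_mult)
      moreover have "1 * (real n * \<bar>y c\<bar>) \<le> (2 * pi) * (real n * \<bar>y c\<bar>)"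
        using pi_gt3 by (intro mult_right_mono) auto
      ultimately have "real n * \<bar>y c\<bar> \<le> \<bar>gh ?g c\<bar>" by simp
      then have "\<bar>y c\<bar> \<le> \<bar>gh ?g c\<bar> * (1 / real n)" using n by (simp add: field_simps)
      also have "\<dots> \<le> (gh ?g c)\<^sup>2 + 1 / (real n)\<^sup>2"
      proof -
        have ab: "\<bar>u\<bar> * v \<le> u\<^sup>2 + v\<^sup>2" if "0 \<le> v" for u v :: real
        proof -
          have "0 \<le> (\<bar>u\<bar> - v)\<^sup>2" "0 \<le> \<bar>u\<bar> * v" using that by simp_all
          then show ?thesis unfolding power2_diff by simp
        qed
        show ?thesis using ab[of "1 / real n" "gh ?g c"] by (simp add: power_divide)
      qed
      finally show "\<bar>y c\<bar> \<le> (gh ?g c)\<^sup>2 + 1 / (real n)\<^sup>2" .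
    qed
    also have "\<dots> = b n + real (card (An1 n \<times> {..<l})) * (1 / (real n)\<^sup>2)"
      unfolding b_def by (simp add: sum.distrib)
    also have "real (card (An1 n \<times> {..<l})) = 2 * real l"
      using n by (simp add: card_cartesian_product An1_def)
    finally show ?thesis .
  qed
  have sa: "summable a"
  proof (rule summable_comparison_test')
    show "summable (\<lambda>n. b n + 2 * real l * (1 / (real n)\<^sup>2))"
      using inverse_power_summable[of 2, where 'a = real]
      by (intro summable_add sb summable_mult) (simp add: inverse_eq_divide)
    show "norm (a n) \<le> b n + 2 * real l * (1 / (real n)\<^sup>2)" if "1 \<le> n" for n
      using le[of n] that by (simp add: a_def sum_nonneg)
  qed
  define T where "T n t = trg l x (An1 n) t" for n t
  have trgT: "trg l x (An N) t = (\<Sum>n\<le>N. T n t)" for N t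
    unfolding T_def trg_def by (rule sum_An)
  have Ta: "norm (T n t) \<le> a n" for n t
  proof -
    have "norm (T n t) \<le> (\<Sum>c\<in>An1 n \<times> {..<l}. norm ((ev x c / wt c) *\<^sub>R ee c t))"
      unfolding T_def trg_def by (rule norm_sum)
    then show ?thesis by (simp add: a_def y_def norm_ee)
  qed
  define Xc where "Xc c t = suminf (\<lambda>n. ev (T n t) c)" for c t
  have ul: "uniform_limit {0..1} (\<lambda>N t. \<Sum>n<N. ev (T n t) c) (Xc c) sequentially" for c
    unfolding Xc_def
    by (rule Weierstrass_m_test[OF _ sa]) (use Ta abs_ev_le order_trans in \<open>fastforce\<close>)
  have Xcc: "continuous_on {0..1} (Xc c)" for c
  proof (rule uniform_limit_theorem[OF _ ul])
    show "\<forall>\<^sub>F N in sequentially. continuous_on {0..1} (\<lambda>t. \<Sum>n<N. ev (T n t) c)"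
      unfolding T_def by (intro always_eventually allI continuous_intros trg_cont)
  qed simp
  define X where "X t = (\<Sum>c\<in>Cl l. Xc c t *\<^sub>R bas c)" for t
  have evX: "ev (X t) c = (if c \<in> Cl l then Xc c t else 0)" for t c
    by (simp add: X_def ev_bas if_distrib[of "\<lambda>t. _ * t"] sum.delta' cong: if_cong)
  have XPs: "X t \<in> Ps l" for t by (simp add: Ps_iff evX)
  have Xcont: "continuous_on {0..1} X" unfolding X_def by (intro continuous_intros Xcc)
  have lim_c: "(\<lambda>N. ev (trg l x (An N) t) c) \<longlonglongrightarrow> Xc c t" for t c
  proof -
    have "summable (\<lambda>n. ev (T n t) c)"
      by (rule summable_comparison_test'[OF sa, of 0]) (use Ta abs_ev_le order_trans in \<open>fastforce\<close>)
    then have "(\<lambda>N. \<Sum>n\<le>N. ev (T n t) c) \<longlonglongrightarrow> Xc c t"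
      unfolding Xc_def by (rule summable_LIMSEQ')
    then show ?thesis by (simp add: trgT)
  qed
  have lim: "(\<lambda>N. trg l x (An N) t) \<longlonglongrightarrow> X t" for t
  proof -
    have "(\<lambda>N. \<Sum>c\<in>Cl l. ev (trg l x (An N) t) c *\<^sub>R bas c) \<longlonglongrightarrow> X t"
      unfolding X_def by (intro tendsto_intros lim_c)
    then show ?thesis by (simp flip: Ps_expand[OF trg_Ps])
  qed
  define S where "S = suminf a"
  have nb: "norm (trg l x (An N) t) \<le> S" for N t
  proof -
    have "norm (trg l x (An N) t) \<le> (\<Sum>n\<le>N. norm (T n t))" unfolding trgT by (rule norm_sum)
    also have "\<dots> \<le> (\<Sum>n\<le>N. a n)" by (rule sum_mono) (rule Ta)
    also have "\<dots> \<le> S" unfolding S_def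
      by (rule sum_le_suminf[OF sa]) (auto simp: a_def sum_nonneg)
    finally show ?thesis .
  qed
  have nX: "norm (X t) \<le> S" for t
    by (rule LIMSEQ_le_const2[OF tendsto_norm[OF lim]]) (use nb in blast)
  have LX: "L2f l X" by (rule L2f_cont[OF XPs Xcont])
  \<comment> \<open>The pointwise limit is also the L^2 limit, by dominated convergence; uniqueness
    of limits then identifies \<open>X\<close> with the loop.\<close>
  have "(\<lambda>N. \<integral>t. (norm (trg l x (An N) t - X t))\<^sup>2 \<partial>MI) \<longlonglongrightarrow> (\<integral>t. 0 \<partial>MI)"
  proof (rule integral_dominated_convergence[where w = "\<lambda>t. (2 * S)\<^sup>2"])
    show "(\<lambda>t. (norm (trg l x (An N) t - X t))\<^sup>2) \<in> borel_measurable MI" for N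
      by (intro borel_measurable_integrable L2f_sq[where l = l] L2f_diff L2f_trg LX)
    show "AE t in MI. (\<lambda>N. (norm (trg l x (An N) t - X t))\<^sup>2) \<longlonglongrightarrow> 0"
    proof (intro AE_I2)
      fix t
      have "(\<lambda>N. (norm (trg l x (An N) t - X t))\<^sup>2) \<longlonglongrightarrow> (norm (X t - X t))\<^sup>2"
        by (intro tendsto_intros lim)
      then show "(\<lambda>N. (norm (trg l x (An N) t - X t))\<^sup>2) \<longlonglongrightarrow> 0" by simp
    qed
    show "AE t in MI. norm ((norm (trg l x (An N) t - X t))\<^sup>2) \<le> (2 * S)\<^sup>2" for N
    proof (intro AE_I2)
      fix t
      have "norm (trg l x (An N) t - X t) \<le> 2 * S"
        using norm_triangle_ineq4[of "trg l x (An N) t" "X t"] nb[of N t] nX[of t] by linarith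
      then have "(norm (trg l x (An N) t - X t))\<^sup>2 \<le> (2 * S)\<^sup>2" by (intro power_mono) auto
      then show "norm ((norm (trg l x (An N) t - X t))\<^sup>2) \<le> (2 * S)\<^sup>2" by simp
    qed
  qed simp_all
  then have "(\<lambda>N. (n2 (\<lambda>t. trg l x (An N) t - X t))\<^sup>2) \<longlonglongrightarrow> 0" by (simp add: n2_sq)
  from tendsto_real_sqrt[OF this] have "(\<lambda>N. n2 (\<lambda>t. trg l x (An N) t - X t)) \<longlonglongrightarrow> 0" by simp
  then have AE: "AE t in MI. lp l x t = X t"
    by (intro L2_limit_unique[OF L2f_lp LX L2f_trg lp_limit])
  have Xs: "X (1 - t) = tauP (X t)" for t
  proof (rule ell2_eqI)
    fix c
    show "ev (X (1 - t)) c = ev (tauP (X t)) c"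
    proof (rule LIMSEQ_unique)
      show "(\<lambda>N. ev (trg l x (An N) (1 - t)) c) \<longlonglongrightarrow> ev (X (1 - t)) c" by (intro tendsto_ev lim)
      have "(\<lambda>N. if snd c then - ev (trg l x (An N) t) c else ev (trg l x (An N) t) c) \<longlonglongrightarrow> (if snd c then - ev (X t) c else ev (X t) c)"
      proof -
        have 1: "(\<lambda>N. ev (trg l x (An N) t) c) \<longlonglongrightarrow> ev (X t) c" by (intro tendsto_ev lim)
        from 1 tendsto_minus[OF 1] show ?thesis by (cases "snd c") auto
      qed
      then show "(\<lambda>N. ev (trg l x (An N) (1 - t)) c) \<longlonglongrightarrow> ev (tauP (X t)) c"
        unfolding tauP_trg[symmetric] by simp
    qed
  qed
  show thesis by (rule that[OF Xcont XPs AE Xs])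
qed

text \<open>The coefficient relations at \<open>n\<close> and \<open>- n\<close>, with parity, are
  exactly those between the Fourier coefficients of \<open>X\<close> and of J0 applied to the
  gradient along \<open>X\<close>. \<open>Fourier_primitive\<close> turns them into a
  derivative.\<close>

lemma crit_derivative:
  assumes x: "x \<in> Es l" and crit: "gradP l gr x = 0"
    and X: "continuous_on {0..1} X" "\<And>t. X t \<in> Ps l" "AE t in MI. lp l x t = X t"
    "\<And>t. t \<in> {0..1} \<Longrightarrow> X (1 - t) = tauP (X t)"
    and i: "i < l" and t: "t \<in> {0..1}"
  shows "((\<lambda>t. ev (X t) (i, False)) has_vector_derivative - ev (gr (X t)) (i, True)) (at t within {0..1})"
    and "((\<lambda>t. ev (X t) (i, True)) has_vector_derivative ev (gr (X t)) (i, False)) (at t within {0..1})"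
proof -
  define uF where "uF t = ev (X t) (i, False)" for t
  define uT where "uT t = ev (X t) (i, True)" for t
  define gF where "gF t = ev (gr (X t)) (i, False)" for t
  define gT where "gT t = ev (gr (X t)) (i, True)" for t
  have uF_eq: "uF = (\<lambda>t. ev (X t) (i, False))" and uT_eq: "uT = (\<lambda>t. ev (X t) (i, True))"
    by (simp_all add: fun_eq_iff uF_def uT_def)
  have gc: "continuous_on {0..1} (\<lambda>t. gr (X t))"
    by (rule continuous_on_compose2[OF gr_cont X(1)]) simp
  have cont: "continuous_on {0..1} uF" "continuous_on {0..1} uT" "continuous_on {0..1} gF" "continuous_on {0..1} gT"
    unfolding uF_def uT_def gF_def gT_def by (intro continuous_intros X gc)+
  have LX: "L2f l X" by (rule L2f_cont[OF X(2,1)])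
  have refl: "uF (1 - t) = uF t" "uT (1 - t) = - uT t" "gF (1 - t) = gF t" "gT (1 - t) = - gT t" if "t \<in> {0..1}" for t
    using X(4)[OF that] gr_tau[of "X t"] by (simp_all add: uF_def uT_def gF_def gT_def)
  have odd: "(\<integral>t. f t \<partial>MI) = 0" if "\<And>t. t \<in> {0..1} \<Longrightarrow> f (1 - t) = - f t" for f :: "real \<Rightarrow> real"
  proof -
    have "(\<integral>t. f t \<partial>MI) = (\<integral>t. f (1 - t) \<partial>MI)" by (rule integral_MI_reflect[symmetric])
    also have "\<dots> = (\<integral>t. - f t \<partial>MI)" by (rule Bochner_Integration.integral_cong) (use that in auto)
    also have "\<dots> = - (\<integral>t. f t \<partial>MI)" by simp
    finally show ?thesis by simp
  qed
  have cs: "cos (2 * pi * real n * (1 - t)) = cos (2 * pi * real n * t)"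
    "sin (2 * pi * real n * (1 - t)) = - sin (2 * pi * real n * t)" for n t
    using cos_integer_2pi[of "real n"] sin_integer_2pi[of "real n"]
    by (simp_all add: right_diff_distrib cos_diff sin_diff mult.assoc)
  \<comment> \<open>Under t -> 1 - t the x components are even and the y components odd, so their
    products with sine and cosine respectively integrate to zero.\<close>
  have o: "(\<integral>t. uF t * sin (2 * pi * real n * t) \<partial>MI) = 0" "(\<integral>t. uT t * cos (2 * pi * real n * t) \<partial>MI) = 0"
    "(\<integral>t. gF t * sin (2 * pi * real n * t) \<partial>MI) = 0" "(\<integral>t. gT t * cos (2 * pi * real n * t) \<partial>MI) = 0" for n
    by (rule odd; simp add: refl cs)+
  have split: "(\<integral>t. inner (f t) (ee (j, i) t) \<partial>MI)
      = (\<integral>t. ev (f t) (i, False) * cos (2 * pi * real_of_int j * t) \<partial>MI) + (\<integral>t. ev (f t) (i, True) * sin (2 * pi * real_of_int j * t) \<partial>MI)"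
    if "continuous_on {0..1} f" for f j
  proof -
    have "(\<integral>t. inner (f t) (ee (j, i) t) \<partial>MI) = (\<integral>t. ev (f t) (i, False) * cos (2 * pi * real_of_int j * t) + ev (f t) (i, True) * sin (2 * pi * real_of_int j * t) \<partial>MI)"
      by (simp add: ee_def inner_add_right mult.commute)
    also have "\<dots> = (\<integral>t. ev (f t) (i, False) * cos (2 * pi * real_of_int j * t) \<partial>MI) + (\<integral>t. ev (f t) (i, True) * sin (2 * pi * real_of_int j * t) \<partial>MI)"
      by (rule Bochner_Integration.integral_add) (intro integrable_MI_cont continuous_intros that)+
    finally show ?thesis .
  qed
  have gL: "L2f l (\<lambda>t. gr (lp l x t))" "L2f l (\<lambda>t. gr (X t))" by (intro L2f_gr L2f_lp LX)+
  have gAE: "AE t in MI. gr (lp l x t) = gr (X t)" using X(3) by eventually_elim simp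
  have yX: "ev x (j, i) / wt (j, i) = (\<integral>t. inner (X t) (ee (j, i) t) \<partial>MI)" for j
  proof -
    have "ev x (j, i) / wt (j, i) = gh (lp l x) (j, i)"
      using lp_coeff[of "(j, i)" l x] i by (simp add: gh_def inner_commute)
    also have "\<dots> = gh X (j, i)" using gh_cong_AE[OF L2f_lp LX X(3), of "(j, i)"] i by simp
    finally show ?thesis by (simp add: gh_def)
  qed
  have key: "(\<integral>t. inner (gr (X t)) (ee (j, i) t) \<partial>MI) = 2 * pi * real_of_int j * (\<integral>t. inner (X t) (ee (j, i) t) \<partial>MI)" for j
    using crit_coeff[OF x crit, of "(j, i)"] gh_cong_AE[OF gL gAE, of "(j, i)"] i
    unfolding yX[symmetric] by (simp add: gh_def)
  have k1: "(\<integral>t. gF t * cos (2 * pi * real n * t) \<partial>MI) + (\<integral>t. gT t * sin (2 * pi * real n * t) \<partial>MI)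
      = 2 * pi * real n * ((\<integral>t. uF t * cos (2 * pi * real n * t) \<partial>MI) + (\<integral>t. uT t * sin (2 * pi * real n * t) \<partial>MI))" for n
    using key[of "int n"] unfolding split[OF gc] split[OF X(1)] by (simp add: uF_def uT_def gF_def gT_def)
  have k2: "(\<integral>t. gF t * cos (2 * pi * real n * t) \<partial>MI) - (\<integral>t. gT t * sin (2 * pi * real n * t) \<partial>MI)
      = - (2 * pi * real n * ((\<integral>t. uF t * cos (2 * pi * real n * t) \<partial>MI) - (\<integral>t. uT t * sin (2 * pi * real n * t) \<partial>MI)))" for n
    using key[of "- int n"] unfolding split[OF gc] split[OF X(1)] by (simp add: uF_def uT_def gF_def gT_def)
  have gF0: "(\<integral>t. gF t \<partial>MI) = 0" using k1[of 0] by simp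
  have gT0: "(\<integral>t. - gT t \<partial>MI) = 0" using o(4)[of 0] by simp
  \<comment> \<open>The sum and the difference of the relations at \<open>n\<close> and
    \<open>- n\<close> separate cosine from sine coefficients.\<close>
  have solve: "c = a * v \<and> s = a * u" if "c + s = a * (u + v)" "c - s = - (a * (u - v))" for a c s u v :: real
    using that by (simp add: algebra_simps)
  have r: "(\<integral>t. gF t * cos (2 * pi * real n * t) \<partial>MI) = 2 * pi * real n * (\<integral>t. uT t * sin (2 * pi * real n * t) \<partial>MI)"
    "(\<integral>t. gT t * sin (2 * pi * real n * t) \<partial>MI) = 2 * pi * real n * (\<integral>t. uF t * cos (2 * pi * real n * t) \<partial>MI)" for n
    using solve[OF k1 k2, of n] by simp_all
  have "(uF has_vector_derivative - gT t) (at t within {0..1})"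
    by (rule Fourier_primitive[OF cont(1) continuous_on_minus[OF cont(4)] gT0 _ _ t]) (simp_all add: o r)
  then show "((\<lambda>t. ev (X t) (i, False)) has_vector_derivative - ev (gr (X t)) (i, True)) (at t within {0..1})"
    by (simp only: uF_eq gT_def)
  have "(uT has_vector_derivative gF t) (at t within {0..1})"
    by (rule Fourier_primitive[OF cont(2) cont(3) gF0 _ _ t]) (simp_all add: o r)
  then show "((\<lambda>t. ev (X t) (i, True)) has_vector_derivative ev (gr (X t)) (i, False)) (at t within {0..1})"
    by (simp only: uT_eq gF_def)
qed

lemma G_has_derivative: "(G has_derivative (\<lambda>h. inner (gr z) h)) (at z)"
  by (rule has_derivative_of_quad[OF G_quad])

text \<open>The velocity is J0 applied to the gradient, hence orthogonal to the gradient, and the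
  energy has zero derivative.\<close>

lemma crit_loop:
  assumes x: "x \<in> Es l" and crit: "gradP l gr x = 0"
  obtains X where "continuous_on {0..1} X" "\<And>t. X t \<in> Ps l" "AE t in MI. lp l x t = X t"
    "\<And>t. t \<in> {0..1} \<Longrightarrow> G (X t) = G (X 0)"
proof -
  obtain X where X: "continuous_on {0..1} X" "\<And>t. X t \<in> Ps l" "AE t in MI. lp l x t = X t"
    "\<And>t. t \<in> {0..1} \<Longrightarrow> X (1 - t) = tauP (X t)" by (rule crit_series[OF x crit]) (rule that; assumption)
  \<comment> \<open>The coordinates of J0 applied to the gradient at \<open>X t\<close>.\<close>
  define X' where "X' t c = (if snd c then ev (gr (X t)) (fst c, False) else - ev (gr (X t)) (fst c, True))" for t c
  have d: "((\<lambda>t. ev (X t) c) has_vector_derivative X' t c) (at t within {0..1})" if "c \<in> Cl l" "t \<in> {0..1}" for c t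
    using crit_derivative[OF x crit X, of "fst c" t] that by (cases c; cases "snd c") (auto simp: X'_def Cl_def)
  have dG: "((\<lambda>t. G (X t)) has_vector_derivative 0) (at t within {0..1})" if t: "t \<in> {0..1}" for t
  proof -
    have "((\<lambda>t. \<Sum>c\<in>Cl l. ev (X t) c *\<^sub>R bas c) has_vector_derivative (\<Sum>c\<in>Cl l. X' t c *\<^sub>R bas c)) (at t within {0..1})"
    proof (rule has_vector_derivative_sum)
      fix c assume "c \<in> Cl l"
      from d[OF this t] show "((\<lambda>t. ev (X t) c *\<^sub>R (bas c :: pv)) has_vector_derivative X' t c *\<^sub>R bas c) (at t within {0..1})"
        unfolding has_real_derivative_iff_has_vector_derivative[symmetric]
        using has_vector_derivative_scaleR[OF _ has_vector_derivative_const, of "\<lambda>t. ev (X t) c" "X' t c" t "{0..1}" "bas c"] by simp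
    qed
    then have dX: "(X has_vector_derivative (\<Sum>c\<in>Cl l. X' t c *\<^sub>R bas c)) (at t within {0..1})"
      by (simp flip: Ps_expand[OF X(2)])
    have "((\<lambda>t. G (X t)) has_derivative (\<lambda>h. inner (gr (X t)) (h *\<^sub>R (\<Sum>c\<in>Cl l. X' t c *\<^sub>R bas c)))) (at t within {0..1})"
      using has_derivative_compose[OF dX[unfolded has_vector_derivative_def] G_has_derivative] by simp
    moreover have "inner (gr (X t)) (\<Sum>c\<in>Cl l. X' t c *\<^sub>R bas c) = 0"
    proof -
      have "inner (gr (X t)) (\<Sum>c\<in>Cl l. X' t c *\<^sub>R bas c) = (\<Sum>c\<in>Cl l. X' t c * ev (gr (X t)) c)"
        by (simp add: inner_sum_right)
      also have "\<dots> = (\<Sum>i<l. \<Sum>b\<in>UNIV. X' t (i, b) * ev (gr (X t)) (i, b))"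
        unfolding Cl_def by (simp add: sum.cartesian_product case_prod_beta)
      also have "\<dots> = 0" by (simp add: UNIV_bool X'_def)
      finally show ?thesis .
    qed
    ultimately show ?thesis by (simp add: has_vector_derivative_def)
  qed
  have Gc: "G (X t) = G (X 0)" if t: "t \<in> {0..1}" for t
  proof -
    have "\<exists>k. \<forall>t\<in>{0..1}. G (X t) = k"
      by (rule has_vector_derivative_zero_constant[of "{0..1}" "\<lambda>t. G (X t)"]) (use dG in auto)
    then show ?thesis using t by force
  qed
  show thesis by (rule that[OF X(1-3) Gc])
qed

end

section \<open>Admissible deformations and the intersection property\<close>

definition dfm :: "(ec \<Rightarrow> real \<Rightarrow> real) \<Rightarrow> (ec \<Rightarrow> real \<Rightarrow> real) \<Rightarrow> (ec \<Rightarrow> real \<Rightarrow> real) \<Rightarrow> (ec \<Rightarrow> real \<Rightarrow> ec) \<Rightarrow> ec \<Rightarrow> real \<Rightarrow> ec" where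
  "dfm a b c K x u = a x u *\<^sub>R Pp x + b x u *\<^sub>R Pz x + c x u *\<^sub>R Pm x + K x u"

text \<open>Sequential relative compactness in (0,oo)^3 x E; positivity of the limits keeps the
  coefficients away from zero on bounded sets.\<close>

abbreviation convergent_subfamily ::
    "nat \<Rightarrow> (ec \<Rightarrow> real \<Rightarrow> real) \<Rightarrow> (ec \<Rightarrow> real \<Rightarrow> real) \<Rightarrow> (ec \<Rightarrow> real \<Rightarrow> real)
      \<Rightarrow> (ec \<Rightarrow> real \<Rightarrow> ec) \<Rightarrow> (nat \<Rightarrow> ec) \<Rightarrow> (nat \<Rightarrow> real) \<Rightarrow> bool" where
  "convergent_subfamily l a b c K s v \<equiv> \<exists>(r :: nat \<Rightarrow> nat) \<alpha> \<beta> \<gamma> k. strict_mono r \<and> 0 < \<alpha> \<and> 0 < \<beta> \<and> 0 < \<gamma> \<and> k \<in> Es l \<and>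
        (\<lambda>m. a (s (r m)) (v (r m))) \<longlonglongrightarrow> \<alpha> \<and> (\<lambda>m. b (s (r m)) (v (r m))) \<longlonglongrightarrow> \<beta> \<and>
        (\<lambda>m. c (s (r m)) (v (r m))) \<longlonglongrightarrow> \<gamma> \<and> (\<lambda>m. K (s (r m)) (v (r m))) \<longlonglongrightarrow> k"

text \<open>The data of an admissible homotopy in scaled coefficients, with no map prescribed at
  time one, so that further steps can be appended.\<close>

locale deform =
  fixes l :: nat and a b c :: "ec \<Rightarrow> real \<Rightarrow> real" and K :: "ec \<Rightarrow> real \<Rightarrow> ec"
  assumes pos: "x \<in> Es l \<Longrightarrow> u \<in> {0..1} \<Longrightarrow> 0 < a x u \<and> 0 < b x u \<and> 0 < c x u"
    and K_Es: "x \<in> Es l \<Longrightarrow> u \<in> {0..1} \<Longrightarrow> K x u \<in> Es l"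
    and cont_a: "continuous_on (Es l \<times> {0..1}) (\<lambda>p. a (fst p) (snd p))"
    and cont_b: "continuous_on (Es l \<times> {0..1}) (\<lambda>p. b (fst p) (snd p))"
    and cont_c: "continuous_on (Es l \<times> {0..1}) (\<lambda>p. c (fst p) (snd p))"
    and cont_K: "continuous_on (Es l \<times> {0..1}) (\<lambda>p. K (fst p) (snd p))"
    and cpt: "(\<And>m :: nat. s m \<in> Es l \<and> norm (s m) \<le> R \<and> v m \<in> {0..1}) \<Longrightarrow>
      convergent_subfamily l a b c K s v"
    and start: "x \<in> Es l \<Longrightarrow> dfm a b c K x 0 = x"
    and nonvan: "x \<in> Es l \<Longrightarrow> u \<in> {0..1} \<Longrightarrow> Pp x \<noteq> 0 \<Longrightarrow> Pp (dfm a b c K x u) \<noteq> 0"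

definition Sp :: "nat \<Rightarrow> ec set" where "Sp l = {x \<in> Es l. Pp x = x \<and> norm x = 1}"

section \<open>Intersection with a ray in finite dimensions\<close>

lemma not_contractible_coordinate_sphere:
  "\<not> contractible {x :: nat \<Rightarrow> real. (\<Sum>i\<le>n. (x i)\<^sup>2) = 1 \<and> (\<forall>i>n. x i = 0)}"
proof -
  have "nsphere n = top_of_set {x :: nat \<Rightarrow> real. (\<Sum>i\<le>n. (x i)\<^sup>2) = 1 \<and> (\<forall>i>n. x i = 0)}"
    unfolding nsphere euclidean_product_topology ..
  then show ?thesis
    using non_contractible_space_nsphere[of n] by (simp add: contractible_space_top_of_set)
qed

abbreviation PN :: "nat \<Rightarrow> ec \<Rightarrow> ec" where "PN N \<equiv> rst (An N \<times> UNIV)"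

definition EN :: "nat \<Rightarrow> nat \<Rightarrow> ec set" where
  "EN l N = {x. \<forall>c. c \<notin> {1..int N} \<times> {..<l} \<longrightarrow> ev x c = 0}"

text \<open>If the end map missed the ray through \<open>e\<close>, its normalisation could be
  joined to the antipode of \<open>e\<close> by segments avoiding zero. Preceded by the normalised
  homotopy \<open>F\<close>, which starts at the identity, this would contract the sphere.\<close>

lemma finite_dim_no_null_homotopy:
  fixes F :: "ec \<Rightarrow> real \<Rightarrow> ec"
  assumes Nl: "0 < N * l"
    and F: "continuous_on ((EN l N \<inter> sphere 0 1) \<times> {0..1}) (\<lambda>p. F (fst p) (snd p))"
    and FN: "\<And>x u. x \<in> EN l N \<Longrightarrow> norm x = 1 \<Longrightarrow> u \<in> {0..1} \<Longrightarrow> F x u \<in> EN l N \<and> F x u \<noteq> 0"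
    and F0: "\<And>x. x \<in> EN l N \<Longrightarrow> norm x = 1 \<Longrightarrow> \<exists>s>0. F x 0 = s *\<^sub>R x"
    and e: "e \<in> EN l N" "e \<noteq> 0"
  shows "\<exists>x\<in>EN l N. norm x = 1 \<and> (\<exists>s>0. F x 1 = s *\<^sub>R e)"
proof (rule ccontr)
  assume no: "\<not> ?thesis"
  define I where "I = {1..int N} \<times> {..<l}"
  obtain n where n: "N * l = Suc n" using Nl by (cases "N * l") auto
  have cI: "card I = Suc n" unfolding I_def n[symmetric] by (simp add: card_cartesian_product)
  have fI: "finite I" by (simp add: I_def)
  obtain \<beta> where "bij_betw \<beta> {0..<Suc n} I" using ex_bij_betw_nat_finite[OF fI] unfolding cI by blast
  moreover have "{0..<Suc n} = {..n}" by auto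
  ultimately have \<beta>: "bij_betw \<beta> {..n} I" by simp
  then have inj: "inj_on \<beta> {..n}" and im: "\<beta> ` {..n} = I" by (auto simp: bij_betw_def)
  have EN: "x \<in> EN l N \<longleftrightarrow> (\<forall>c. c \<notin> I \<longrightarrow> ev x c = 0)" for x by (simp add: EN_def I_def)
  define S :: "(nat \<Rightarrow> real) set" where "S = {x. (\<Sum>i\<le>n. (x i)\<^sup>2) = 1 \<and> (\<forall>i>n. x i = 0)}"
  define \<theta> :: "(nat \<Rightarrow> real) \<Rightarrow> ec" where "\<theta> z = (\<Sum>i\<le>n. z i *\<^sub>R bas (\<beta> i))" for z
  define \<rho> :: "ec \<Rightarrow> nat \<Rightarrow> real" where "\<rho> x i = (if i \<le> n then ev x (\<beta> i) else 0)" for x i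
  have ev_\<theta>: "ev (\<theta> z) (\<beta> i) = z i" if "i \<le> n" for z i
  proof -
    have "ev (\<theta> z) (\<beta> i) = (\<Sum>k\<le>n. if i = k then z k else 0)"
      unfolding \<theta>_def ev_sum using inj that by (intro sum.cong) (auto simp: ev_bas inj_on_def)
    then show ?thesis using that by simp
  qed
  have \<theta>_EN: "\<theta> z \<in> EN l N" for z
    unfolding EN \<theta>_def ev_sum using im by (auto simp: ev_bas intro!: sum.neutral)
  have nrm: "(norm x)\<^sup>2 = (\<Sum>i\<le>n. (ev x (\<beta> i))\<^sup>2)" if "x \<in> EN l N" for x
  proof -
    have "(norm x)\<^sup>2 = (\<Sum>c\<in>I. (ev x c)\<^sup>2)" using that by (intro norm_sq_finite[OF fI]) (auto simp: EN)
    also have "\<dots> = (\<Sum>i\<le>n. (ev x (\<beta> i))\<^sup>2)" unfolding im[symmetric] using inj by (simp add: sum.reindex)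
    finally show ?thesis .
  qed
  have \<theta>_norm: "norm (\<theta> z) = 1" if "z \<in> S" for z
  proof -
    have "(norm (\<theta> z))\<^sup>2 = 1" using that unfolding nrm[OF \<theta>_EN] S_def by (simp add: ev_\<theta>)
    then show ?thesis using power2_eq_1_iff[of "norm (\<theta> z)"] norm_ge_zero[of "\<theta> z"] by linarith
  qed
  have \<rho>_S: "\<rho> x \<in> S" if "x \<in> EN l N" "norm x = 1" for x
    using nrm[OF that(1)] that(2) by (auto simp: S_def \<rho>_def)
  have \<rho>_\<theta>: "\<rho> (\<theta> z) = z" if "z \<in> S" for z
    using that by (auto simp: \<rho>_def ev_\<theta> S_def fun_eq_iff)
  have \<theta>_cont: "continuous_on A \<theta>" for A
    unfolding \<theta>_def by (intro continuous_intros continuous_on_product_then_coordinatewise)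
  have \<rho>_cont: "continuous_on A (\<lambda>p. \<rho> (f p))" if "continuous_on A f" for f :: "'z :: topological_space \<Rightarrow> ec" and A
  proof (rule continuous_on_coordinatewise_then_product)
    fix i show "continuous_on A (\<lambda>p. \<rho> (f p) i)"
      unfolding \<rho>_def by (cases "i \<le> n") (simp_all add: continuous_on_ev that)
  qed
  have scEN: "r *\<^sub>R x \<in> EN l N" if "x \<in> EN l N" for r x using that by (simp add: EN)
  define nz where "nz x = (1 / norm x) *\<^sub>R x" for x :: ec
  have nz: "nz x \<in> EN l N" "norm (nz x) = 1" if "x \<in> EN l N" "x \<noteq> 0" for x
    using that by (auto simp: nz_def scEN)
  define H1 where "H1 p = \<rho> (nz (F (\<theta> (snd p)) (fst p)))" for p :: "real \<times> (nat \<Rightarrow> real)"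
  define f1 where "f1 z = nz (F (\<theta> z) 1)" for z :: "nat \<Rightarrow> real"
  \<comment> \<open>The segment from a unit vector to the antipode of \<open>nz e\<close> meets zero
    only at its midpoint, and only if that vector is \<open>nz e\<close>.\<close>
  define g2 where "g2 p = (1 - fst p) *\<^sub>R f1 (snd p) - fst p *\<^sub>R nz e" for p :: "real \<times> (nat \<Rightarrow> real)"
  define H2 where "H2 p = \<rho> (nz (g2 p))" for p
  have F_ok: "F (\<theta> z) u \<in> EN l N \<and> F (\<theta> z) u \<noteq> 0" if "z \<in> S" "u \<in> {0..1}" for z u
    using that by (intro FN \<theta>_EN \<theta>_norm)
  have Fc: "continuous_on ({0..1} \<times> S) (\<lambda>p. F (\<theta> (snd p)) (fst p))"
  proof -
    have 1: "continuous_on ({0..1} \<times> S) (\<lambda>p. (\<theta> (snd p), fst p))"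
      by (intro continuous_on_Pair continuous_on_compose2[OF \<theta>_cont[of UNIV]] continuous_intros) simp
    show ?thesis
      using continuous_on_compose2[OF F 1] \<theta>_EN \<theta>_norm by (auto simp: image_subset_iff)
  qed
  have nzc: "continuous_on A (\<lambda>p. nz (f p))" if "continuous_on A f" "\<And>p. p \<in> A \<Longrightarrow> f p \<noteq> 0"
    for f :: "real \<times> (nat \<Rightarrow> real) \<Rightarrow> ec" and A
    unfolding nz_def by (intro continuous_intros that) (use that in auto)
  have H1c: "continuous_on ({0..1} \<times> S) H1"
    unfolding H1_def by (intro \<rho>_cont nzc Fc) (use F_ok in auto)
  have H1S: "H1 p \<in> S" if "p \<in> {0..1} \<times> S" for p
    unfolding H1_def using F_ok[of "snd p" "fst p"] that by (intro \<rho>_S nz) auto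
  have f1: "f1 z \<in> EN l N" "norm (f1 z) = 1" if "z \<in> S" for z
    unfolding f1_def using F_ok[OF that, of 1] nz by auto
  have diffEN: "x - y \<in> EN l N" if "x \<in> EN l N" "y \<in> EN l N" for x y using that by (simp add: EN)
  have g2: "g2 p \<in> EN l N" "g2 p \<noteq> 0" if p: "p \<in> {0..1} \<times> S" for p
  proof -
    let ?u = "fst p" and ?z = "snd p"
    have u: "0 \<le> ?u" "?u \<le> 1" and z: "?z \<in> S" using p by auto
    show "g2 p \<in> EN l N" unfolding g2_def by (intro diffEN scEN f1 z nz e)
    show "g2 p \<noteq> 0"
    proof
      assume "g2 p = 0"
      then have eq: "(1 - ?u) *\<^sub>R f1 ?z = ?u *\<^sub>R nz e" by (simp add: g2_def)
      then have "norm ((1 - ?u) *\<^sub>R f1 ?z) = norm (?u *\<^sub>R nz e)" by simp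
      then have "1 - ?u = ?u" using u f1(2)[OF z] nz(2)[OF e] by simp
      with eq have "f1 ?z = nz e" by simp
      then have "F (\<theta> ?z) 1 = (norm (F (\<theta> ?z) 1) / norm e) *\<^sub>R e"
      proof -
        have "F (\<theta> ?z) 1 = norm (F (\<theta> ?z) 1) *\<^sub>R f1 ?z"
          using F_ok[OF z, of 1] by (simp add: f1_def nz_def)
        also have "\<dots> = (norm (F (\<theta> ?z) 1) / norm e) *\<^sub>R e"
          unfolding \<open>f1 ?z = nz e\<close> by (simp add: nz_def)
        finally show ?thesis .
      qed
      moreover have "0 < norm (F (\<theta> ?z) 1) / norm e" using F_ok[OF z, of 1] e(2) by simp
      ultimately show False using no \<theta>_EN[of ?z] \<theta>_norm[OF z] by blast
    qed
  qed
  have f1c: "continuous_on ({0..1::real} \<times> S) (\<lambda>p. f1 (snd p))"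
  proof -
    have 1: "continuous_on ({0..1::real} \<times> S) (\<lambda>p. (1 :: real, snd p))" by (intro continuous_intros)
    have "continuous_on ({0..1::real} \<times> S) (\<lambda>p. F (\<theta> (snd (1 :: real, snd p))) (fst (1 :: real, snd p)))"
      by (rule continuous_on_compose2[OF Fc 1]) auto
    then have 2: "continuous_on ({0..1::real} \<times> S) (\<lambda>p. F (\<theta> (snd p)) 1)" by simp
    show ?thesis unfolding f1_def by (rule nzc[OF 2]) (use F_ok in auto)
  qed
  have H2c: "continuous_on ({0..1} \<times> S) H2"
  proof -
    have "continuous_on ({0..1} \<times> S) g2" unfolding g2_def by (intro continuous_intros f1c)
    from nzc[OF this g2(2)] show ?thesis unfolding H2_def by (rule \<rho>_cont)
  qed
  have H2S: "H2 p \<in> S" if "p \<in> {0..1} \<times> S" for p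
    unfolding H2_def using g2[OF that] by (intro \<rho>_S nz)
  have hom: "homotopic_with_canon (\<lambda>_. True) S S (\<lambda>z. h (0, z)) (\<lambda>z. h (1, z))"
    if "continuous_on ({0..1} \<times> S) h" "\<And>p. p \<in> {0..1} \<times> S \<Longrightarrow> h p \<in> S" for h :: "real \<times> (nat \<Rightarrow> real) \<Rightarrow> nat \<Rightarrow> real"
    unfolding homotopic_with_def
    using that by (intro exI[of _ h]) (auto simp flip: subtopology_Times simp: Pi_iff image_subset_iff)
  have "homotopic_with_canon (\<lambda>_. True) S S (\<lambda>z. H1 (0, z)) (\<lambda>z. H1 (1, z))" by (rule hom[OF H1c H1S])
  moreover have "homotopic_with_canon (\<lambda>_. True) S S (\<lambda>z. H2 (0, z)) (\<lambda>z. H2 (1, z))" by (rule hom[OF H2c H2S])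
  moreover have "H2 (0, z) = H1 (1, z)" if "z \<in> S" for z
  proof -
    have "nz (f1 z) = f1 z" using f1(2)[OF that] by (simp add: nz_def)
    then show ?thesis by (simp add: H1_def H2_def g2_def f1_def)
  qed
  ultimately have "homotopic_with_canon (\<lambda>_. True) S S (\<lambda>z. H1 (0, z)) (\<lambda>z. H2 (1, z))"
    using homotopic_with_trans homotopic_with_eq[of "\<lambda>_. True" "top_of_set S" "top_of_set S" "\<lambda>z. H2 (0, z)" "\<lambda>z. H2 (1, z)" "\<lambda>z. H1 (1, z)" "\<lambda>z. H2 (1, z)"]
    by auto
  then have "homotopic_with_canon (\<lambda>_. True) S S id (\<lambda>z. \<rho> (nz (- nz e)))"
  proof (rule homotopic_with_eq)
    fix z assume "z \<in> topspace (top_of_set S)"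
    then have z: "z \<in> S" by simp
    obtain s where s: "0 < s" "F (\<theta> z) 0 = s *\<^sub>R \<theta> z" using F0[OF \<theta>_EN \<theta>_norm[OF z]] by blast
    have "nz (F (\<theta> z) 0) = \<theta> z" using s \<theta>_norm[OF z] by (simp add: nz_def)
    then show "id z = H1 (0, z)" using \<rho>_\<theta>[OF z] by (simp add: H1_def)
    show "\<rho> (nz (- nz e)) = H2 (1, z)" by (simp add: H2_def g2_def)
  qed simp
  then have "contractible S" unfolding contractible_def by blast
  then show False using not_contractible_coordinate_sphere[of n] by (simp add: S_def)
qed

section \<open>Intersection with a ray in infinite dimensions\<close>

context deform
begin

lemma start_scaled:
  assumes "x \<in> Es l" "Pp x = x"
  shows "a x 0 *\<^sub>R x + Pp (K x 0) = x"
proof -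
  have "Pp (dfm a b c K x 0) = Pp x" using start[OF assms(1)] by simp
  then show ?thesis using assms(2) by (simp add: dfm_def P_add P_scaleR)
qed

text \<open>On the unit sphere of E^+ the positive part of the deformation is \<open>a x u\<close>
  times \<open>x + \<kappa> x u\<close>, a compact perturbation of the identity; a positive factor
  is harmless when only rays matter.\<close>

definition \<kappa> :: "ec \<Rightarrow> real \<Rightarrow> ec" where "\<kappa> x u = (1 / a x u) *\<^sub>R Pp (K x u)"

lemma Sp_D: "x \<in> Sp l \<Longrightarrow> x \<in> Es l" "x \<in> Sp l \<Longrightarrow> Pp x = x" "x \<in> Sp l \<Longrightarrow> norm x = 1"
  by (auto simp: Sp_def)

lemma Sp_nz: "x \<in> Sp l \<Longrightarrow> Pp x \<noteq> 0"
  unfolding Sp_def by force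

lemma Pp_dfm: "x \<in> Sp l \<Longrightarrow> u \<in> {0..1} \<Longrightarrow> Pp (dfm a b c K x u) = a x u *\<^sub>R (x + \<kappa> x u)"
  using pos[OF Sp_D(1), of x u] Sp_D(2)[of x]
  by (simp add: dfm_def P_add P_scaleR \<kappa>_def scaleR_add_right)

lemma \<kappa>_cpt:
  assumes "\<And>m :: nat. s m \<in> Sp l" "\<And>m. v m \<in> {0..1}"
  shows "\<exists>(r :: nat \<Rightarrow> nat) k w. strict_mono r \<and> k \<in> Es l \<and> Pp k = k \<and> w \<in> {0..1} \<and>
    (\<lambda>m. v (r m)) \<longlonglongrightarrow> w \<and> (\<lambda>m. \<kappa> (s (r m)) (v (r m))) \<longlonglongrightarrow> k"
proof -
  obtain w q where q: "w \<in> {0..1}" "strict_mono q" "(\<lambda>m. v (q m)) \<longlonglongrightarrow> w"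
  proof (rule seq_compactE[OF compact_imp_seq_compact[OF compact_Icc[of 0 1]], of v])
    fix w q assume "w \<in> {0..1}" "strict_mono q" "(v \<circ> q) \<longlonglongrightarrow> w"
    then show thesis using that[of w q] by (simp add: o_def)
  qed (use assms(2) in simp)
  have A: "s (q m) \<in> Es l \<and> norm (s (q m)) \<le> 1 \<and> v (q m) \<in> {0..1}" for m
    using Sp_D[OF assms(1)] assms(2) by simp
  obtain r \<alpha> k where r: "strict_mono (r :: nat \<Rightarrow> nat)" "0 < \<alpha>" "k \<in> Es l"
      "(\<lambda>m. a (s (q (r m))) (v (q (r m)))) \<longlonglongrightarrow> \<alpha>" "(\<lambda>m. K (s (q (r m))) (v (q (r m)))) \<longlonglongrightarrow> k"
    using cpt[of "\<lambda>m. s (q m)" 1 "\<lambda>m. v (q m)", OF A] by blast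
  have "(\<lambda>m. \<kappa> (s (q (r m))) (v (q (r m)))) \<longlonglongrightarrow> (1 / \<alpha>) *\<^sub>R Pp k"
    unfolding \<kappa>_def using r(2) by (intro tendsto_intros r) simp
  moreover have "(\<lambda>m. v (q (r m))) \<longlonglongrightarrow> w"
    using LIMSEQ_subseq_LIMSEQ[OF q(3) r(1)] by (simp add: o_def)
  moreover have "strict_mono (\<lambda>m. q (r m))" using q(2) r(1) by (simp add: strict_mono_def)
  moreover have "(1 / \<alpha>) *\<^sub>R Pp k \<in> Es l" "Pp ((1 / \<alpha>) *\<^sub>R Pp k) = (1 / \<alpha>) *\<^sub>R Pp k"
    using r(3) by (simp_all add: Es_scaleR P_Es P_scaleR)
  ultimately show ?thesis using q(1) by blast
qed

lemma \<kappa>_cont: "continuous_on (Sp l \<times> {0..1}) (\<lambda>p. \<kappa> (fst p) (snd p))"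
proof -
  have sub: "Sp l \<times> {0..1} \<subseteq> Es l \<times> {0..1::real}" by (auto simp: Sp_def)
  have "continuous_on (Sp l \<times> {0..1}) (\<lambda>p. Pp (K (fst p) (snd p)))"
    unfolding Pp_def by (intro continuous_on_rst continuous_on_subset[OF cont_K sub])
  then show ?thesis
    unfolding \<kappa>_def
    by (intro continuous_on_scaleR continuous_on_divide continuous_on_const continuous_on_subset[OF cont_a sub])
      (use pos Sp_D(1) in force)+
qed

lemma Sp_closed:
  assumes "\<And>m :: nat. s m \<in> Sp l" "s \<longlonglongrightarrow> x"
  shows "x \<in> Sp l"
proof -
  have "x \<in> Es l" using Es_closed_seq[of s l x] assms Sp_D(1) by blast
  moreover have "Pp x = x"
    using LIMSEQ_unique[OF tendsto_P(1)[OF assms(2)], of x] assms Sp_D(2) by simp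
  moreover have "norm x = 1"
    using LIMSEQ_unique[OF tendsto_norm[OF assms(2)], of 1] assms(1) Sp_D(3) by simp
  ultimately show ?thesis by (simp add: Sp_def)
qed

lemma \<kappa>_seq_cont:
  assumes "\<And>m :: nat. s m \<in> Sp l" "s \<longlonglongrightarrow> x" "\<And>m. v m \<in> {0..1}" "v \<longlonglongrightarrow> w" "w \<in> {0..1}"
  shows "(\<lambda>m. \<kappa> (s m) (v m)) \<longlonglongrightarrow> \<kappa> x w"
  using continuous_on_tendsto_compose[OF \<kappa>_cont, of "\<lambda>m. (s m, v m)" "(x, w)" sequentially]
    tendsto_Pair[OF assms(2,4)] Sp_closed[OF assms(1,2)] assms by simp

text \<open>The identity plus a compact map is closed on the sphere, so a compact set of multiples
  of \<open>e\<close> that is missed is missed by a uniform margin.\<close>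

lemma \<kappa>_avoid:
  assumes Rr: "closed Rr" "bounded Rr" and no: "\<And>x u s. x \<in> Sp l \<Longrightarrow> u \<in> U \<Longrightarrow> s \<in> Rr \<Longrightarrow> x + \<kappa> x u \<noteq> s *\<^sub>R e"
    and U: "closed U" "U \<subseteq> {0..1}"
  shows "\<exists>d>0. \<forall>x\<in>Sp l. \<forall>u\<in>U. \<forall>s\<in>Rr. d \<le> norm (x + \<kappa> x u - s *\<^sub>R e)"
proof (rule ccontr)
  assume neg: "\<not> ?thesis"
  have "\<exists>x\<in>Sp l. \<exists>u\<in>U. \<exists>s\<in>Rr. norm (x + \<kappa> x u - s *\<^sub>R e) < 1 / (real m + 1)" for m :: nat
    using neg[simplified, rule_format, of "1 / (real m + 1)"] by (auto simp: not_le)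
  then obtain x u s where xs: "\<And>m. x m \<in> Sp l" "\<And>m. u m \<in> U" "\<And>m. s m \<in> Rr"
      "\<And>m :: nat. norm (x m + \<kappa> (x m) (u m) - s m *\<^sub>R e) < 1 / (real m + 1)" by metis
  have u01: "u m \<in> {0..1}" for m using xs(2) U(2) by blast
  have "compact Rr" using Rr by (simp add: compact_eq_bounded_closed)
  then obtain s' q where q: "s' \<in> Rr" "strict_mono q" "(\<lambda>m. s (q m)) \<longlonglongrightarrow> s'"
  proof (rule seq_compactE[OF compact_imp_seq_compact, of Rr s])
    fix w q assume "w \<in> Rr" "strict_mono q" "(s \<circ> q) \<longlonglongrightarrow> w"
    then show thesis using that[of w q] by (simp add: o_def)
  qed (use xs(3) in simp)
  obtain r k w where r: "strict_mono (r :: nat \<Rightarrow> nat)" "w \<in> {0..1}" "(\<lambda>m. u (q (r m))) \<longlonglongrightarrow> w"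
      "(\<lambda>m. \<kappa> (x (q (r m))) (u (q (r m)))) \<longlonglongrightarrow> k"
    using \<kappa>_cpt[of "\<lambda>m. x (q m)" "\<lambda>m. u (q m)"] xs(1) u01 by blast
  define t where "t m = q (r m)" for m
  have t: "strict_mono t" unfolding t_def using q(2) r(1) by (simp add: strict_mono_def)
  have w: "w \<in> U" using closed_sequentially[OF U(1), of "\<lambda>m. u (q (r m))" w] xs(2) r(3) by blast
  have st: "(\<lambda>m. s (t m)) \<longlonglongrightarrow> s'" unfolding t_def using LIMSEQ_subseq_LIMSEQ[OF q(3) r(1)] by (simp add: o_def)
  have z: "(\<lambda>m. x m + \<kappa> (x m) (u m) - s m *\<^sub>R e) \<longlonglongrightarrow> 0"
  proof (rule Lim_null_comparison)
    show "\<forall>\<^sub>F m in sequentially. norm (x m + \<kappa> (x m) (u m) - s m *\<^sub>R e) \<le> 1 / (real m + 1)"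
      using xs(4) by (intro always_eventually allI less_imp_le)
    show "(\<lambda>m. 1 / (real m + 1)) \<longlonglongrightarrow> 0"
      using LIMSEQ_inverse_real_of_nat by (simp add: inverse_eq_divide add.commute)
  qed
  have "(\<lambda>m. (x (t m) + \<kappa> (x (t m)) (u (t m)) - s (t m) *\<^sub>R e) - \<kappa> (x (t m)) (u (t m)) + s (t m) *\<^sub>R e) \<longlonglongrightarrow> 0 - k + s' *\<^sub>R e"
    using LIMSEQ_subseq_LIMSEQ[OF z t] r(4)
    by (intro tendsto_add tendsto_diff tendsto_scaleR tendsto_const st) (simp_all add: o_def t_def)
  then have xl: "(\<lambda>m. x (t m)) \<longlonglongrightarrow> s' *\<^sub>R e - k" by simp
  have xS: "s' *\<^sub>R e - k \<in> Sp l" by (rule Sp_closed[OF _ xl]) (rule xs(1))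
  have "(\<lambda>m. \<kappa> (x (t m)) (u (t m))) \<longlonglongrightarrow> \<kappa> (s' *\<^sub>R e - k) w"
    by (rule \<kappa>_seq_cont[OF xs(1) xl u01 _ r(2)]) (use r(3) in \<open>simp add: t_def\<close>)
  then have "\<kappa> (s' *\<^sub>R e - k) w = k" using LIMSEQ_unique r(4) by (simp add: t_def) blast
  then show False using no[OF xS w q(1)] by simp
qed

lemma \<kappa>_bounded: "\<exists>B. \<forall>x\<in>Sp l. \<forall>u\<in>{0..1}. norm (\<kappa> x u) \<le> B"
proof (rule ccontr)
  assume neg: "\<not> ?thesis"
  have "\<exists>x\<in>Sp l. \<exists>u\<in>{0..1}. real m < norm (\<kappa> x u)" for m :: nat
    using neg[simplified, rule_format, of "real m"] by (auto simp: not_le)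
  then obtain x u where xs: "\<And>m. x m \<in> Sp l" "\<And>m. u m \<in> {0..1}" "\<And>m :: nat. real m < norm (\<kappa> (x m) (u m))" by metis
  obtain r k where r: "strict_mono (r :: nat \<Rightarrow> nat)" "(\<lambda>m. \<kappa> (x (r m)) (u (r m))) \<longlonglongrightarrow> k"
    using \<kappa>_cpt[of x u, OF xs(1,2)] by blast
  have "Bseq (\<lambda>m. \<kappa> (x (r m)) (u (r m)))" using r(2) convergent_imp_Bseq convergent_def by blast
  then obtain B where B: "\<And>m. norm (\<kappa> (x (r m)) (u (r m))) \<le> B" by (auto simp: Bseq_def)
  obtain m :: nat where "B < real m" using reals_Archimedean2 by blast
  moreover have "real m \<le> real (r m)" using seq_suble[OF r(1), of m] by simp
  ultimately show False using B[of m] xs(3)[of "r m"] by linarith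
qed

lemma PN_le: "norm (PN N x) \<le> norm x" by (rule norm_rst_le)

text \<open>The truncations converge pointwise and do not increase norms, hence converge uniformly
  on the relatively compact image of \<open>\<kappa>\<close>.\<close>

lemma \<kappa>_PN:
  assumes "0 < \<delta>"
  shows "\<exists>N0. \<forall>N\<ge>N0. \<forall>x\<in>Sp l. \<forall>u\<in>{0..1}. norm (PN N (\<kappa> x u) - \<kappa> x u) < \<delta>"
proof (rule ccontr)
  assume neg: "\<not> ?thesis"
  have "\<exists>N x u. m \<le> N \<and> x \<in> Sp l \<and> u \<in> {0..1} \<and> \<delta> \<le> norm (PN N (\<kappa> x u) - \<kappa> x u)" for m :: nat
  proof -
    have "\<forall>N0. \<exists>N\<ge>N0. \<exists>x\<in>Sp l. \<exists>u\<in>{0..1}. \<delta> \<le> norm (PN N (\<kappa> x u) - \<kappa> x u)"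
      using neg by (auto simp: not_less)
    from spec[OF this, of m] show ?thesis by blast
  qed
  then obtain N x u where xs: "\<And>m. m \<le> N m" "\<And>m. x m \<in> Sp l" "\<And>m. u m \<in> {0..1}"
      "\<And>m :: nat. \<delta> \<le> norm (PN (N m) (\<kappa> (x m) (u m)) - \<kappa> (x m) (u m))" by metis
  obtain r k where r: "strict_mono (r :: nat \<Rightarrow> nat)" "(\<lambda>m. \<kappa> (x (r m)) (u (r m))) \<longlonglongrightarrow> k"
    using \<kappa>_cpt[of x u, OF xs(2,3)] by blast
  obtain M1 where M1: "\<And>m. M1 \<le> m \<Longrightarrow> norm (\<kappa> (x (r m)) (u (r m)) - k) < \<delta> / 4"
    using LIMSEQ_D[OF r(2), of "\<delta> / 4"] assms by auto
  obtain M2 where M2: "\<And>m. M2 \<le> m \<Longrightarrow> norm (PN m k - k) < \<delta> / 4"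
    using LIMSEQ_D[OF rst_An_tendsto[of k], of "\<delta> / 4"] assms by auto
  define m where "m = max M1 M2"
  let ?y = "\<kappa> (x (r m)) (u (r m))" and ?N = "N (r m)"
  have "M2 \<le> ?N" using xs(1)[of "r m"] seq_suble[OF r(1), of m] by (simp add: m_def)
  then have 1: "norm (PN ?N k - k) < \<delta> / 4" by (rule M2)
  have 2: "norm (?y - k) < \<delta> / 4" by (rule M1) (simp add: m_def)
  have 3: "norm (PN ?N (?y - k)) < \<delta> / 4" using PN_le[of ?N "?y - k"] 2 by linarith
  have eq: "PN ?N ?y - ?y = PN ?N (?y - k) + (PN ?N k - k) - (?y - k)" by (simp add: rst_diff)
  have "norm (PN ?N ?y - ?y) \<le> norm (PN ?N (?y - k)) + norm (PN ?N k - k) + norm (?y - k)"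
  proof -
    have "norm (A + B - C) \<le> norm A + norm B + norm C" for A B C :: ec
      using norm_triangle_ineq4[of "A + B" C] norm_triangle_ineq[of A B] by linarith
    then show ?thesis unfolding eq by blast
  qed
  then show False using xs(4)[of "r m"] 1 2 3 assms by linarith
qed

text \<open>If the ray is missed, it is missed by a margin, and so is zero during the homotopy.
  Truncation to finitely many modes costs less than these margins, and the truncated map would
  contradict the finite-dimensional statement.\<close>

lemma intersection:
  assumes e: "e \<in> Es l" "Pp e = e" "e \<noteq> 0"
  shows "\<exists>x\<in>Sp l. \<exists>s>0. Pp (dfm a b c K x 1) = s *\<^sub>R e"
proof (rule ccontr)
  assume neg: "\<not> ?thesis"
  \<comment> \<open>The value \<open>s = 0\<close> is excluded as well, since the positive part
    never vanishes; only then is the range of multiples closed, as \<open>\<kappa>_avoid\<close>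
    requires.\<close>
  have no: "x + \<kappa> x 1 \<noteq> s *\<^sub>R e" if "x \<in> Sp l" "0 \<le> s" for x s
  proof
    assume eq: "x + \<kappa> x 1 = s *\<^sub>R e"
    have "Pp (dfm a b c K x 1) = (a x 1 * s) *\<^sub>R e" using Pp_dfm[OF that(1), of 1] eq by simp
    moreover have "Pp (dfm a b c K x 1) \<noteq> 0"
      using nonvan[OF Sp_D(1)[OF that(1)], of 1] Sp_nz[OF that(1)] by simp
    ultimately show False
      using neg that pos[OF Sp_D(1)[OF that(1)], of 1] by (cases "s = 0") auto
  qed
  have no0: "x + \<kappa> x u \<noteq> 0" if "x \<in> Sp l" "u \<in> {0..1}" for x u
  proof
    assume "x + \<kappa> x u = 0"
    then have "Pp (dfm a b c K x u) = 0" using Pp_dfm[OF that] by simp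
    then show False using nonvan[OF Sp_D(1)[OF that(1)] that(2)] Sp_nz[OF that(1)] by simp
  qed
  obtain B where B: "\<And>x u. x \<in> Sp l \<Longrightarrow> u \<in> {0..1} \<Longrightarrow> norm (\<kappa> x u) \<le> B" using \<kappa>_bounded by blast
  \<comment> \<open>Bounds the multiple \<open>s\<close> that the truncated problem can produce: its
    image has norm at most \<open>1 + \<bar>B\<bar>\<close>, and the truncated \<open>e\<close>
    keeps at least half of its norm.\<close>
  define M where "M = 2 * (1 + \<bar>B\<bar>) / norm e + 1"
  have M: "0 < M" using e(3) by (simp add: M_def add_pos_nonneg)
  obtain d1 where d1: "0 < d1" "\<And>x u. x \<in> Sp l \<Longrightarrow> u \<in> {0..1} \<Longrightarrow> d1 \<le> norm (x + \<kappa> x u)"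
    using \<kappa>_avoid[of "{0}" "{0..1}" e] no0 by auto
  obtain d2 where d2: "0 < d2" "\<And>x s. x \<in> Sp l \<Longrightarrow> s \<in> {0..M} \<Longrightarrow> d2 \<le> norm (x + \<kappa> x 1 - s *\<^sub>R e)"
    using \<kappa>_avoid[of "{0..M}" "{1}" e] no by auto
  define \<delta> where "\<delta> = min d1 d2 / 2"
  have \<delta>: "0 < \<delta>" using d1(1) d2(1) by (simp add: \<delta>_def)
  obtain N0 where N0: "\<And>N x u. N0 \<le> N \<Longrightarrow> x \<in> Sp l \<Longrightarrow> u \<in> {0..1} \<Longrightarrow> norm (PN N (\<kappa> x u) - \<kappa> x u) < \<delta>"
    using \<kappa>_PN[OF \<delta>] by blast
  \<comment> \<open>The first entry makes replacing the truncated \<open>e\<close> by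
    \<open>e\<close> cost at most \<open>\<delta>\<close> for multiples up to \<open>M\<close>; the
    second keeps half the norm of \<open>e\<close>.\<close>
  define \<delta>' where "\<delta>' = min (\<delta> / M) (norm e / 2)"
  have \<delta>': "0 < \<delta>'" using \<delta> M e(3) by (simp add: \<delta>'_def)
  obtain N1 where N1: "\<And>N. N1 \<le> N \<Longrightarrow> norm (PN N e - e) < \<delta>'"
    using LIMSEQ_D[OF rst_An_tendsto[of e] \<delta>'] by blast
  define N where "N = Suc (max N0 N1)"
  have N: "N0 \<le> N" "N1 \<le> N" "0 < N" by (auto simp: N_def)
  have eN: "norm (PN N e - e) < \<delta> / M" "norm (PN N e - e) < norm e / 2" using N1[OF N(2)] by (auto simp: \<delta>'_def)
  have eN2: "norm e / 2 \<le> norm (PN N e)"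
    using norm_triangle_ineq2[of e "e - PN N e"] eN(2) by (simp add: norm_minus_commute)
  have "\<exists>cc. ev e cc \<noteq> 0" using e(3) ell2_eqI[of e 0] by auto
  then have l0: "0 < l" using Es_nz[OF e(1)] by (metis gr_implies_not_zero not_gr_zero prod.exhaust)
  have ENI: "PN N y \<in> EN l N" if "y \<in> Es l" "Pp y = y" for y
  proof -
    have "ev y (j, i) = 0" if "\<not> 0 < j" for j i
      using arg_cong[OF \<open>Pp y = y\<close>, of "\<lambda>z. ev z (j, i)"] that by simp
    then show ?thesis using Es_nz[OF that(1)] by (fastforce simp: EN_def)
  qed
  have ENS: "x \<in> Sp l \<and> PN N x = x" if "x \<in> EN l N" "norm x = 1" for x
  proof -
    have x0: "ev x (j, i) = 0" if "\<not> (1 \<le> j \<and> j \<le> int N \<and> i < l)" for j i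
      using \<open>x \<in> EN l N\<close> that by (auto simp: EN_def)
    have "x \<in> Es l" using x0 by (auto simp: Es_def)
    moreover have "Pp x = x" "PN N x = x" using x0 by (auto intro!: pair_ell2_eqI)
    ultimately show ?thesis using that(2) by (simp add: Sp_def)
  qed
  define F where "F x u = x + PN N (\<kappa> x u)" for x u
  have \<kappa>Es: "\<kappa> x u \<in> Es l" "Pp (\<kappa> x u) = \<kappa> x u" if "x \<in> Sp l" "u \<in> {0..1}" for x u
    using K_Es[OF Sp_D(1)[OF that(1)] that(2)] by (simp_all add: \<kappa>_def Es_scaleR P_Es P_scaleR)
  have Fdiff: "norm (F x u - (x + \<kappa> x u)) < \<delta>" if "x \<in> Sp l" "u \<in> {0..1}" for x u
    using N0[OF N(1) that] by (simp add: F_def)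
  have "\<exists>x\<in>EN l N. norm x = 1 \<and> (\<exists>s>0. F x 1 = s *\<^sub>R PN N e)"
  proof (rule finite_dim_no_null_homotopy)
    show "0 < N * l" using N(3) l0 by simp
    have sub: "(EN l N \<inter> sphere 0 1) \<times> {0..1} \<subseteq> Sp l \<times> {0..1::real}" using ENS by auto
    show "continuous_on ((EN l N \<inter> sphere 0 1) \<times> {0..1}) (\<lambda>p. F (fst p) (snd p))"
      unfolding F_def by (intro continuous_intros continuous_on_subset[OF \<kappa>_cont sub])
    show "F x u \<in> EN l N \<and> F x u \<noteq> 0" if "x \<in> EN l N" "norm x = 1" "u \<in> {0..1}" for x u
    proof
      have xS: "x \<in> Sp l" using ENS that by blast
      show "F x u \<in> EN l N"
        using that(1) ENI[OF \<kappa>Es[OF xS that(3)]] by (simp add: F_def EN_def)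
      have "d1 \<le> norm (x + \<kappa> x u)" by (rule d1(2)[OF xS that(3)])
      moreover have "\<delta> < d1" using d1(1) d2(1) by (simp add: \<delta>_def)
      ultimately have "norm (F x u - (x + \<kappa> x u)) < norm (x + \<kappa> x u)" using Fdiff[OF xS that(3)] by linarith
      then show "F x u \<noteq> 0" unfolding norm_minus_commute[of "F x u"] by auto
    qed
    show "\<exists>s>0. F x 0 = s *\<^sub>R x" if "x \<in> EN l N" "norm x = 1" for x
    proof -
      have xS: "x \<in> Sp l" "PN N x = x" using ENS that by blast+
      have a0: "0 < a x 0" using pos[OF Sp_D(1)[OF xS(1)], of 0] by simp
      have "a x 0 *\<^sub>R (x + \<kappa> x 0) = x"
        using start_scaled[OF Sp_D(1,2)[OF xS(1)]] a0 by (simp add: \<kappa>_def scaleR_add_right)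
      then have "x + \<kappa> x 0 = (1 / a x 0) *\<^sub>R x" using a0
        by (metis (no_types) divide_inverse_commute mult_1 order_less_irrefl right_inverse scaleR_one scaleR_scaleR mult.commute inverse_eq_divide)
      then have "PN N (x + \<kappa> x 0) = (1 / a x 0) *\<^sub>R x" using xS(2) by (simp add: rst_scaleR)
      then have "F x 0 = (1 / a x 0) *\<^sub>R x" using xS(2) by (simp add: F_def rst_add)
      then show ?thesis using a0 by (intro exI[of _ "1 / a x 0"]) simp
    qed
    show "PN N e \<in> EN l N" by (rule ENI[OF e(1,2)])
    show "PN N e \<noteq> 0" using eN2 e(3) by auto
  qed
  then obtain x s where xs: "x \<in> EN l N" "norm x = 1" "0 < s" "F x 1 = s *\<^sub>R PN N e" by blast
  have xS: "x \<in> Sp l" using ENS xs by blast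
  have "norm (F x 1) \<le> 1 + \<bar>B\<bar>"
  proof -
    have "norm (F x 1) \<le> norm x + norm (PN N (\<kappa> x 1))" unfolding F_def by (rule norm_triangle_ineq)
    then show ?thesis using PN_le[of N "\<kappa> x 1"] B[OF xS, of 1] xs(2) by simp
  qed
  then have "s * norm (PN N e) \<le> 1 + \<bar>B\<bar>" using xs(3,4) by simp
  moreover have "s * (norm e / 2) \<le> s * norm (PN N e)" using xs(3) eN2 by (intro mult_left_mono) auto
  ultimately have "s * (norm e / 2) \<le> 1 + \<bar>B\<bar>" by linarith
  then have "s \<le> 2 * (1 + \<bar>B\<bar>) / norm e" using e(3) by (simp add: pos_le_divide_eq)
  then have sM: "s \<in> {0..M}" using xs(3) by (simp add: M_def)
  have "d2 \<le> norm (x + \<kappa> x 1 - s *\<^sub>R e)" by (rule d2(2)[OF xS sM])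
  also have "x + \<kappa> x 1 - s *\<^sub>R e = s *\<^sub>R (PN N e - e) - (F x 1 - (x + \<kappa> x 1))"
    using xs(4) by (simp add: scaleR_diff_right)
  also have "norm \<dots> \<le> norm (s *\<^sub>R (PN N e - e)) + norm (F x 1 - (x + \<kappa> x 1))" by (rule norm_triangle_ineq4)
  also have "norm (s *\<^sub>R (PN N e - e)) \<le> M * (\<delta> / M)"
    using sM eN(1) M by (simp only: norm_scaleR) (intro mult_mono, auto)
  finally have "d2 < M * (\<delta> / M) + \<delta>" using Fdiff[OF xS, of 1] by simp
  then have "d2 < 2 * \<delta>" using M by simp
  then show False by (simp add: \<delta>_def)
qed

end

section \<open>Translation between coefficient families and the Hilbert space\<close>

lemma Espace_bound:
  assumes "x \<in> Espace l"
  obtains B where "\<And>F. finite F \<Longrightarrow> (\<Sum>c\<in>F. (wt c * x (fst c) (snd c))\<^sup>2) \<le> B"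
proof -
  let ?q = "\<lambda>j. \<bar>real_of_int j\<bar> * (\<Sum>i<l. (x j i)\<^sup>2)"
  have E: "(\<forall>j i. l \<le> i \<longrightarrow> x j i = 0) \<and> ?q summable_on UNIV"
    using assms unfolding Espace_def by (rule CollectD)
  have x0: "x j i = 0" if "\<not> i < l" for j i
    using conjunct1[OF E, rule_format, of i j] that by linarith
  note s = conjunct2[OF E]
  define B where "B = (\<Sum>i<l. (x 0 i)\<^sup>2) + 2 * pi * infsum ?q UNIV"
  have "(\<Sum>c\<in>F. (wt c * x (fst c) (snd c))\<^sup>2) \<le> B" if F: "finite F" for F
  proof -
    let ?J = "fst ` F"
    have fJ: "finite ?J" using F by simp
    have "(\<Sum>c\<in>F. (wt c * x (fst c) (snd c))\<^sup>2) = (\<Sum>c\<in>F \<inter> UNIV \<times> {..<l}. (wt c * x (fst c) (snd c))\<^sup>2)"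
    proof (rule sum.mono_neutral_right[OF F])
      show "\<forall>c\<in>F - F \<inter> UNIV \<times> {..<l}. (wt c * x (fst c) (snd c))\<^sup>2 = 0"
      proof
        fix c assume "c \<in> F - F \<inter> UNIV \<times> {..<l}"
        then have "\<not> snd c < l" by (simp add: mem_Times_iff)
        from x0[OF this, of "fst c"] show "(wt c * x (fst c) (snd c))\<^sup>2 = 0" by simp
      qed
    qed simp
    also have "\<dots> \<le> (\<Sum>c\<in>?J \<times> {..<l}. (wt c * x (fst c) (snd c))\<^sup>2)"
      by (rule sum_mono2) (auto simp: fJ intro: rev_image_eqI)
    also have "\<dots> = (\<Sum>j\<in>?J. \<Sum>i<l. (wt (j, i) * x j i)\<^sup>2)"
      by (simp add: sum.cartesian_product case_prod_beta)
    also have "\<dots> = (\<Sum>j\<in>?J. (if j = 0 then (\<Sum>i<l. (x 0 i)\<^sup>2) else 0) + 2 * pi * ?q j)"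
      by (intro sum.cong refl) (simp add: power_mult_distrib wt_sq sum_distrib_left mult.assoc)
    also have "\<dots> = (\<Sum>j\<in>?J. (if j = 0 then (\<Sum>i<l. (x 0 i)\<^sup>2) else 0)) + 2 * pi * (\<Sum>j\<in>?J. ?q j)"
      by (simp only: sum.distrib sum_distrib_left)
    also have "\<dots> \<le> B"
      unfolding B_def
    proof (intro add_mono mult_left_mono)
      show "(\<Sum>j\<in>?J. (if j = 0 then (\<Sum>i<l. (x 0 i)\<^sup>2) else 0)) \<le> (\<Sum>i<l. (x 0 i)\<^sup>2)"
        using fJ by (auto simp: sum_nonneg)
      show "(\<Sum>j\<in>?J. ?q j) \<le> infsum ?q UNIV"
      proof (rule finite_sum_le_infsum[OF s fJ subset_UNIV])
        show "0 \<le> ?q j" for j by (intro mult_nonneg_nonneg sum_nonneg) simp_all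
      qed
    qed simp
    finally show ?thesis .
  qed
  then show thesis by (rule that)
qed

lemma ev_toE: "x \<in> Espace l \<Longrightarrow> ev (toE x) (j, i) = wt (j, i) * x j i"
  unfolding toE_def by (erule Espace_bound, subst ell2_of_bound(2)) (assumption, simp)

lemma toE_Es: "x \<in> Espace l \<Longrightarrow> toE x \<in> Es l"
  by (simp add: Es_def ev_toE Espace_def)

lemma ofE_toE: "x \<in> Espace l \<Longrightarrow> ofE (toE x) = x"
  by (intro ext) (simp add: ofE_def ev_toE)

lemma ofE_Espace:
  assumes "\<xi> \<in> Es l"
  shows "ofE \<xi> \<in> Espace l"
proof -
  have "(\<lambda>j. \<bar>real_of_int j\<bar> * (\<Sum>i<l. (ofE \<xi> j i)\<^sup>2)) summable_on UNIV"
  proof (rule nonneg_bdd_above_summable_on)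
    show "bdd_above (sum (\<lambda>j. \<bar>real_of_int j\<bar> * (\<Sum>i<l. (ofE \<xi> j i)\<^sup>2)) ` {F. F \<subseteq> UNIV \<and> finite F})"
    proof (rule bdd_aboveI2)
      fix J :: "int set" assume "J \<in> {F. F \<subseteq> UNIV \<and> finite F}"
      then have J: "finite J" by simp
      have le: "\<bar>real_of_int j\<bar> * (ofE \<xi> j i)\<^sup>2 \<le> (ev \<xi> (j, i))\<^sup>2" for j i
      proof (cases "j = 0")
        case False
        have "\<bar>real_of_int j\<bar> * 1 \<le> \<bar>real_of_int j\<bar> * (2 * pi)" using pi_gt3 by (intro mult_left_mono) auto
        then have "\<bar>real_of_int j\<bar> \<le> (wt (j, i))\<^sup>2" using False by (simp add: wt_sq mult.commute)
        then have "\<bar>real_of_int j\<bar> * (ofE \<xi> j i)\<^sup>2 \<le> (wt (j, i))\<^sup>2 * (ofE \<xi> j i)\<^sup>2" by (rule mult_right_mono) simp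
        then show ?thesis by (simp add: ofE_def power_divide)
      qed simp
      have "(\<Sum>j\<in>J. \<bar>real_of_int j\<bar> * (\<Sum>i<l. (ofE \<xi> j i)\<^sup>2)) \<le> (\<Sum>j\<in>J. \<Sum>i<l. (ev \<xi> (j, i))\<^sup>2)"
        unfolding sum_distrib_left by (intro sum_mono le)
      also have "\<dots> = (\<Sum>c\<in>J \<times> {..<l}. (ev \<xi> c)\<^sup>2)" by (simp add: sum.cartesian_product case_prod_beta)
      also have "\<dots> \<le> (norm \<xi>)\<^sup>2" using J by (intro sum_sq_le_norm) simp
      finally show "(\<Sum>j\<in>J. \<bar>real_of_int j\<bar> * (\<Sum>i<l. (ofE \<xi> j i)\<^sup>2)) \<le> (norm \<xi>)\<^sup>2" .
    qed
    show "0 \<le> \<bar>real_of_int j\<bar> * (\<Sum>i<l. (ofE \<xi> j i)\<^sup>2)" for j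
      by (intro mult_nonneg_nonneg sum_nonneg) simp_all
  qed
  then show ?thesis using assms by (simp add: Espace_def ofE_def Es_def)
qed

lemma toE_ofE: "\<xi> \<in> Es l \<Longrightarrow> toE (ofE \<xi>) = \<xi>"
  by (rule pair_ell2_eqI) (subst ev_toE[OF ofE_Espace], auto simp: ofE_def)

text \<open>The double series is summed row by row over frequencies. The row of frequency zero has
  weight 1 instead of 2 pi |j|, which produces the separate constant term.\<close>

lemma E_inner_toE:
  assumes x: "x \<in> Espace l" and y: "y \<in> Espace l"
  shows "E_inner l x y = inner (toE x) (toE y)"
proof -
  let ?p = "\<lambda>c. ev (toE x) c * ev (toE y) c"
  let ?q = "\<lambda>j. 2 * pi * \<bar>real_of_int j\<bar> * (\<Sum>i<l. x j i * y j i)"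
  let ?z = "\<lambda>j. if j = (0::int) then (\<Sum>i<l. x 0 i * y 0 i) else 0"
  have p: "?p summable_on UNIV" by (intro prod_summable ev_summable)
  then have p': "(\<lambda>(j, i). ?p (j, i)) summable_on (SIGMA j:UNIV. {..<l})"
    using summable_on_subset_banach[OF p, of "UNIV \<times> {..<l}"] by (simp add: split_def)
  have row: "infsum (\<lambda>i. ?p (j, i)) {..<l} = ?q j + ?z j" for j
  proof -
    have "infsum (\<lambda>i. ?p (j, i)) {..<l} = (\<Sum>i<l. (wt (j, i))\<^sup>2 * (x j i * y j i))"
      by (simp add: ev_toE[OF x] ev_toE[OF y] power2_eq_square ac_simps)
    also have "\<dots> = ?q j + ?z j"
      by (cases "j = 0") (simp_all add: wt_sq sum_distrib_left)
    finally show ?thesis .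
  qed
  have "inner (toE x) (toE y) = infsum ?p (SIGMA j:UNIV. {..<l})"
    unfolding inner_infsum
  proof (rule infsum_cong_neutral)
    fix c :: "int \<times> nat" assume "c \<in> UNIV - UNIV \<times> {..<l}"
    then have "\<not> snd c < l" by (simp add: mem_Times_iff)
    then have "ev (toE x) (fst c, snd c) = 0" using Es_nz[OF toE_Es[OF x]] by blast
    then show "?p c = 0" by simp
  qed simp_all
  also have "\<dots> = infsum (\<lambda>(j, i). ?p (j, i)) (SIGMA j:UNIV. {..<l})" by (simp add: split_def)
  also have "\<dots> = infsum (\<lambda>j. infsum (\<lambda>i. ?p (j, i)) {..<l}) UNIV"
    by (rule infsum_Sigma'_banach[OF p', symmetric])
  also have "\<dots> = infsum (\<lambda>j. ?q j + ?z j) UNIV" unfolding row ..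
  also have "\<dots> = infsum ?q UNIV + infsum ?z UNIV"
  proof (rule infsum_add)
    have "(\<lambda>j. infsum (\<lambda>i. ?p (j, i)) {..<l}) summable_on UNIV"
      by (rule summable_on_Sigma_banach[OF p'])
    then have 1: "(\<lambda>j. ?q j + ?z j) summable_on UNIV" unfolding row .
    have "?z summable_on {0}" by simp
    then show 2: "?z summable_on UNIV"
      by (rule summable_on_cong_neutral[THEN iffD1, rotated -1]) simp_all
    show "?q summable_on UNIV"
    proof -
      have gen: "r + w + (-1) * w = r" for r w :: real by simp
      have "(\<lambda>j. (?q j + ?z j) + (-1) * ?z j) summable_on UNIV"
        by (rule summable_on_add[OF 1 summable_on_cmult_right[OF 2]])
      then show ?thesis unfolding gen .
    qed
  qed
  also have "infsum ?z UNIV = infsum ?z {0}" by (rule infsum_cong_neutral) auto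
  finally show ?thesis by (simp add: E_inner_def)
qed

lemma E_norm_toE: "x \<in> Espace l \<Longrightarrow> E_norm l x = norm (toE x)"
  by (simp add: E_norm_def E_inner_toE norm_eq_sqrt_inner)

lemma E_norm_ofE: "\<xi> \<in> Es l \<Longrightarrow> E_norm l (ofE \<xi>) = norm \<xi>"
  by (simp add: E_norm_toE[OF ofE_Espace] toE_ofE)

lemma ofE_diff: "E_diff (ofE \<xi>) (ofE \<eta>) = ofE (\<xi> - \<eta>)"
  by (simp add: E_diff_def ofE_def diff_divide_distrib)

lemma E_norm_diff: "\<xi> \<in> Es l \<Longrightarrow> \<eta> \<in> Es l \<Longrightarrow> E_norm l (E_diff (ofE \<xi>) (ofE \<eta>)) = norm (\<xi> - \<eta>)"
  by (simp add: ofE_diff E_norm_ofE Es_diff)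

lemma E_norm_diff': "x \<in> Espace l \<Longrightarrow> y \<in> Espace l \<Longrightarrow> E_norm l (E_diff x y) = norm (toE x - toE y)"
  using E_norm_diff[OF toE_Es toE_Es, of x l y] by (simp add: ofE_toE)

lemma Eplus_ofE: "Eplus (ofE \<xi>) = ofE (Pp \<xi>)"
  and Eminus_ofE: "Eminus (ofE \<xi>) = ofE (Pm \<xi>)"
  by (auto simp: Eplus_def Eminus_def ofE_def fun_eq_iff)

lemma ofE_zero: "ofE 0 = (\<lambda>j i. 0)"
  by (simp add: ofE_def)

lemma ofE_eq_iff: "\<xi> \<in> Es l \<Longrightarrow> \<eta> \<in> Es l \<Longrightarrow> ofE \<xi> = ofE \<eta> \<longleftrightarrow> \<xi> = \<eta>"
  using toE_ofE by metis

lemma Esphere_plus_ofE: "Esphere_plus l = ofE ` Sp l"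
proof (intro equalityI subsetI)
  fix x assume x: "x \<in> Esphere_plus l"
  then have X: "x \<in> Espace l" "Eplus x = x" "E_norm l x = 1" by (auto simp: Esphere_plus_def)
  have "ofE (Pp (toE x)) = ofE (toE x)" using X(2) ofE_toE[OF X(1)] by (simp flip: Eplus_ofE)
  then have "Pp (toE x) = toE x" using ofE_eq_iff[OF P_Es(1) , OF toE_Es toE_Es] X(1) by blast
  then have "toE x \<in> Sp l" using X toE_Es[OF X(1)] by (simp add: Sp_def E_norm_toE)
  then show "x \<in> ofE ` Sp l" using ofE_toE[OF X(1)] by force
next
  fix x assume "x \<in> ofE ` Sp l"
  then show "x \<in> Esphere_plus l"
    by (auto simp: Esphere_plus_def Sp_def ofE_Espace Eplus_ofE E_norm_ofE)
qed

lemma pnt_lp: "pnt (lp l \<xi> t) = Eloop l (ofE \<xi>) t"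
  using is_loop_of_Eloop[of l \<xi>] by (simp add: lp_def pnt_iota is_loop_of_def)

lemma PhiH_ofE: "\<xi> \<in> Es l \<Longrightarrow> PhiH l H (ofE \<xi>) = Phi l (\<lambda>v. H (pnt v)) \<xi>"
  by (simp add: PhiH_def Phi_def Act_def IG_def Eplus_ofE Eminus_ofE E_norm_ofE P_Es pnt_lp integral_MI)

lemma Edeform_ofE:
  "Edeform (\<lambda>x. a (toE x)) (\<lambda>x. b (toE x)) (\<lambda>x. c (toE x)) (\<lambda>x u. ofE (K (toE x) u)) x u = ofE (dfm a b c K (toE x) u)"
  if "x \<in> Espace l"
proof -
  have x: "x j i = ev (toE x) (j, i) / wt (j, i)" for j i using ev_toE[OF that] by simp
  show ?thesis
    unfolding Edeform_def by (intro ext, subst x) (simp add: ofE_def dfm_def add_divide_distrib)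
qed

lemma continuous_on_pair_iff:
  fixes f :: "ec \<Rightarrow> real \<Rightarrow> 'b :: metric_space"
  shows "continuous_on (Es l \<times> {0..1}) (\<lambda>p. f (fst p) (snd p)) \<longleftrightarrow>
    (\<forall>x\<in>Es l. \<forall>u\<in>{0..1}. \<forall>e>0. \<exists>d>0. \<forall>x'\<in>Es l. \<forall>u'\<in>{0..1}.
       norm (x' - x) < d \<and> \<bar>u' - u\<bar> < d \<longrightarrow> dist (f x' u') (f x u) < e)" (is "_ \<longleftrightarrow> ?R")
proof -
  have lt: "dist (x', u') (x, u) < d" if "norm (x' - x) < d / 2" "\<bar>u' - u\<bar> < d / 2" for x x' :: ec and u u' d :: real
  proof -
    have "dist (x', u') (x, u) = sqrt ((norm (x' - x))\<^sup>2 + (\<bar>u' - u\<bar>)\<^sup>2)"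
      by (simp add: dist_norm norm_Pair)
    also have "\<dots> \<le> norm (x' - x) + \<bar>u' - u\<bar>" by (rule sqrt_sum_squares_le_sum) auto
    finally show ?thesis using that by linarith
  qed
  have ge: "norm (x' - x) < d \<and> \<bar>u' - u\<bar> < d" if "dist (x', u') (x, u) < d" for x x' :: ec and u u' d :: real
    using that dist_fst_le[of "(x', u')" "(x, u)"] dist_snd_le[of "(x', u')" "(x, u)"] by (simp add: dist_norm dist_real_def)
  show ?thesis
  proof
    assume L: "continuous_on (Es l \<times> {0..1}) (\<lambda>p. f (fst p) (snd p))"
    show "?R"
    proof (intro ballI allI impI)
      fix x :: ec and u e :: real assume xu: "x \<in> Es l" "u \<in> {0..1}" "0 < e"
      obtain d where d: "0 < d" "\<And>p. p \<in> Es l \<times> {0..1} \<Longrightarrow> dist p (x, u) < d \<Longrightarrow> dist (f (fst p) (snd p)) (f x u) < e"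
        using L[unfolded continuous_on_iff, rule_format, of "(x, u)" e] xu by auto
      show "\<exists>d>0. \<forall>x'\<in>Es l. \<forall>u'\<in>{0..1}. norm (x' - x) < d \<and> \<bar>u' - u\<bar> < d \<longrightarrow> dist (f x' u') (f x u) < e"
      proof (intro exI[of _ "d / 2"] conjI ballI impI)
        fix x' u' assume "x' \<in> Es l" "u' \<in> {0..1::real}" "norm (x' - x) < d / 2 \<and> \<bar>u' - u\<bar> < d / 2"
        then show "dist (f x' u') (f x u) < e" using d(2)[of "(x', u')"] lt[of x' x d u' u] by simp
      qed (use d in simp)
    qed
  next
    assume R: "?R"
    show "continuous_on (Es l \<times> {0..1}) (\<lambda>p. f (fst p) (snd p))"
      unfolding continuous_on_iff
    proof (intro ballI allI impI)
      fix p and e :: real assume p: "p \<in> Es l \<times> {0..1::real}" "0 < e"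
      obtain x u where xu: "p = (x, u)" "x \<in> Es l" "u \<in> {0..1}" using p(1) by (cases p) auto
      obtain d where d: "0 < d" "\<And>x' u'. x' \<in> Es l \<Longrightarrow> u' \<in> {0..1} \<Longrightarrow> norm (x' - x) < d \<Longrightarrow> \<bar>u' - u\<bar> < d \<Longrightarrow> dist (f x' u') (f x u) < e"
        using R xu(2,3) p(2) by meson
      show "\<exists>d>0. \<forall>q\<in>Es l \<times> {0..1}. dist q p < d \<longrightarrow> dist (f (fst q) (snd q)) (f (fst p) (snd p)) < e"
      proof (intro exI[of _ d] conjI ballI impI)
        fix q assume q: "q \<in> Es l \<times> {0..1::real}" "dist q p < d"
        obtain x' u' where xu': "q = (x', u')" "x' \<in> Es l" "u' \<in> {0..1}" using q(1) by (cases q) auto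
        then show "dist (f (fst q) (snd q)) (f (fst p) (snd p)) < e"
          using d(2)[of x' u'] ge[of x' u' x u d] q(2) xu(1) by simp
      qed (use d in simp)
    qed
  qed
qed

abbreviation E_close ::
    "nat \<Rightarrow> (ecoef \<Rightarrow> real \<Rightarrow> real) \<Rightarrow> (ecoef \<Rightarrow> real \<Rightarrow> real) \<Rightarrow> (ecoef \<Rightarrow> real \<Rightarrow> real)
      \<Rightarrow> (ecoef \<Rightarrow> real \<Rightarrow> ecoef) \<Rightarrow> ecoef \<Rightarrow> real \<Rightarrow> real \<Rightarrow> bool" where
  "E_close l a b c K x u e \<equiv> \<exists>\<delta>>0. \<forall>x'\<in>Espace l. \<forall>u'\<in>{0..1}.
           E_norm l (E_diff x' x) < \<delta> \<and> \<bar>u' - u\<bar> < \<delta> \<longrightarrow>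
             \<bar>a x' u' - a x u\<bar> < e \<and> \<bar>b x' u' - b x u\<bar> < e \<and> \<bar>c x' u' - c x u\<bar> < e \<and>
             E_norm l (E_diff (K x' u') (K x u)) < e"

abbreviation E_convergent_subfamily ::
    "nat \<Rightarrow> (ecoef \<Rightarrow> real \<Rightarrow> real) \<Rightarrow> (ecoef \<Rightarrow> real \<Rightarrow> real) \<Rightarrow> (ecoef \<Rightarrow> real \<Rightarrow> real)
      \<Rightarrow> (ecoef \<Rightarrow> real \<Rightarrow> ecoef) \<Rightarrow> (nat \<Rightarrow> ecoef) \<Rightarrow> (nat \<Rightarrow> real) \<Rightarrow> bool" where
  "E_convergent_subfamily l a b c K s v \<equiv> \<exists>(r :: nat \<Rightarrow> nat) \<alpha> \<beta> \<gamma> k. strict_mono r \<and> 0 < \<alpha> \<and> 0 < \<beta> \<and> 0 < \<gamma> \<and> k \<in> Espace l \<and>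
              (\<lambda>m. a (s (r m)) (v (r m))) \<longlonglongrightarrow> \<alpha> \<and>
              (\<lambda>m. b (s (r m)) (v (r m))) \<longlonglongrightarrow> \<beta> \<and>
              (\<lambda>m. c (s (r m)) (v (r m))) \<longlonglongrightarrow> \<gamma> \<and>
              (\<lambda>m. E_norm l (E_diff (K (s (r m)) (v (r m))) k)) \<longlonglongrightarrow> 0"

text \<open>Coefficient functions are composed with \<open>ofE\<close>, and the values of the
  compact part with \<open>toE\<close>; these maps are isometries, so continuity and compactness
  carry over.\<close>

lemma deform_of_admissible:
  assumes "admissible_deformation l g"
  obtains a b c K where "deform l a b c K" "\<And>\<xi>. \<xi> \<in> Es l \<Longrightarrow> g (ofE \<xi>) = ofE (dfm a b c K \<xi> 1)"
proof -
  obtain a b c K where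
    pos: "\<And>x u. x \<in> Espace l \<Longrightarrow> u \<in> {0..1} \<Longrightarrow> 0 < a x u \<and> 0 < b x u \<and> 0 < c x u \<and> K x u \<in> Espace l"
    and cont: "\<And>x u e. x \<in> Espace l \<Longrightarrow> u \<in> {0..1} \<Longrightarrow> 0 < e \<Longrightarrow> E_close l a b c K x u e"
    and cpt: "\<And>R (s :: nat \<Rightarrow> ecoef) (v :: nat \<Rightarrow> real). (\<forall>m. s m \<in> Espace l \<and> E_norm l (s m) \<le> R \<and> v m \<in> {0..1}) \<Longrightarrow>
           (E_convergent_subfamily l a b c K s v)"
    and st: "\<And>x. x \<in> Espace l \<Longrightarrow> Edeform a b c K x 0 = x"
    and en: "\<And>x. x \<in> Espace l \<Longrightarrow> Edeform a b c K x 1 = g x"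
    and nv: "\<And>x u. x \<in> Espace l \<Longrightarrow> u \<in> {0..1} \<Longrightarrow> Eplus x \<noteq> (\<lambda>j i. 0) \<Longrightarrow> Eplus (Edeform a b c K x u) \<noteq> (\<lambda>j i. 0)"
  proof -
    note A = assms[unfolded admissible_deformation_def]
    from A[THEN conjunct2, THEN conjunct2] obtain a b c K where
      B: "(\<forall>x\<in>Espace l. \<forall>u\<in>{0..1}. 0 < a x u \<and> 0 < b x u \<and> 0 < c x u \<and> K x u \<in> Espace l) \<and>
        (\<forall>x\<in>Espace l. \<forall>u\<in>{0..1}. \<forall>\<epsilon>>0. E_close l a b c K x u \<epsilon>) \<and>
        (\<forall>R (s :: nat \<Rightarrow> ecoef) (v :: nat \<Rightarrow> real). (\<forall>m. s m \<in> Espace l \<and> E_norm l (s m) \<le> R \<and> v m \<in> {0..1}) \<longrightarrow>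
           (E_convergent_subfamily l a b c K s v)) \<and>
        (\<forall>x\<in>Espace l. Edeform a b c K x 0 = x) \<and>
        (\<forall>x\<in>Espace l. Edeform a b c K x 1 = g x) \<and>
        (\<forall>x\<in>Espace l. \<forall>u\<in>{0..1}.
           Eplus x \<noteq> (\<lambda>j i. 0) \<longrightarrow> Eplus (Edeform a b c K x u) \<noteq> (\<lambda>j i. 0))"
      by (elim exE)
    note B1 = B[THEN conjunct1] and B2 = B[THEN conjunct2, THEN conjunct1]
      and B3 = B[THEN conjunct2, THEN conjunct2, THEN conjunct1]
      and B4 = B[THEN conjunct2, THEN conjunct2, THEN conjunct2, THEN conjunct1]
      and B5 = B[THEN conjunct2, THEN conjunct2, THEN conjunct2, THEN conjunct2, THEN conjunct1]
      and B6 = B[THEN conjunct2, THEN conjunct2, THEN conjunct2, THEN conjunct2, THEN conjunct2]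
    show thesis
      by (rule that[OF B1[rule_format] B2[rule_format] B3[rule_format] B4[rule_format] B5[rule_format] B6[rule_format]]) auto
  qed
  define a' where "a' \<xi> = a (ofE \<xi>)" for \<xi>
  define b' where "b' \<xi> = b (ofE \<xi>)" for \<xi>
  define c' where "c' \<xi> = c (ofE \<xi>)" for \<xi>
  define K' where "K' \<xi> u = toE (K (ofE \<xi>) u)" for \<xi> u
  have Ed: "Edeform a b c K (ofE \<xi>) u = ofE (dfm a' b' c' K' \<xi> u)" if "\<xi> \<in> Es l" "u \<in> {0..1}" for \<xi> u
  proof -
    have k: "K (ofE \<xi>) u j i = ev (K' \<xi> u) (j, i) / wt (j, i)" for j i
      unfolding K'_def using ev_toE[of "K (ofE \<xi>) u" l j i] pos[OF ofE_Espace[OF that(1)] that(2)] by simp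
    show ?thesis
      unfolding Edeform_def
      by (intro ext, subst k) (simp add: ofE_def dfm_def a'_def b'_def c'_def add_divide_distrib)
  qed
  have K'Es: "K' \<xi> u \<in> Es l" if "\<xi> \<in> Es l" "u \<in> {0..1}" for \<xi> u
    unfolding K'_def using pos[OF ofE_Espace[OF that(1)] that(2)] by (intro toE_Es) auto
  have dEs: "dfm a' b' c' K' \<xi> u \<in> Es l" if "\<xi> \<in> Es l" "u \<in> {0..1}" for \<xi> u
    unfolding dfm_def using that by (intro Es_add Es_scaleR P_Es K'Es)
  have cont': "\<exists>\<delta>>0. \<forall>x'\<in>Es l. \<forall>u'\<in>{0..1}. norm (x' - x) < \<delta> \<and> \<bar>u' - u\<bar> < \<delta> \<longrightarrow>
             \<bar>a' x' u' - a' x u\<bar> < e \<and> \<bar>b' x' u' - b' x u\<bar> < e \<and> \<bar>c' x' u' - c' x u\<bar> < e \<and> norm (K' x' u' - K' x u) < e"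
    if xue: "x \<in> Es l" "u \<in> {0..1}" "0 < e" for x u e
  proof -
    note that = xue
    obtain \<delta> where d: "0 < \<delta>" "\<forall>x'\<in>Espace l. \<forall>u'\<in>{0..1}.
           E_norm l (E_diff x' (ofE x)) < \<delta> \<and> \<bar>u' - u\<bar> < \<delta> \<longrightarrow>
             \<bar>a x' u' - a (ofE x) u\<bar> < e \<and> \<bar>b x' u' - b (ofE x) u\<bar> < e \<and> \<bar>c x' u' - c (ofE x) u\<bar> < e \<and>
             E_norm l (E_diff (K x' u') (K (ofE x) u)) < e"
      using cont[OF ofE_Espace[OF xue(1)] xue(2,3)] by blast
    show ?thesis
    proof (intro exI[of _ \<delta>] conjI d(1) ballI impI)
      fix x' u' assume x': "x' \<in> Es l" "u' \<in> {0..1}" "norm (x' - x) < \<delta> \<and> \<bar>u' - u\<bar> < \<delta>"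
      have KE: "K (ofE x') u' \<in> Espace l" "K (ofE x) u \<in> Espace l"
        using pos[OF ofE_Espace[OF x'(1)] x'(2)] pos[OF ofE_Espace[OF that(1)] that(2)] by auto
      have "E_norm l (E_diff (ofE x') (ofE x)) < \<delta> \<and> \<bar>u' - u\<bar> < \<delta>"
        using x'(3) E_norm_diff[OF x'(1) that(1)] by simp
      from d(2)[rule_format, OF ofE_Espace[OF x'(1)] x'(2) this]
      show "\<bar>a' x' u' - a' x u\<bar> < e" "\<bar>b' x' u' - b' x u\<bar> < e" "\<bar>c' x' u' - c' x u\<bar> < e" "norm (K' x' u' - K' x u) < e"
        using E_norm_diff'[OF KE] by (simp_all add: a'_def b'_def c'_def K'_def)
    qed
  qed
  have "deform l a' b' c' K'"
  proof
    fix x u assume "x \<in> Es l" "u \<in> {0..1::real}"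
    then show "0 < a' x u \<and> 0 < b' x u \<and> 0 < c' x u" using pos[OF ofE_Espace] by (simp add: a'_def b'_def c'_def)
  next
    show "continuous_on (Es l \<times> {0..1}) (\<lambda>p. a' (fst p) (snd p))"
      unfolding continuous_on_pair_iff dist_real_def using cont' by meson
    show "continuous_on (Es l \<times> {0..1}) (\<lambda>p. b' (fst p) (snd p))"
      unfolding continuous_on_pair_iff dist_real_def using cont' by meson
    show "continuous_on (Es l \<times> {0..1}) (\<lambda>p. c' (fst p) (snd p))"
      unfolding continuous_on_pair_iff dist_real_def using cont' by meson
    show "continuous_on (Es l \<times> {0..1}) (\<lambda>p. K' (fst p) (snd p))"
      unfolding continuous_on_pair_iff dist_norm using cont' by meson
  next
    fix s :: "nat \<Rightarrow> ec" and R and v :: "nat \<Rightarrow> real"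
    assume A: "\<And>m. s m \<in> Es l \<and> norm (s m) \<le> R \<and> v m \<in> {0..1}"
    then have "\<forall>m. ofE (s m) \<in> Espace l \<and> E_norm l (ofE (s m)) \<le> R \<and> v m \<in> {0..1}"
      by (simp add: ofE_Espace E_norm_ofE)
    from cpt[OF this] obtain r \<alpha> \<beta> \<gamma> k where r: "strict_mono (r :: nat \<Rightarrow> nat)" "0 < \<alpha>" "0 < \<beta>" "0 < \<gamma>" "k \<in> Espace l"
      "(\<lambda>m. a (ofE (s (r m))) (v (r m))) \<longlonglongrightarrow> \<alpha>" "(\<lambda>m. b (ofE (s (r m))) (v (r m))) \<longlonglongrightarrow> \<beta>"
      "(\<lambda>m. c (ofE (s (r m))) (v (r m))) \<longlonglongrightarrow> \<gamma>" "(\<lambda>m. E_norm l (E_diff (K (ofE (s (r m))) (v (r m))) k)) \<longlonglongrightarrow> 0"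
      by blast
    have "E_norm l (E_diff (K (ofE (s (r m))) (v (r m))) k) = norm (K' (s (r m)) (v (r m)) - toE k)" for m
      unfolding K'_def using pos[OF ofE_Espace, of "s (r m)" "v (r m)"] A[of "r m"] r(5) by (intro E_norm_diff') auto
    then have "(\<lambda>m. K' (s (r m)) (v (r m))) \<longlonglongrightarrow> toE k"
      using r(9) by (simp add: tendsto_norm_zero_iff LIM_zero_iff)
    then show "convergent_subfamily l a' b' c' K' s v"
      using r toE_Es[OF r(5)] unfolding a'_def b'_def c'_def by blast
  next
    fix x assume x: "x \<in> Es l"
    have "ofE (dfm a' b' c' K' x 0) = ofE x" using st[OF ofE_Espace[OF x]] Ed[OF x, of 0] by simp
    then show "dfm a' b' c' K' x 0 = x" using ofE_eq_iff[OF dEs[OF x, of 0] x] by simp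
  next
    fix x u assume x: "x \<in> Es l" "u \<in> {0..1::real}" "Pp x \<noteq> 0"
    have "Eplus (ofE x) \<noteq> (\<lambda>j i. 0)"
      using x ofE_eq_iff[OF P_Es(1)[OF x(1)] Es_0] by (simp add: Eplus_ofE flip: ofE_zero)
    from nv[OF ofE_Espace[OF x(1)] x(2) this]
    show "Pp (dfm a' b' c' K' x u) \<noteq> 0"
      unfolding Ed[OF x(1,2)] Eplus_ofE by (metis ofE_zero)
  qed (rule K'Es)
  moreover have "g (ofE \<xi>) = ofE (dfm a' b' c' K' \<xi> 1)" if "\<xi> \<in> Es l" for \<xi>
    using en[OF ofE_Espace[OF that]] Ed[OF that, of 1] by simp
  ultimately show thesis by (rule that)
qed

lemma (in deform) dfm_Es: "x \<in> Es l \<Longrightarrow> u \<in> {0..1} \<Longrightarrow> dfm a b c K x u \<in> Es l"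
  unfolding dfm_def by (intro Es_add Es_scaleR P_Es K_Es)

lemma (in deform) dfm_cont: "continuous_on (Es l \<times> {0..1}) (\<lambda>p. dfm a b c K (fst p) (snd p))"
  unfolding dfm_def Pp_def Pm_def Pz_def
  by (intro continuous_intros cont_a cont_b cont_c cont_K)

text \<open>The converse passage: a deformation constructed in the Hilbert space competes in the
  supremum defining the capacity.\<close>

lemma (in deform) admissible_ofE: "admissible_deformation l (\<lambda>x. ofE (dfm a b c K (toE x) 1))"
proof -
  let ?a = "\<lambda>x. a (toE x)" and ?b = "\<lambda>x. b (toE x)" and ?c = "\<lambda>x. c (toE x)" and ?K = "\<lambda>x u. ofE (K (toE x) u)"
  let ?g = "\<lambda>x. ofE (dfm a b c K (toE x) 1)"
  have cg: "\<exists>\<delta>>0. \<forall>x'\<in>Espace l. E_norm l (E_diff x' x) < \<delta> \<longrightarrow> E_norm l (E_diff (?g x') (?g x)) < e"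
    if x: "x \<in> Espace l" and e: "0 < e" for x e
  proof -
    obtain d where d: "0 < d" "\<forall>x'\<in>Es l. \<forall>u'\<in>{0..1}. norm (x' - toE x) < d \<and> \<bar>u' - 1\<bar> < d \<longrightarrow> dist (dfm a b c K x' u') (dfm a b c K (toE x) 1) < e"
      using dfm_cont[unfolded continuous_on_pair_iff, rule_format, OF toE_Es[OF x], of 1 e] e by auto
    show ?thesis
    proof (intro exI[of _ d] conjI d(1) ballI impI)
      fix x' assume x': "x' \<in> Espace l" "E_norm l (E_diff x' x) < d"
      have "norm (toE x' - toE x) < d \<and> \<bar>1 - 1 :: real\<bar> < d"
        using d(1) x'(2) by (simp add: E_norm_diff'[OF x'(1) x])
      then have "dist (dfm a b c K (toE x') 1) (dfm a b c K (toE x) 1) < e"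
        using d(2)[rule_format, OF toE_Es[OF x'(1)], of 1] by simp
      then show "E_norm l (E_diff (?g x') (?g x)) < e"
        using E_norm_diff[OF dfm_Es[OF toE_Es[OF x'(1)], of 1] dfm_Es[OF toE_Es[OF x], of 1]] by (simp add: dist_norm)
    qed
  qed
  have cc: "E_close l ?a ?b ?c ?K x u e"
    if x: "x \<in> Espace l" and u: "u \<in> {0..1}" and e: "0 < e" for x u e
  proof -
    note X = toE_Es[OF x]
    obtain d1 where d1: "0 < d1" "\<forall>x'\<in>Es l. \<forall>u'\<in>{0..1}. norm (x' - toE x) < d1 \<and> \<bar>u' - u\<bar> < d1 \<longrightarrow> dist (a x' u') (a (toE x) u) < e"
      using cont_a[unfolded continuous_on_pair_iff, rule_format, OF X u e] by blast
    obtain d2 where d2: "0 < d2" "\<forall>x'\<in>Es l. \<forall>u'\<in>{0..1}. norm (x' - toE x) < d2 \<and> \<bar>u' - u\<bar> < d2 \<longrightarrow> dist (b x' u') (b (toE x) u) < e"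
      using cont_b[unfolded continuous_on_pair_iff, rule_format, OF X u e] by blast
    obtain d3 where d3: "0 < d3" "\<forall>x'\<in>Es l. \<forall>u'\<in>{0..1}. norm (x' - toE x) < d3 \<and> \<bar>u' - u\<bar> < d3 \<longrightarrow> dist (c x' u') (c (toE x) u) < e"
      using cont_c[unfolded continuous_on_pair_iff, rule_format, OF X u e] by blast
    obtain d4 where d4: "0 < d4" "\<forall>x'\<in>Es l. \<forall>u'\<in>{0..1}. norm (x' - toE x) < d4 \<and> \<bar>u' - u\<bar> < d4 \<longrightarrow> dist (K x' u') (K (toE x) u) < e"
      using cont_K[unfolded continuous_on_pair_iff, rule_format, OF X u e] by blast
    show ?thesis
    proof (intro exI[of _ "min (min d1 d2) (min d3 d4)"] conjI ballI impI)
      fix x' u' assume x': "x' \<in> Espace l" "u' \<in> {0..1}"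
        "E_norm l (E_diff x' x) < min (min d1 d2) (min d3 d4) \<and> \<bar>u' - u\<bar> < min (min d1 d2) (min d3 d4)"
      note X' = toE_Es[OF x'(1)]
      have n: "norm (toE x' - toE x) < d1" "norm (toE x' - toE x) < d2" "norm (toE x' - toE x) < d3" "norm (toE x' - toE x) < d4"
        "\<bar>u' - u\<bar> < d1" "\<bar>u' - u\<bar> < d2" "\<bar>u' - u\<bar> < d3" "\<bar>u' - u\<bar> < d4"
        using x'(3) by (auto simp: E_norm_diff'[OF x'(1) x])
      show "\<bar>?a x' u' - ?a x u\<bar> < e" using d1(2) X' x'(2) n by (auto simp: dist_real_def)
      show "\<bar>?b x' u' - ?b x u\<bar> < e" using d2(2) X' x'(2) n by (auto simp: dist_real_def)
      show "\<bar>?c x' u' - ?c x u\<bar> < e" using d3(2) X' x'(2) n by (auto simp: dist_real_def)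
      have "dist (K (toE x') u') (K (toE x) u) < e" using d4(2) X' x'(2) n by blast
      then show "E_norm l (E_diff (?K x' u') (?K x u)) < e"
        using E_norm_diff[OF K_Es[OF X' x'(2)] K_Es[OF X u]] by (simp add: dist_norm)
    qed (use d1 d2 d3 d4 in auto)
  qed
  have cp: "E_convergent_subfamily l ?a ?b ?c ?K s v"
    if A: "\<forall>m. s m \<in> Espace l \<and> E_norm l (s m) \<le> R \<and> v m \<in> {0..1}" for R and s :: "nat \<Rightarrow> ecoef" and v :: "nat \<Rightarrow> real"
  proof -
    have "toE (s m) \<in> Es l \<and> norm (toE (s m)) \<le> R \<and> v m \<in> {0..1}" for m
      using A[rule_format, of m] toE_Es[of "s m" l] E_norm_toE[of "s m" l] by simp
    from cpt[of "\<lambda>m. toE (s m)" R v, OF this]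
    obtain r \<alpha> \<beta> \<gamma> k where r: "strict_mono (r :: nat \<Rightarrow> nat)" "0 < \<alpha>" "0 < \<beta>" "0 < \<gamma>" "k \<in> Es l"
      "(\<lambda>m. ?a (s (r m)) (v (r m))) \<longlonglongrightarrow> \<alpha>" "(\<lambda>m. ?b (s (r m)) (v (r m))) \<longlonglongrightarrow> \<beta>"
      "(\<lambda>m. ?c (s (r m)) (v (r m))) \<longlonglongrightarrow> \<gamma>" "(\<lambda>m. K (toE (s (r m))) (v (r m))) \<longlonglongrightarrow> k" by blast
    have "E_norm l (E_diff (?K (s (r m)) (v (r m))) (ofE k)) = norm (K (toE (s (r m))) (v (r m)) - k)" for m
      using A by (intro E_norm_diff K_Es toE_Es r(5)) auto
    moreover have "(\<lambda>m. norm (K (toE (s (r m))) (v (r m)) - k)) \<longlonglongrightarrow> 0"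
      using r(9) by (simp add: tendsto_norm_zero_iff LIM_zero_iff)
    ultimately have "(\<lambda>m. E_norm l (E_diff (?K (s (r m)) (v (r m))) (ofE k))) \<longlonglongrightarrow> 0" by simp
    with r ofE_Espace[OF r(5)] show ?thesis by blast
  qed
  have n: "Eplus (Edeform ?a ?b ?c ?K x u) \<noteq> (\<lambda>j i. 0)"
    if "x \<in> Espace l" "u \<in> {0..1}" "Eplus x \<noteq> (\<lambda>j i. 0)" for x u
  proof -
    have "Eplus x = ofE (Pp (toE x))" using Eplus_ofE[of "toE x"] ofE_toE[OF that(1)] by simp
    then have "Pp (toE x) \<noteq> 0" using that(3) ofE_zero by metis
    then have "Pp (dfm a b c K (toE x) u) \<noteq> 0" using nonvan toE_Es[OF that(1)] that(2) by blast
    then have "ofE (Pp (dfm a b c K (toE x) u)) \<noteq> ofE 0"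
      using ofE_eq_iff[OF P_Es(1)[OF dfm_Es[OF toE_Es[OF that(1)] that(2)]] Es_0] by blast
    then show ?thesis unfolding Edeform_ofE[OF that(1)] Eplus_ofE ofE_zero .
  qed
  have p: "0 < ?a x u \<and> 0 < ?b x u \<and> 0 < ?c x u \<and> ?K x u \<in> Espace l" if "x \<in> Espace l" "u \<in> {0..1}" for x u
    using pos[OF toE_Es[OF that(1)] that(2)] ofE_Espace[OF K_Es[OF toE_Es[OF that(1)] that(2)]] by blast
  have s0: "Edeform ?a ?b ?c ?K x 0 = x" if "x \<in> Espace l" for x
    unfolding Edeform_ofE[OF that] start[OF toE_Es[OF that]] by (rule ofE_toE[OF that])
  have g: "?g x \<in> Espace l" if "x \<in> Espace l" for x
    by (intro ofE_Espace dfm_Es toE_Es that) simp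
  show ?thesis
    unfolding admissible_deformation_def
    by (intro conjI exI[of _ ?a] exI[of _ ?b] exI[of _ ?c] exI[of _ ?K])
      ((intro ballI allI impI; (rule g | rule cg | rule p | rule cc | rule cp | rule s0 | rule Edeform_ofE | rule n); assumption)+)
qed

section \<open>Discrete gradient steps\<close>

lemma P_cross [simp]: "Pp (Pz x) = 0" "Pp (Pm x) = 0" "Pm (Pp x) = 0" "Pm (Pz x) = 0" "Pz (Pp x) = 0" "Pz (Pm x) = 0"
  by (rule ell2_eqI, simp)+

lemma P_dfm: "Pp (dfm a b c K x u) = a x u *\<^sub>R Pp x + Pp (K x u)" "Pm (dfm a b c K x u) = c x u *\<^sub>R Pm x + Pm (K x u)"
  by (simp_all add: dfm_def P_add P_scaleR)

lemma Icc_subseq: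
  assumes "\<And>m :: nat. v m \<in> {a..b :: real}"
  shows "\<exists>r v'. strict_mono (r :: nat \<Rightarrow> nat) \<and> v' \<in> {a..b} \<and> (\<lambda>m. v (r m)) \<longlonglongrightarrow> v'"
proof -
  have "seq_compact {a..b}" by (rule compact_imp_seq_compact[OF compact_Icc])
  moreover have "\<forall>n. v n \<in> {a..b}" using assms by blast
  ultimately show ?thesis unfolding seq_compact_def o_def by blast
qed

context ham begin

lemma Phi_cont: "continuous_on (Es l) (Phi l G)"
  unfolding continuous_on_sequentially o_def by (intro allI ballI impI Phi_tendsto) auto

lemma Wg_cont: "continuous_on S (Wg l gr)"
proof (rule lipschitz_on_continuous_on)
  show "Lc-lipschitz_on S (Wg l gr)"
  proof (rule lipschitz_onI)
    show "dist (Wg l gr x) (Wg l gr y) \<le> Lc * dist x y" for x y unfolding dist_norm by (rule Wg_lip)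
  qed (use Lc1 in linarith)
qed

lemma IG_nonneg: "0 \<le> IG l G x"
  unfolding IG_def by (intro Bochner_Integration.integral_nonneg G_nonneg)

lemma Phi_pos_Pp:
  assumes "0 < Phi l G y"
  shows "Pp y \<noteq> 0"
proof
  assume "Pp y = 0"
  then have "Phi l G y = - ((norm (Pm y))\<^sup>2 / 2) - IG l G y" by (simp add: Phi_def Act_def)
  moreover have "0 \<le> (norm (Pm y))\<^sup>2 / 2" by simp
  ultimately show False using assms IG_nonneg[of y] by linarith
qed

text \<open>Since the gradient is x^+ - x^- minus a compact term, a step of length
  \<open>\<theta>\<close> multiplies \<open>a\<close> by \<open>1 + \<theta>\<close> and
  \<open>c\<close> by \<open>1 - \<theta>\<close>, keeps \<open>b\<close>, and sends the rest into
  the compact part. The factor \<open>u\<close> leaves the homotopy unchanged at time zero.\<close>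

lemma deform_step:
  assumes D: "deform l a b c K"
    and \<tau>: "0 \<le> \<tau>" "\<tau> * (2 * (Lc + 1)) \<le> 1"
    and \<phi>: "continuous_on UNIV \<phi>" "\<And>s. 0 \<le> \<phi> s \<and> \<phi> s \<le> 1" "\<And>s. s \<le> 0 \<Longrightarrow> \<phi> s = 0"
  shows "\<exists>a' b' c' K'. deform l a' b' c' K' \<and> (\<forall>x\<in>Es l. \<forall>u\<in>{0..1}. dfm a' b' c' K' x u =
    dfm a b c K x u + (u * \<tau> * \<phi> (Phi l G (dfm a b c K x u))) *\<^sub>R gradP l gr (dfm a b c K x u))"
proof -
  interpret D: deform l a b c K by fact
  define y where "y = dfm a b c K"
  define \<theta> where "\<theta> x u = u * \<tau> * \<phi> (Phi l G (y x u))" for x u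
  define a' where "a' x u = a x u * (1 + \<theta> x u)" for x u
  define c' where "c' x u = c x u * (1 - \<theta> x u)" for x u
  \<comment> \<open>The step also acts on the positive and negative components of the old compact
    part, which are not covered by the new \<open>a\<close> and \<open>c\<close>.\<close>
  define K' where "K' x u = K x u + \<theta> x u *\<^sub>R (Pp (K x u) - Pm (K x u) - Wg l gr (y x u))" for x u
  have yEs: "y x u \<in> Es l" if "x \<in> Es l" "u \<in> {0..1}" for x u unfolding y_def by (rule D.dfm_Es[OF that])
  \<comment> \<open>Keeps \<open>1 - \<theta>\<close>, the factor of the negative part, strictly
    positive.\<close>
  have \<tau>4: "\<tau> \<le> 1 / 4"
  proof -
    have "\<tau> * 4 \<le> \<tau> * (2 * (Lc + 1))" using \<tau>(1) Lc1 by (intro mult_left_mono) auto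
    then show ?thesis using \<tau>(2) by linarith
  qed
  have \<theta>: "0 \<le> \<theta> x u" "\<theta> x u \<le> \<tau>" if "u \<in> {0..1}" for x u
  proof -
    show "0 \<le> \<theta> x u" unfolding \<theta>_def using that \<tau> \<phi>(2) by (intro mult_nonneg_nonneg) auto
    have "u * \<tau> * \<phi> (Phi l G (y x u)) \<le> 1 * \<tau> * 1" using that \<tau> \<phi>(2) by (intro mult_mono) auto
    then show "\<theta> x u \<le> \<tau>" unfolding \<theta>_def by simp
  qed
  have eq: "dfm a' b c' K' x u = y x u + \<theta> x u *\<^sub>R gradP l gr (y x u)" for x u
    unfolding y_def gradP_def P_dfm
    by (simp add: dfm_def a'_def c'_def K'_def y_def algebra_simps)
  have y_cont: "continuous_on (Es l \<times> {0..1}) (\<lambda>p. y (fst p) (snd p))" unfolding y_def by (rule D.dfm_cont)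
  have \<theta>_cont: "continuous_on (Es l \<times> {0..1}) (\<lambda>p. \<theta> (fst p) (snd p))"
    unfolding \<theta>_def
    by (intro continuous_intros continuous_on_compose2[OF \<phi>(1)] continuous_on_compose2[OF Phi_cont] y_cont)
      (auto simp: yEs)
  have W_cont: "continuous_on (Es l \<times> {0..1}) (\<lambda>p. Wg l gr (y (fst p) (snd p)))"
    by (rule continuous_on_compose2[OF Wg_cont y_cont subset_refl])
  have "deform l a' b c' K'"
  proof
    fix x u assume xu: "x \<in> Es l" "u \<in> {0..1::real}"
    show "0 < a' x u \<and> 0 < b x u \<and> 0 < c' x u"
      unfolding a'_def c'_def using D.pos[OF xu] \<theta>[OF xu(2), of x] \<tau>4 by (intro conjI mult_pos_pos) auto
    show "K' x u \<in> Es l"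
      unfolding K'_def by (intro Es_add Es_scaleR Es_diff P_Es D.K_Es xu Wg_Es)
    assume "Pp x \<noteq> 0"
    then have Py: "Pp (y x u) \<noteq> 0" unfolding y_def by (rule D.nonvan[OF xu])
    show "Pp (dfm a' b c' K' x u) \<noteq> 0"
    \<comment> \<open>Positive action forces a nonzero positive part, and the step does not decrease
      the action; at nonpositive action the cut-off suppresses the step.\<close>
    proof (cases "0 < Phi l G (y x u)")
      case True
      have "\<theta> x u * (2 * (Lc + 1)) \<le> \<tau> * (2 * (Lc + 1))"
        using \<theta>[OF xu(2), of x] Lc1 by (intro mult_right_mono) auto
      then have "Phi l G (y x u) + \<theta> x u / 2 * (norm (gradP l gr (y x u)))\<^sup>2 \<le> Phi l G (dfm a' b c' K' x u)"
        unfolding eq using \<theta>[OF xu(2), of x] \<tau> by (intro Phi_ascent yEs xu) auto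
      moreover have "0 \<le> \<theta> x u / 2 * (norm (gradP l gr (y x u)))\<^sup>2"
        using \<theta>[OF xu(2), of x] by simp
      ultimately show ?thesis using True by (intro Phi_pos_Pp) linarith
    next
      case False
      then have "\<theta> x u = 0" unfolding \<theta>_def using \<phi>(3) by simp
      then show ?thesis unfolding eq using Py by simp
    qed
  next
    fix x assume x: "x \<in> Es l"
    have "\<theta> x 0 = 0" by (simp add: \<theta>_def)
    then show "dfm a' b c' K' x 0 = x" unfolding eq y_def by (simp add: D.start[OF x])
  next
    fix s :: "nat \<Rightarrow> ec" and R and v :: "nat \<Rightarrow> real"
    assume A: "\<And>m. s m \<in> Es l \<and> norm (s m) \<le> R \<and> v m \<in> {0..1}"
    obtain r \<alpha> \<beta> \<gamma> k where r: "strict_mono (r :: nat \<Rightarrow> nat)" "0 < \<alpha>" "0 < \<beta>" "0 < \<gamma>" "k \<in> Es l"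
      and lim: "(\<lambda>m. a (s (r m)) (v (r m))) \<longlonglongrightarrow> \<alpha>" "(\<lambda>m. b (s (r m)) (v (r m))) \<longlonglongrightarrow> \<beta>"
        "(\<lambda>m. c (s (r m)) (v (r m))) \<longlonglongrightarrow> \<gamma>" "(\<lambda>m. K (s (r m)) (v (r m))) \<longlonglongrightarrow> k"
      using D.cpt[of s R v, OF A] by (elim exE conjE) (rule that; assumption)
    \<comment> \<open>All coefficients converge along the subsequence, so the images
      \<open>y\<close> are bounded there; compactness of the Hamiltonian gradient needs this
      bound.\<close>
    obtain B where B: "\<And>m. norm (y (s (r m)) (v (r m))) \<le> B"
    proof -
      obtain A1 where A1: "\<And>m. norm (a (s (r m)) (v (r m))) \<le> A1" using convergent_imp_Bseq[OF convergentI[OF lim(1)]] by (elim BseqE) (rule that, erule spec)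
      obtain A2 where A2: "\<And>m. norm (b (s (r m)) (v (r m))) \<le> A2" using convergent_imp_Bseq[OF convergentI[OF lim(2)]] by (elim BseqE) (rule that, erule spec)
      obtain A3 where A3: "\<And>m. norm (c (s (r m)) (v (r m))) \<le> A3" using convergent_imp_Bseq[OF convergentI[OF lim(3)]] by (elim BseqE) (rule that, erule spec)
      obtain A4 where A4: "\<And>m. norm (K (s (r m)) (v (r m))) \<le> A4" using convergent_imp_Bseq[OF convergentI[OF lim(4)]] by (elim BseqE) (rule that, erule spec)
      have "norm (y (s (r m)) (v (r m))) \<le> A1 * R + A2 * R + A3 * R + A4" for m
      proof -
        have nR: "norm (Pp (s (r m))) \<le> R" "norm (Pz (s (r m))) \<le> R" "norm (Pm (s (r m))) \<le> R"
          using norm_P_le[of "s (r m)"] A[of "r m"] by linarith+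
        have p: "0 \<le> A1" "0 \<le> A2" "0 \<le> A3"
          using order_trans[OF norm_ge_zero A1[of 0]] order_trans[OF norm_ge_zero A2[of 0]] order_trans[OF norm_ge_zero A3[of 0]] .
        have "norm (y (s (r m)) (v (r m))) \<le> norm (a (s (r m)) (v (r m)) *\<^sub>R Pp (s (r m))) + norm (b (s (r m)) (v (r m)) *\<^sub>R Pz (s (r m)))
          + norm (c (s (r m)) (v (r m)) *\<^sub>R Pm (s (r m))) + norm (K (s (r m)) (v (r m)))"
          unfolding y_def dfm_def by (intro norm_triangle_le add_mono order_refl)
        also have "\<dots> \<le> A1 * R + A2 * R + A3 * R + A4"
          unfolding norm_scaleR real_norm_def[symmetric]
          by (intro add_mono mult_mono A1 A2 A3 A4 nR p norm_ge_zero)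
        finally show ?thesis .
      qed
      then show thesis by (rule that)
    qed
    let ?y = "\<lambda>m. y (s (r m)) (v (r m))"
    have "n2 (\<lambda>t. gr (lp l (?y m) t)) \<le> norm (gr 0) + Lc * B" for m
    proof -
      have "Lc * norm (?y m) \<le> Lc * B" using Lc1 by (intro mult_left_mono B) auto
      then show ?thesis using n2_gr_lp[of "?y m"] by linarith
    qed
    note cptW = Jst_compact[of l "\<lambda>m t. gr (lp l (?y m) t)", OF L2f_gr[OF L2f_lp] this, folded Wg_def]
    obtain r2 w where r2: "strict_mono (r2 :: nat \<Rightarrow> nat)" "w \<in> Es l" "(\<lambda>m. Wg l gr (?y (r2 m))) \<longlonglongrightarrow> w"
      using cptW by (elim exE conjE) (rule that; assumption)
    have "\<theta> (s (r (r2 m))) (v (r (r2 m))) \<in> {0..\<tau>}" for m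
      using \<theta>[of "v (r (r2 m))" "s (r (r2 m))"] A[of "r (r2 m)"] by simp
    from Icc_subseq[of "\<lambda>m. \<theta> (s (r (r2 m))) (v (r (r2 m)))", OF this]
    obtain r3 \<theta>' where r3: "\<theta>' \<in> {0..\<tau>}" "strict_mono (r3 :: nat \<Rightarrow> nat)"
        "(\<lambda>m. \<theta> (s (r (r2 (r3 m)))) (v (r (r2 (r3 m))))) \<longlonglongrightarrow> \<theta>'"
      by (elim exE conjE) (rule that; assumption)
    define q where "q m = r (r2 (r3 m))" for m
    have q: "strict_mono q"
      unfolding q_def using r(1) r2(1) r3(2) by (simp add: strict_mono_def)
    have sm: "strict_mono (\<lambda>m. r2 (r3 m))" using r2(1) r3(2) by (simp add: strict_mono_def)
    note sub = LIMSEQ_subseq_LIMSEQ[OF _ sm, unfolded o_def]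
    have L: "(\<lambda>m. a (s (q m)) (v (q m))) \<longlonglongrightarrow> \<alpha>" "(\<lambda>m. b (s (q m)) (v (q m))) \<longlonglongrightarrow> \<beta>"
        "(\<lambda>m. c (s (q m)) (v (q m))) \<longlonglongrightarrow> \<gamma>" "(\<lambda>m. K (s (q m)) (v (q m))) \<longlonglongrightarrow> k"
        "(\<lambda>m. Wg l gr (y (s (q m)) (v (q m)))) \<longlonglongrightarrow> w" "(\<lambda>m. \<theta> (s (q m)) (v (q m))) \<longlonglongrightarrow> \<theta>'"
      unfolding q_def using sub[OF lim(1)] sub[OF lim(2)] sub[OF lim(3)] sub[OF lim(4)]
        LIMSEQ_subseq_LIMSEQ[OF r2(3) r3(2)] r3(3) by (simp_all add: o_def)
    have 1: "(\<lambda>m. a' (s (q m)) (v (q m))) \<longlonglongrightarrow> \<alpha> * (1 + \<theta>')" unfolding a'_def by (intro tendsto_intros L)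
    have 2: "(\<lambda>m. c' (s (q m)) (v (q m))) \<longlonglongrightarrow> \<gamma> * (1 - \<theta>')" unfolding c'_def by (intro tendsto_intros L)
    have 3: "(\<lambda>m. K' (s (q m)) (v (q m))) \<longlonglongrightarrow> k + \<theta>' *\<^sub>R (Pp k - Pm k - w)" unfolding K'_def by (intro tendsto_intros L)
    have 4: "0 < \<alpha> * (1 + \<theta>')" "0 < \<gamma> * (1 - \<theta>')" using r(2,4) r3(1) \<tau>4 by (simp_all add: mult_pos_pos)
    have 5: "k + \<theta>' *\<^sub>R (Pp k - Pm k - w) \<in> Es l" by (intro Es_add Es_scaleR Es_diff P_Es r r2(2))
    show "convergent_subfamily l a' b c' K' s v"
      by (rule exI[of _ q], rule exI[of _ "\<alpha> * (1 + \<theta>')"], rule exI[of _ \<beta>], rule exI[of _ "\<gamma> * (1 - \<theta>')"],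
          rule exI[of _ "k + \<theta>' *\<^sub>R (Pp k - Pm k - w)"]) (intro conjI q 1 2 3 4 5 L(2) r(3))
  next
    show "continuous_on (Es l \<times> {0..1}) (\<lambda>p. a' (fst p) (snd p))"
      unfolding a'_def by (intro continuous_intros D.cont_a \<theta>_cont)
    show "continuous_on (Es l \<times> {0..1}) (\<lambda>p. b (fst p) (snd p))" by (rule D.cont_b)
    show "continuous_on (Es l \<times> {0..1}) (\<lambda>p. c' (fst p) (snd p))"
      unfolding c'_def by (intro continuous_intros D.cont_c \<theta>_cont)
    show "continuous_on (Es l \<times> {0..1}) (\<lambda>p. K' (fst p) (snd p))"
      unfolding K'_def Pp_def Pm_def by (intro continuous_intros D.cont_K \<theta>_cont W_cont)
  qed
  with eq show ?thesis
    unfolding y_def \<theta>_def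
    by (intro exI[of _ a'] exI[of _ b] exI[of _ c'] exI[of _ K'] conjI ballI)
qed

end

text \<open>The linear homotopy from the identity to x -> \<open>\<rho>\<close> x + q, which carries
  the unit sphere to a small sphere centred at a constant loop.\<close>

lemma deform_start:
  assumes \<rho>: "0 < \<rho>"
  shows "deform l (\<lambda>x u. 1 - u + u * \<rho>) (\<lambda>x u. 1 - u + u * \<rho>) (\<lambda>x u. 1 - u + u * \<rho>) (\<lambda>x u. u *\<^sub>R cst l q)"
    (is "deform l ?a ?a ?a ?K")
    and "dfm (\<lambda>x u. 1 - u + u * \<rho>) (\<lambda>x u. 1 - u + u * \<rho>) (\<lambda>x u. 1 - u + u * \<rho>) (\<lambda>x u. u *\<^sub>R cst l q) x u
      = (1 - u + u * \<rho>) *\<^sub>R x + u *\<^sub>R cst l q"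
proof -
  have eq: "dfm ?a ?a ?a ?K x u = (1 - u + u * \<rho>) *\<^sub>R x + u *\<^sub>R cst l q" for x u
    unfolding dfm_def scaleR_right_distrib[symmetric] P_decomp[of x, symmetric] ..
  then show "dfm ?a ?a ?a ?K x u = (1 - u + u * \<rho>) *\<^sub>R x + u *\<^sub>R cst l q" .
  have pos: "0 < 1 - u + u * \<rho>" if "u \<in> {0..1}" for u
  proof (cases "u = 0")
    case False
    then have "0 < u * \<rho>" using that \<rho> by simp
    then show ?thesis using that by auto
  qed simp
  show "deform l ?a ?a ?a ?K"
  proof
    fix x u assume xu: "x \<in> Es l" "u \<in> {0..1::real}"
    show "0 < ?a x u \<and> 0 < ?a x u \<and> 0 < ?a x u" using pos[OF xu(2)] by simp
    show "?K x u \<in> Es l" by (intro Es_scaleR cst_Es)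
    show "Pp (dfm ?a ?a ?a ?K x u) \<noteq> 0" if "Pp x \<noteq> 0"
      unfolding eq using that pos[OF xu(2)] by (simp add: P_add P_scaleR)
  next
    fix x show "dfm ?a ?a ?a ?K x 0 = x" unfolding eq by simp
  next
    fix s :: "nat \<Rightarrow> ec" and R and v :: "nat \<Rightarrow> real"
    assume A: "\<And>m. s m \<in> Es l \<and> norm (s m) \<le> R \<and> v m \<in> {0..1}"
    obtain r v' where r: "v' \<in> {0..1}" "strict_mono (r :: nat \<Rightarrow> nat)" and v: "(\<lambda>m. v (r m)) \<longlonglongrightarrow> v'"
      using Icc_subseq[of v, OF conjunct2[OF conjunct2[OF A]]] by (elim exE conjE) (rule that; assumption)
    show "convergent_subfamily l ?a ?a ?a ?K s v"
      by (rule exI[of _ r], rule exI[of _ "1 - v' + v' * \<rho>"], rule exI[of _ "1 - v' + v' * \<rho>"],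
          rule exI[of _ "1 - v' + v' * \<rho>"], rule exI[of _ "v' *\<^sub>R cst l q"])
        (intro conjI r(2) pos r(1) tendsto_intros v Es_scaleR cst_Es)
  qed (intro continuous_intros)+
qed

text \<open>Low Fourier modes of a small loop are uniformly small, and high modes are small in
  $L^2$ relative to the $H^{1/2}$ norm.\<close>

lemma norm_trg_le:
  assumes "finite A"
  shows "norm (trg l x A t) \<le> real (card A * l) * norm x"
proof -
  have "norm (trg l x A t) \<le> (\<Sum>c\<in>A \<times> {..<l}. norm x)"
    unfolding trg_def
  proof (rule sum_norm_le)
    fix c
    have "\<bar>ev x c\<bar> / wt c \<le> norm x / 1"
      using abs_ev_le[of x c] wt_ge_1[of c] by (intro frac_le) auto
    then show "norm ((ev x c / wt c) *\<^sub>R ee c t) \<le> norm x" by (simp add: norm_ee)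
  qed
  then show ?thesis by (simp add: card_cartesian_product)
qed

lemma lp_minus_trg:
  assumes "x \<in> Es l"
  shows "(n2 (\<lambda>t. lp l x t - trg l x (An N) t))\<^sup>2 \<le> (norm x)\<^sup>2 / (2 * pi * (real N + 1))"
proof -
  let ?h = "rst (- (An N \<times> UNIV)) x" and ?w = "rst (An N \<times> UNIV) x"
  have 1: "AE t in MI. lp l ?w t = trg l x (An N) t"
  proof (rule L2_limit_unique[where l = l and s = "\<lambda>M. trg l ?w (An M)"])
    have "trg l ?w (An M) t = trg l x (An N) t" if "N \<le> M" for M t
      unfolding trg_def using that
      by (intro sum.mono_neutral_cong_right) auto
    then have "\<forall>\<^sub>F M in sequentially. n2 (\<lambda>t. trg l ?w (An M) t - trg l x (An N) t) = 0"
      unfolding eventually_sequentially by (intro exI[of _ N]) (simp add: n2_def)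
    then show "(\<lambda>M. n2 (\<lambda>t. trg l ?w (An M) t - trg l x (An N) t)) \<longlonglongrightarrow> 0" by (rule tendsto_eventually)
  qed (use lp_limit L2f_lp in auto)
  have 2: "AE t in MI. lp l x t = lp l ?w t + lp l ?h t"
    using lp_add[of l ?w ?h] rst_compl[of "An N \<times> UNIV" x] by simp
  have "n2 (\<lambda>t. lp l x t - trg l x (An N) t) = n2 (lp l ?h)"
  proof (rule n2_cong_AE[where l = l])
    show "AE t in MI. lp l x t - trg l x (An N) t = lp l ?h t" using 1 2 by eventually_elim simp
  qed (intro L2f_diff L2f_lp L2f_trg)+
  also have "\<dots> \<le> norm (iw ?h)" by (rule n2_lp_le_iw)
  finally have le: "n2 (\<lambda>t. lp l x t - trg l x (An N) t) \<le> norm (iw ?h)" .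
  have "(norm (iw ?h))\<^sup>2 \<le> (norm x)\<^sup>2 / (2 * pi * (real N + 1))"
  proof -
    have "iw ?h = Abs_ell2 (ev (iw ?h))" by (simp add: ev_inverse)
    have "(norm (Abs_ell2 (ev (iw ?h))))\<^sup>2 \<le> (norm x)\<^sup>2 / (2 * pi * (real N + 1))"
    proof (rule ell2_of_bound(3))
      fix F :: "(int \<times> nat) set" assume F: "finite F"
      have "(\<Sum>c\<in>F. (ev (iw ?h) c)\<^sup>2) \<le> (\<Sum>c\<in>F. (ev x c)\<^sup>2 / (2 * pi * (real N + 1)))"
      proof (rule sum_mono)
        fix c :: "int \<times> nat"
        show "(ev (iw ?h) c)\<^sup>2 \<le> (ev x c)\<^sup>2 / (2 * pi * (real N + 1))"
        proof (cases "fst c \<in> An N")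
          case False
          then have "real N + 1 \<le> \<bar>real_of_int (fst c)\<bar>" by auto
          moreover from this have "(wt c)\<^sup>2 = 2 * pi * \<bar>real_of_int (fst c)\<bar>" by (auto simp: wt_sq)
          ultimately have "2 * pi * (real N + 1) \<le> (wt c)\<^sup>2" by simp
          then have "(ev x c)\<^sup>2 / (wt c)\<^sup>2 \<le> (ev x c)\<^sup>2 / (2 * pi * (real N + 1))"
            by (intro divide_left_mono mult_pos_pos) auto
          then show ?thesis using False by (cases c) (simp add: power_divide mem_Times_iff)
        qed (cases c, simp add: mem_Times_iff)
      qed
      also have "\<dots> = (\<Sum>c\<in>F. (ev x c)\<^sup>2) / (2 * pi * (real N + 1))" by (simp add: sum_divide_distrib)
      also have "\<dots> \<le> (norm x)\<^sup>2 / (2 * pi * (real N + 1))" using F by (intro divide_right_mono sum_sq_le_norm) auto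
      finally show "(\<Sum>c\<in>F. (ev (iw ?h) c)\<^sup>2) \<le> (norm x)\<^sup>2 / (2 * pi * (real N + 1))" .
    qed
    then show ?thesis using \<open>iw ?h = _\<close> by simp
  qed
  moreover have "(n2 (\<lambda>t. lp l x t - trg l x (An N) t))\<^sup>2 \<le> (norm (iw ?h))\<^sup>2"
    using le by (intro power_mono) simp_all
  ultimately show ?thesis by linarith
qed

text \<open>A loop of small norm in E may still be unbounded, so it need not stay where
  \<open>G\<close> vanishes. Where it leaves the ball of radius \<open>d\<close>, its low modes
  account for at most half of its size; there \<open>G\<close> is controlled by the high modes,
  whose L^2 norm is a small fraction of the norm in E.\<close>

lemma (in ham) Phi_near_constant:
  assumes q: "q \<in> L0 l" and A: "0 < A" "\<And>z. z \<in> Ps l \<Longrightarrow> G z \<le> A * (norm (z - q))\<^sup>2"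
    and d: "0 < d" "\<And>z. z \<in> Ps l \<Longrightarrow> norm (z - q) < d \<Longrightarrow> G z = 0"
  shows "\<exists>r>0. \<forall>x\<in>Es l. Pp x = x \<longrightarrow> norm x \<le> r \<longrightarrow> (norm x)\<^sup>2 / 4 \<le> Phi l G (x + cst l q)"
proof -
  \<comment> \<open>With \<open>4 * A \<le> real N + 1\<close> and 4 below 2 pi, the integral over
    the excursions is at most a quarter of the squared norm.\<close>
  define N where "N = nat \<lceil>4 * A\<rceil>"
  \<comment> \<open>Keeps the sum of the low modes within \<open>d / 2\<close> at every time; the
    \<open>+ 1\<close> avoids division by zero.\<close>
  define r where "r = d / (2 * (real (card (An N) * l) + 1))"
  have r: "0 < r" unfolding r_def using d(1) by (intro divide_pos_pos mult_pos_pos add_nonneg_pos of_nat_0_le_iff) simp_all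
  have NA: "4 * A \<le> real N + 1" unfolding N_def by linarith
  have "(norm x)\<^sup>2 / 4 \<le> Phi l G (x + cst l q)" if x: "x \<in> Es l" "Pp x = x" "norm x \<le> r" for x
  proof -
    let ?lo = "trg l x (An N)"
    have lo: "norm (?lo t) \<le> d / 2" for t
    proof -
      have "norm (?lo t) \<le> real (card (An N) * l) * norm x" by (rule norm_trg_le) simp
      also have "\<dots> \<le> (real (card (An N) * l) + 1) * r" using x(3) by (intro mult_mono) auto
      also have "\<dots> = d / 2"
      proof -
      have gen: "a * (d / (2 * a)) = d / 2" if "0 < a" for a using that by simp
      show ?thesis unfolding r_def by (rule gen) (simp add: add_nonneg_pos)
    qed
      finally show ?thesis .
    qed
    have "AE t in MI. lp l (x + cst l q) t = lp l x t + q"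
      using lp_add[of l x "cst l q"] lp_cst[OF q] by eventually_elim simp
    then have ae: "AE t in MI. G (lp l (x + cst l q) t) \<le> 4 * A * (norm (lp l x t - ?lo t))\<^sup>2"
    proof eventually_elim
      case (elim t)
      have zq: "lp l (x + cst l q) t - q = lp l x t" using elim by simp
      show ?case
      proof (cases "norm (lp l x t) < d")
        case True
        then have "G (lp l (x + cst l q) t) = 0" using zq by (intro d(2) lp_Ps) simp
        then show ?thesis using A(1) by simp
      next
        case False
        have "norm (lp l x t) \<le> norm (?lo t) + norm (lp l x t - ?lo t)"
          using norm_triangle_ineq[of "?lo t" "lp l x t - ?lo t"] by simp
        then have "norm (lp l x t) \<le> 2 * norm (lp l x t - ?lo t)" using lo[of t] False by linarith
        then have "(norm (lp l x t))\<^sup>2 \<le> (2 * norm (lp l x t - ?lo t))\<^sup>2" by (intro power_mono) auto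
        then have "A * (norm (lp l x t))\<^sup>2 \<le> A * (4 * (norm (lp l x t - ?lo t))\<^sup>2)"
          using A(1) by (intro mult_left_mono) (simp_all add: power_mult_distrib)
        then show ?thesis using A(2)[OF lp_Ps, of "x + cst l q" t] zq by simp
      qed
    qed
    have L: "L2f l (\<lambda>t. lp l x t - ?lo t)" by (intro L2f_diff L2f_lp L2f_trg)
    have "IG l G (x + cst l q) \<le> (\<integral>t. 4 * A * (norm (lp l x t - ?lo t))\<^sup>2 \<partial>MI)"
      unfolding IG_def by (intro integral_mono_AE ae G_integrable L2f_lp integrable_mult_right L2f_sq[OF L])
    also have "\<dots> = 4 * A * (n2 (\<lambda>t. lp l x t - ?lo t))\<^sup>2" by (simp add: n2_sq)
    also have "\<dots> \<le> 4 * A * ((norm x)\<^sup>2 / (2 * pi * (real N + 1)))"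
      using A(1) by (intro mult_left_mono lp_minus_trg x) auto
    also have "\<dots> \<le> (norm x)\<^sup>2 / 4"
    proof -
      have "4 * A * 4 \<le> (real N + 1) * (2 * pi)" using NA pi_gt3 A(1) by (intro mult_mono) auto
      then have "4 * A / (2 * pi * (real N + 1)) \<le> 1 / 4"
        by (simp add: divide_le_eq mult.commute)
      then have "(4 * A / (2 * pi * (real N + 1))) * (norm x)\<^sup>2 \<le> 1 / 4 * (norm x)\<^sup>2" by (rule mult_right_mono) simp
      then show ?thesis by simp
    qed
    finally have "IG l G (x + cst l q) \<le> (norm x)\<^sup>2 / 4" .
    moreover have "Act (x + cst l q) = (norm x)\<^sup>2 / 2"
    proof -
      have "Pm x = 0" using arg_cong[OF x(2), of Pm] by simp
      then show ?thesis by (simp add: Act_def P_add x(2))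
    qed
    ultimately show ?thesis by (simp add: Phi_def)
  qed
  then show ?thesis using r by blast
qed

section \<open>Products\<close>

definition sp :: "(nat \<Rightarrow> nat) \<Rightarrow> nat \<Rightarrow> nat" where "sp n i = (\<Sum>j<i. n j)"

lemma sp_mono: "i < j \<Longrightarrow> sp n i + n i \<le> sp n j"
proof -
  assume "i < j"
  then have "sp n (Suc i) \<le> sp n j" unfolding sp_def by (intro sum_mono2) auto
  then show ?thesis by (simp add: sp_def)
qed

lemma sum_blocks: "(\<Sum>i<k. if sp n i \<le> m \<and> m < sp n i + n i then a else 0) = (if m < sp n k then a else (0 :: real))"
proof (induction k)
  case (Suc k)
  have "sp n (Suc k) = sp n k + n k" by (simp add: sp_def)
  with Suc show ?case by auto
qed (simp add: sp_def)

lemma sum_block_single: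
  assumes "i < k" "m < n i"
  shows "(\<Sum>j<k. if sp n j \<le> sp n i + m \<and> sp n i + m < sp n j + n j then f j else 0) = (f i :: real)"
proof -
  have "(\<Sum>j<k. if sp n j \<le> sp n i + m \<and> sp n i + m < sp n j + n j then f j else 0)
      = (\<Sum>j\<in>{i}. if sp n j \<le> sp n i + m \<and> sp n i + m < sp n j + n j then f j else 0)"
  proof (rule sum.mono_neutral_right)
    show "\<forall>j\<in>{..<k} - {i}. (if sp n j \<le> sp n i + m \<and> sp n i + m < sp n j + n j then f j else 0) = 0"
    proof
      fix j assume "j \<in> {..<k} - {i}"
      then have "j < i \<or> i < j" by auto
      then have "\<not> (sp n j \<le> sp n i + m \<and> sp n i + m < sp n j + n j)"
        using sp_mono[of j i n] sp_mono[of i j n] assms(2) by linarith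
      then show "(if sp n j \<le> sp n i + m \<and> sp n i + m < sp n j + n j then f j else 0) = 0" by (rule if_not_P)
    qed
  qed (use assms in auto)
  then show ?thesis using assms by simp
qed

lemma inner_embE:
  assumes "v \<in> Es n"
  shows "inner (embE s n v) w = inner v (blkE s n w)"
proof -
  let ?f = "\<lambda>c. (fst c, s + snd c) :: int \<times> nat"
  let ?p = "\<lambda>c. ev (embE s n v) c * ev w c"
  have inj: "inj_on ?f (UNIV \<times> {..<n})" by (rule inj_onI) (simp add: prod_eq_iff)
  have "inner (embE s n v) w = infsum ?p (?f ` (UNIV \<times> {..<n}))"
    unfolding inner_infsum
  proof (rule infsum_cong_neutral)
    fix c :: "int \<times> nat" assume c: "c \<in> UNIV - ?f ` (UNIV \<times> {..<n})"
    have "\<not> (s \<le> snd c \<and> snd c < s + n)"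
    proof
      assume "s \<le> snd c \<and> snd c < s + n"
      then have "c = ?f (fst c, snd c - s)" "(fst c, snd c - s) \<in> UNIV \<times> {..<n}" by auto
      then show False using c by blast
    qed
    then have "ev (embE s n v) (fst c, snd c) = 0" unfolding ev_embE by (rule if_not_P)
    then show "?p c = 0" by simp
  qed simp_all
  also have "\<dots> = infsum (\<lambda>c. ev v c * ev (blkE s n w) c) (UNIV \<times> {..<n})"
    unfolding infsum_reindex[OF inj] o_def
  proof (rule infsum_cong)
    fix c :: "int \<times> nat" assume "c \<in> UNIV \<times> {..<n}"
    then show "?p (?f c) = ev v c * ev (blkE s n w) c" by (cases c) simp
  qed
  also have "\<dots> = inner v (blkE s n w)"
    unfolding inner_infsum
  proof (rule infsum_cong_neutral)
    fix c :: "int \<times> nat" assume "c \<in> UNIV - UNIV \<times> {..<n}"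
    then have "n \<le> snd c" by (simp add: mem_Times_iff)
    then show "ev v c * ev (blkE s n w) c = 0" using Es_ev[OF assms] by simp
  qed simp_all
  finally show ?thesis .
qed

lemma blk_decomp: "x \<in> Es (sp n k) \<Longrightarrow> x = (\<Sum>i<k. embE (sp n i) (n i) (blkE (sp n i) (n i) x))"
proof (rule pair_ell2_eqI)
  fix j m assume x: "x \<in> Es (sp n k)"
  have "ev (\<Sum>i<k. embE (sp n i) (n i) (blkE (sp n i) (n i) x)) (j, m)
      = (\<Sum>i<k. if sp n i \<le> m \<and> m < sp n i + n i then ev x (j, m) else 0)"
    unfolding ev_sum by (intro sum.cong refl) (simp add: less_diff_conv2)
  also have "\<dots> = ev x (j, m)" unfolding sum_blocks using Es_ev[OF x, of "(j, m)"] by simp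
  finally show "ev x (j, m) = ev (\<Sum>i<k. embE (sp n i) (n i) (blkE (sp n i) (n i) x)) (j, m)" by simp
qed

lemma norm_blocks: "x \<in> Es (sp n k) \<Longrightarrow> (norm x)\<^sup>2 = (\<Sum>i<k. (norm (blkE (sp n i) (n i) x))\<^sup>2)"
proof -
  assume x: "x \<in> Es (sp n k)"
  have "(norm x)\<^sup>2 = inner (\<Sum>i<k. embE (sp n i) (n i) (blkE (sp n i) (n i) x)) x"
    using blk_decomp[OF x] by (simp add: power2_norm_eq_inner)
  then show ?thesis by (simp add: inner_sum_left inner_embE power2_norm_eq_inner)
qed

lemma blkE_P: "blkE s n (Pp x) = Pp (blkE s n x)" "blkE s n (Pm x) = Pm (blkE s n x)"
  by (rule pair_ell2_eqI, simp)+

lemma Act_blocks: "x \<in> Es (sp n k) \<Longrightarrow> Act x = (\<Sum>i<k. Act (blkE (sp n i) (n i) x))"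
  unfolding Act_def using norm_blocks[OF P_Es(1)] norm_blocks[OF P_Es(2)]
  by (simp add: blkE_P sum_subtractf sum_divide_distrib)

text \<open>The weight \<open>wt\<close> depends on the frequency only and is unaffected by a shift
  of coordinates.\<close>

lemma L2f_Jst_blk:
  assumes f: "L2f N f" and sn: "s + n \<le> N"
  shows "blkE s n (Jst N f) = Jst n (\<lambda>t. blkP s n (f t))"
proof (rule pair_ell2_eqI)
  fix j m
  show "ev (blkE s n (Jst N f)) (j, m) = ev (Jst n (\<lambda>t. blkP s n (f t))) (j, m)"
  proof (cases "m < n")
    case True
    have "inner (f t) (ee (j, s + m) t) = inner (blkP s n (f t)) (ee (j, m) t)" for t
      using ee_blk(2)[of "(j, m)" n s t] inner_embP[OF ee_Ps, of "(j, m)" n s t "f t"] True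
      by (simp add: inner_commute)
    then have "gh f (j, s + m) = gh (\<lambda>t. blkP s n (f t)) (j, m)" by (simp add: gh_def)
    then show ?thesis using True sn by (simp add: ev_Jst[OF f] ev_Jst[OF L2f_blkP[OF f]] wt_def)
  qed (simp add: ev_Jst[OF L2f_blkP[OF f]])
qed

section \<open>Sums of Hamiltonians over the factors\<close>

locale ham_fam =
  fixes k :: nat and n :: "nat \<Rightarrow> nat" and G :: "nat \<Rightarrow> pv \<Rightarrow> real" and gr :: "nat \<Rightarrow> pv \<Rightarrow> pv" and Lc :: real
  assumes k: "1 \<le> k" and ham: "i < k \<Longrightarrow> ham (n i) (G i) (gr i) Lc"
begin

abbreviation "N \<equiv> sp n k"
abbreviation "bE i \<equiv> blkE (sp n i) (n i)"
abbreviation "bP i \<equiv> blkP (sp n i) (n i)"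

definition GT :: "pv \<Rightarrow> real" where "GT z = (\<Sum>i<k. G i (bP i z))"
definition grT :: "pv \<Rightarrow> pv" where "grT z = (\<Sum>i<k. embP (sp n i) (n i) (gr i (bP i z)))"

lemma blk_le: "i < k \<Longrightarrow> sp n i + n i \<le> N" by (rule sp_mono)

lemma bP_grT:
  assumes i: "i < k"
  shows "bP i (grT z) = gr i (bP i z)"
proof (rule pair_ell2_eqI)
  fix m b
  show "ev (bP i (grT z)) (m, b) = ev (gr i (bP i z)) (m, b)"
  proof (cases "m < n i")
    case True
    have "ev (grT z) (sp n i + m, b) = (\<Sum>j<k. if sp n j \<le> sp n i + m \<and> sp n i + m < sp n j + n j
        then ev (gr j (bP j z)) (sp n i + m - sp n j, b) else 0)"
      unfolding grT_def ev_sum by simp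
    also have "\<dots> = ev (gr i (bP i z)) (sp n i + m - sp n i, b)" by (rule sum_block_single[where n = n and f = "\<lambda>j. ev (gr j (bP j z)) (sp n i + m - sp n j, b)", OF i True])
    finally show ?thesis using True by simp
  next
    case False
    then show ?thesis using ham.gr_Ps[OF ham[OF i] blkP_Ps[of "sp n i" "n i" z]] by (simp add: Ps_def)
  qed
qed

lemma ham_T: "ham N GT grT (real k * Lc)"
proof
  have L1: "1 \<le> Lc" using ham.Lc1[OF ham[of 0]] k by simp
  have "1 * 1 \<le> real k * Lc" using k L1 by (intro mult_mono) auto
  then show "1 \<le> real k * Lc" by simp
  show "0 \<le> GT z" for z unfolding GT_def by (intro sum_nonneg ham.G_nonneg[OF ham]) simp
  show "grT z \<in> Ps N" for z unfolding grT_def by (intro Ps_sum embP_Ps blk_le) simp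
  fix z w :: pv
  have "norm (grT z - grT w) \<le> (\<Sum>i<k. Lc * norm (z - w))"
    unfolding grT_def sum_subtractf[symmetric]
  proof (rule sum_norm_le)
    fix i assume "i \<in> {..<k}"
    then have i: "i < k" by simp
    have "norm (embP (sp n i) (n i) (gr i (bP i z)) - embP (sp n i) (n i) (gr i (bP i w)))
        = norm (embP (sp n i) (n i) (gr i (bP i z) - gr i (bP i w)))"
      by (rule arg_cong[of _ _ norm], rule pair_ell2_eqI) simp
    also have "\<dots> \<le> norm (gr i (bP i z) - gr i (bP i w))" by (rule norm_embP_le)
    also have "\<dots> \<le> Lc * norm (bP i z - bP i w)" by (rule ham.gr_lip[OF ham[OF i]])
    also have "\<dots> \<le> Lc * norm (z - w)"
      using L1 norm_blkP_le[of "sp n i" "n i" "z - w"] by (intro mult_left_mono) (auto simp: blkP_diff)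
    finally show "norm (embP (sp n i) (n i) (gr i (bP i z)) - embP (sp n i) (n i) (gr i (bP i w))) \<le> Lc * norm (z - w)" .
  qed
  then show "norm (grT z - grT w) \<le> real k * Lc * norm (z - w)" by simp
  have eq: "GT w - GT z - inner (grT z) (w - z) = (\<Sum>i<k. G i (bP i w) - G i (bP i z) - inner (gr i (bP i z)) (bP i w - bP i z))"
  proof -
    have "inner (embP (sp n i) (n i) (gr i (bP i z))) (w - z) = inner (gr i (bP i z)) (bP i w - bP i z)" if "i < k" for i
      using inner_embP[OF ham.gr_Ps[OF ham[OF that] blkP_Ps]] by (simp add: blkP_diff)
    then show ?thesis unfolding GT_def grT_def inner_sum_left by (simp add: sum_subtractf)
  qed
  have "\<bar>GT w - GT z - inner (grT z) (w - z)\<bar> \<le> (\<Sum>i<k. Lc * (norm (w - z))\<^sup>2)"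
    unfolding eq
  proof (rule order_trans[OF sum_abs sum_mono])
    fix i assume "i \<in> {..<k}"
    then have i: "i < k" by simp
    have "\<bar>G i (bP i w) - G i (bP i z) - inner (gr i (bP i z)) (bP i w - bP i z)\<bar> \<le> Lc * (norm (bP i w - bP i z))\<^sup>2"
      by (rule ham.G_quad[OF ham[OF i]])
    also have "\<dots> \<le> Lc * (norm (w - z))\<^sup>2"
      using L1 norm_blkP_le[of "sp n i" "n i" "w - z"] by (intro mult_left_mono power_mono) (auto simp: blkP_diff)
    finally show "\<bar>G i (bP i w) - G i (bP i z) - inner (gr i (bP i z)) (bP i w - bP i z)\<bar> \<le> Lc * (norm (w - z))\<^sup>2" .
  qed
  then show "\<bar>GT w - GT z - inner (grT z) (w - z)\<bar> \<le> real k * Lc * (norm (w - z))\<^sup>2" by simp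
qed

sublocale T: ham N GT grT "real k * Lc" by (rule ham_T)

lemma Phi_blocks:
  assumes x: "x \<in> Es N"
  shows "Phi N GT x = (\<Sum>i<k. Phi (n i) (G i) (bE i x))"
proof -
  have "IG N GT x = (\<Sum>i<k. \<integral>t. G i (bP i (lp N x t)) \<partial>MI)"
    unfolding IG_def GT_def
    by (intro Bochner_Integration.integral_sum ham.G_integrable[OF ham] L2f_blkP[where N = N] L2f_lp) simp
  also have "\<dots> = (\<Sum>i<k. IG (n i) (G i) (bE i x))"
  proof (rule sum.cong[OF refl])
    fix i assume "i \<in> {..<k}"
    then have i: "i < k" by simp
    have 1: "integrable MI (\<lambda>t. G i (bP i (lp N x t)))" by (intro ham.G_integrable[OF ham[OF i]] L2f_blkP[where N = N] L2f_lp)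
    have 2: "integrable MI (\<lambda>t. G i (lp (n i) (bE i x) t))" by (intro ham.G_integrable[OF ham[OF i]] L2f_lp)
    have "AE t in MI. G i (bP i (lp N x t)) = G i (lp (n i) (bE i x) t)"
      using lp_blk[OF blk_le[OF i], of x] by eventually_elim simp
    then show "(\<integral>t. G i (bP i (lp N x t)) \<partial>MI) = IG (n i) (G i) (bE i x)"
      unfolding IG_def by (intro integral_cong_AE borel_measurable_integrable[OF 1] borel_measurable_integrable[OF 2])
  qed
  finally show ?thesis unfolding Phi_def Act_blocks[OF x] by (simp add: sum_subtractf)
qed

text \<open>Consequently a gradient step in the product moves every block along its own
  gradient.\<close>

lemma gradP_blocks:
  assumes i: "i < k"
  shows "bE i (gradP N grT x) = gradP (n i) (gr i) (bE i x)"
proof -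
  have "bE i (Wg N grT x) = Jst (n i) (\<lambda>t. bP i (grT (lp N x t)))"
    unfolding Wg_def by (intro L2f_Jst_blk[where N = N] T.L2f_gr L2f_lp blk_le i)
  also have "\<dots> = Wg (n i) (gr i) (bE i x)"
    unfolding Wg_def
  proof (rule Jst_cong_AE)
    show "L2f (n i) (\<lambda>t. bP i (grT (lp N x t)))" by (intro L2f_blkP[where N = N] T.L2f_gr L2f_lp)
    show "L2f (n i) (\<lambda>t. gr i (lp (n i) (bE i x) t))" by (intro ham.L2f_gr[OF ham[OF i]] L2f_lp)
    show "AE t in MI. bP i (grT (lp N x t)) = gr i (lp (n i) (bE i x) t)"
      using lp_blk[OF blk_le[OF i], of x] by eventually_elim (simp add: bP_grT[OF i])
  qed
  finally show ?thesis by (simp add: gradP_def blkE_diff blkE_P)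
qed

text \<open>Zero up to \<open>\<epsilon> / 2\<close>, one from \<open>\<epsilon>\<close> on. In
  \<open>stp\<close> it is evaluated at the total action, so all blocks move with the same step
  length and the step remains a multiple of the gradient in the product.\<close>

definition cut :: "real \<Rightarrow> real \<Rightarrow> real" where "cut \<epsilon> s = max 0 (min 1 ((s - \<epsilon> / 2) / (\<epsilon> / 2)))"

definition stp :: "real \<Rightarrow> real \<Rightarrow> ec \<Rightarrow> ec" where
  "stp \<tau> \<epsilon> y = y + (\<tau> * cut \<epsilon> (Phi N GT y)) *\<^sub>R gradP N grT y"

lemma cut: "0 \<le> cut \<epsilon> s" "cut \<epsilon> s \<le> 1" by (auto simp: cut_def)

lemma cut_zero: "0 < \<epsilon> \<Longrightarrow> s \<le> 0 \<Longrightarrow> cut \<epsilon> s = 0"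
  by (simp add: cut_def divide_nonpos_pos)

lemma cut_one: "0 < \<epsilon> \<Longrightarrow> \<epsilon> \<le> s \<Longrightarrow> cut \<epsilon> s = 1"
  by (simp add: cut_def)

lemma stp_Es: "y \<in> Es N \<Longrightarrow> stp \<tau> \<epsilon> y \<in> Es N"
  unfolding stp_def by (intro Es_add Es_scaleR T.gradP_Es)

lemma stp_iter_Es: "y \<in> Es N \<Longrightarrow> (stp \<tau> \<epsilon> ^^ m) y \<in> Es N"
  by (induction m) (simp_all add: stp_Es)

text \<open>Each iterate is again the end map of a homotopy, so the gradient step can be appended
  any finite number of times.\<close>

lemma stp_deform:
  assumes \<tau>: "0 \<le> \<tau>" "\<tau> * (2 * (real k * Lc + 1)) \<le> 1" and \<epsilon>: "0 < \<epsilon>" and \<rho>: "0 < \<rho>"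
  shows "\<exists>a b c K. deform N a b c K \<and> (\<forall>x\<in>Es N. dfm a b c K x 1 = (stp \<tau> \<epsilon> ^^ m) (\<rho> *\<^sub>R x + cst N q))"
proof (induction m)
  case 0
  show ?case
  proof (rule exI, rule exI, rule exI, rule exI, rule conjI[OF deform_start(1)[OF \<rho>, of N q]], rule ballI)
    fix x
    show "dfm (\<lambda>x u. 1 - u + u * \<rho>) (\<lambda>x u. 1 - u + u * \<rho>) (\<lambda>x u. 1 - u + u * \<rho>) (\<lambda>x u. u *\<^sub>R cst N q) x 1
        = (stp \<tau> \<epsilon> ^^ 0) (\<rho> *\<^sub>R x + cst N q)"
      unfolding deform_start(2)[OF \<rho>] by simp
  qed
next
  case (Suc m)
  then obtain a b c K where D: "deform N a b c K"
    and e: "\<forall>x\<in>Es N. dfm a b c K x 1 = (stp \<tau> \<epsilon> ^^ m) (\<rho> *\<^sub>R x + cst N q)" by (elim exE conjE)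
  have cc: "continuous_on UNIV (cut \<epsilon>)" unfolding cut_def using \<epsilon> by (intro continuous_intros) auto
  obtain a' b' c' K' where D': "deform N a' b' c' K'" and e': "\<forall>x\<in>Es N. \<forall>u\<in>{0..1}. dfm a' b' c' K' x u =
    dfm a b c K x u + (u * \<tau> * cut \<epsilon> (Phi N GT (dfm a b c K x u))) *\<^sub>R gradP N grT (dfm a b c K x u)"
  proof -
    have "0 \<le> cut \<epsilon> s \<and> cut \<epsilon> s \<le> 1" for s using cut by blast
    note st = T.deform_step[OF D \<tau> cc this]
    show thesis
      by (rule exE[OF st], erule cut_zero[OF \<epsilon>], elim exE conjE, rule that)
  qed
  have "dfm a' b' c' K' x 1 = (stp \<tau> \<epsilon> ^^ Suc m) (\<rho> *\<^sub>R x + cst N q)" if "x \<in> Es N" for x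
    using bspec[OF bspec[OF e' that], of 1] bspec[OF e that] by (simp add: stp_def)
  with D' show ?case by (intro exI[of _ a'] exI[of _ b'] exI[of _ c'] exI[of _ K'] conjI ballI)
qed

text \<open>The common step length is short enough for the constant of each block, so the ascent
  estimate applies block by block.\<close>

lemma stp_block_mono:
  assumes \<tau>: "0 \<le> \<tau>" "\<tau> * (2 * (Lc + 1)) \<le> 1" and i: "i < k"
  shows "Phi (n i) (G i) (bE i y) + \<tau> * cut \<epsilon> (Phi N GT y) / 2 * (norm (gradP (n i) (gr i) (bE i y)))\<^sup>2
    \<le> Phi (n i) (G i) (bE i (stp \<tau> \<epsilon> y))"
proof -
  let ?\<theta> = "\<tau> * cut \<epsilon> (Phi N GT y)"
  have L1: "1 \<le> Lc" by (rule ham.Lc1[OF ham[OF i]])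
  have "?\<theta> * (2 * (Lc + 1)) \<le> \<tau> * (2 * (Lc + 1))"
    using \<tau> cut[of \<epsilon> "Phi N GT y"] L1 by (intro mult_right_mono) (auto simp: mult_left_le)
  then have "?\<theta> * (2 * (Lc + 1)) \<le> 1" using \<tau> by linarith
  from ham.Phi_ascent[OF ham[OF i] blkE_Es _ this, of "sp n i" y] show ?thesis
    unfolding stp_def using \<tau> cut by (simp add: blkE_add blkE_scaleR gradP_blocks[OF i])
qed

text \<open>No block loses action, so the others stay nonnegative and the total stays above the
  action of block \<open>i\<close>, hence above \<open>\<epsilon>\<close>, where the cut-off equals
  one. Until block \<open>i\<close> passes \<open>\<beta>\<close>, each step adds at least
  \<open>\<tau> / 2 * \<delta>\<^sup>2\<close> to it.\<close>

lemma flow_reaches: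
  assumes \<tau>: "0 < \<tau>" "\<tau> * (2 * (Lc + 1)) \<le> 1" and \<epsilon>: "0 < \<epsilon>" and \<delta>: "0 < \<delta>"
    and gap: "\<And>i x. i < k \<Longrightarrow> x \<in> Es (n i) \<Longrightarrow> \<epsilon> \<le> Phi (n i) (G i) x \<Longrightarrow> Phi (n i) (G i) x \<le> \<beta>
      \<Longrightarrow> \<delta> \<le> norm (gradP (n i) (gr i) x)"
    and y: "y \<in> Es N" "\<And>i. i < k \<Longrightarrow> 0 \<le> Phi (n i) (G i) (bE i y)"
    and i: "i < k" "\<epsilon> \<le> Phi (n i) (G i) (bE i y)"
    and m: "\<beta> \<le> real m * (\<tau> / 2 * \<delta>\<^sup>2)"
  shows "\<beta> \<le> Phi N GT ((stp \<tau> \<epsilon> ^^ m) y)"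
proof -
  let ?y = "\<lambda>m. (stp \<tau> \<epsilon> ^^ m) y"
  let ?f = "\<lambda>j m. Phi (n j) (G j) (bE j (?y m))"
  have step: "?f j m + \<tau> * cut \<epsilon> (Phi N GT (?y m)) / 2 * (norm (gradP (n j) (gr j) (bE j (?y m))))\<^sup>2 \<le> ?f j (Suc m)"
    if "j < k" for j m using stp_block_mono[OF less_imp_le[OF \<tau>(1)] \<tau>(2) that, where \<epsilon> = \<epsilon> and y = "?y m"] by simp
  have "?f j m \<le> ?f j (Suc m)" if "j < k" for j m
  proof -
    have "0 \<le> \<tau> * cut \<epsilon> (Phi N GT (?y m)) / 2 * (norm (gradP (n j) (gr j) (bE j (?y m))))\<^sup>2"
      using \<tau>(1) cut by (intro mult_nonneg_nonneg divide_nonneg_nonneg) auto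
    then show ?thesis using step[OF that, of m] by linarith
  qed
  then have mono: "?f j 0 \<le> ?f j m" if "j < k" for j m
    using that by (induction m) (auto intro: order_trans)
  then have nn: "0 \<le> ?f j m" if "j < k" for j m using order_trans[OF y(2)[OF that], of "?f j m"] that by simp
  have tot: "?f i m \<le> Phi N GT (?y m)" for m
    unfolding Phi_blocks[OF stp_iter_Es[OF y(1)]]
    by (rule member_le_sum[of i "{..<k}" "\<lambda>j. ?f j m"]) (use i nn in auto)
  have e: "\<epsilon> \<le> ?f i m" for m using order_trans[OF i(2), of "?f i m"] mono[OF i(1), of m] by simp
  have "min \<beta> (real m * (\<tau> / 2 * \<delta>\<^sup>2)) \<le> ?f i m" for m
  proof (induction m)
    case 0
    then show ?case using e[of 0] \<epsilon> by simp
  next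
    case (Suc m)
    show ?case
    proof (cases "?f i m \<le> \<beta>")
      case True
      have "\<delta> \<le> norm (gradP (n i) (gr i) (bE i (?y m)))" by (intro gap i blkE_Es e True)
      then have "\<delta>\<^sup>2 \<le> (norm (gradP (n i) (gr i) (bE i (?y m))))\<^sup>2" using \<delta> by (intro power_mono) auto
      then have "\<tau> / 2 * \<delta>\<^sup>2 \<le> \<tau> / 2 * (norm (gradP (n i) (gr i) (bE i (?y m))))\<^sup>2"
        using \<tau>(1) by (intro mult_left_mono) auto
      moreover have "cut \<epsilon> (Phi N GT (?y m)) = 1" using order_trans[OF e tot] by (rule cut_one[OF \<epsilon>])
      ultimately have "?f i m + \<tau> / 2 * \<delta>\<^sup>2 \<le> ?f i (Suc m)" using step[OF i(1), of m] by simp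
      moreover have "0 \<le> \<tau> / 2 * \<delta>\<^sup>2" using \<tau>(1) by simp
      ultimately show ?thesis using Suc by (simp add: distrib_right min_def split: if_splits)
    next
      case False
      then have "\<beta> \<le> ?f i (Suc m)" using \<open>\<And>j m. j < k \<Longrightarrow> ?f j m \<le> ?f j (Suc m)\<close>[OF i(1), of m] by linarith
      then show ?thesis by (rule min.coboundedI1)
    qed
  qed
  from this[of m] have "\<beta> \<le> ?f i m" using m by simp
  then show ?thesis using tot[of m] by linarith
qed

lemma Min_pos:
  assumes "\<And>i. i < k \<Longrightarrow> (0 :: real) < r i"
  shows "0 < Min (r ` {..<k})" "\<And>i. i < k \<Longrightarrow> Min (r ` {..<k}) \<le> r i"
proof -
  have "{..<k} \<noteq> {}" using k by (simp add: lessThan_empty_iff)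
  then have "Min (r ` {..<k}) \<in> r ` {..<k}" by (intro Min_in) auto
  then show "0 < Min (r ` {..<k})" using assms by auto
  show "Min (r ` {..<k}) \<le> r i" if "i < k" for i using that by (intro Min_le) auto
qed

text \<open>On a small sphere around a constant loop some block carries at least the fraction
  \<open>1 / real k\<close> of the squared norm; its action is at least \<open>\<epsilon>\<close>,
  and the steps lift it to \<open>\<beta>\<close>. Lowering the Hamiltonian from \<open>GT\<close>
  to \<open>G0\<close> only raises the action.\<close>

lemma lower_bound:
  assumes gap: "\<And>i \<epsilon>. i < k \<Longrightarrow> 0 < \<epsilon> \<Longrightarrow> \<exists>\<delta>>0. \<forall>x\<in>Es (n i). \<epsilon> \<le> Phi (n i) (G i) x \<longrightarrow> Phi (n i) (G i) x \<le> \<beta>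
      \<longrightarrow> \<delta> \<le> norm (gradP (n i) (gr i) x)"
    and near: "\<And>i. i < k \<Longrightarrow> \<exists>r>0. \<forall>x\<in>Es (n i). Pp x = x \<longrightarrow> norm x \<le> r \<longrightarrow> (norm x)\<^sup>2 / 4 \<le> Phi (n i) (G i) (x + cst (n i) (q i))"
    and G0: "\<And>v. v \<in> Ps N \<Longrightarrow> 0 \<le> G0 (pnt v) \<and> G0 (pnt v) \<le> GT v"
  shows "ereal \<beta> \<le> cEH_fun N G0"
proof -
  have k0: "0 < k" using k by simp
  have L1: "1 \<le> Lc" by (rule ham.Lc1[OF ham[OF k0]])
  have kL: "Lc \<le> real k * Lc" using k L1 by (simp add: mult_le_cancel_right1)
  let ?A = "\<lambda>i r. 0 < r \<and> (\<forall>x\<in>Es (n i). Pp x = x \<longrightarrow> norm x \<le> r \<longrightarrow> (norm x)\<^sup>2 / 4 \<le> Phi (n i) (G i) (x + cst (n i) (q i)))"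
  from near obtain r where "\<forall>i\<in>{..<k}. ?A i (r i)"
    using bchoice[of "{..<k}" ?A]
    by auto
  then have r: "\<And>i. i < k \<Longrightarrow> 0 < r i" "\<And>i x. i < k \<Longrightarrow> x \<in> Es (n i) \<Longrightarrow> Pp x = x \<Longrightarrow> norm x \<le> r i \<Longrightarrow> (norm x)\<^sup>2 / 4 \<le> Phi (n i) (G i) (x + cst (n i) (q i))"
    by simp_all
  define \<rho> where "\<rho> = Min (r ` {..<k})"
  have \<rho>: "0 < \<rho>" "\<And>i. i < k \<Longrightarrow> \<rho> \<le> r i" unfolding \<rho>_def by (rule Min_pos[of r, OF r(1)], assumption)+
  define \<epsilon> where "\<epsilon> = \<rho>\<^sup>2 / (4 * real k)"
  have \<epsilon>: "0 < \<epsilon>" unfolding \<epsilon>_def using \<rho>(1) k0 by simp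
  let ?B = "\<lambda>i d. 0 < d \<and> (\<forall>x\<in>Es (n i). \<epsilon> \<le> Phi (n i) (G i) x \<longrightarrow> Phi (n i) (G i) x \<le> \<beta>
      \<longrightarrow> d \<le> norm (gradP (n i) (gr i) x))"
  from gap obtain d where "\<forall>i\<in>{..<k}. ?B i (d i)"
    using bchoice[of "{..<k}" ?B] \<epsilon> by auto
  then have d: "\<And>i. i < k \<Longrightarrow> 0 < d i" "\<And>i x. i < k \<Longrightarrow> x \<in> Es (n i) \<Longrightarrow> \<epsilon> \<le> Phi (n i) (G i) x \<Longrightarrow> Phi (n i) (G i) x \<le> \<beta> \<Longrightarrow> d i \<le> norm (gradP (n i) (gr i) x)"
    by simp_all
  define \<delta> where "\<delta> = Min (d ` {..<k})"
  have \<delta>: "0 < \<delta>" "\<And>i. i < k \<Longrightarrow> \<delta> \<le> d i" unfolding \<delta>_def by (rule Min_pos[of d, OF d(1)], assumption)+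
  \<comment> \<open>The largest length allowed by the constant of the sum, which is at least that of
    each block.\<close>
  define \<tau> where "\<tau> = 1 / (2 * (real k * Lc + 1))"
  have den: "0 < 2 * (real k * Lc + 1)"
  proof -
    have gen: "0 < 2 * (a + 1)" if "b \<le> a" "1 \<le> b" for a b :: real
    proof -
      have "0 < a + 1" using that by linarith
      then show ?thesis by simp
    qed
    show ?thesis by (rule gen[OF kL L1])
  qed
  have \<tau>: "0 < \<tau>" "\<tau> * (2 * (real k * Lc + 1)) \<le> 1" unfolding \<tau>_def using den by simp_all
  have "\<tau> * (2 * (Lc + 1)) \<le> \<tau> * (2 * (real k * Lc + 1))" using \<tau>(1) kL by (intro mult_left_mono) auto
  then have \<tau>': "\<tau> * (2 * (Lc + 1)) \<le> 1" using \<tau>(2) by linarith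
  have "0 < \<tau> / 2 * \<delta>\<^sup>2" using \<tau> \<delta> by simp
  then obtain m where m: "\<beta> \<le> real m * (\<tau> / 2 * \<delta>\<^sup>2)" using reals_Archimedean3[of "\<tau> / 2 * \<delta>\<^sup>2"] by (auto intro: less_imp_le)
  \<comment> \<open>The centre of the sphere, with the constant \<open>q i\<close> in block
    \<open>i\<close>.\<close>
  define Q where "Q = (\<Sum>i<k. embP (sp n i) (n i) (q i))"
  have bQ: "bE i (cst N Q) = cst (n i) (q i)" if i: "i < k" for i
  proof (rule pair_ell2_eqI)
    fix j m
    show "ev (bE i (cst N Q)) (j, m) = ev (cst (n i) (q i)) (j, m)"
    proof (cases "m < n i")
      case True
      have "ev Q (sp n i + m, False) = (\<Sum>j<k. if sp n j \<le> sp n i + m \<and> sp n i + m < sp n j + n j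
          then ev (q j) (sp n i + m - sp n j, False) else 0)"
        unfolding Q_def ev_sum by simp
      also have "\<dots> = ev (q i) (sp n i + m - sp n i, False)" by (rule sum_block_single[where n = n and f = "\<lambda>j. ev (q j) (sp n i + m - sp n j, False)", OF i True])
      finally show ?thesis using True blk_le[OF i] by (simp add: ev_cst)
    qed (simp add: ev_cst)
  qed
  obtain a b c K where D: "deform N a b c K" and e: "\<forall>x\<in>Es N. dfm a b c K x 1 = (stp \<tau> \<epsilon> ^^ m) (\<rho> *\<^sub>R x + cst N Q)"
    using stp_deform[OF less_imp_le[OF \<tau>(1)] \<tau>(2) \<epsilon> \<rho>(1), of m Q] by (elim exE conjE)
  interpret D: deform N a b c K by fact
  have main: "\<beta> \<le> Phi N GT (dfm a b c K x 1)" if x: "x \<in> Sp N" for x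
  proof -
    have xs: "x \<in> Es N" "Pp x = x" "norm x = 1" using x by (simp_all add: Sp_def)
    let ?y = "\<rho> *\<^sub>R x + cst N Q"
    have yb: "bE i ?y = \<rho> *\<^sub>R bE i x + cst (n i) (q i)" if "i < k" for i
      by (simp add: blkE_add blkE_scaleR bQ[OF that])
    have init: "\<rho>\<^sup>2 * (norm (bE i x))\<^sup>2 / 4 \<le> Phi (n i) (G i) (bE i ?y)" if "i < k" for i
    proof -
      have "norm (\<rho> *\<^sub>R bE i x) \<le> \<rho> * 1" using \<rho>(1) norm_blkE_le[of "sp n i" "n i" x] xs(3) by simp
      then have "norm (\<rho> *\<^sub>R bE i x) \<le> r i" using \<rho>(2)[OF that] by linarith
      moreover have "Pp (\<rho> *\<^sub>R bE i x) = \<rho> *\<^sub>R bE i x" using xs(2) by (simp add: P_scaleR flip: blkE_P)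
      ultimately have "(norm (\<rho> *\<^sub>R bE i x))\<^sup>2 / 4 \<le> Phi (n i) (G i) (\<rho> *\<^sub>R bE i x + cst (n i) (q i))"
        by (intro r(2)[OF that] Es_scaleR blkE_Es)
      then show ?thesis unfolding yb[OF that] by (simp add: power_mult_distrib)
    qed
    have "\<exists>i<k. 1 / real k \<le> (norm (bE i x))\<^sup>2"
    proof (rule ccontr)
      assume no: "\<not> ?thesis"
      have "(\<Sum>i<k. (norm (bE i x))\<^sup>2) < (\<Sum>i<k. 1 / real k)"
        by (rule sum_strict_mono) (use no k0 in \<open>auto simp: not_le\<close>)
      then show False using norm_blocks[OF xs(1)] xs(3) k0 by simp
    qed
    then obtain i where i: "i < k" "1 / real k \<le> (norm (bE i x))\<^sup>2" by blast
    have "\<rho>\<^sup>2 * (1 / real k) \<le> \<rho>\<^sup>2 * (norm (bE i x))\<^sup>2" by (intro mult_left_mono i) simp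
    then have ei: "\<epsilon> \<le> Phi (n i) (G i) (bE i ?y)" using init[OF i(1)] unfolding \<epsilon>_def by simp
    have "\<beta> \<le> Phi N GT ((stp \<tau> \<epsilon> ^^ m) ?y)"
    proof (rule flow_reaches[OF \<tau>(1) \<tau>' \<epsilon> \<delta>(1) _ _ _ i(1) ei m])
      fix j z assume z: "j < k" "z \<in> Es (n j)" "\<epsilon> \<le> Phi (n j) (G j) z" "Phi (n j) (G j) z \<le> \<beta>"
      show "\<delta> \<le> norm (gradP (n j) (gr j) z)" using d(2)[OF z] \<delta>(2)[OF z(1)] by linarith
    next
      show "?y \<in> Es N" by (intro Es_add Es_scaleR xs cst_Es)
    next
      fix j assume "j < k"
      have "0 \<le> \<rho>\<^sup>2 * (norm (bE j x))\<^sup>2 / 4" by simp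
      then show "0 \<le> Phi (n j) (G j) (bE j ?y)" using init[OF \<open>j < k\<close>] by linarith
    qed
    then show ?thesis using bspec[OF e xs(1)] by simp
  qed
  have le: "ereal \<beta> \<le> ereal (PhiH N G0 (ofE (dfm a b c K (toE z) 1)))" if zS: "z \<in> Esphere_plus N" for z
  proof -
    obtain x where x: "x \<in> Sp N" "z = ofE x" using zS unfolding Esphere_plus_ofE by (elim imageE)
    then have xE: "x \<in> Es N" by (simp add: Sp_def)
    let ?w = "dfm a b c K x 1"
    have wE: "?w \<in> Es N" using D.dfm_Es[OF xE, of 1] by simp
    \<comment> \<open>Integrability is asked of the larger function only: a function without
      integral gets the value 0, which the nonnegative right-hand side exceeds or equals.\<close>
    have "IG N (\<lambda>v. G0 (pnt v)) ?w \<le> IG N GT ?w"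
      unfolding IG_def by (rule integral_mono') (use T.G_integrable[OF L2f_lp] G0[OF lp_Ps] T.G_nonneg in auto)
    then have "\<beta> \<le> PhiH N G0 (ofE ?w)"
      using main[OF x(1)] unfolding PhiH_ofE[OF wE] Phi_def by linarith
    then show ?thesis using x(2) toE_ofE[OF xE] by simp
  qed
  have "ereal \<beta> \<le> (INF z\<in>Esphere_plus N. ereal (PhiH N G0 (ofE (dfm a b c K (toE z) 1))))"
    by (rule INF_greatest) (rule le)
  also have "\<dots> \<le> cEH_fun N G0"
    unfolding cEH_fun_def by (rule SUP_upper2[OF _ order_refl]) (simp add: D.admissible_ofE)
  finally show ?thesis .
qed

end

section \<open>Squared distance to a convex body\<close>

text \<open>The nearest-point projection; for convex \<open>K\<close> the choice is unique by
  \<open>pr_unique\<close>.\<close>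

definition pr :: "'a :: real_inner set \<Rightarrow> 'a \<Rightarrow> 'a" where
  "pr K z = (SOME y. y \<in> K \<and> (\<forall>w\<in>K. norm (z - y) \<le> norm (z - w)))"

lemma pr_props:
  assumes "compact K" "K \<noteq> {}"
  shows pr_in: "pr K z \<in> K" and pr_le: "w \<in> K \<Longrightarrow> norm (z - pr K z) \<le> norm (z - w)"
proof -
  have "\<exists>y\<in>K. \<forall>w\<in>K. norm (z - y) \<le> norm (z - w)"
    by (intro continuous_attains_inf assms continuous_intros)
  then have "\<exists>y. y \<in> K \<and> (\<forall>w\<in>K. norm (z - y) \<le> norm (z - w))" by (simp add: Bex_def)
  from someI_ex[OF this] show "pr K z \<in> K" and "w \<in> K \<Longrightarrow> norm (z - pr K z) \<le> norm (z - w)"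
    unfolding pr_def by blast+
qed

lemma pr_var:
  assumes K: "compact K" "convex K" and w: "w \<in> K"
  shows "inner (z - pr K z) (w - pr K z) \<le> 0"
proof (rule any_closest_point_dot[OF K(2) compact_imp_closed[OF K(1)] pr_in[OF K(1)] w])
  show "\<forall>y\<in>K. dist z (pr K z) \<le> dist z y"
    unfolding dist_norm using w by (intro ballI pr_le K) auto
qed (use w in blast)

lemma pr_unique:
  assumes K: "compact K" "convex K" and y: "y \<in> K" "\<And>w. w \<in> K \<Longrightarrow> inner (z - y) (w - y) \<le> 0"
  shows "pr K z = y"
proof -
  have K0: "K \<noteq> {}" using y by blast
  have 1: "inner (z - y) (pr K z - y) \<le> 0" by (rule y(2)[OF pr_in[OF K(1) K0]])
  have 2: "inner (z - pr K z) (y - pr K z) \<le> 0" by (rule pr_var[OF K y(1)])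
  have "inner (pr K z - y) (pr K z - y) = inner (z - y) (pr K z - y) + inner (z - pr K z) (y - pr K z)"
    by (simp add: algebra_simps inner_commute)
  then have "inner (pr K z - y) (pr K z - y) \<le> 0" using 1 2 by linarith
  then show ?thesis using inner_ge_zero[of "pr K z - y"] by (metis antisym inner_eq_zero_iff right_minus_eq)
qed

lemma pr_id: "compact K \<Longrightarrow> convex K \<Longrightarrow> z \<in> K \<Longrightarrow> pr K z = z"
  by (rule pr_unique) auto

definition rs :: "'a :: real_inner set \<Rightarrow> 'a \<Rightarrow> 'a" where "rs K z = z - pr K z"

text \<open>The variational inequalities at the two feet show that the increments of projection and
  residual have nonnegative inner product, so neither is longer than their sum.\<close>

lemma rs_lip:
  assumes K: "compact K" "convex K" "K \<noteq> {}"
  shows "norm (rs K z - rs K w) \<le> norm (z - w)"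
proof -
  let ?p = "pr K z - pr K w" and ?u = "rs K z - rs K w"
  have 1: "inner (rs K z) (pr K w - pr K z) \<le> 0" unfolding rs_def by (intro pr_var pr_in K)
  have 2: "inner (rs K w) (pr K z - pr K w) \<le> 0" unfolding rs_def by (intro pr_var pr_in K)
  have 3: "inner ?p ?u = - inner (rs K z) (pr K w - pr K z) - inner (rs K w) (pr K z - pr K w)"
    by (simp add: inner_diff_left inner_diff_right inner_commute)
  have "z - w = 1 *\<^sub>R ?p + ?u" by (simp add: rs_def)
  then have "(norm (z - w))\<^sup>2 = (norm ?p)\<^sup>2 + 2 * inner ?p ?u + (norm ?u)\<^sup>2"
    using norm_sq_comb[of 1 ?p ?u] by simp
  then have "(norm ?u)\<^sup>2 \<le> (norm (z - w))\<^sup>2" using 1 2 3 zero_le_power2[of "norm ?p"] by linarith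
  then show ?thesis by (rule power2_le_imp_le) simp
qed

text \<open>The lower bound is convexity of the squared distance; the upper bound compares
  \<open>w\<close> with the foot of \<open>z\<close>.\<close>

lemma rs_quad:
  assumes K: "compact K" "convex K" "K \<noteq> {}"
  shows "0 \<le> (norm (rs K w))\<^sup>2 - (norm (rs K z))\<^sup>2 - 2 * inner (rs K z) (w - z)"
    and "(norm (rs K w))\<^sup>2 - (norm (rs K z))\<^sup>2 - 2 * inner (rs K z) (w - z) \<le> (norm (w - z))\<^sup>2"
proof -
  let ?a = "rs K z" and ?b = "rs K w"
  have 1: "inner ?a (pr K w - pr K z) \<le> 0" unfolding rs_def by (intro pr_var pr_in K)
  have "w - z = ?b - ?a + (pr K w - pr K z)" by (simp add: rs_def)
  then have 2: "inner ?a (w - z) = inner ?a ?b - inner ?a ?a + inner ?a (pr K w - pr K z)"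
    by (simp add: inner_add_right inner_diff_right)
  have 3: "0 \<le> (norm (?b - ?a))\<^sup>2" by simp
  have 4: "(norm (?b - ?a))\<^sup>2 = (norm ?b)\<^sup>2 - 2 * inner ?a ?b + (norm ?a)\<^sup>2"
    by (simp add: power2_norm_eq_inner inner_diff_left inner_diff_right inner_commute)
  have 5: "inner ?a ?a = (norm ?a)\<^sup>2" by (simp add: power2_norm_eq_inner)
  show "0 \<le> (norm ?b)\<^sup>2 - (norm ?a)\<^sup>2 - 2 * inner ?a (w - z)" using 1 2 3 4 5 by linarith
  have "norm ?b \<le> norm (w - pr K z)" unfolding rs_def by (intro pr_le pr_in K)
  then have "(norm ?b)\<^sup>2 \<le> (norm (1 *\<^sub>R ?a + (w - z)))\<^sup>2" by (intro power_mono) (simp_all add: rs_def)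
  then show "(norm ?b)\<^sup>2 - (norm ?a)\<^sup>2 - 2 * inner ?a (w - z) \<le> (norm (w - z))\<^sup>2"
    unfolding norm_sq_comb by simp
qed

lemma inner_tauP_shift: "inner (tauP v) w = inner v (tauP w)"
  using inner_tauP[of v "tauP w"] by simp

text \<open>The involution is an isometry preserving \<open>K\<close>, so the image of the foot
  satisfies the variational inequality at the image point.\<close>

lemma pr_tau:
  assumes K: "compact K" "convex K" "K \<noteq> {}" and tau: "\<And>z. z \<in> K \<Longrightarrow> tauP z \<in> K"
  shows "pr K (tauP z) = tauP (pr K z)"
proof (rule pr_unique[OF K(1,2)])
  show "tauP (pr K z) \<in> K" by (intro tau pr_in K)
  fix w assume "w \<in> K"
  have "inner (tauP z - tauP (pr K z)) (w - tauP (pr K z)) = inner (z - pr K z) (tauP w - pr K z)"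
    unfolding tauP_diff[symmetric] inner_tauP_shift by (simp add: tauP_diff)
  then show "inner (tauP z - tauP (pr K z)) (w - tauP (pr K z)) \<le> 0"
    using pr_var[OF K(1,2) tau[OF \<open>w \<in> K\<close>], of z] by simp
qed

lemma ham_mono: "ham l G gr L \<Longrightarrow> L \<le> L' \<Longrightarrow> ham l G gr L'"
  unfolding ham_def by (meson mult_right_mono norm_ge_zero order_trans zero_le_power2)

text \<open>By the mean value theorem the remainder is the gradient increment at a point of the
  segment, tested against \<open>w - z\<close>.\<close>

lemma quad_of_lipschitz:
  fixes G :: "'a :: real_inner \<Rightarrow> real"
  assumes d: "\<And>z. (G has_derivative (\<lambda>h. inner (gr z) h)) (at z)"
    and L: "\<And>z w. norm (gr z - gr w) \<le> L * norm (z - w)" "0 \<le> L"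
  shows "\<bar>G w - G z - inner (gr z) (w - z)\<bar> \<le> L * (norm (w - z))\<^sup>2"
proof -
  let ?x = "\<lambda>t. z + t *\<^sub>R (w - z)"
  have dx: "((\<lambda>t. G (?x t)) has_derivative (\<lambda>h. inner (gr (?x t)) (h *\<^sub>R (w - z)))) (at t within S)" for t S
    by (rule has_derivative_compose[OF _ d]) (auto intro!: derivative_eq_intros)
  obtain t where t: "t \<in> {0<..<1}" "G (?x 1) - G (?x 0) = inner (gr (?x t)) ((1 - 0) *\<^sub>R (w - z))"
    using mvt_simple[of 0 1 "\<lambda>t. G (?x t)" "\<lambda>t h. inner (gr (?x t)) (h *\<^sub>R (w - z))"] dx by auto
  then have "G w - G z - inner (gr z) (w - z) = inner (gr (?x t) - gr z) (w - z)"
    by (simp add: inner_diff_left)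
  also have "\<bar>\<dots>\<bar> \<le> norm (gr (?x t) - gr z) * norm (w - z)" by (rule Cauchy_Schwarz_ineq2)
  also have "\<dots> \<le> (L * norm (w - z)) * norm (w - z)"
  proof (rule mult_right_mono)
    have "norm (gr (?x t) - gr z) \<le> L * norm (?x t - z)" by (rule L)
    also have "\<dots> \<le> L * norm (w - z)" using t(1) L(2) by (intro mult_left_mono) (auto simp: mult_left_le_one_le)
    finally show "norm (gr (?x t) - gr z) \<le> L * norm (w - z)" .
  qed simp
  finally show ?thesis by (simp add: power2_eq_square mult.assoc)
qed

section \<open>The squared-distance Hamiltonian and its critical points\<close>

text \<open>\<open>K\<close> stands for a closed neighbourhood of a body and \<open>p\<close> for a
  point of the body in the fixed space; the ball around \<open>p\<close> is what makes the
  Hamiltonian coercive.\<close>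

locale cvx =
  fixes l :: nat and K :: "pv set" and p :: pv and r M :: real
  assumes cK: "compact K" and xK: "convex K" and KPs: "K \<subseteq> Ps l" and tauK: "z \<in> K \<Longrightarrow> tauP z \<in> K"
    and p: "p \<in> L0 l" and r: "0 < r" and ball: "z \<in> Ps l \<Longrightarrow> norm (z - p) \<le> r \<Longrightarrow> z \<in> K"
    and M: "1 \<le> M"
begin

lemma pPs: "p \<in> Ps l" using p by (simp add: L0_def)

lemma pK: "p \<in> K" using ball[OF pPs] r by simp

lemma K0: "K \<noteq> {}" using pK by blast

definition HK :: "pv \<Rightarrow> real" where "HK z = M * (norm (rs K z))\<^sup>2"
definition gK :: "pv \<Rightarrow> pv" where "gK z = (2 * M) *\<^sub>R rs K z"

lemma rs_Ps: "z \<in> Ps l \<Longrightarrow> rs K z \<in> Ps l"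
  unfolding rs_def using pr_in[OF cK K0] KPs by (intro Ps_diff) auto

lemma rs_tau: "rs K (tauP z) = tauP (rs K z)"
  using pr_tau[OF cK xK K0 tauK] by (simp add: rs_def tauP_diff)

lemma HK_tau: "HK (tauP z) = HK z"
  unfolding HK_def rs_tau norm_tauP ..

lemma HK_eq_0: "HK z = 0 \<longleftrightarrow> z \<in> K"
proof
  assume "HK z = 0"
  then have "rs K z = 0" using M by (simp add: HK_def)
  then show "z \<in> K" using pr_in[OF cK K0, of z] by (simp add: rs_def)
qed (simp add: HK_def rs_def pr_id[OF cK xK])

lemma gK_0: "z \<in> K \<Longrightarrow> gK z = 0"
  by (simp add: gK_def rs_def pr_id[OF cK xK])

lemma ham_sym_HK: "ham_sym l HK gK (2 * M)"
proof
  show "1 \<le> 2 * M" using M by simp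
  show "0 \<le> HK z" for z unfolding HK_def using M by simp
  show "gK z \<in> Ps l" if "z \<in> Ps l" for z unfolding gK_def by (intro Ps_scaleR rs_Ps that)
  show "gK (tauP z) = tauP (gK z)" for z by (simp add: gK_def rs_tau tauP_scaleR)
  fix z w :: pv
  have "gK z - gK w = (2 * M) *\<^sub>R (rs K z - rs K w)" by (simp add: gK_def scaleR_diff_right)
  then show "norm (gK z - gK w) \<le> 2 * M * norm (z - w)"
    using rs_lip[OF cK xK K0, of z w] M by simp
  have "HK w - HK z - inner (gK z) (w - z) = M * ((norm (rs K w))\<^sup>2 - (norm (rs K z))\<^sup>2 - 2 * inner (rs K z) (w - z))"
    by (simp add: HK_def gK_def algebra_simps)
  moreover have "\<bar>(norm (rs K w))\<^sup>2 - (norm (rs K z))\<^sup>2 - 2 * inner (rs K z) (w - z)\<bar> \<le> (norm (w - z))\<^sup>2"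
    using rs_quad[OF cK xK K0, of w z] by linarith
  then have "M * \<bar>(norm (rs K w))\<^sup>2 - (norm (rs K z))\<^sup>2 - 2 * inner (rs K z) (w - z)\<bar> \<le> 2 * M * (norm (w - z))\<^sup>2"
    using M by (intro mult_mono) auto
  ultimately show "\<bar>HK w - HK z - inner (gK z) (w - z)\<bar> \<le> 2 * M * (norm (w - z))\<^sup>2"
    using M by (simp add: abs_mult)
qed

sublocale H: ham_sym l HK gK "2 * M" by (rule ham_sym_HK)

text \<open>The residual is an outer normal at the foot, and \<open>K\<close> contains the point at
  distance \<open>r\<close> from \<open>p\<close> in its direction.\<close>

lemma support_ge: "r * norm (rs K z) \<le> inner (rs K z) (pr K z - p)" if "z \<in> Ps l"
proof (cases "rs K z = 0")
  case False
  let ?w = "p + (r / norm (rs K z)) *\<^sub>R rs K z"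
  have "?w \<in> K" using r False by (intro ball Ps_add Ps_scaleR pPs rs_Ps that) simp
  from pr_var[OF cK xK this, of z] have "inner (rs K z) (?w - pr K z) \<le> 0" by (simp add: rs_def)
  then have "inner (rs K z) (p - pr K z) + (r / norm (rs K z)) * (norm (rs K z))\<^sup>2 \<le> 0"
    by (simp add: inner_diff_right inner_add_right power2_norm_eq_inner)
  then show ?thesis using False by (simp add: inner_diff_right power2_eq_square)
qed simp

text \<open>After integration this inequality makes a critical point of the action a maximum over a half-space.\<close>

lemma HK_cone:
  assumes "0 \<le> \<rho>"
  shows "HK (p + u) - inner (gK (p + u)) u / 2 + \<rho> * inner (gK (p + u)) v - \<rho>\<^sup>2 * inner (gK (p + u)) u / 2 \<le> HK (p + v)"
proof -
  let ?U = "rs K (p + u)" and ?V = "rs K (p + v)"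
  define e where "e = inner ?U (pr K (p + u) - p)"
  define f where "f = inner ?U (pr K (p + v) - p)"
  have u: "u = ?U + (pr K (p + u) - p)" and v: "v = ?V + (pr K (p + v) - p)" by (simp_all add: rs_def)
  have Uu: "inner ?U u = (norm ?U)\<^sup>2 + e" by (subst u) (simp add: inner_add_right e_def power2_norm_eq_inner)
  have Uv: "inner ?U v = inner ?U ?V + f" by (subst v) (simp add: inner_add_right f_def)
  have e0: "0 \<le> e" using pr_var[OF cK xK pK, of "p + u"] by (simp add: e_def rs_def inner_diff_right)
  \<comment> \<open>The foot of \<open>p + u\<close> maximises the linear functional given by its
    residual over \<open>K\<close>, and the foot of \<open>p + v\<close> is a competitor.\<close>
  have fe: "f \<le> e"
    using pr_var[OF cK xK pr_in[OF cK K0, of "p + v"], of "p + u"] by (simp add: e_def f_def rs_def inner_diff_right)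
  have sq: "0 \<le> (norm (\<rho> *\<^sub>R ?U + (- 1) *\<^sub>R ?V))\<^sup>2" by simp
  have "(norm (\<rho> *\<^sub>R ?U + (- 1) *\<^sub>R ?V))\<^sup>2 = \<rho>\<^sup>2 * (norm ?U)\<^sup>2 - 2 * \<rho> * inner ?U ?V + (norm ?V)\<^sup>2"
    unfolding norm_sq_comb by simp
  then have 1: "2 * \<rho> * inner ?U ?V - \<rho>\<^sup>2 * (norm ?U)\<^sup>2 \<le> (norm ?V)\<^sup>2" using sq by linarith
  have 2: "0 \<le> (1 - \<rho>)\<^sup>2 * e" using e0 by simp
  have 3: "\<rho> * f \<le> \<rho> * e" using assms fe by (rule mult_left_mono[rotated])
  have "(norm ?U)\<^sup>2 - ((norm ?U)\<^sup>2 + e) + 2 * \<rho> * (inner ?U ?V + f) - \<rho>\<^sup>2 * ((norm ?U)\<^sup>2 + e) \<le> (norm ?V)\<^sup>2"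
    using 1 2 3 by (simp add: power2_eq_square algebra_simps)
  then have "M * ((norm ?U)\<^sup>2 - inner ?U u + 2 * \<rho> * inner ?U v - \<rho>\<^sup>2 * inner ?U u) \<le> M * (norm ?V)\<^sup>2"
    unfolding Uu Uv using M by (intro mult_left_mono) auto
  then show ?thesis by (simp add: HK_def gK_def algebra_simps)
qed

text \<open>\<open>HK_cone\<close> is integrated with \<open>u\<close> and \<open>v\<close> the
  loops of \<open>x\<close> and \<open>y\<close> minus \<open>p\<close>. The critical point equation
  evaluates the linear terms; the positive parts cancel because they are proportional, and the
  negative parts leave the square of \<open>s *\<^sub>R Pm x - Pm y\<close>.\<close>

lemma crit_max:
  assumes x: "x \<in> Es l" and crit: "gradP l gK x = 0"
    and y: "y \<in> Es l" "Pp y = s *\<^sub>R Pp x" "0 \<le> s"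
  shows "Phi l HK y \<le> Phi l HK x"
proof -
  let ?g = "\<lambda>t. gK (lp l x t)"
  have W: "Wg l gK x = Pp x - Pm x" using crit by (simp add: gradP_def)
  have Lg: "L2f l ?g" by (intro H.L2f_gr L2f_lp)
  have ip: "inner (Wg l gK x) \<xi> = (\<integral>t. inner (?g t) (lp l \<xi> t) \<partial>MI)" if "\<xi> \<in> Es l" for \<xi>
    unfolding Wg_def by (rule inner_Jst[OF Lg that])
  define u where "u = x - cst l p"
  define v where "v = y - cst l p"
  have uE: "u \<in> Es l" and vE: "v \<in> Es l" unfolding u_def v_def by (intro Es_diff x y cst_Es)+
  have iu: "integrable MI (\<lambda>t. inner (?g t) (lp l u t))" and iv: "integrable MI (\<lambda>t. inner (?g t) (lp l v t))"
    by (intro L2f_inner_integrable[OF Lg L2f_lp])+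
  have iH: "integrable MI (\<lambda>t. HK (lp l \<xi> t))" for \<xi> by (intro H.G_integrable L2f_lp)
  have ae: "AE t in MI. HK (lp l x t) - inner (?g t) (lp l u t) / 2 + s * inner (?g t) (lp l v t)
      - s\<^sup>2 * inner (?g t) (lp l u t) / 2 \<le> HK (lp l y t)"
    using lp_diff[of l x "cst l p"] lp_diff[of l y "cst l p"] lp_cst[OF p]
  proof eventually_elim
    case (elim t)
    then have "lp l x t = p + lp l u t" "lp l y t = p + lp l v t" by (simp_all add: u_def v_def)
    then show ?case using HK_cone[OF y(3), of "lp l u t" "lp l v t"] by simp
  qed
  let ?I = "\<lambda>t. HK (lp l x t) - inner (?g t) (lp l u t) / 2 + s * inner (?g t) (lp l v t) - s\<^sup>2 * inner (?g t) (lp l u t) / 2"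
  have int: "integrable MI ?I"
    by (intro Bochner_Integration.integrable_diff Bochner_Integration.integrable_add integrable_mult_right integrable_divide iu iv iH)
  have "integral\<^sup>L MI ?I
      \<le> IG l HK y"
    unfolding IG_def by (rule integral_mono_AE[OF int iH ae])
  also have "integral\<^sup>L MI ?I
      = IG l HK x - inner (Wg l gK x) u / 2 + s * inner (Wg l gK x) v - s\<^sup>2 * inner (Wg l gK x) u / 2"
    unfolding IG_def ip[OF uE] ip[OF vE] by (simp add: iu iv iH)
  also have "inner (Wg l gK x) u = (norm (Pp x))\<^sup>2 - (norm (Pm x))\<^sup>2"
  proof -
    have "Pp u = Pp x" "Pm u = Pm x" by (simp_all add: u_def P_diff)
    then show ?thesis
      unfolding W inner_diff_left inner_P_self[of x u] by (simp add: power2_norm_eq_inner)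
  qed
  also have "inner (Wg l gK x) v = s * (norm (Pp x))\<^sup>2 - inner (Pm x) (Pm y)"
  proof -
    have "Pp v = s *\<^sub>R Pp x" "Pm v = Pm y" using y(2) by (simp_all add: v_def P_diff)
    then show ?thesis
      unfolding W inner_diff_left inner_P_self[of x v] by (simp add: power2_norm_eq_inner)
  qed
  finally have le: "IG l HK x - ((norm (Pp x))\<^sup>2 - (norm (Pm x))\<^sup>2) / 2 + s * (s * (norm (Pp x))\<^sup>2 - inner (Pm x) (Pm y))
      - s\<^sup>2 * ((norm (Pp x))\<^sup>2 - (norm (Pm x))\<^sup>2) / 2 \<le> IG l HK y" .
  have "0 \<le> (norm (s *\<^sub>R Pm x + (- 1) *\<^sub>R Pm y))\<^sup>2" by simp
  then have sq: "0 \<le> s\<^sup>2 * (norm (Pm x))\<^sup>2 - 2 * s * inner (Pm x) (Pm y) + (norm (Pm y))\<^sup>2"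
    unfolding norm_sq_comb by simp
  have nP: "(norm (Pp y))\<^sup>2 = s\<^sup>2 * (norm (Pp x))\<^sup>2" using y(2) by (simp add: power_mult_distrib)
  have gen: "s\<^sup>2 * a / 2 - n / 2 - I' \<le> a / 2 - b / 2 - I"
    if "I - (a - b) / 2 + s * (s * a - c) - s\<^sup>2 * (a - b) / 2 \<le> I'" "0 \<le> s\<^sup>2 * b - 2 * s * c + n" for I I' a b c n :: real
    using that by (simp add: power2_eq_square field_simps)
  show ?thesis
    unfolding Phi_def Act_def nP by (rule gen[OF le sq])
qed

end

section \<open>Hamiltonians vanishing near the boundary\<close>

text \<open>The truncated square has derivative Lipschitz with constant 2; the cases are the
  positions of \<open>s\<close> and \<open>t\<close> relative to the kink \<open>a\<close>.\<close>

lemma trunc_sq_quad: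
  fixes s :: real
  shows "\<bar>(max 0 (a - t))\<^sup>2 - (max 0 (a - s))\<^sup>2 - (- 2 * max 0 (a - s)) * (t - s)\<bar> \<le> 1 * (t - s)\<^sup>2"
proof -
  have 1: "\<bar>y\<^sup>2 - x\<^sup>2 - 2 * x * (y - x)\<bar> \<le> (y - x)\<^sup>2" for x y :: real
  proof -
    have "y\<^sup>2 - x\<^sup>2 - 2 * x * (y - x) = (y - x)\<^sup>2" by (simp add: power2_eq_square algebra_simps)
    then show ?thesis by simp
  qed
  consider "a \<le> s" "a \<le> t" | "a \<le> s" "t < a" | "s < a" "a \<le> t" | "s < a" "t < a" by linarith
  then show ?thesis
  proof cases
    case 2
    then have "(a - t)\<^sup>2 \<le> (s - t)\<^sup>2" by (intro power_mono) auto
    then show ?thesis using 2 by (simp add: power2_commute)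
  next
    case 3
    have "0 \<le> (a - s) * (t - a)" using 3 by simp
    moreover have "0 \<le> (t - a)\<^sup>2" by simp
    moreover have "- (a - s)\<^sup>2 + 2 * (a - s) * (t - s) = (a - s)\<^sup>2 + 2 * ((a - s) * (t - a))"
      "(t - s)\<^sup>2 = (a - s)\<^sup>2 + 2 * ((a - s) * (t - a)) + (t - a)\<^sup>2"
      by (simp_all add: power2_eq_square algebra_simps)
    moreover have "0 \<le> (a - s)\<^sup>2" by simp
    ultimately have "\<bar>- (a - s)\<^sup>2 + 2 * (a - s) * (t - s)\<bar> \<le> (t - s)\<^sup>2" by linarith
    moreover have "max 0 (a - t) = 0" "max 0 (a - s) = a - s" using 3 by simp_all
    moreover have "0\<^sup>2 - (a - s)\<^sup>2 - (- 2 * (a - s)) * (t - s) = - (a - s)\<^sup>2 + 2 * (a - s) * (t - s)" by (simp add: algebra_simps)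
    ultimately show ?thesis by (simp only: mult_1)
  next
    case 4
    then have m: "max 0 (a - t) = a - t" "max 0 (a - s) = a - s" by simp_all
    have e: "- 2 * (a - s) * (t - s) = 2 * (a - s) * ((a - t) - (a - s))" "(t - s)\<^sup>2 = ((a - t) - (a - s))\<^sup>2"
      by (simp_all add: power2_eq_square algebra_simps)
    show ?thesis unfolding m e mult_1 by (rule 1)
  qed simp_all
qed

text \<open>Of the constant 3, one part comes from the size of the weight and two from its variation
  times the radius; both weights vanish outside the ball.\<close>

lemma trunc_lipschitz:
  fixes u v :: "'a :: real_inner"
  assumes \<rho>: "0 < \<rho>"
  shows "norm (max 0 (\<rho>\<^sup>2 - (norm u)\<^sup>2) *\<^sub>R u - max 0 (\<rho>\<^sup>2 - (norm v)\<^sup>2) *\<^sub>R v) \<le> 3 * \<rho>\<^sup>2 * norm (u - v)"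
proof -
  define s where "s w = max 0 (\<rho>\<^sup>2 - (norm w)\<^sup>2)" for w :: 'a
  have s: "0 \<le> s w" "s w \<le> \<rho>\<^sup>2" for w by (auto simp: s_def)
  have s0: "s w = 0" if "\<rho> \<le> norm w" for w
  proof -
    have "\<rho>\<^sup>2 \<le> (norm w)\<^sup>2" using that \<rho> by (intro power_mono) auto
    then show ?thesis by (simp add: s_def)
  qed
  have in_case: "norm (s u *\<^sub>R u - s v *\<^sub>R v) \<le> 3 * \<rho>\<^sup>2 * norm (u - v)" if v: "norm v < \<rho>" for u v
  proof -
    have d: "\<bar>norm u - norm v\<bar> \<le> norm (u - v)" by (rule norm_triangle_ineq3)
    have sv: "s v = (\<rho> + norm v) * (\<rho> - norm v)"
    proof -
      have "(norm v)\<^sup>2 \<le> \<rho>\<^sup>2" using v by (intro power_mono) auto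
      then show ?thesis by (simp add: s_def power2_eq_square algebra_simps)
    qed
    have "\<bar>s u - s v\<bar> \<le> 2 * \<rho> * norm (u - v)"
    proof (cases "norm u < \<rho>")
      case True
      have "(norm u)\<^sup>2 \<le> \<rho>\<^sup>2" using True by (intro power_mono) auto
      then have "s u - s v = (norm v + norm u) * (norm v - norm u)"
        unfolding sv by (simp add: s_def power2_eq_square algebra_simps)
      also have "\<bar>\<dots>\<bar> \<le> (2 * \<rho>) * norm (u - v)"
        unfolding abs_mult using True v d \<rho> by (intro mult_mono) auto
      finally show ?thesis .
    next
      case False
      have "(\<rho> + norm v) * (\<rho> - norm v) \<le> (2 * \<rho>) * norm (u - v)"
        using False v d \<rho> by (intro mult_mono) auto
      then show ?thesis using s0[of u] s[of v] False sv by simp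
    qed
    then have "\<bar>s u - s v\<bar> * norm v \<le> 2 * \<rho> * norm (u - v) * \<rho>" using v \<rho> by (intro mult_mono) auto
    moreover have "s u * norm (u - v) \<le> \<rho>\<^sup>2 * norm (u - v)" using s by (intro mult_right_mono) auto
    moreover have "s u *\<^sub>R u - s v *\<^sub>R v = s u *\<^sub>R (u - v) + (s u - s v) *\<^sub>R v" by (simp add: algebra_simps)
    then have "norm (s u *\<^sub>R u - s v *\<^sub>R v) \<le> norm (s u *\<^sub>R (u - v)) + norm ((s u - s v) *\<^sub>R v)"
      by (simp only: norm_triangle_ineq)
    moreover have "norm (s u *\<^sub>R (u - v)) = s u * norm (u - v)" using s[of u] by simp
    moreover have "norm ((s u - s v) *\<^sub>R v) = \<bar>s u - s v\<bar> * norm v" by simp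
    moreover have "2 * \<rho> * norm (u - v) * \<rho> + \<rho>\<^sup>2 * norm (u - v) = 3 * \<rho>\<^sup>2 * norm (u - v)"
      by (simp add: power2_eq_square)
    ultimately show ?thesis by linarith
  qed
  have "norm (s u *\<^sub>R u - s v *\<^sub>R v) \<le> 3 * \<rho>\<^sup>2 * norm (u - v)"
  proof (cases "norm v < \<rho>")
    case True then show ?thesis by (rule in_case)
  next
    case F: False
    show ?thesis
    proof (cases "norm u < \<rho>")
      case True
      from in_case[OF True, of v] show ?thesis by (simp add: norm_minus_commute)
    next
      case False
      then show ?thesis using s0[of u] s0[of v] F \<rho> by simp
    qed
  qed
  then show ?thesis by (simp add: s_def)
qed

text \<open>\<open>C\<close> stands for the inner parallel body, \<open>M'\<close> for the height
  parameter of the bump. The neighbourhood of \<open>C\<close> of radius \<open>\<rho>\<close> lies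
  in \<open>K\<close>, so bump and squared distance never act at the same point.\<close>

locale bump = cvx +
  fixes C :: "pv set" and \<rho> M' :: real
  assumes cC: "compact C" and xC: "convex C" and CPs: "C \<subseteq> Ps l" and tauC: "z \<in> C \<Longrightarrow> tauP z \<in> C"
    and pC: "p \<in> C" and \<rho>: "0 < \<rho>" and M': "0 \<le> M'"
    and CK: "c \<in> C \<Longrightarrow> z \<in> Ps l \<Longrightarrow> norm (z - c) \<le> \<rho> \<Longrightarrow> z \<in> K"
begin

lemma C0: "C \<noteq> {}" using pC by blast

text \<open>The bump \<open>bC\<close> uses the square of this truncation: the gradient stays
  Lipschitz across the edge of the support, and on \<open>C\<close> the bump has the value
  \<open>M' * \<rho> ^ 4\<close>.\<close>

definition sC :: "pv \<Rightarrow> real" where "sC z = max 0 (\<rho>\<^sup>2 - (norm (rs C z))\<^sup>2)"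
definition bC :: "pv \<Rightarrow> real" where "bC z = M' * (sC z)\<^sup>2"
definition gC :: "pv \<Rightarrow> pv" where "gC z = (- (4 * M')) *\<^sub>R (sC z *\<^sub>R rs C z)"
definition GB :: "pv \<Rightarrow> real" where "GB z = HK z + bC z"
definition gB :: "pv \<Rightarrow> pv" where "gB z = gK z + gC z"
definition LB :: real where "LB = 2 * M + 12 * M' * \<rho>\<^sup>2"

lemma sC: "0 \<le> sC z" "sC z \<le> \<rho>\<^sup>2" by (auto simp: sC_def)

lemma sC_out:
  assumes z: "z \<in> Ps l" "z \<notin> K"
  shows "sC z = 0"
proof -
  have "\<rho> < norm (rs C z)"
    using CK[OF pr_in[OF cC C0, of z] z(1)] z(2) unfolding rs_def by linarith
  then have "\<rho>\<^sup>2 \<le> (norm (rs C z))\<^sup>2" using \<rho> by (intro power_mono) auto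
  then show ?thesis by (simp add: sC_def)
qed

lemma rs_tau_C: "rs C (tauP z) = tauP (rs C z)"
  using pr_tau[OF cC xC C0 tauC] by (simp add: rs_def tauP_diff)

lemma bC_derivative: "(bC has_derivative (\<lambda>h. inner (gC z) h)) (at z)"
proof -
  have 1: "((\<lambda>z. (norm (rs C z))\<^sup>2) has_derivative (\<lambda>h. inner (2 *\<^sub>R rs C z) h)) (at z)"
  proof (rule has_derivative_of_quad)
    show "\<bar>(norm (rs C w))\<^sup>2 - (norm (rs C z))\<^sup>2 - inner (2 *\<^sub>R rs C z) (w - z)\<bar> \<le> 1 * (norm (w - z))\<^sup>2" for w
      using rs_quad[OF cC xC C0, of w z] by simp
  qed
  let ?t = "(norm (rs C z))\<^sup>2"
  have 2: "((\<lambda>t. (max 0 (\<rho>\<^sup>2 - t))\<^sup>2) has_derivative (\<lambda>h. inner (- 2 * max 0 (\<rho>\<^sup>2 - ?t)) h)) (at ?t)"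
  proof (rule has_derivative_of_quad)
    show "\<bar>(max 0 (\<rho>\<^sup>2 - w))\<^sup>2 - (max 0 (\<rho>\<^sup>2 - ?t))\<^sup>2 - inner (- 2 * max 0 (\<rho>\<^sup>2 - ?t)) (w - ?t)\<bar> \<le> 1 * (norm (w - ?t))\<^sup>2" for w
      using trunc_sq_quad[of "\<rho>\<^sup>2" w ?t] by simp
  qed
  have "((\<lambda>z. M' * (max 0 (\<rho>\<^sup>2 - (norm (rs C z))\<^sup>2))\<^sup>2) has_derivative
      (\<lambda>h. M' * inner (- 2 * max 0 (\<rho>\<^sup>2 - ?t)) (inner (2 *\<^sub>R rs C z) h))) (at z)"
    by (rule has_derivative_mult_right[OF has_derivative_compose[OF 1 2]])
  moreover have "(\<lambda>h. M' * inner (- 2 * max 0 (\<rho>\<^sup>2 - ?t)) (inner (2 *\<^sub>R rs C z) h)) = (\<lambda>h. inner (gC z) h)"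
    unfolding gC_def sC_def by (rule ext) simp
  moreover have "(\<lambda>z. M' * (max 0 (\<rho>\<^sup>2 - (norm (rs C z))\<^sup>2))\<^sup>2) = bC"
    unfolding bC_def sC_def by (rule ext) simp
  ultimately show ?thesis by simp
qed

lemma gC_lip: "norm (gC z - gC w) \<le> 12 * M' * \<rho>\<^sup>2 * norm (z - w)"
proof -
  have "gC z - gC w = (- (4 * M')) *\<^sub>R (sC z *\<^sub>R rs C z - sC w *\<^sub>R rs C w)"
    by (simp add: gC_def scaleR_diff_right)
  then have "norm (gC z - gC w) = 4 * M' * norm (sC z *\<^sub>R rs C z - sC w *\<^sub>R rs C w)" using M' by simp
  also have "\<dots> \<le> 4 * M' * (3 * \<rho>\<^sup>2 * norm (rs C z - rs C w))"
    unfolding sC_def using M' by (intro mult_left_mono trunc_lipschitz \<rho>) auto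
  also have "\<dots> \<le> 4 * M' * (3 * \<rho>\<^sup>2 * norm (z - w))"
    using M' by (intro mult_left_mono rs_lip cC xC C0) auto
  finally show ?thesis by simp
qed

lemma ham_sym_GB: "ham_sym l GB gB LB"
proof
  have L: "0 \<le> 12 * M' * \<rho>\<^sup>2" using M' by simp
  show "1 \<le> LB" using M L by (simp add: LB_def)
  show "0 \<le> GB z" for z unfolding GB_def bC_def using H.G_nonneg[of z] M' by simp
  show "gB z \<in> Ps l" if "z \<in> Ps l" for z
    unfolding gB_def gC_def rs_def using pr_in[OF cC C0, of z] CPs
    by (intro Ps_add H.gr_Ps Ps_scaleR Ps_diff that) auto
  show "gB (tauP z) = tauP (gB z)" for z
    unfolding gB_def gC_def sC_def rs_tau_C H.gr_tau norm_tauP tauP_add tauP_scaleR ..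
  fix z w :: pv
  have "norm (gB z - gB w) \<le> norm (gK z - gK w) + norm (gC z - gC w)"
    unfolding gB_def by (simp add: norm_diff_triangle_ineq)
  then show "norm (gB z - gB w) \<le> LB * norm (z - w)"
    using H.gr_lip[of z w] gC_lip[of z w] by (simp add: LB_def distrib_right)
  have "\<bar>bC w - bC z - inner (gC z) (w - z)\<bar> \<le> 12 * M' * \<rho>\<^sup>2 * (norm (w - z))\<^sup>2"
    by (rule quad_of_lipschitz[OF bC_derivative gC_lip L])
  moreover have "GB w - GB z - inner (gB z) (w - z)
      = (HK w - HK z - inner (gK z) (w - z)) + (bC w - bC z - inner (gC z) (w - z))"
    by (simp add: GB_def gB_def inner_add_left)
  ultimately show "\<bar>GB w - GB z - inner (gB z) (w - z)\<bar> \<le> LB * (norm (w - z))\<^sup>2"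
    using H.G_quad[of w z] by (simp add: LB_def distrib_right)
qed

sublocale B: ham_sym l GB gB LB by (rule ham_sym_GB)

text \<open>As \<open>p\<close> lies in \<open>C\<close>, the residual with respect to
  \<open>C\<close> has nonnegative inner product with \<open>z - p\<close>: the distance to
  \<open>C\<close> does not decrease along rays from \<open>p\<close>.\<close>

lemma gC_star: "inner (gC z) (z - p) \<le> 0"
proof -
  have "inner (rs C z) (p - pr C z) \<le> 0" unfolding rs_def by (rule pr_var[OF cC xC pC])
  moreover have "inner (rs C z) (z - p) = inner (rs C z) (rs C z) - inner (rs C z) (p - pr C z)"
    by (simp add: rs_def inner_diff_right)
  ultimately have "0 \<le> inner (rs C z) (z - p)" using inner_ge_zero[of "rs C z"] by linarith
  then have "0 \<le> 4 * M' * (sC z * inner (rs C z) (z - p))" using M' sC by simp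
  then show ?thesis by (simp add: gC_def)
qed

text \<open>\<open>support_ge\<close> gives linear growth for the squared distance, and the bump,
  supported in the bounded set \<open>K\<close>, changes the expression by at most a
  constant.\<close>

lemma GB_coercive: "\<exists>cc c. ham_coercive l GB gB LB p cc c"
proof -
  obtain R where R: "\<And>z. z \<in> K \<Longrightarrow> norm z \<le> R" using compact_imp_bounded[OF cK] unfolding bounded_iff by blast
  have R0: "0 \<le> R" using order_trans[OF norm_ge_zero R[OF pK]] .
  \<comment> \<open>The first term bounds the bump, the second half its radial derivative, whose
    base points lie within \<open>2 * R\<close> of \<open>p\<close>.\<close>
  define Q where "Q = M' * \<rho> ^ 4 + 4 * M' * \<rho> ^ 3 * R"
  have "M * r * norm z - (M * r * R + Q) \<le> inner (gB z) (z - p) / 2 - GB z" if z: "z \<in> Ps l" for z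
  proof -
    have 1: "M * r * norm z - M * r * R \<le> inner (gK z) (z - p) / 2 - HK z"
    proof -
      have zp: "z - p = rs K z + (pr K z - p)" by (simp add: rs_def)
      have "inner (gK z) (z - p) / 2 - HK z = M * inner (rs K z) (pr K z - p)"
      proof -
        have gen: "2 * M * (x + y) / 2 - M * x = M * y" for x y :: real by (simp add: field_simps)
        have "inner (gK z) (z - p) = 2 * M * ((norm (rs K z))\<^sup>2 + inner (rs K z) (pr K z - p))"
          unfolding zp gK_def by (simp add: inner_add_right power2_norm_eq_inner distrib_left)
        then show ?thesis unfolding HK_def by (simp only: gen)
      qed
      also have "\<dots> \<ge> M * (r * norm (rs K z))" using M support_ge[OF z] by (intro mult_left_mono) auto
      finally have a: "M * (r * norm (rs K z)) \<le> inner (gK z) (z - p) / 2 - HK z" .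
      have "norm z \<le> norm (rs K z) + norm (pr K z)"
        using norm_triangle_ineq[of "rs K z" "pr K z"] by (simp add: rs_def)
      then have "norm z - R \<le> norm (rs K z)" using R[OF pr_in[OF cK K0, of z]] by linarith
      then have "M * (r * (norm z - R)) \<le> M * (r * norm (rs K z))" using M r by (intro mult_left_mono) auto
      then show ?thesis using a by (simp add: algebra_simps)
    qed
    have 2: "- Q \<le> inner (gC z) (z - p) / 2 - bC z"
    proof -
      have "(sC z)\<^sup>2 \<le> (\<rho>\<^sup>2)\<^sup>2" using sC by (intro power_mono)
      then have b: "bC z \<le> M' * \<rho> ^ 4" unfolding bC_def using M' by (intro mult_left_mono) simp_all
      have g: "\<bar>inner (gC z) (z - p)\<bar> \<le> 8 * M' * \<rho> ^ 3 * R"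
      proof (cases "sC z = 0")
        case True
        then show ?thesis using M' \<rho> R0 by (simp add: gC_def)
      next
        case False
        then have zK: "z \<in> K" using sC_out[OF z] by blast
        have "\<not> \<rho> \<le> norm (rs C z)"
        proof
          assume "\<rho> \<le> norm (rs C z)"
          then have "\<rho>\<^sup>2 \<le> (norm (rs C z))\<^sup>2" using \<rho> by (intro power_mono) auto
          then show False using False by (simp add: sC_def)
        qed
        then have n: "norm (gC z) \<le> 4 * M' * (\<rho>\<^sup>2 * \<rho>)"
          unfolding gC_def using M' sC[of z] \<rho> by (simp add: mult_left_mono mult_mono)
        have "norm (z - p) \<le> 2 * R" using R[OF zK] R[OF pK] norm_triangle_ineq4[of z p] by linarith
        then have "norm (gC z) * norm (z - p) \<le> (4 * M' * (\<rho>\<^sup>2 * \<rho>)) * (2 * R)" using n M' \<rho> by (intro mult_mono) auto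
        then show ?thesis using Cauchy_Schwarz_ineq2[of "gC z" "z - p"]
          by (simp add: power3_eq_cube power2_eq_square)
      qed
      show ?thesis using b g unfolding Q_def by (simp add: abs_le_iff)
    qed
    have gen: "x - (y + Q) \<le> (u + v) / 2 - (h + b)" if "x - y \<le> u / 2 - h" "- Q \<le> v / 2 - b" for x y u v h b :: real
      using that by (simp add: field_simps)
    show ?thesis unfolding gB_def GB_def inner_add_left by (rule gen[OF 1 2])
  qed
  moreover have "0 < M * r" using M r by simp
  ultimately have "ham_coercive l GB gB LB p (M * r) (M * r * R + Q)"
    by unfold_locales (use p in auto)
  then show ?thesis by blast
qed

text \<open>A critical loop has constant energy, so it stays either in \<open>K\<close>, where the action is
  nonpositive by star-shapedness, or outside \<open>K\<close>, where the bump vanishes.\<close>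

lemma crit_outside:
  assumes x: "x \<in> Es l" and crit: "gradP l gB x = 0" and pos: "0 < Phi l GB x"
  shows "gradP l gK x = 0" "Phi l HK x = Phi l GB x"
proof -
  obtain X where X: "continuous_on {0..1} X" "\<And>t. X t \<in> Ps l" "AE t in MI. lp l x t = X t"
    "\<And>t. t \<in> {0..1} \<Longrightarrow> GB (X t) = GB (X 0)" by (rule B.crit_loop[OF x crit]) (rule that; assumption)
  let ?g0 = "GB (X 0)"
  have dich: "X t \<in> K \<and> HK (X t) = 0 \<or> X t \<notin> K \<and> HK (X t) = ?g0" if "t \<in> {0..1}" for t
  proof (cases "X t \<in> K")
    case False
    then have "bC (X t) = 0" using sC_out[OF X(2)] by (simp add: bC_def)
    then show ?thesis using False X(4)[OF that] by (simp add: GB_def)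
  qed (simp add: HK_eq_0)
  have W: "Wg l gB x = Pp x - Pm x" using crit by (simp add: gradP_def)
  have MI01: "AE t in MI. t \<in> {0..1}" by (rule AE_I2) (simp add: space_MI)
  have out: "X t \<notin> K" if t: "t \<in> {0..1}" for t
  proof
    assume "X t \<in> K"
    then have f0: "HK (X t) = 0" by (simp add: HK_eq_0)
    have all: "X s \<in> K" if s: "s \<in> {0..1}" for s
    proof (rule ccontr)
      assume n: "X s \<notin> K"
      then have g: "HK (X s) = ?g0" using dich[OF s] by blast
      have "HK (X s) \<noteq> 0" using n by (simp add: HK_eq_0)
      then have g0: "0 < HK (X s)" using H.G_nonneg[of "X s"] by linarith
      have "continuous_on {0..1} (\<lambda>t. HK (X t))"
        by (rule continuous_on_compose2[OF H.G_cont X(1) subset_UNIV])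
      then have "connected ((\<lambda>t. HK (X t)) ` {0..1})" by (intro connected_continuous_image connected_Icc)
      then have "{HK (X t)..HK (X s)} \<subseteq> (\<lambda>t. HK (X t)) ` {0..1}"
        by (rule connected_contains_Icc) (use t s in auto)
      \<comment> \<open>By \<open>dich\<close> the squared-distance energy along the loop takes only
        the values 0 and \<open>?g0\<close>; half of \<open>?g0\<close> would have to occur by
        connectedness.\<close>
      moreover have "HK (X s) / 2 \<in> {HK (X t)..HK (X s)}" using f0 g0 by simp
      ultimately have "HK (X s) / 2 \<in> (\<lambda>t. HK (X t)) ` {0..1}" by (rule subsetD)
      then obtain s' where "s' \<in> {0..1}" "HK (X s) / 2 = HK (X s')" by (elim imageE)
      then show False using dich[of s'] g g0 by auto
    qed
    \<comment> \<open>Testing the critical point equation against the loop minus \<open>p\<close>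
      gives twice the action on one side; inside \<open>K\<close> only the bump contributes to the
      other.\<close>
    have "inner (Wg l gB x) (x - cst l p) = (\<integral>t. inner (gB (lp l x t)) (lp l (x - cst l p) t) \<partial>MI)"
      unfolding Wg_def by (intro inner_Jst B.L2f_gr L2f_lp Es_diff x cst_Es)
    also have "\<dots> \<le> (\<integral>t. 0 \<partial>MI)"
    proof (rule integral_mono_AE)
      show "integrable MI (\<lambda>t. inner (gB (lp l x t)) (lp l (x - cst l p) t))"
        by (intro L2f_inner_integrable[where l = l] B.L2f_gr L2f_lp)
      show "AE t in MI. inner (gB (lp l x t)) (lp l (x - cst l p) t) \<le> 0"
        using X(3) lp_diff[of l x "cst l p"] lp_cst[OF p] MI01
      proof eventually_elim
        case (elim t)
        have "gB (X t) = gC (X t)" using gK_0[OF all[OF elim(4)]] by (simp add: gB_def)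
        then show ?case using gC_star[of "X t"] elim by simp
      qed
    qed simp
    finally have "inner (Pp x - Pm x) (x - cst l p) \<le> 0" unfolding W by simp
    moreover have "inner (Pp x - Pm x) (x - cst l p) = 2 * Act x"
      using inner_P_self(1)[of x "x - cst l p"] inner_P_self(2)[of x "x - cst l p"]
      by (simp add: inner_diff_left P_diff Act_def power2_norm_eq_inner)
    ultimately have "Phi l GB x \<le> 0" using B.IG_nonneg[of x] by (simp add: Phi_def)
    then show False using pos by linarith
  qed
  have ae: "AE t in MI. GB (lp l x t) = HK (lp l x t) \<and> gB (lp l x t) = gK (lp l x t)"
    using X(3) MI01
  proof eventually_elim
    case (elim t)
    have "sC (X t) = 0" by (rule sC_out[OF X(2) out[OF elim(2)]])
    then show ?case using elim by (simp add: GB_def gB_def bC_def gC_def)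
  qed
  have "Wg l gB x = Wg l gK x"
    unfolding Wg_def
  proof (rule Jst_cong_AE)
    show "AE t in MI. gB (lp l x t) = gK (lp l x t)" using ae by eventually_elim simp
  qed (intro B.L2f_gr H.L2f_gr L2f_lp)+
  then show "gradP l gK x = 0" using crit by (simp add: gradP_def)
  have "IG l GB x = IG l HK x"
    unfolding IG_def
  proof (rule integral_cong_AE)
    show "AE t in MI. GB (lp l x t) = HK (lp l x t)" using ae by eventually_elim simp
  qed (intro borel_measurable_integrable B.G_integrable H.G_integrable L2f_lp)+
  then show "Phi l HK x = Phi l GB x" by (simp add: Phi_def)
qed

text \<open>The bump creates no positive critical levels by \<open>crit_outside\<close>, so a level
  interval free for \<open>HK\<close> is free for \<open>GB\<close>, and the Palais-Smale condition
  supplies the margin.\<close>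

lemma bump_gap:
  assumes nocrit: "\<And>x. x \<in> Es l \<Longrightarrow> gradP l gK x = 0 \<Longrightarrow> 0 < Phi l HK x \<Longrightarrow> \<beta> < Phi l HK x"
    and \<epsilon>: "0 < \<epsilon>"
  shows "\<exists>\<delta>>0. \<forall>x\<in>Es l. \<epsilon> \<le> Phi l GB x \<longrightarrow> Phi l GB x \<le> \<beta> \<longrightarrow> \<delta> \<le> norm (gradP l gB x)"
proof -
  obtain cc c where "ham_coercive l GB gB LB p cc c" using GB_coercive by blast
  then interpret co: ham_coercive l GB gB LB p cc c .
  show ?thesis
  proof (rule co.PS_gap)
    fix x assume x: "x \<in> Es l" "gradP l gB x = 0"
    show "\<not> (\<epsilon> \<le> Phi l GB x \<and> Phi l GB x \<le> \<beta>)"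
    proof
      assume a: "\<epsilon> \<le> Phi l GB x \<and> Phi l GB x \<le> \<beta>"
      then have "0 < Phi l GB x" using \<epsilon> by linarith
      from crit_outside[OF x this] nocrit[OF x(1)] this a show False by simp
    qed
  qed
qed

text \<open>Around \<open>q\<close> both summands vanish: the ball of radius \<open>d\<close> lies
  in \<open>K\<close> and, when the bump is present, outside its support.\<close>

lemma bump_near:
  assumes q: "q \<in> L0 l" "q \<in> K" and d: "0 < d" "\<And>z. z \<in> Ps l \<Longrightarrow> norm (z - q) < d \<Longrightarrow> z \<in> K"
    and far: "\<And>c. c \<in> C \<Longrightarrow> 0 < M' \<Longrightarrow> d + \<rho> \<le> norm (q - c)"
  shows "\<exists>r>0. \<forall>x\<in>Es l. Pp x = x \<longrightarrow> norm x \<le> r \<longrightarrow> (norm x)\<^sup>2 / 4 \<le> Phi l GB (x + cst l q)"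
proof -
  have b0: "bC z = 0" "gC z = 0" if "norm (z - q) < d" for z
  proof -
    have "M' * sC z = 0"
    proof (cases "M' = 0")
      case False
      have "norm (q - pr C z) \<le> norm (z - q) + norm (rs C z)"
        using norm_triangle_ineq[of "q - z" "rs C z"] by (simp add: rs_def norm_minus_commute)
      then have "\<rho> \<le> norm (rs C z)" using far[OF pr_in[OF cC C0, of z]] that False M' by linarith
      then have "\<rho>\<^sup>2 \<le> (norm (rs C z))\<^sup>2" using \<rho> by (intro power_mono) auto
      then show ?thesis by (simp add: sC_def)
    qed simp
    then show "bC z = 0" "gC z = 0" by (auto simp: bC_def gC_def)
  qed
  have qPs: "q \<in> Ps l" using q(1) by (simp add: L0_def)
  have Gq: "GB q = 0" "gB q = 0"
    using b0[of q] d(1) q(2) HK_eq_0[of q] gK_0[OF q(2)] by (simp_all add: GB_def gB_def)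
  show ?thesis
  proof (rule B.Phi_near_constant[OF q(1) _ _ d(1)])
    show "0 < LB" using B.Lc1 by linarith
    show "GB z \<le> LB * (norm (z - q))\<^sup>2" for z using B.G_quad[of z q] Gq by simp
    show "GB z = 0" if "z \<in> Ps l" "norm (z - q) < d" for z
      using b0[OF that(2)] HK_eq_0[of z] d(2)[OF that] by (simp add: GB_def)
  qed
qed

end

section \<open>Upper bounds from critical levels\<close>

lemma Ps_limit:
  assumes "\<And>m :: nat. x m \<in> Ps l" "x \<longlonglongrightarrow> z"
  shows "z \<in> Ps l"
  unfolding Ps_iff
proof (intro allI impI)
  fix c assume "c \<notin> Cl l"
  then have "ev (x m) c = 0" for m using Ps_ev[OF assms(1)] by blast
  moreover have "(\<lambda>m. ev (x m) c) \<longlonglongrightarrow> ev z c" by (intro tendsto_ev assms)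
  ultimately show "ev z c = 0" by (simp add: LIMSEQ_const_iff)
qed

text \<open>Only finitely many coordinates are nonzero, so coordinatewise limits of bounded
  sequences are norm limits.\<close>

lemma compact_Ps_cball: "compact (Ps l \<inter> cball 0 R)"
  unfolding compact_eq_seq_compact_metric seq_compact_def
proof (intro allI impI)
  fix f :: "nat \<Rightarrow> pv" assume f: "\<forall>m. f m \<in> Ps l \<inter> cball 0 R"
  then have fP: "f m \<in> Ps l" and fR: "norm (f m) \<le> R" for m by auto
  obtain r z where r: "strict_mono (r :: nat \<Rightarrow> nat)" "norm z \<le> R" "\<And>c. (\<lambda>m. ev (f (r m)) c) \<longlonglongrightarrow> ev z c"
    using ell2_bounded_weak_subseq[of f R] fR by blast
  let ?z = "\<Sum>c\<in>Cl l. ev z c *\<^sub>R bas c :: pv"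
  have "(\<lambda>m. \<Sum>c\<in>Cl l. ev (f (r m)) c *\<^sub>R bas c :: pv) \<longlonglongrightarrow> ?z" by (intro tendsto_intros r)
  then have lim: "(\<lambda>m. f (r m)) \<longlonglongrightarrow> ?z" using Ps_expand[OF fP] by simp
  have "norm ?z \<le> R" using fR by (intro LIMSEQ_le_const2[OF tendsto_norm[OF lim]]) auto
  moreover have "?z \<in> Ps l" by (rule Ps_limit[OF _ lim]) (rule fP)
  ultimately show "\<exists>l'\<in>Ps l \<inter> cball 0 R. \<exists>r. strict_mono r \<and> (f \<circ> r) \<longlonglongrightarrow> l'"
    using lim r(1) by (intro bexI[of _ ?z] exI[of _ r]) (simp_all add: o_def)
qed

section \<open>Neighbourhoods and inner parallel sets of a convex body\<close>

definition nb :: "nat \<Rightarrow> pv set \<Rightarrow> real \<Rightarrow> pv set" where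
  "nb l S d = {z \<in> Ps l. \<exists>w\<in>S. norm (z - w) \<le> d}"

definition er :: "nat \<Rightarrow> pv set \<Rightarrow> real \<Rightarrow> pv set" where
  "er l S d = {z \<in> Ps l. \<forall>w\<in>Ps l. norm (w - z) \<le> d \<longrightarrow> w \<in> S}"

text \<open>The image of one factor, possibly with empty interior; \<open>1 \<le> l\<close> provides
  the coordinate that \<open>ex_q\<close> maximises.\<close>

locale body =
  fixes l :: nat and S :: "pv set"
  assumes l: "1 \<le> l" and cS: "compact S" and xS: "convex S" and SPs: "S \<subseteq> Ps l" and S0: "S \<noteq> {}"
    and tauS: "z \<in> S \<Longrightarrow> tauP z \<in> S"
begin

text \<open>The neighbourhood as a Minkowski sum, from which compactness and convexity
  follow.\<close>

lemma nb_sums: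
  shows "nb l S d = (\<Union>x\<in>S. \<Union>y\<in>Ps l \<inter> cball 0 d. {x + y})"
proof (intro equalityI subsetI)
  fix z assume "z \<in> nb l S d"
  then obtain w where w: "z \<in> Ps l" "w \<in> S" "norm (z - w) \<le> d" by (auto simp: nb_def)
  have "z = w + (z - w)" "z - w \<in> Ps l \<inter> cball 0 d" using w SPs by (auto intro!: Ps_diff)
  then show "z \<in> (\<Union>x\<in>S. \<Union>y\<in>Ps l \<inter> cball 0 d. {x + y})" using w(2) by blast
next
  fix z assume "z \<in> (\<Union>x\<in>S. \<Union>y\<in>Ps l \<inter> cball 0 d. {x + y})"
  then obtain x y where "x \<in> S" "y \<in> Ps l" "norm y \<le> d" "z = x + y" by auto
  then show "z \<in> nb l S d" using SPs by (auto simp: nb_def intro!: Ps_add bexI[of _ x])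
qed

lemma nb_compact: "compact (nb l S d)"
  unfolding nb_sums by (rule compact_sums'[OF cS compact_Ps_cball])

lemma convex_Ps: "convex (Ps l)"
  by (rule convexI) (intro Ps_add Ps_scaleR)

lemma nb_convex: "convex (nb l S d)"
  unfolding nb_sums by (rule convex_sums[OF xS convex_Int[OF convex_Ps convex_cball]])

lemma nb_tau: "z \<in> nb l S d \<Longrightarrow> tauP z \<in> nb l S d"
  unfolding nb_def using tauS norm_tauP by (auto simp: simp flip: tauP_diff intro!: bexI[of _ "tauP _"])

lemma sub_nb: "0 \<le> d \<Longrightarrow> S \<subseteq> nb l S d"
  unfolding nb_def using SPs by (auto intro!: bexI)

lemma er_sub: "0 \<le> d \<Longrightarrow> er l S d \<subseteq> S"
  by (auto simp: er_def)

lemma er_compact: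
  assumes d: "0 \<le> d"
  shows "compact (er l S d)"
proof -
  have "closed (er l S d)"
    unfolding closed_sequential_limits
  proof (intro allI impI)
    fix x z assume A: "(\<forall>m. x m \<in> er l S d) \<and> x \<longlonglongrightarrow> z"
    then have xm: "x m \<in> Ps l" "\<And>w. w \<in> Ps l \<Longrightarrow> norm (w - x m) \<le> d \<Longrightarrow> w \<in> S" for m by (auto simp: er_def)
    note lim = conjunct2[OF A]
    have zP: "z \<in> Ps l" by (rule Ps_limit[of x, OF xm(1) lim])
    have "w \<in> S" if w: "w \<in> Ps l" "norm (w - z) \<le> d" for w
    proof -
      have "w + (x m - z) \<in> S" for m
        by (rule xm(2)[of "w + (x m - z)" m]) (use w zP xm(1)[of m] in \<open>simp_all add: Ps_add Ps_diff\<close>)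
      moreover have "(\<lambda>m. w + (x m - z)) \<longlonglongrightarrow> w + (z - z)" by (intro tendsto_intros lim)
      ultimately have "w + (z - z) \<in> S" by (rule closed_sequentially[OF compact_imp_closed[OF cS]])
      then show "w \<in> S" by simp
    qed
    then show "z \<in> er l S d" using zP by (simp add: er_def)
  qed
  then have "compact (S \<inter> er l S d)" by (rule compact_Int_closed[OF cS])
  then show ?thesis using er_sub[OF d] by (simp add: Int_absorb1)
qed

text \<open>A displacement from the convex combination is applied to both end points, and the
  results are combined again.\<close>

lemma er_convex: "convex (er l S d)"
proof (rule convexI)
  fix x y and u v :: real
  assume x: "x \<in> er l S d" and y: "y \<in> er l S d" and uv: "0 \<le> u" "0 \<le> v" "u + v = 1"
  have P: "x \<in> Ps l" "y \<in> Ps l" using x y by (auto simp: er_def)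
  let ?z = "u *\<^sub>R x + v *\<^sub>R y"
  have zP: "?z \<in> Ps l" by (intro Ps_add Ps_scaleR P)
  have "w \<in> S" if w: "w \<in> Ps l" "norm (w - ?z) \<le> d" for w
  proof -
    have "v' + (w - ?z) \<in> S" if v': "v' \<in> er l S d" for v'
    proof -
      have "v' \<in> Ps l" using v' by (simp add: er_def)
      then have "v' + (w - ?z) \<in> Ps l" by (intro Ps_add[OF _ Ps_diff[OF w(1) zP]])
      moreover have "norm (v' + (w - ?z) - v') \<le> d" using w(2) by simp
      ultimately show ?thesis using v' unfolding er_def by blast
    qed
    from this[OF x] this[OF y] have "u *\<^sub>R (x + (w - ?z)) + v *\<^sub>R (y + (w - ?z)) \<in> S" by (rule convexD[OF xS _ _ uv])
    moreover have "u *\<^sub>R (x + (w - ?z)) + v *\<^sub>R (y + (w - ?z)) = ?z + (u + v) *\<^sub>R (w - ?z)"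
      unfolding scaleR_add_right scaleR_add_left by (simp add: add.assoc add.left_commute)
    ultimately show "w \<in> S" by (simp add: uv(3))
  qed
  then show "?z \<in> er l S d" using zP by (simp add: er_def)
qed

lemma er_tau:
  assumes "z \<in> er l S d"
  shows "tauP z \<in> er l S d"
proof -
  have "w \<in> S" if w: "w \<in> Ps l" "norm (w - tauP z) \<le> d" for w
  proof -
    have "norm (tauP w - z) = norm (tauP (w - tauP z))" by (simp add: tauP_diff)
    then have "tauP w \<in> S" using assms w unfolding er_def by simp
    then show "w \<in> S" using tauS[of "tauP w"] by simp
  qed
  then show ?thesis using assms by (simp add: er_def)
qed

lemma midpoint_L0: "z \<in> Ps l \<Longrightarrow> (1 / 2) *\<^sub>R z + (1 / 2) *\<^sub>R tauP z \<in> L0 l"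
  unfolding L0_def by (auto intro!: Ps_add Ps_scaleR)

lemma midpoint_in: "convex T \<Longrightarrow> z \<in> T \<Longrightarrow> tauP z \<in> T \<Longrightarrow> (1 / 2) *\<^sub>R z + (1 / 2) *\<^sub>R tauP z \<in> T"
  by (rule convexD) auto

text \<open>The mean of a point and its reflection is fixed by the involution and stays in every
  symmetric convex set. It is taken in the inner parallel set whenever possible, since the bump has
  to decrease along rays from \<open>p\<close>.\<close>

lemma ex_p: "\<exists>p. p \<in> L0 l \<and> p \<in> S \<and> (er l S d \<noteq> {} \<longrightarrow> p \<in> er l S d)" if d: "0 \<le> d"
proof (cases "er l S d = {}")
  case True
  obtain z where z: "z \<in> S" using S0 by blast
  then show ?thesis using True midpoint_L0[of z] midpoint_in[OF xS z tauS[OF z]] SPs by blast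
next
  case False
  then obtain z where z: "z \<in> er l S d" by blast
  have "(1 / 2) *\<^sub>R z + (1 / 2) *\<^sub>R tauP z \<in> er l S d" by (rule midpoint_in[OF er_convex z er_tau[OF z]])
  moreover have "z \<in> Ps l" using z by (simp add: er_def)
  ultimately show ?thesis using midpoint_L0 er_sub[OF d] by blast
qed

text \<open>A point maximising one Lagrangian coordinate lies on the boundary.\<close>

lemma ex_q: "\<exists>q. q \<in> L0 l \<and> q \<in> S \<and> (\<forall>d\<ge>0. \<forall>c\<in>er l S d. d \<le> norm (q - c))"
proof -
  obtain z where z: "z \<in> S" "\<And>y. y \<in> S \<Longrightarrow> ev y (0, False) \<le> ev z (0, False)"
    using continuous_attains_sup[OF cS S0, of "\<lambda>v. ev v (0, False)", OF continuous_on_ev[OF continuous_on_id]] by blast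
  define q where "q = (1 / 2) *\<^sub>R z + (1 / 2) *\<^sub>R tauP z"
  have q: "q \<in> L0 l" "q \<in> S" "ev q (0, False) = ev z (0, False)"
    unfolding q_def using midpoint_L0[of z] midpoint_in[OF xS z(1) tauS[OF z(1)]] SPs z(1) by auto
  have "d \<le> norm (q - c)" if d: "0 \<le> d" "c \<in> er l S d" for d c
  proof -
    \<comment> \<open>Moving \<open>c\<close> by \<open>d\<close> along the maximised coordinate
      stays in \<open>S\<close>, so the coordinate of \<open>q\<close> exceeds that of
      \<open>c\<close> by at least \<open>d\<close>.\<close>
    have "c + d *\<^sub>R bas (0, False) \<in> Ps l"
      using d(2) l by (intro Ps_add Ps_scaleR) (auto simp: er_def Ps_def ev_bas)
    moreover have "norm (c + d *\<^sub>R bas (0, False) - c) \<le> d" using d(1) by (simp add: norm_bas)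
    ultimately have "c + d *\<^sub>R bas (0, False) \<in> S" using d(2) unfolding er_def by blast
    from z(2)[OF this] have "d \<le> ev (q - c) (0, False)" unfolding q(3)[symmetric] by (simp add: ev_bas)
    then show ?thesis using abs_ev_le[of "q - c" "(0, False)"] by linarith
  qed
  then show ?thesis using q by blast
qed

lemma cvx_nb:
  assumes "0 < d" "1 \<le> M" "p \<in> L0 l" "p \<in> S"
  shows "cvx l (nb l S d) p d M"
proof
  show "nb l S d \<subseteq> Ps l" by (auto simp: nb_def)
  show "z \<in> nb l S d" if "z \<in> Ps l" "norm (z - p) \<le> d" for z using that assms(4) by (auto simp: nb_def)
qed (use assms nb_compact nb_convex nb_tau in auto)

end

section \<open>Critical levels bound the capacities from above\<close>

text \<open>\<open>d\<close> and \<open>M\<close> are kept as parameters: the upper bound holds for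
  any of them, and the lower bound picks them according to the competing Hamiltonian.\<close>

definition crit_level :: "nat \<Rightarrow> pv set \<Rightarrow> real \<Rightarrow> real \<Rightarrow> real \<Rightarrow> bool" where
  "crit_level l S d M c \<longleftrightarrow> 0 < c \<and>
    (\<exists>x\<in>Es l. gradP l (cvx.gK (nb l S d) M) x = 0 \<and> Phi l (cvx.HK (nb l S d) M) x = c)"

lemma iota_tau0: "iota N (tau0 z) = tauP (iota N z)"
  by (rule pair_ell2_eqI) (simp add: ev_iota tau0_def)

lemma blkP_tauP: "blkP s n (tauP v) = tauP (blkP s n v)"
  by (rule pair_ell2_eqI) simp

lemma pnt_Lag0: "v \<in> L0 N \<Longrightarrow> pnt v \<in> Lag0 N"
  using pnt_pts[of v N] by (simp add: L0_def Lag0_def tau0_def) (simp add: pnt_def)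

lemma open_iota_vimage: "open O' \<Longrightarrow> openin (top_of_set (pts N)) {z \<in> pts N. iota N z \<in> O'}"
proof -
  assume "open O'"
  then have "open (iota N -` O')" by (rule open_vimage[OF _ continuous_on_iota])
  moreover have "{z \<in> pts N. iota N z \<in> O'} = pts N \<inter> (iota N -` O')" by auto
  ultimately show ?thesis unfolding openin_open by blast
qed

text \<open>\<open>HK\<close> on one block is not quadratic at infinity, so it is raised to an
  admissible Hamiltonian by a maximum. Every deformation meets the ray of the embedded positive part
  of the critical point; there the action is at most that of the block, and \<open>crit_max\<close>
  bounds it by \<open>c\<close>. Offset 0 with \<open>N = l\<close> gives the factor itself.\<close>

lemma (in body) upper:
  assumes crit: "crit_level l S d M c" and d: "0 < d" and M: "1 \<le> M"
    and s: "s + l \<le> N" and B: "B \<subseteq> pts N" "closed B" "\<And>z. z \<in> B \<Longrightarrow> norm (iota N z) \<le> R"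
    and BS: "\<And>z. z \<in> B \<Longrightarrow> blkP s l (iota N z) \<in> S"
  shows "cEH_set N B \<le> ereal c"
proof -
  obtain p where pp: "p \<in> L0 l" "p \<in> S" using ex_p[of 0] by auto
  interpret cvx l "nb l S d" p d M by (rule cvx_nb[OF d M pp])
  obtain \<xi> where \<xi>: "\<xi> \<in> Es l" "gradP l gK \<xi> = 0" "Phi l HK \<xi> = c" and c: "0 < c"
    using crit unfolding crit_level_def by blast
  \<comment> \<open>Beyond 2 pi, the part \<open>2 * M\<close> covers the growth of
    \<open>HK\<close>, and the extra 1 absorbs the constants outside radius
    \<open>R2\<close>.\<close>
  define a where "a = 2 * M + 2 * pi + 1"
  \<comment> \<open>Covers all points within distance 1 of \<open>B\<close> and of the embedded
    point \<open>p\<close>, around which the Hamiltonian must vanish; \<open>b\<close> then keeps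
    the quadratic branch nonpositive there.\<close>
  define R1 where "R1 = \<bar>R\<bar> + norm p + 1"
  define b where "b = a * R1\<^sup>2"
  define R2 where "R2 = 1 + b + 2 * M * (norm p)\<^sup>2"
  define \<eta> where "\<eta> = min d 1"
  have \<eta>: "0 < \<eta>" "\<eta> \<le> d" "\<eta> \<le> 1" using d by (auto simp: \<eta>_def)
  have a0: "0 \<le> a" using M by (simp add: a_def)
  define Ht where "Ht v = max (HK (blkP s l v)) (a * (norm v)\<^sup>2 - b)" for v
  define Hh where "Hh z = Ht (iota N z)" for z
  have Ht_cont: "continuous_on UNIV Ht"
    unfolding Ht_def
    by (intro continuous_intros continuous_on_compose2[OF H.G_cont _ subset_UNIV] continuous_on_blkP continuous_on_id)
  have zero: "Ht v = 0" if v: "norm (v - w) < \<eta>" "norm w \<le> \<bar>R\<bar> + norm p" "blkP s l w \<in> S" for v w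
  proof -
    have "norm (blkP s l v - blkP s l w) \<le> d"
      using norm_blkP_le[of s l "v - w"] v(1) \<eta>(2) by (simp add: blkP_diff)
    then have "blkP s l v \<in> nb l S d" using v(3) by (auto simp: nb_def)
    then have h: "HK (blkP s l v) = 0" by (simp add: HK_eq_0)
    have "norm v \<le> R1" using norm_triangle_sub[of v w] v \<eta>(3) by (simp add: R1_def)
    then have "(norm v)\<^sup>2 \<le> R1\<^sup>2" by (intro power_mono) auto
    then have "a * (norm v)\<^sup>2 \<le> b" unfolding b_def using a0 by (rule mult_left_mono)
    then show ?thesis using h by (simp add: Ht_def)
  qed
  have adm: "admissible_H N B Hh"
    unfolding admissible_H_def
  proof (intro conjI)
    show "continuous_on (pts N) Hh"
      unfolding Hh_def by (rule continuous_on_compose2[OF Ht_cont continuous_on_iota subset_UNIV])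
    show "\<forall>z\<in>pts N. 0 \<le> Hh z" unfolding Hh_def Ht_def using H.G_nonneg by (auto simp: max.coboundedI1)
    show "\<forall>z\<in>pts N. Hh (tau0 z) = Hh z"
      unfolding Hh_def Ht_def iota_tau0 blkP_tauP HK_tau norm_tauP by simp
    let ?p = "embP s l p"
    have pL: "?p \<in> L0 N"
      using pp(1) embP_Ps[OF s, of p] by (auto simp: L0_def)
    then have pP: "?p \<in> Ps N" by (simp add: L0_def)
    let ?T = "{z \<in> pts N. iota N z \<in> ball ?p \<eta>}"
    have "blkP s l ?p = p"
      using pp(1) by (intro pair_ell2_eqI) (auto simp: L0_def Ps_def)
    then have "?T \<subseteq> {z \<in> pts N. Hh z = 0}"
      unfolding Hh_def using pp(2) norm_embP_le[of s l p]
      by (auto intro!: zero[of _ ?p] simp: dist_norm norm_minus_commute)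
    then have "?T \<subseteq> (top_of_set (pts N)) interior_of {z \<in> pts N. Hh z = 0}"
      by (intro interior_of_maximal open_iota_vimage) auto
    moreover have "pnt ?p \<in> ?T" using pP \<eta>(1) by (simp add: pnt_pts iota_pnt)
    ultimately show "(top_of_set (pts N)) interior_of {z \<in> pts N. Hh z = 0} \<inter> Lag0 N \<noteq> {}"
      using pnt_Lag0[OF pL] by blast
    show "\<exists>a b z0 C. a > 2 * pi \<and> z0 \<in> Lag0 N \<and> compact C \<and>
        (\<forall>z\<in>pts N - C. Hh z = a * pt_sqnorm N z + pt_inner N z z0 + b)"
    proof (intro exI conjI)
      show "2 * pi < a" using M by (simp add: a_def)
      show "((\<lambda>i. 0, \<lambda>i. 0) :: pt) \<in> Lag0 N" by (auto simp: Lag0_def pts_def tau0_def)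
      show "compact (pnt ` (Ps N \<inter> cball 0 R2))"
        by (rule compact_continuous_image[OF continuous_on_pnt compact_Ps_cball])
      show "\<forall>z\<in>pts N - pnt ` (Ps N \<inter> cball 0 R2). Hh z = a * pt_sqnorm N z + pt_inner N z (\<lambda>i. 0, \<lambda>i. 0) + (- b)"
      proof
        fix z assume z: "z \<in> pts N - pnt ` (Ps N \<inter> cball 0 R2)"
        let ?v = "iota N z"
        have zz: "z = pnt ?v" using z by (simp add: pnt_iota)
        have "\<not> norm ?v \<le> R2"
        proof
          assume "norm ?v \<le> R2"
          then have "?v \<in> Ps N \<inter> cball 0 R2" by simp
          then show False using z zz by blast
        qed
        then have big: "R2 \<le> norm ?v" by simp
        have b0: "0 \<le> b" using a0 by (simp add: b_def)
        have m0: "0 \<le> 2 * M * (norm p)\<^sup>2" using M by simp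
        have R2: "1 \<le> R2" "b + 2 * M * (norm p)\<^sup>2 \<le> R2" using b0 m0 by (auto simp: R2_def)
        have "R2 * 1 \<le> norm ?v * norm ?v" using big R2(1) by (intro mult_mono) auto
        then have sq: "b + 2 * M * (norm p)\<^sup>2 \<le> (norm ?v)\<^sup>2" using R2(2) by (simp add: power2_eq_square)
        have "p \<in> nb l S d" using pp(2) sub_nb[of d] d by auto
        then have "norm (rs (nb l S d) (blkP s l ?v)) \<le> norm (blkP s l ?v - p)" unfolding rs_def by (rule pr_le[OF cK K0])
        also have "\<dots> \<le> norm ?v + norm p"
          using norm_triangle_ineq4[of "blkP s l ?v" p] norm_blkP_le[of s l ?v] by linarith
        finally have "(norm (rs (nb l S d) (blkP s l ?v)))\<^sup>2 \<le> (norm ?v + norm p)\<^sup>2" by (intro power_mono) auto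
        also have "\<dots> \<le> 2 * (norm ?v)\<^sup>2 + 2 * (norm p)\<^sup>2"
          using zero_le_power2[of "norm ?v - norm p"] by (simp add: power2_eq_square algebra_simps)
        finally have "HK (blkP s l ?v) \<le> M * (2 * (norm ?v)\<^sup>2 + 2 * (norm p)\<^sup>2)"
          unfolding HK_def using M by (intro mult_left_mono) auto
        also have "\<dots> \<le> a * (norm ?v)\<^sup>2 - b"
        proof -
          have gen: "M * (2 * X + 2 * Y) \<le> (2 * M + P + 1) * X - b" if "0 \<le> P * X" "b + 2 * M * Y \<le> X" for P X Y :: real
            using that by (simp add: algebra_simps)
          show ?thesis unfolding a_def by (rule gen[OF _ sq]) simp
        qed
        finally have "Hh z = a * (norm ?v)\<^sup>2 - b" by (simp add: Hh_def Ht_def)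
        then show "Hh z = a * pt_sqnorm N z + pt_inner N z (\<lambda>i. 0, \<lambda>i. 0) + (- b)"
          by (simp add: pt_sqnorm_iota pt_inner_def)
      qed
    qed
    let ?O = "\<Union>w\<in>B. ball (iota N w) \<eta>"
    show "\<exists>U. openin (top_of_set (pts N)) U \<and> closure B \<subseteq> U \<and> (\<forall>z\<in>U. Hh z = 0)"
    proof (intro exI conjI ballI)
      show "openin (top_of_set (pts N)) {z \<in> pts N. iota N z \<in> ?O}" by (rule open_iota_vimage) auto
      show "closure B \<subseteq> {z \<in> pts N. iota N z \<in> ?O}"
      proof
        fix z assume "z \<in> closure B"
        then have z: "z \<in> B" using B(2) by (simp add: closure_closed)
        moreover have "iota N z \<in> ball (iota N z) \<eta>" using \<eta>(1) by simp
        ultimately show "z \<in> {z \<in> pts N. iota N z \<in> ?O}" using B(1) by blast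
      qed
      fix z assume "z \<in> {z \<in> pts N. iota N z \<in> ?O}"
      then obtain w where w: "w \<in> B" "norm (iota N z - iota N w) < \<eta>" by (auto simp: dist_norm norm_minus_commute)
      have "norm (iota N w) \<le> \<bar>R\<bar> + norm p" using B(3)[OF w(1)] norm_ge_zero[of p] by linarith
      then show "Hh z = 0" unfolding Hh_def by (rule zero[OF w(2) _ BS[OF w(1)]])
    qed
  qed
  have fin: "(INF z\<in>Esphere_plus N. ereal (PhiH N Hh (h z))) \<le> ereal c" if h: "admissible_deformation N h" for h
  proof -
    obtain a1 b1 c1 K1 where D: "deform N a1 b1 c1 K1" and hd: "\<And>x. x \<in> Es N \<Longrightarrow> h (ofE x) = ofE (dfm a1 b1 c1 K1 x 1)"
      by (rule deform_of_admissible[OF h]) (rule that; assumption)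
    interpret D: deform N a1 b1 c1 K1 by (rule D)
    let ?e = "embE s l (Pp \<xi>)"
    have be: "blkE s l ?e = Pp \<xi>" by (rule blkE_embE[OF P_Es(1)[OF \<xi>(1)]])
    have "Pp \<xi> \<noteq> 0" by (rule H.Phi_pos_Pp) (simp add: \<xi>(3) c)
    have "blkE s l 0 = 0" by (rule pair_ell2_eqI) simp
    then have e0: "?e \<noteq> 0" using be \<open>Pp \<xi> \<noteq> 0\<close> by metis
    have Pe: "Pp ?e = ?e" by (rule pair_ell2_eqI) simp
    obtain x r where x: "x \<in> Sp N" and r: "r > 0" and Py: "Pp (dfm a1 b1 c1 K1 x 1) = r *\<^sub>R ?e"
      using D.intersection[OF embE_Es[OF s] Pe e0] by (elim bexE exE conjE) (rule that; assumption)
    let ?y = "dfm a1 b1 c1 K1 x 1"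
    have xE: "x \<in> Es N" using x by (simp add: Sp_def)
    have yE: "?y \<in> Es N" using D.dfm_Es[OF xE, of 1] by simp
    have Pb: "Pp (blkE s l ?y) = r *\<^sub>R Pp \<xi>"
      unfolding blkE_P(1)[symmetric] Py by (simp add: blkE_scaleR be)
    have 1: "norm (Pp ?y) \<le> norm (Pp (blkE s l ?y))"
      unfolding Py Pb using r norm_embE_le[of s l "Pp \<xi>"] by simp
    have 2: "norm (Pm (blkE s l ?y)) \<le> norm (Pm ?y)"
      unfolding blkE_P(2)[symmetric] by (rule norm_blkE_le)
    \<comment> \<open>The positive part lies entirely in the chosen block, and extraction can only
      shorten the negative part.\<close>
    have A: "Act ?y \<le> Act (blkE s l ?y)"
      unfolding Act_def
      by (intro diff_mono divide_right_mono power_mono 1 2 norm_ge_zero) simp_all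
    have i1: "integrable MI (\<lambda>t. HK (blkP s l (lp N ?y t)))" by (intro H.G_integrable L2f_blkP[where N = N] L2f_lp)
    have i2: "integrable MI (\<lambda>t. (norm (lp N ?y t))\<^sup>2)" by (rule L2f_sq[OF L2f_lp])
    have i3: "integrable MI (\<lambda>t. Ht (lp N ?y t))"
    proof (rule Bochner_Integration.integrable_bound)
      show "integrable MI (\<lambda>t. HK (blkP s l (lp N ?y t)) + a * (norm (lp N ?y t))\<^sup>2)"
        by (intro Bochner_Integration.integrable_add integrable_mult_right i1 i2)
      show "(\<lambda>t. Ht (lp N ?y t)) \<in> borel_measurable MI"
        by (rule continuous_measurable[OF Ht_cont lp_Ps L2f_ev[OF L2f_lp]])
      have "\<bar>Ht v\<bar> \<le> \<bar>HK (blkP s l v) + a * (norm v)\<^sup>2\<bar>" for v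
      proof -
        have "0 \<le> HK (blkP s l v)" "0 \<le> a * (norm v)\<^sup>2" "0 \<le> b" using H.G_nonneg a0 by (auto simp: b_def)
        then show ?thesis by (simp add: Ht_def max_def)
      qed
      then show "AE t in MI. norm (Ht (lp N ?y t)) \<le> norm (HK (blkP s l (lp N ?y t)) + a * (norm (lp N ?y t))\<^sup>2)" by simp
    qed
    have "IG l HK (blkE s l ?y) = (\<integral>t. HK (blkP s l (lp N ?y t)) \<partial>MI)"
      unfolding IG_def
    proof (rule integral_cong_AE)
      show "AE t in MI. HK (lp l (blkE s l ?y) t) = HK (blkP s l (lp N ?y t))"
        using lp_blk[OF s, of ?y] by eventually_elim simp
    qed (intro borel_measurable_integrable i1 H.G_integrable L2f_lp)+
    also have "\<dots> \<le> (\<integral>t. Ht (lp N ?y t) \<partial>MI)"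
      by (rule integral_mono[OF i1 i3]) (simp add: Ht_def)
    also have "\<dots> = IG N (\<lambda>v. Hh (pnt v)) ?y" unfolding IG_def Hh_def by (simp add: iota_pnt)
    finally have I: "IG l HK (blkE s l ?y) \<le> IG N (\<lambda>v. Hh (pnt v)) ?y" .
    have "Phi l HK (blkE s l ?y) \<le> c"
      using crit_max[OF \<xi>(1,2) blkE_Es Pb less_imp_le[OF r]] \<xi>(3) by simp
    then have "PhiH N Hh (h (ofE x)) \<le> c"
      unfolding hd[OF xE] PhiH_ofE[OF yE] using A I unfolding Phi_def by linarith
    then show ?thesis
      using x by (intro INF_lower2[of "ofE x"]) (auto simp: Esphere_plus_ofE)
  qed
  have "cEH_set N B \<le> cEH_fun N Hh" unfolding cEH_set_def by (rule INF_lower) (simp add: adm)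
  also have "\<dots> \<le> ereal c" unfolding cEH_fun_def by (rule SUP_least) (use fin in simp)
  finally show ?thesis .
qed

section \<open>Lower bounds and the product formula\<close>

text \<open>For a body with inner parallel set empty at depth \<open>d\<close> there is nothing to
  dominate deep inside; the bump then has height 0 over a single point, which keeps the two cases in
  one locale.\<close>

lemma (in body) body_bump:
  assumes d: "0 < d" and M: "1 \<le> M" and M': "0 \<le> M'"
  shows "\<exists>p C m. bump l (nb l S d) p d M C (d / 2) m \<and> m \<le> M' \<and> (er l S d \<noteq> {} \<longrightarrow> C = er l S d \<and> m = M') \<and>
    (er l S d = {} \<longrightarrow> m = 0)"
proof -
  obtain p where pp: "p \<in> L0 l" "p \<in> S" "er l S d \<noteq> {} \<longrightarrow> p \<in> er l S d" using ex_p[of d] d by auto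
  interpret cvx l "nb l S d" p d M by (rule cvx_nb[OF d M pp(1,2)])
  have S_K: "z \<in> nb l S d" if "c \<in> S" "z \<in> Ps l" "norm (z - c) \<le> d / 2" for c z
    using that d by (auto simp: nb_def intro!: bexI[of _ c])
  show ?thesis
  proof (cases "er l S d = {}")
    case True
    have "tauP p = p" using pp(1) by (intro pair_ell2_eqI) (simp add: L0_def)
    then have "bump l (nb l S d) p d M {p} (d / 2) 0"
      using pp d pPs S_K by unfold_locales auto
    then show ?thesis using True M' by blast
  next
    case False
    have "bump l (nb l S d) p d M (er l S d) (d / 2) M'"
    proof unfold_locales
      show "er l S d \<subseteq> Ps l" by (auto simp: er_def)
      show "p \<in> er l S d" using False pp(3) by blast
      show "z \<in> nb l S d" if "c \<in> er l S d" "z \<in> Ps l" "norm (z - c) \<le> d / 2" for c z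
        using S_K[OF _ that(2,3)] that(1) er_sub[of d] d by auto
    qed (use d M' er_compact er_convex er_tau in auto)
    then show ?thesis
      by (intro exI[of _ p] exI[of _ "er l S d"] exI[of _ M'] conjI) (use False in auto)
  qed
qed

text \<open>The extremal point \<open>q\<close> has distance at least \<open>d\<close> from the
  inner parallel set, which splits evenly into the radius of the bump and that of the ball around
  \<open>q\<close>.\<close>

lemma (in body) body_near:
  assumes b: "bump l (nb l S d) p d M C (d / 2) m" and mC: "er l S d \<noteq> {} \<longrightarrow> C = er l S d" "er l S d = {} \<longrightarrow> m = 0"
    and d: "0 < d"
    and q: "q \<in> L0 l" "q \<in> S" "\<forall>d\<ge>0. \<forall>c\<in>er l S d. d \<le> norm (q - c)"
  shows "\<exists>r>0. \<forall>x\<in>Es l. Pp x = x \<longrightarrow> norm x \<le> r \<longrightarrow>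
    (norm x)\<^sup>2 / 4 \<le> Phi l (bump.GB (nb l S d) M C (d / 2) m) (x + cst l q)"
proof -
  interpret bump l "nb l S d" p d M C "d / 2" m by (rule b)
  show ?thesis
  proof (rule bump_near[OF q(1)])
    show "q \<in> nb l S d" using q(2) sub_nb[of d] d by auto
    show "0 < d / 2" using d by simp
    show "z \<in> nb l S d" if "z \<in> Ps l" "norm (z - q) < d / 2" for z
      using that q(2) d by (auto simp: nb_def intro!: bexI[of _ q])
    show "d / 2 + d / 2 \<le> norm (q - c)" if "c \<in> C" "0 < m" for c
    proof -
      have "c \<in> er l S d" using that mC by (cases "er l S d = {}") auto
      then show ?thesis using q(3) d by simp
    qed
  qed
qed

lemma iota_blk: "i < k \<Longrightarrow> iota (n i) (blk n i z) = blkP (sp n i) (n i) (iota (sp n k) z)"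
proof (rule pair_ell2_eqI)
  fix m b assume i: "i < k"
  have "sp n i + n i \<le> sp n k" by (rule sp_mono[OF i])
  then show "ev (iota (n i) (blk n i z)) (m, b) = ev (blkP (sp n i) (n i) (iota (sp n k) z)) (m, b)"
    by (simp add: ev_iota blk_def sp_def)
qed

lemma blk_pts: "blk n i z \<in> pts (n i)"
  by (simp add: blk_def pts_def)

lemma norm_blkP_sum:
  assumes "v \<in> Ps (sp n k)"
  shows "(norm v)\<^sup>2 = (\<Sum>i<k. (norm (blkP (sp n i) (n i) v))\<^sup>2)"
proof -
  have v: "v = (\<Sum>i<k. embP (sp n i) (n i) (blkP (sp n i) (n i) v))"
  proof (rule pair_ell2_eqI)
    fix m b
    have "ev (\<Sum>i<k. embP (sp n i) (n i) (blkP (sp n i) (n i) v)) (m, b)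
        = (\<Sum>i<k. if sp n i \<le> m \<and> m < sp n i + n i then ev v (m, b) else 0)"
      unfolding ev_sum by (intro sum.cong refl) (simp add: less_diff_conv2)
    also have "\<dots> = ev v (m, b)" unfolding sum_blocks using assms by (simp add: Ps_def)
    finally show "ev v (m, b) = ev (\<Sum>i<k. embP (sp n i) (n i) (blkP (sp n i) (n i) v)) (m, b)" by simp
  qed
  have "(norm v)\<^sup>2 = inner (\<Sum>i<k. embP (sp n i) (n i) (blkP (sp n i) (n i) v)) v"
    using v by (simp add: power2_norm_eq_inner)
  then show ?thesis by (simp add: inner_sum_left inner_embP power2_norm_eq_inner)
qed

lemma closed_pts: "closed (pts l)"
proof -
  have eq: "pts l = (\<Inter>i\<in>{l..}. {z. fst z i = 0} \<inter> {z. snd z i = 0})" by (auto simp: pts_def)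
  have cl: "closed ({z :: pt. fst z i = 0} \<inter> {z. snd z i = 0})" for i
  proof -
    have f: "continuous_on UNIV (\<lambda>z :: pt. fst z i)"
      by (rule continuous_on_product_then_coordinatewise) (intro continuous_intros)
    have g: "continuous_on UNIV (\<lambda>z :: pt. snd z i)"
      by (rule continuous_on_product_then_coordinatewise) (intro continuous_intros)
    show ?thesis by (intro closed_Int closed_Collect_eq f g continuous_on_const)
  qed
  show ?thesis unfolding eq by (intro closed_INT ballI cl)
qed

lemma mem_interior_iota:
  assumes D: "D \<subseteq> pts l" and x: "x \<in> (top_of_set (pts l)) interior_of D"
  shows "\<exists>\<eta>>0. \<forall>w\<in>Ps l. norm (w - iota l x) \<le> \<eta> \<longrightarrow> w \<in> iota l ` D"
proof -
  obtain T where T: "openin (top_of_set (pts l)) T" "x \<in> T" "T \<subseteq> D" using x by (auto simp: interior_of_def)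
  obtain V where V: "open V" "T = pts l \<inter> V" using T(1) by (auto simp: openin_open)
  have xp: "x \<in> pts l" "x \<in> V" using T V by auto
  have "open (pnt -` V)" by (rule open_vimage[OF V(1) continuous_on_pnt])
  moreover have "iota l x \<in> pnt -` V" using xp by (simp add: pnt_iota)
  ultimately have "\<exists>e>0. cball (iota l x) e \<subseteq> pnt -` V" unfolding open_contains_cball by (rule bspec)
  then obtain e where e: "0 < e" "cball (iota l x) e \<subseteq> pnt -` V" by blast
  have "w \<in> iota l ` D" if w: "w \<in> Ps l" "norm (w - iota l x) \<le> e" for w
  proof -
    have "w \<in> cball (iota l x) e" using w(2) by (simp add: dist_norm norm_minus_commute)
    then have "pnt w \<in> V" using e(2) by blast
    then have "pnt w \<in> D" using V(2) T(3) pnt_pts[OF w(1)] by blast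
    then show ?thesis using iota_pnt[OF w(1)] by (intro image_eqI[of _ _ "pnt w"]) auto
  qed
  then show ?thesis using e(1) by blast
qed

text \<open>As \<open>d\<close> tends to zero, points with every block close to its body and none at
  depth \<open>d\<close> accumulate only at points with every block on the boundary, and these
  belong to the open set \<open>U\<close>.\<close>

lemma frontier_nbhd:
  assumes D: "\<And>i. i < k \<Longrightarrow> D i \<subseteq> pts (n i)" and b: "\<And>i. i < k \<Longrightarrow> body (n i) (iota (n i) ` D i)"
    and U: "openin (top_of_set (pts (sp n k))) U" "prod_set n k (\<lambda>i. pts_frontier (n i) (D i)) \<subseteq> U"
  shows "\<exists>d>0. \<forall>v\<in>Ps (sp n k). (\<forall>i<k. blkP (sp n i) (n i) v \<in> nb (n i) (iota (n i) ` D i) (2 * d)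
    \<and> blkP (sp n i) (n i) v \<notin> er (n i) (iota (n i) ` D i) d) \<longrightarrow> pnt v \<in> U"
proof (rule ccontr)
  let ?N = "sp n k" and ?S = "\<lambda>i. iota (n i) ` D i" and ?b = "\<lambda>i. blkP (sp n i) (n i)"
  let ?d = "\<lambda>m :: nat. 1 / (real m + 1)"
  assume no: "\<not> ?thesis"
  have "\<exists>v. v \<in> Ps ?N \<and> (\<forall>i<k. ?b i v \<in> nb (n i) (?S i) (2 * ?d m) \<and> ?b i v \<notin> er (n i) (?S i) (?d m)) \<and> pnt v \<notin> U" for m
  proof -
    have "0 < ?d m" by simp
    then show ?thesis using no by blast
  qed
  then obtain v where v: "\<And>m. v m \<in> Ps ?N" "\<And>m i. i < k \<Longrightarrow> ?b i (v m) \<in> nb (n i) (?S i) (2 * ?d m)"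
    "\<And>m i. i < k \<Longrightarrow> ?b i (v m) \<notin> er (n i) (?S i) (?d m)" "\<And>m. pnt (v m) \<notin> U" by metis
  have "\<exists>R. \<forall>w\<in>?S i. norm w \<le> R" if "i < k" for i
    using compact_imp_bounded[OF body.cS[OF b[OF that]]] unfolding bounded_iff .
  then obtain R where R: "\<And>i w. i < k \<Longrightarrow> w \<in> ?S i \<Longrightarrow> norm w \<le> R i" by metis
  have near: "\<exists>w\<in>?S i. norm (?b i (v m) - w) \<le> 2 * ?d m" if "i < k" for i m
    using v(2)[OF that, of m] by (simp add: nb_def)
  have d1: "?d m \<le> 1" for m by simp
  have bd: "norm (?b i (v m)) \<le> R i + 2" if i: "i < k" for i m
  proof -
    obtain w where w: "w \<in> ?S i" "norm (?b i (v m) - w) \<le> 2 * ?d m" using near[OF i] by blast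
    show ?thesis using R[OF i w(1)] w(2) d1[of m] norm_triangle_sub[of "?b i (v m)" w] by linarith
  qed
  define Q where "Q = sqrt (\<Sum>i<k. (R i + 2)\<^sup>2)"
  have "norm (v m) \<le> Q" for m
  proof -
    have "(norm (v m))\<^sup>2 \<le> (\<Sum>i<k. (R i + 2)\<^sup>2)"
      unfolding norm_blkP_sum[OF v(1)] by (intro sum_mono power_mono bd) auto
    then show ?thesis unfolding Q_def by (rule real_le_rsqrt)
  qed
  then have vQ: "\<forall>m. v m \<in> Ps ?N \<inter> cball 0 Q" using v(1) by simp
  have "seq_compact (Ps ?N \<inter> cball 0 Q)" by (rule compact_imp_seq_compact[OF compact_Ps_cball])
  then obtain z r where z: "z \<in> Ps ?N \<inter> cball 0 Q" and r: "strict_mono (r :: nat \<Rightarrow> nat)" and lim: "(v \<circ> r) \<longlonglongrightarrow> z"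
    using vQ unfolding seq_compact_def by blast
  have zP: "z \<in> Ps ?N" using z by simp
  have lim': "(\<lambda>m. v (r m)) \<longlonglongrightarrow> z" using lim by (simp add: o_def)
  have d0: "(\<lambda>m. ?d (r m)) \<longlonglongrightarrow> 0"
    using LIMSEQ_subseq_LIMSEQ[OF LIMSEQ_inverse_real_of_nat r] by (simp add: o_def inverse_eq_divide add.commute)
  have bl: "(\<lambda>m. ?b i (v (r m))) \<longlonglongrightarrow> ?b i z" for i
    by (rule bounded_linear.tendsto[OF bounded_linear_blkP lim'])
  have inS: "?b i z \<in> ?S i" if i: "i < k" for i
  proof -
    from near[OF i] obtain w where w: "\<And>m. w m \<in> ?S i" "\<And>m. norm (?b i (v m) - w m) \<le> 2 * ?d m" by metis
    have "(\<lambda>m. ?b i (v (r m)) - w (r m)) \<longlonglongrightarrow> 0"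
    proof (rule Lim_null_comparison)
      show "\<forall>\<^sub>F m in sequentially. norm (?b i (v (r m)) - w (r m)) \<le> 2 * ?d (r m)" using w(2) by simp
      show "(\<lambda>m. 2 * ?d (r m)) \<longlonglongrightarrow> 0" using tendsto_mult_left[OF d0, of 2] by simp
    qed
    from tendsto_diff[OF bl[of i] this] have "(\<lambda>m. w (r m)) \<longlonglongrightarrow> ?b i z" by simp
    then show ?thesis
      by (rule closed_sequentially[OF compact_imp_closed[OF body.cS[OF b[OF i]]], rotated]) (rule w)
  qed
  have fr: "blk n i (pnt z) \<in> pts_frontier (n i) (D i)" if i: "i < k" for i
  proof -
    have e: "iota (n i) (blk n i (pnt z)) = ?b i z" using iota_blk[OF i, of n "pnt z"] iota_pnt[OF zP] by simp
    obtain y where y: "y \<in> D i" "?b i z = iota (n i) y" using inS[OF i] by blast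
    have "blk n i (pnt z) = y"
      using pnt_iota[OF blk_pts, of n i "pnt z"] pnt_iota[of y "n i"] D[OF i] y e by auto
    then have mem: "blk n i (pnt z) \<in> D i" using y(1) by simp
    have "blk n i (pnt z) \<notin> (top_of_set (pts (n i))) interior_of (D i)"
    proof
      assume "blk n i (pnt z) \<in> (top_of_set (pts (n i))) interior_of (D i)"
      from mem_interior_iota[OF D[OF i] this] obtain \<eta> where \<eta>: "0 < \<eta>" "\<forall>w\<in>Ps (n i). norm (w - ?b i z) \<le> \<eta> \<longrightarrow> w \<in> ?S i"
        unfolding e by blast
      have "\<forall>\<^sub>F m in sequentially. dist (?b i (v (r m))) (?b i z) < \<eta> / 2 \<and> dist (?d (r m)) 0 < \<eta> / 2"
        using \<eta>(1) by (intro eventually_conj tendstoD[OF bl] tendstoD[OF d0]) auto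
      then obtain m where m: "dist (?b i (v (r m))) (?b i z) < \<eta> / 2" "dist (?d (r m)) 0 < \<eta> / 2"
        unfolding eventually_sequentially by blast
      have "w \<in> ?S i" if w: "w \<in> Ps (n i)" "norm (w - ?b i (v (r m))) \<le> ?d (r m)" for w
      proof -
        have "norm (w - ?b i z) \<le> norm (w - ?b i (v (r m))) + norm (?b i (v (r m)) - ?b i z)"
          using norm_triangle_ineq[of "w - ?b i (v (r m))" "?b i (v (r m)) - ?b i z"] by simp
        moreover have "norm (?b i (v (r m)) - ?b i z) < \<eta> / 2" "?d (r m) < \<eta> / 2" using m by (simp_all add: dist_norm)
        ultimately have "norm (w - ?b i z) \<le> \<eta>" using w(2) by linarith
        then show ?thesis using \<eta>(2) w(1) by blast
      qed
      then have "?b i (v (r m)) \<in> er (n i) (?S i) (?d (r m))" by (simp add: er_def)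
      then show False using v(3)[OF i] by blast
    qed
    moreover have "blk n i (pnt z) \<in> (top_of_set (pts (n i))) closure_of (D i)"
      using closure_of_subset[of "D i" "top_of_set (pts (n i))"] D[OF i] mem by auto
    ultimately show ?thesis by (simp add: pts_frontier_def frontier_of_def)
  qed
  have "pnt z \<in> prod_set n k (\<lambda>i. pts_frontier (n i) (D i))"
    using fr pnt_pts[OF zP] by (simp add: prod_set_def sp_def)
  then have zU: "pnt z \<in> U" using U(2) by blast
  obtain V where V: "open V" "U = pts ?N \<inter> V" using U(1) by (auto simp: openin_open)
  have "open (pnt -` V)" by (rule open_vimage[OF V(1) continuous_on_pnt])
  then have "\<forall>\<^sub>F m in sequentially. v (r m) \<in> pnt -` V"
    using zU V(2) by (intro topological_tendstoD[OF lim']) auto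
  then obtain m where "pnt (v (r m)) \<in> V" unfolding eventually_sequentially by auto
  then show False using v(4)[of "r m"] V(2) pnt_pts[OF v(1)] by blast
qed

text \<open>Compactness bounds the Hamiltonian on \<open>C\<close>; outside, the linear term is
  absorbed by the quadratic one.\<close>

lemma admissible_quad_bound:
  assumes "admissible_H N B H"
  shows "\<exists>A1 A2. 0 \<le> A1 \<and> 0 \<le> A2 \<and> (\<forall>v\<in>Ps N. H (pnt v) \<le> A1 + A2 * (norm v)\<^sup>2)"
proof -
  obtain a b z0 C where a: "a > 2 * pi" and C: "compact C"
    and q: "\<forall>z\<in>pts N - C. H z = a * pt_sqnorm N z + pt_inner N z z0 + b"
    and c: "continuous_on (pts N) H"
    using assms unfolding admissible_H_def by blast
  have "compact (pts N \<inter> C)" using compact_Int_closed[OF C closed_pts[of N]] by (simp add: Int_commute)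
  then have "compact (H ` (pts N \<inter> C))"
    by (rule compact_continuous_image[OF continuous_on_subset[OF c Int_lower1]])
  then have "bounded (H ` (pts N \<inter> C))" by (rule compact_imp_bounded)
  then obtain B1 where B1: "\<forall>y\<in>H ` (pts N \<inter> C). norm y \<le> B1" unfolding bounded_iff by blast
  let ?A1 = "\<bar>B1\<bar> + (norm (iota N z0))\<^sup>2 + \<bar>b\<bar>" and ?A2 = "a + 1"
  have a0: "0 \<le> a" using a pi_ge_zero by linarith
  have "H (pnt v) \<le> ?A1 + ?A2 * (norm v)\<^sup>2" if v: "v \<in> Ps N" for v
  proof (cases "pnt v \<in> C")
    case True
    have "\<bar>H (pnt v)\<bar> \<le> B1" using B1 True pnt_pts[OF v] by simp
    moreover have "0 \<le> ?A2 * (norm v)\<^sup>2" using a0 by simp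
    moreover have "0 \<le> (norm (iota N z0))\<^sup>2" by simp
    ultimately show ?thesis by linarith
  next
    case False
    then have "H (pnt v) = a * (norm v)\<^sup>2 + inner v (iota N z0) + b"
      using q pnt_pts[OF v] by (simp add: pt_sqnorm_iota iota_pnt[OF v] flip: inner_iota)
    moreover have "inner v (iota N z0) \<le> (norm v)\<^sup>2 + (norm (iota N z0))\<^sup>2"
    proof -
      have "0 \<le> (norm (v - iota N z0))\<^sup>2" by simp
      then have "2 * inner v (iota N z0) \<le> (norm v)\<^sup>2 + (norm (iota N z0))\<^sup>2"
        by (simp add: power2_norm_eq_inner inner_diff_left inner_diff_right inner_commute)
      moreover have "0 \<le> (norm v)\<^sup>2 + (norm (iota N z0))\<^sup>2" by simp
      ultimately show ?thesis by linarith
    qed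
    ultimately show ?thesis by (simp add: distrib_right)
  qed
  moreover have "0 \<le> ?A1" "0 \<le> ?A2" using a0 by simp_all
  ultimately show ?thesis by blast
qed

text \<open>Outside \<open>U\<close> some block is farther than \<open>2 * d\<close> from its body
  or at depth \<open>d\<close> inside it. In the first case the squared distance, in the second the
  bump, dominates the constant part of the competitor; the squared distances of all blocks dominate
  its quadratic growth.\<close>

lemma lower:
  assumes k: "1 \<le> k" and D: "\<And>i. i < k \<Longrightarrow> D i \<subseteq> pts (n i)" and b: "\<And>i. i < k \<Longrightarrow> body (n i) (iota (n i) ` D i)"
    and nocrit: "\<And>i d M c. i < k \<Longrightarrow> 0 < d \<Longrightarrow> 1 \<le> M \<Longrightarrow> crit_level (n i) (iota (n i) ` D i) d M c \<Longrightarrow> \<beta> < c"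
  shows "ereal \<beta> \<le> cEH_set (sp n k) (prod_set n k (\<lambda>i. pts_frontier (n i) (D i)))"
  unfolding cEH_set_def
proof (rule INF_greatest)
  let ?N = "sp n k" and ?S = "\<lambda>i. iota (n i) ` D i" and ?b = "\<lambda>i. blkP (sp n i) (n i)"
  let ?B = "prod_set n k (\<lambda>i. pts_frontier (n i) (D i))"
  fix H assume "H \<in> {H. admissible_H ?N ?B H}"
  then have adm: "admissible_H ?N ?B H" by simp
  then have nn: "\<And>z. z \<in> pts ?N \<Longrightarrow> 0 \<le> H z" by (simp add: admissible_H_def)
  from adm obtain U where U: "openin (top_of_set (pts ?N)) U" "closure ?B \<subseteq> U" "\<forall>z\<in>U. H z = 0"
    unfolding admissible_H_def by blast
  have BU: "?B \<subseteq> U" using closure_subset U(2) by (rule order_trans)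
  obtain d where d: "0 < d" and dU: "\<forall>v\<in>Ps ?N. (\<forall>i<k. ?b i v \<in> nb (n i) (?S i) (2 * d) \<and> ?b i v \<notin> er (n i) (?S i) d) \<longrightarrow> pnt v \<in> U"
    using frontier_nbhd[OF D b U(1) BU] by blast
  obtain A1 A2 where A: "0 \<le> A1" "0 \<le> A2" "\<And>v. v \<in> Ps ?N \<Longrightarrow> H (pnt v) \<le> A1 + A2 * (norm v)\<^sup>2"
    using admissible_quad_bound[OF adm] by blast
  have "\<exists>R. 0 \<le> R \<and> (\<forall>w\<in>nb (n i) (?S i) d. norm w \<le> R)" if "i < k" for i
    using compact_imp_bounded[OF body.nb_compact[OF b[OF that]]] unfolding bounded_iff by (meson le_max_iff_disj max.cobounded1)
  then obtain R where R: "\<And>i. i < k \<Longrightarrow> 0 \<le> R i" "\<And>i w. i < k \<Longrightarrow> w \<in> nb (n i) (?S i) d \<Longrightarrow> norm w \<le> R i" by metis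
  \<comment> \<open>The constant left over once the squared norm is bounded by twice the squared
    distances plus twice the squared radii of the neighbourhoods.\<close>
  define A3 where "A3 = A1 + 2 * A2 * (\<Sum>i<k. (R i)\<^sup>2)"
  have A3: "0 \<le> A3" unfolding A3_def using A by (intro add_nonneg_nonneg mult_nonneg_nonneg sum_nonneg) auto
  \<comment> \<open>\<open>2 * A2\<close> serves the quadratic growth; \<open>A3 / d\<^sup>2\<close>
    yields the constant \<open>A3\<close> at distance \<open>d\<close> from the
    neighbourhood.\<close>
  define M where "M = 1 + 2 * A2 + A3 / d\<^sup>2"
  \<comment> \<open>Gives the bump of radius \<open>d / 2\<close> exactly the value
    \<open>A3\<close> on the inner parallel set.\<close>
  define M' where "M' = A3 / ((d / 2)\<^sup>2)\<^sup>2"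
  have M: "1 \<le> M" "2 * A2 + A3 / d\<^sup>2 \<le> M" using A(2) A3 by (simp_all add: M_def)
  have M': "0 \<le> M'" "M' * ((d / 2)\<^sup>2)\<^sup>2 = A3" unfolding M'_def using A3 d by simp_all
  define Lc where "Lc = 2 * M + 12 * M' * (d / 2)\<^sup>2"
  let ?bm = "\<lambda>i x. bump (n i) (nb (n i) (?S i) d) (fst x) d M (fst (snd x)) (d / 2) (snd (snd x)) \<and> snd (snd x) \<le> M'
      \<and> (er (n i) (?S i) d \<noteq> {} \<longrightarrow> fst (snd x) = er (n i) (?S i) d \<and> snd (snd x) = M')
      \<and> (er (n i) (?S i) d = {} \<longrightarrow> snd (snd x) = 0)"
  have "\<forall>i\<in>{..<k}. \<exists>x. ?bm i x"
    using body.body_bump[OF b d M(1) M'(1)] by simp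
  from bchoice[OF this] obtain f where f: "\<forall>i\<in>{..<k}. ?bm i (f i)"
    by (elim exE)
  define C where "C i = fst (snd (f i))" for i
  define m where "m i = snd (snd (f i))" for i
  have bmp: "\<And>i. i < k \<Longrightarrow> bump (n i) (nb (n i) (?S i) d) (fst (f i)) d M (C i) (d / 2) (m i)"
    and mM: "\<And>i. i < k \<Longrightarrow> m i \<le> M'"
    and Cer: "\<And>i. i < k \<Longrightarrow> er (n i) (?S i) d \<noteq> {} \<Longrightarrow> C i = er (n i) (?S i) d \<and> m i = M'"
    and m0: "\<And>i. i < k \<Longrightarrow> er (n i) (?S i) d = {} \<Longrightarrow> m i = 0"
    using f by (simp_all add: C_def m_def)
  let ?Q = "\<lambda>i q. q \<in> L0 (n i) \<and> q \<in> ?S i \<and> (\<forall>d\<ge>0. \<forall>c\<in>er (n i) (?S i) d. d \<le> norm (q - c))"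
  have "\<forall>i\<in>{..<k}. \<exists>q. ?Q i q"
    using body.ex_q[OF b] by simp
  from bchoice[OF this] obtain q where "\<forall>i\<in>{..<k}. ?Q i (q i)"
    by (elim exE)
  then have q: "\<And>i. i < k \<Longrightarrow> ?Q i (q i)"
    by simp
  let ?G = "\<lambda>i. bump.GB (nb (n i) (?S i) d) M (C i) (d / 2) (m i)"
  let ?g = "\<lambda>i. bump.gB (nb (n i) (?S i) d) M (C i) (d / 2) (m i)"
  interpret F: ham_fam k n ?G ?g Lc
  proof (rule ham_fam.intro)
    show "1 \<le> k" by (rule k)
    fix i assume i: "i < k"
    have h: "ham (n i) (?G i) (?g i) (bump.LB M (d / 2) (m i))"
      using bump.ham_sym_GB[OF bmp[OF i]] by (rule ham_sym.axioms(1))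
    have "bump.LB M (d / 2) (m i) \<le> Lc"
      unfolding bump.LB_def[OF bmp[OF i]] Lc_def using mM[OF i]
      by (intro add_left_mono mult_right_mono mult_left_mono) auto
    with h show "ham (n i) (?G i) (?g i) Lc" by (rule ham_mono)
  qed
  show "ereal \<beta> \<le> cEH_fun ?N H"
  proof (rule F.lower_bound)
    fix i and \<epsilon> :: real assume i: "i < k" and e: "0 < \<epsilon>"
    show "\<exists>\<delta>>0. \<forall>x\<in>Es (n i). \<epsilon> \<le> Phi (n i) (?G i) x \<longrightarrow> Phi (n i) (?G i) x \<le> \<beta> \<longrightarrow> \<delta> \<le> norm (gradP (n i) (?g i) x)"
    proof (rule bump.bump_gap[OF bmp[OF i] _ e])
      fix x let ?h = "Phi (n i) (cvx.HK (nb (n i) (?S i) d) M) x"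
      assume x: "x \<in> Es (n i)" "gradP (n i) (cvx.gK (nb (n i) (?S i) d) M) x = 0" "0 < ?h"
      then have "crit_level (n i) (?S i) d M (?h)" unfolding crit_level_def by blast
      then show "\<beta> < ?h" by (rule nocrit[OF i d M(1)])
    qed
  next
    fix i assume i: "i < k"
    show "\<exists>r>0. \<forall>x\<in>Es (n i). Pp x = x \<longrightarrow> norm x \<le> r \<longrightarrow> (norm x)\<^sup>2 / 4 \<le> Phi (n i) (?G i) (x + cst (n i) (q i))"
      using q[OF i] Cer[OF i] m0[OF i] by (intro body.body_near[OF b[OF i] bmp[OF i] _ _ d]) auto
  next
    fix v assume v: "v \<in> Ps ?N"
    have GT: "F.GT v = (\<Sum>i<k. ?G i (?b i v))" by (rule F.GT_def)
    have GTn: "0 \<le> F.GT v" by (rule F.T.G_nonneg)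
    have "H (pnt v) \<le> F.GT v"
    proof (cases "pnt v \<in> U")
      case True
      then show ?thesis using U(3) GTn by simp
    next
      case False
      let ?u = "\<lambda>i. (norm (rs (nb (n i) (?S i) d) (?b i v)))\<^sup>2"
      have parts: "?G i (?b i v) = M * ?u i + m i * (max 0 ((d / 2)\<^sup>2 - (norm (rs (C i) (?b i v)))\<^sup>2))\<^sup>2" if i: "i < k" for i
      proof -
        interpret bump "n i" "nb (n i) (?S i) d" "fst (f i)" d M "C i" "d / 2" "m i" by (rule bmp[OF i])
        show ?thesis by (simp add: GB_def HK_def bC_def sC_def)
      qed
      have m_nn: "0 \<le> m i" if "i < k" for i by (rule bump.M'[OF bmp[OF that]])
      have u_le: "M * ?u i \<le> ?G i (?b i v)" if i: "i < k" for i
        unfolding parts[OF i] using m_nn[OF i] by simp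
      have nv: "(norm v)\<^sup>2 \<le> 2 * (\<Sum>i<k. ?u i) + 2 * (\<Sum>i<k. (R i)\<^sup>2)"
      proof -
        have "(norm (?b i v))\<^sup>2 \<le> 2 * ?u i + 2 * (R i)\<^sup>2" if i: "i < k" for i
        proof -
          let ?K = "nb (n i) (?S i) d"
          have K: "compact ?K" "?K \<noteq> {}"
            using body.nb_compact[OF b[OF i]] body.sub_nb[OF b[OF i], of d] body.S0[OF b[OF i]] d by auto
          have "norm (?b i v) \<le> norm (rs ?K (?b i v)) + norm (pr ?K (?b i v))"
            using norm_triangle_ineq[of "rs ?K (?b i v)" "pr ?K (?b i v)"] by (simp add: rs_def)
          also have "\<dots> \<le> norm (rs ?K (?b i v)) + R i" using R(2)[OF i pr_in[OF K]] by simp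
          finally have "(norm (?b i v))\<^sup>2 \<le> (norm (rs ?K (?b i v)) + R i)\<^sup>2" by (intro power_mono) auto
          also have "\<dots> \<le> 2 * ?u i + 2 * (R i)\<^sup>2"
            using zero_le_power2[of "norm (rs ?K (?b i v)) - R i"] by (simp add: power2_eq_square algebra_simps)
          finally show ?thesis .
        qed
        then have "(\<Sum>i<k. (norm (?b i v))\<^sup>2) \<le> (\<Sum>i<k. 2 * ?u i + 2 * (R i)\<^sup>2)" by (intro sum_mono) simp
        then show ?thesis unfolding norm_blkP_sum[OF v] by (simp add: sum.distrib sum_distrib_left)
      qed
      have "H (pnt v) \<le> A1 + A2 * (norm v)\<^sup>2" by (rule A(3)[OF v])
      also have "\<dots> \<le> A1 + A2 * (2 * (\<Sum>i<k. ?u i) + 2 * (\<Sum>i<k. (R i)\<^sup>2))"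
        using A(2) nv by (intro add_left_mono mult_left_mono)
      also have "\<dots> = A3 + 2 * A2 * (\<Sum>i<k. ?u i)" by (simp add: A3_def algebra_simps)
      finally have Hle: "H (pnt v) \<le> A3 + 2 * A2 * (\<Sum>i<k. ?u i)" .
      obtain i where i: "i < k" and ci: "?b i v \<notin> nb (n i) (?S i) (2 * d) \<or> ?b i v \<in> er (n i) (?S i) d"
        using dU[rule_format, OF v] False by blast
      have "A3 + 2 * A2 * ?u i \<le> ?G i (?b i v)"
      proof (cases "?b i v \<in> er (n i) (?S i) d")
        case True
        then have C: "C i = er (n i) (?S i) d" "m i = M'" using Cer[OF i] by auto
        have r0: "rs (C i) (?b i v) = 0"
          using True body.er_compact[OF b[OF i], of d] body.er_convex[OF b[OF i]] d unfolding rs_def C(1) by (simp add: pr_id)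
        have mx: "(max 0 ((d / 2)\<^sup>2 - (norm (rs (C i) (?b i v)))\<^sup>2))\<^sup>2 = ((d / 2)\<^sup>2)\<^sup>2" unfolding r0 by simp
        have "?G i (?b i v) = M * ?u i + A3" using parts[OF i] unfolding mx C(2) M'(2) .
        moreover have "0 \<le> A3 / d\<^sup>2" using A3 by simp
        then have "2 * A2 * ?u i \<le> M * ?u i" using M(2) by (intro mult_right_mono) auto
        ultimately show ?thesis by simp
      next
        case False
        then have far: "?b i v \<notin> nb (n i) (?S i) (2 * d)" using ci by blast
        let ?K = "nb (n i) (?S i) d"
        have K: "compact ?K" "?K \<noteq> {}"
          using body.nb_compact[OF b[OF i]] body.sub_nb[OF b[OF i], of d] body.S0[OF b[OF i]] d by auto
        obtain w where w: "w \<in> ?S i" "norm (pr ?K (?b i v) - w) \<le> d" using pr_in[OF K, of "?b i v"] by (auto simp: nb_def)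
        have "2 * d < norm (?b i v - w)" using far w(1) by (auto simp: nb_def not_le)
        moreover have "norm (?b i v - w) \<le> norm (rs ?K (?b i v)) + norm (pr ?K (?b i v) - w)"
          using norm_triangle_ineq[of "rs ?K (?b i v)" "pr ?K (?b i v) - w"] by (simp add: rs_def)
        \<comment> \<open>Distance more than \<open>2 * d\<close> to the body leaves at least
          \<open>d\<close> to its \<open>d\<close>-neighbourhood.\<close>
        ultimately have "d \<le> norm (rs ?K (?b i v))" using w(2) by linarith
        then have du: "d\<^sup>2 \<le> ?u i" using d by (intro power_mono) auto
        have "A3 / d\<^sup>2 * d\<^sup>2 \<le> A3 / d\<^sup>2 * ?u i" using A3 du by (intro mult_left_mono) auto
        then have "A3 \<le> A3 / d\<^sup>2 * ?u i" using d by simp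
        moreover have "(2 * A2 + A3 / d\<^sup>2) * ?u i \<le> M * ?u i" using M(2) by (intro mult_right_mono) auto
        ultimately show ?thesis using u_le[OF i] by (simp add: distrib_right)
      qed
      moreover have "2 * A2 * ?u j \<le> ?G j (?b j v)" if j: "j < k" for j
      proof -
        have "0 \<le> A3 / d\<^sup>2" using A3 by simp
        then have "2 * A2 * ?u j \<le> M * ?u j" using M(2) by (intro mult_right_mono) auto
        then show ?thesis using u_le[OF j] by linarith
      qed
      ultimately have each: "(if j = i then A3 else 0) + 2 * A2 * ?u j \<le> ?G j (?b j v)" if "j < k" for j
        using that by auto
      have "(\<Sum>j<k. (if j = i then A3 else 0) + 2 * A2 * ?u j) \<le> F.GT v"
        unfolding GT by (intro sum_mono each) simp
      moreover have "(\<Sum>j<k. (if j = i then A3 else 0) + 2 * A2 * ?u j) = A3 + 2 * A2 * (\<Sum>j<k. ?u j)"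
        using i by (simp add: sum.distrib sum_distrib_left)
      ultimately show ?thesis using Hle by linarith
    qed
    then show "0 \<le> H (pnt v) \<and> H (pnt v) \<le> F.GT v" using nn[OF pnt_pts[OF v]] by simp
  qed
qed

section \<open>The product formula\<close>

text \<open>A smaller set admits more Hamiltonians.\<close>

lemma cEH_set_mono: "B \<subseteq> B' \<Longrightarrow> cEH_set N B \<le> cEH_set N B'"
  unfolding cEH_set_def
proof (rule INF_superset_mono)
  assume BB: "B \<subseteq> B'"
  show "{H. admissible_H N B' H} \<subseteq> {H. admissible_H N B H}"
  proof (intro Collect_mono impI)
    fix H assume "admissible_H N B' H"
    note H = this[unfolded admissible_H_def]
    obtain U where U: "openin (top_of_set (pts N)) U" "closure B' \<subseteq> U" "\<forall>z\<in>U. H z = 0"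
      using H by (elim conjE exE) (rule that; assumption)
    have "closure B \<subseteq> U" by (rule order_trans[OF closure_mono[OF BB] U(2)])
    then have "\<exists>U. openin (top_of_set (pts N)) U \<and> closure B \<subseteq> U \<and> (\<forall>z\<in>U. H z = 0)"
      using U(1,3) by (intro exI[of _ U] conjI)
    with H show "admissible_H N B H" unfolding admissible_H_def by (elim conjE) (intro conjI)
  qed
qed simp

lemma body_iota:
  assumes "1 \<le> l" "D \<subseteq> pts l" "D \<noteq> {}" "tau0 ` D = D" "compact D" "convex_pts D"
  shows "body l (iota l ` D)"
proof
  show "compact (iota l ` D)" by (rule compact_continuous_image[OF continuous_on_iota assms(5)])
  show "convex (iota l ` D)"
  proof (rule convexI)
    fix x y and u v :: real assume xy: "x \<in> iota l ` D" "y \<in> iota l ` D" and uv: "0 \<le> u" "0 \<le> v" "u + v = 1"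
    then obtain z w where zw: "z \<in> D" "w \<in> D" "x = iota l z" "y = iota l w" by blast
    have "pt_comb (1 - v) z v w \<in> D" using assms(6) zw(1,2) uv unfolding convex_pts_def by auto
    moreover have "1 - v = u" using uv(3) by simp
    ultimately have "iota l (pt_comb u z v w) \<in> iota l ` D" by simp
    then show "u *\<^sub>R x + v *\<^sub>R y \<in> iota l ` D" unfolding iota_comb zw(3,4) .
  qed
  show "tauP z \<in> iota l ` D" if z: "z \<in> iota l ` D" for z
  proof -
    obtain w where w: "w \<in> D" "z = iota l w" using z by blast
    then have "tau0 w \<in> D" using assms(4) by blast
    then show ?thesis unfolding w(2) iota_tau0[symmetric] by (rule imageI)
  qed
  show "iota l ` D \<subseteq> Ps l" by auto
qed (use assms in auto)

theorem theorem1p14: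
  fixes k :: nat and n :: "nat \<Rightarrow> nat" and D :: "nat \<Rightarrow> pt set"
  assumes "1 \<le> k"
    and "\<forall>i<k. 1 \<le> n i"
    and "\<forall>i<k. D i \<subseteq> pts (n i)"
    and "\<forall>i<k. D i \<noteq> {}"
    and "\<forall>i<k. tau0 ` D i = D i"
    and "\<forall>i<k. compact (D i)"
    and "\<forall>i<k. convex_pts (D i)"
  shows "cEH_set (\<Sum>i<k. n i) (prod_set n k D) = Min ((\<lambda>i. cEH_set (n i) (D i)) ` {..<k})
       \<and> cEH_set (\<Sum>i<k. n i) (prod_set n k D)
           = cEH_set (\<Sum>i<k. n i) (prod_set n k (\<lambda>i. pts_frontier (n i) (D i)))"
proof -
  let ?N = "sp n k" and ?S = "\<lambda>i. iota (n i) ` D i" and ?F = "\<lambda>i. pts_frontier (n i) (D i)"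
  let ?P = "prod_set n k D"
  have D: "D i \<subseteq> pts (n i)" "compact (D i)" if "i < k" for i using assms(3,6) that by blast+
  have b: "body (n i) (?S i)" if "i < k" for i
    by (rule body_iota) (use assms(2-7) that in blast)+
  have DF: "?F i \<subseteq> D i" if i: "i < k" for i
  proof -
    have "closedin (top_of_set (pts (n i))) (D i)"
      using compact_imp_closed[OF D(2)[OF i]] D(1)[OF i] by (auto simp: closedin_closed)
    then have "(top_of_set (pts (n i))) closure_of (D i) = D i" by (simp add: closure_of_eq)
    then show ?thesis by (auto simp: pts_frontier_def frontier_of_def)
  qed
  have Pcl: "closed ?P"
  proof -
    have eq: "?P = pts ?N \<inter> (\<Inter>i\<in>{..<k}. (\<lambda>z. blkP (sp n i) (n i) (iota ?N z)) -` ?S i)"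
    proof (intro equalityI subsetI)
      fix z assume "z \<in> ?P"
      then have z: "z \<in> pts ?N" "\<And>i. i < k \<Longrightarrow> blk n i z \<in> D i" by (auto simp: prod_set_def sp_def)
      have "blkP (sp n i) (n i) (iota ?N z) \<in> ?S i" if "i < k" for i
        unfolding iota_blk[OF that, symmetric] by (rule imageI[OF z(2)[OF that]])
      then show "z \<in> pts ?N \<inter> (\<Inter>i\<in>{..<k}. (\<lambda>z. blkP (sp n i) (n i) (iota ?N z)) -` ?S i)" using z(1) by simp
    next
      fix z assume z: "z \<in> pts ?N \<inter> (\<Inter>i\<in>{..<k}. (\<lambda>z. blkP (sp n i) (n i) (iota ?N z)) -` ?S i)"
      have "blk n i z \<in> D i" if i: "i < k" for i
      proof -
        have "iota (n i) (blk n i z) \<in> ?S i" unfolding iota_blk[OF i] using z i by blast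
        then obtain y where y: "y \<in> D i" "iota (n i) (blk n i z) = iota (n i) y" by blast
        then have "blk n i z = y"
          using pnt_iota[OF blk_pts, of n i z] pnt_iota[of y "n i"] D(1)[OF i] by auto
        then show ?thesis using y(1) by simp
      qed
      then show "z \<in> ?P" using z by (simp add: prod_set_def sp_def)
    qed
    have "closed ((\<lambda>z. blkP (sp n i) (n i) (iota ?N z)) -` ?S i)" if i: "i < k" for i
      by (intro closed_vimage compact_imp_closed body.cS[OF b[OF i]] continuous_on_blkP continuous_on_iota)
    then show ?thesis unfolding eq by (intro closed_Int closed_pts closed_INT) simp
  qed
  have PS: "blkP (sp n i) (n i) (iota ?N z) \<in> ?S i" if "z \<in> ?P" "i < k" for z i
    unfolding iota_blk[OF that(2), symmetric] using that by (intro imageI) (simp add: prod_set_def)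
  have Ppts: "?P \<subseteq> pts ?N" by (auto simp: prod_set_def sp_def)
  have "\<forall>i\<in>{..<k}. \<exists>R. \<forall>w\<in>?S i. norm w \<le> R"
    using compact_imp_bounded[OF body.cS[OF b]] unfolding bounded_iff by blast
  from bchoice[OF this] obtain R where R: "\<And>i w. i < k \<Longrightarrow> w \<in> ?S i \<Longrightarrow> norm w \<le> R i" by auto
  have PR: "norm (iota ?N z) \<le> sqrt (\<Sum>i<k. (R i)\<^sup>2)" if "z \<in> ?P" for z
  proof (rule real_le_rsqrt)
    show "(norm (iota ?N z))\<^sup>2 \<le> (\<Sum>i<k. (R i)\<^sup>2)"
      unfolding norm_blkP_sum[OF iota_Ps] using R PS[OF that] by (intro sum_mono power_mono) auto
  qed
  have up1: "cEH_set ?N ?P \<le> ereal c" if "i < k" "0 < d" "1 \<le> M" "crit_level (n i) (?S i) d M c" for i d M c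
    by (rule body.upper[OF b[OF that(1)] that(4,2,3) sp_mono[OF that(1)] Ppts Pcl PR PS[OF _ that(1)]])
  have up2: "cEH_set (n i) (D i) \<le> ereal c" if i: "i < k" and c: "0 < d" "1 \<le> M" "crit_level (n i) (?S i) d M c" for i d M c
  proof (rule body.upper[OF b[OF i] c(3,1,2), of 0])
    show "blkP 0 (n i) (iota (n i) z) \<in> ?S i" if "z \<in> D i" for z
    proof -
      have "blkP 0 (n i) (iota (n i) z) = iota (n i) z" by (rule pair_ell2_eqI) (simp add: ev_iota)
      then show ?thesis using that by simp
    qed
    show "norm (iota (n i) z) \<le> R i" if "z \<in> D i" for z using R[OF i] that by blast
  qed (use D[OF i] compact_imp_closed in auto)
  have mono: "cEH_set ?N (prod_set n k ?F) \<le> cEH_set ?N ?P"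
    using DF by (intro cEH_set_mono) (auto simp: prod_set_def)
  \<comment> \<open>A level below the capacity of the product lies below every critical level of
    factor \<open>i\<close> by \<open>up1\<close>, so the lower bound for that factor alone reaches
    it.\<close>
  have "cEH_set ?N ?P \<le> cEH_set (n i) (D i)" if i: "i < k" for i
  proof (rule ereal_le_real)
    fix \<beta>' assume le: "cEH_set (n i) (D i) \<le> ereal \<beta>'"
    show "cEH_set ?N ?P \<le> ereal \<beta>'"
    proof (rule ccontr)
      assume "\<not> ?thesis"
      then have "ereal \<beta>' < cEH_set ?N ?P" by simp
      then obtain \<beta> where \<beta>: "\<beta>' < \<beta>" "ereal \<beta> < cEH_set ?N ?P" using ereal_dense2[of "ereal \<beta>'" "cEH_set ?N ?P"] by auto
      \<comment> \<open>The one-fold product over the constant family; its set of boundary points is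
        contained in \<open>D i\<close>, so monotonicity passes to the factor.\<close>
      have "ereal \<beta> \<le> cEH_set (sp (\<lambda>_. n i) 1) (prod_set (\<lambda>_. n i) 1 (\<lambda>_. ?F i))"
      proof (rule lower[where D = "\<lambda>_. D i"])
        fix j d M c assume "0 < (d :: real)" "1 \<le> M" "crit_level (n i) (?S i) d M c"
        from up1[OF i this] \<beta>(2) have "ereal \<beta> < ereal c" by (rule less_le_trans[rotated])
        then show "\<beta> < c" by simp
      qed (use D[OF i] b[OF i] in auto)
      also have "\<dots> \<le> cEH_set (n i) (D i)"
      proof -
        have "prod_set (\<lambda>_. n i) 1 (\<lambda>_. ?F i) \<subseteq> D i"
        proof
          fix z assume z: "z \<in> prod_set (\<lambda>_. n i) 1 (\<lambda>_. ?F i)"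
          then have "z \<in> pts (n i)" "blk (\<lambda>_. n i) 0 z \<in> D i" using DF[OF i] by (auto simp: prod_set_def)
          moreover from this(1) have "blk (\<lambda>_. n i) 0 z = z" by (cases z) (auto simp: blk_def pts_def fun_eq_iff)
          ultimately show "z \<in> D i" by simp
        qed
        then show ?thesis by (simp add: sp_def cEH_set_mono)
      qed
      finally have "ereal \<beta> \<le> ereal \<beta>'" using le by (rule order_trans)
      then show False using \<beta>(1) by simp
    qed
  qed
  then have P_le: "cEH_set ?N ?P \<le> Min ((\<lambda>i. cEH_set (n i) (D i)) ` {..<k})"
    using assms(1) by (intro Min.boundedI) (auto simp: lessThan_empty_iff)
  \<comment> \<open>A level below all factor capacities lies below all critical levels by
    \<open>up2\<close>, so the lower bound applies to the product of the boundaries. Comparison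
    against real numbers only also covers infinite values.\<close>
  have "Min ((\<lambda>i. cEH_set (n i) (D i)) ` {..<k}) \<le> cEH_set ?N (prod_set n k ?F)" (is "?m \<le> ?f")
  proof (rule ereal_le_real)
    fix \<beta>' assume le: "?f \<le> ereal \<beta>'"
    show "?m \<le> ereal \<beta>'"
    proof (rule ccontr)
      assume "\<not> ?m \<le> ereal \<beta>'"
      then have "ereal \<beta>' < ?m" by simp
      then obtain \<beta> where \<beta>: "\<beta>' < \<beta>" "ereal \<beta> < ?m" using ereal_dense2[of "ereal \<beta>'" ?m] by auto
      have "ereal \<beta> \<le> ?f"
      proof (rule lower[OF assms(1) D(1) b])
        fix i d M c assume A: "i < k" "0 < (d :: real)" "1 \<le> M" "crit_level (n i) (?S i) d M c"
        have "?m \<le> cEH_set (n i) (D i)" using A(1) by (intro Min_le) auto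
        also have "\<dots> \<le> ereal c" by (rule up2[OF A])
        finally have "ereal \<beta> < ereal c" using \<beta>(2) by (rule less_le_trans[rotated])
        then show "\<beta> < c" by simp
      qed
      then have "ereal \<beta> \<le> ereal \<beta>'" using le by (rule order_trans)
      then show False using \<beta>(1) by simp
    qed
  qed
  then show ?thesis using P_le mono unfolding sp_def by (intro conjI antisym) (auto intro: order_trans)
qed

end
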